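(* Let $\alpha\geq 0$, $\beta>0$, $1<p<\infty$ and $1\leq q<\infty$. Then the Riesz potential $I_\beta$ is bounded from $F_{p,q}^{\alpha}(\gamma_d)$ into $F_{p,q}^{\alpha+\beta}(\gamma_d)$; that is, $I_\beta f\in F_{p,q}^{\alpha+\beta}(\gamma_d)$ for every $f\in F_{p,q}^{\alpha}(\gamma_d)$, and there is a constant $C$ independent of $f$ such that $\|I_\beta f\|_{F_{p,q}^{\alpha+\beta}}\leq C\|f\|_{F_{p,q}^{\alpha}}$.
   Context: Let $\gamma_d(dx)=\pi^{-d/2}e^{-|x|^2}dx$ be the Gaussian measure on $\mathbb{R}^d$, and write $\|\cdot\|_{p,\gamma_d}$ for the norm of $L^p(\gamma_d)$. For a multi-index $\nu=(\nu_1,\dots,\nu_d)$ of nonnegative integers, $|\nu|=\sum_i\nu_i$, $\nu!=\prod_i\nu_i!$, the normalized Hermite polynomial is $h_\nu(x)=(2^{|\nu|}\nu!)^{-1/2}\prod_{i=1}^d(-1)^{\nu_i}e^{x_i^2}\partial_i^{\nu_i}(e^{-x_i^2})$. Ornstein-Uhlenbeck semigroup: $T_tf(x)=\int_{\mathbb{R}^d}f(\sqrt{1-e^{-2t}}\,u+e^{-t}x)\,\gamma_d(du)$, $t\ge 0$. Poisson-Hermite semigroup: $P_tf(x)=\frac{1}{\sqrt{\pi}}\int_0^\infty\frac{e^{-u}}{\sqrt{u}}T_{t^2/(4u)}f(x)\,du$ for $t>0$, $P_0=I$. It satisfies $P_th_\nu=e^{-t\sqrt{|\nu|}}h_\nu$.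 Put $P_\infty f=\int_{\mathbb{R}^d}f\,d\gamma_d$. Gaussian Triebel-Lizorkin spaces: for $\alpha\geq 0$, $1\leq p,q<\infty$, let $k$ be the smallest integer greater than $\alpha$. Then $F_{p,q}^{\alpha}(\gamma_d)$ is the set of $f\in L^p(\gamma_d)$ with $$\|f\|_{F_{p,q}^{\alpha}}:=\|f\|_{p,\gamma_d}+\left\|\left(\int_0^\infty\left(t^{k-\alpha}\left|\frac{\partial^kP_tf}{\partial t^k}\right|\right)^q\frac{dt}{t}\right)^{1/q}\right\|_{p,\gamma_d}<\infty.$$ (It is known that replacing $k$ by any other integer greater than $\alpha$ gives the same space with an equivalent norm.) Riesz potential of order $\beta>0$: $I_\beta$ is the linear operator determined on polynomials by $I_\beta h_\nu=|\nu|^{-\beta/2}h_\nu$ for $|\nu|>0$ and $I_\beta h_0=0$. For $1<p<\infty$ it is known (P. A. Meyer's multiplier theorem) that it extends continuously to $L^p(\gamma_d)$; this extension is again denoted $I_\beta$, and one has $I_\beta f=\frac{1}{\Gamma(\beta)}\int_0^\infty t^{\beta-1}(P_tf-P_\infty f)\,dt$. *)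

theory Defs
  imports "HOL-Analysis.Analysis"
begin

definition gauss_measure :: "(real ^ 'd) measure" where
  "gauss_measure =
     density lborel (\<lambda>x. ennreal (pi powr (- real CARD('d) / 2) * exp (- (norm x)\<^sup>2)))"

text \<open>Real powers on the extended nonnegative reals; only used with exponent \<open>r > 0\<close>,
  for which the power of infinity is infinity.\<close>

definition epowr :: "ennreal \<Rightarrow> real \<Rightarrow> ennreal" where
  "epowr a r = (if a = \<infinity> then \<infinity> else ennreal (enn2real a powr r))"

definition gLp_norm :: "real \<Rightarrow> (real ^ 'd \<Rightarrow> ennreal) \<Rightarrow> ennreal" where
  "gLp_norm p G = epowr (\<integral>\<^sup>+ x. epowr (G x) p \<partial>gauss_measure) (1 / p)"

text \<open>Elements of \<open>L\<^sup>p\<close> are Borel representatives; functions are not identified when equal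
  almost everywhere, so operator identities below are stated almost everywhere.\<close>

definition gLp :: "real \<Rightarrow> (real ^ 'd \<Rightarrow> real) set" where
  "gLp p = {f \<in> borel_measurable borel. gLp_norm p (\<lambda>x. ennreal \<bar>f x\<bar>) < \<infinity>}"

definition mi_abs :: "('d::finite \<Rightarrow> nat) \<Rightarrow> nat" where
  "mi_abs \<nu> = (\<Sum>i\<in>UNIV. \<nu> i)"

definition hermite :: "('d \<Rightarrow> nat) \<Rightarrow> real ^ 'd \<Rightarrow> real" where
  "hermite \<nu> x =
     (2 ^ mi_abs \<nu> * (\<Prod>i\<in>UNIV. fact (\<nu> i))) powr (- 1 / 2) *
     (\<Prod>i\<in>UNIV. (- 1) ^ \<nu> i * exp ((x $ i)\<^sup>2) *
        (deriv ^^ \<nu> i) (\<lambda>y::real. exp (- (y\<^sup>2))) (x $ i))"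

definition ou_semigroup :: "real \<Rightarrow> (real ^ 'd \<Rightarrow> real) \<Rightarrow> real ^ 'd \<Rightarrow> real" where
  "ou_semigroup t f x =
     (\<integral>u. f (sqrt (1 - exp (- 2 * t)) *\<^sub>R u + exp (- t) *\<^sub>R x) \<partial>gauss_measure)"

definition poisson_hermite :: "real \<Rightarrow> (real ^ 'd \<Rightarrow> real) \<Rightarrow> real ^ 'd \<Rightarrow> real" where
  "poisson_hermite t f x =
     (if t = 0 then f x
      else 1 / sqrt pi *
        (LINT u:{0<..}|lborel. exp (- u) / sqrt u * ou_semigroup (t\<^sup>2 / (4 * u)) f x))"

text \<open>For \<open>f\<close> in \<open>L\<^sup>1\<close> of the Gaussian measure, \<open>t \<mapsto> P\<^sub>t f x\<close> is finite and smooth on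
  \<open>t > 0\<close> for every \<open>x\<close>, so the iterated \<open>deriv\<close> is a pointwise derivative.\<close>

definition tl_seminorm ::
    "nat \<Rightarrow> real \<Rightarrow> real \<Rightarrow> real \<Rightarrow> (real ^ 'd \<Rightarrow> real) \<Rightarrow> ennreal" where
  "tl_seminorm k \<alpha> p q f =
     gLp_norm p (\<lambda>x. epowr
       (\<integral>\<^sup>+ t\<in>{0<..}.
          ennreal ((t powr (real k - \<alpha>) *
            \<bar>(deriv ^^ k) (\<lambda>s. poisson_hermite s f x) t\<bar>) powr q / t) \<partial>lborel)
       (1 / q))"

definition tl_norm :: "real \<Rightarrow> real \<Rightarrow> real \<Rightarrow> (real ^ 'd \<Rightarrow> real) \<Rightarrow> ennreal" where
  "tl_norm \<alpha> p q f =
     gLp_norm p (\<lambda>x. ennreal \<bar>f x\<bar>) + tl_seminorm (LEAST k. \<alpha> < real k) \<alpha> p q f"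

definition tl_space :: "real \<Rightarrow> real \<Rightarrow> real \<Rightarrow> (real ^ 'd \<Rightarrow> real) set" where
  "tl_space \<alpha> p q = {f \<in> gLp p. tl_norm \<alpha> p q f < \<infinity>}"

text \<open>\<open>J\<close> is a bounded linear operator on \<open>L\<^sup>p\<close> that acts on the Hermite polynomials, hence on
  all polynomials, as the Riesz potential of order \<open>\<beta>\<close>.\<close>

definition is_riesz_extension ::
    "real \<Rightarrow> real \<Rightarrow> ((real ^ 'd \<Rightarrow> real) \<Rightarrow> real ^ 'd \<Rightarrow> real) \<Rightarrow> bool" where
  "is_riesz_extension p \<beta> J \<longleftrightarrow>
     (\<forall>f\<in>gLp p. J f \<in> gLp p) \<and>
     (\<forall>f\<in>gLp p. \<forall>g\<in>gLp p. \<forall>a b.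
        AE x in gauss_measure. J (\<lambda>y. a * f y + b * g y) x = a * J f x + b * J g x) \<and>
     (\<exists>C\<ge>0. \<forall>f\<in>gLp p.
        gLp_norm p (\<lambda>x. ennreal \<bar>J f x\<bar>) \<le> ennreal C * gLp_norm p (\<lambda>x. ennreal \<bar>f x\<bar>)) \<and>
     (\<forall>\<nu>. AE x in gauss_measure.
        J (hermite \<nu>) x =
          (if mi_abs \<nu> = 0 then 0 else real (mi_abs \<nu>) powr (- \<beta> / 2) * hermite \<nu> x))"

text \<open>For \<open>1 < p < \<infinity>\<close> the extension exists by Meyer's multiplier theorem, and it is unique up to
  null sets because polynomials are dense in \<open>L\<^sup>p\<close>; the choice only fixes representatives.\<close>

definition riesz_potential ::
    "real \<Rightarrow> real \<Rightarrow> (real ^ 'd \<Rightarrow> real) \<Rightarrow> real ^ 'd \<Rightarrow> real" where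
  "riesz_potential p \<beta> = (SOME J. is_riesz_extension p \<beta> J)"

end

theory Submission
  imports Defs "HOL-Probability.Probability"
begin

text \<open>
  By density of the Hermite polynomials, \<open>\<partial>\<^sub>t\<^sup>m P\<^sub>t I\<^sub>\<beta> f\<close> is the fractional integral
  \<open>\<Gamma>(\<beta>)\<^sup>-\<^sup>1 \<integral> s\<^sup>\<beta>\<^sup>-\<^sup>1 \<partial>\<^sub>t\<^sup>m P\<^sub>t\<^sub>+\<^sub>s f ds\<close>, so that Hardy's inequality bounds the norm of
  \<open>I\<^sub>\<beta> f\<close> by the \<open>F\<^sup>\<alpha>\<close>-norm of \<open>f\<close> computed with \<open>m\<close> instead of \<open>k \<le> m\<close> derivatives.
  To return to \<open>k\<close> derivatives, write \<open>\<partial>\<^sup>m P\<^sub>t f = \<partial>\<^sup>m\<^sup>-\<^sup>k P\<^sub>t\<^sub>/\<^sub>2 (\<partial>\<^sup>k P\<^sub>t\<^sub>/\<^sub>2 f)\<close> and dominate \<open>t\<^sup>j \<partial>\<^sup>j P\<^sub>t\<close> by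
  a positive symmetric average of the Ornstein-Uhlenbeck semigroup. These averages are bounded on
  \<open>L\<^sup>p(L\<^sup>q(dt/t))\<close> by duality with the Hopf-Dunford-Schwartz maximal function. The operator \<open>I\<^sub>\<beta>\<close> itself
  exists on \<open>L\<^sup>p\<close> because the Mehler kernel converges to \<open>1\<close> at rate \<open>e\<^sup>-\<^sup>t\<close>, up to a factor
  \<open>exp (\<epsilon> (|x|\<^sup>2 + |y|\<^sup>2))\<close>.
\<close>

section \<open>Extended nonnegative powers\<close>

text \<open>The Gaussian measure is not doubling, so the usual road to mixed-norm bounds through
  vector-valued maximal inequalities on doubling spaces is closed. Its substitute is that the
  Ornstein-Uhlenbeck operators are positive, symmetric and Markovian: for them Hopf's maximal lemma
  needs no geometry at all. The majorant of the Poisson derivatives uses the weight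
  \<open>t * max r (t^2) powr (-3/2)\<close>, nonincreasing in the Ornstein-Uhlenbeck time
  \<open>r\<close>. Averages against it are mixtures of plain time averages, so one maximal function
  bounds them for all \<open>t\<close> simultaneously, and it can be taken out of the integral over
  \<open>t\<close>. \<open>k\<close> and \<open>m\<close> are the least integers above
  \<open>\<alpha>\<close> and \<open>\<alpha> + \<beta>\<close>. The order of differentiation
  therefore only has to be raised, which the semigroup law does with a loss of half the time. The
  Riesz potential is built from the Ornstein-Uhlenbeck semigroup with exponent
  \<open>\<beta> / 2\<close>, not from the Poisson semigroup with exponent \<open>\<beta>\<close>,
  because the kernel of the former is explicit.\<close>

lemma epowr_ennreal [simp]: "0 \<le> x \<Longrightarrow> epowr (ennreal x) r = ennreal (x powr r)"
  by (simp add: epowr_def)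

lemma epowr_top [simp]: "epowr top r = top" "epowr \<infinity> r = \<infinity>"
  by (simp_all add: epowr_def)

lemma epowr_0 [simp]: "epowr 0 r = 0"
  by (simp add: epowr_def)

lemma epowr_1 [simp]: "epowr 1 r = 1"
  by (simp add: epowr_def)

lemma epowr_one [simp]: "epowr a 1 = a"
  by (cases a) (auto simp: epowr_def)

lemma epowr_eq_0_iff: "epowr a r = 0 \<longleftrightarrow> a = 0"
  by (cases a) (auto simp: epowr_def)

lemma epowr_eq_top_iff [simp]: "epowr a r = top \<longleftrightarrow> a = top"
  by (cases a) (auto simp: epowr_def)

lemma epowr_less_top_iff [simp]: "epowr a r < top \<longleftrightarrow> a < top"
  by (metis epowr_eq_top_iff less_top)

lemma epowr_mono: "0 < r \<Longrightarrow> a \<le> b \<Longrightarrow> epowr a r \<le> epowr b r"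
  by (cases a; cases b) (auto simp: top_unique intro!: ennreal_leI powr_mono2)

lemma epowr_mult: "0 < r \<Longrightarrow> epowr (a * b) r = epowr a r * epowr b r"
  by (cases a; cases b)
     (auto simp: ennreal_mult[symmetric] powr_mult ennreal_mult_top ennreal_top_mult epowr_eq_0_iff)

lemma epowr_epowr: "epowr (epowr a r) s = epowr a (r * s)"
  by (cases a) (auto simp: powr_powr)

lemma epowr_add: "epowr a (r + s) = epowr a r * epowr a s"
  by (cases a) (auto simp: powr_add ennreal_mult)

lemma epowr_minus_self: "a \<noteq> top \<Longrightarrow> epowr a r * epowr a (1 - r) = a"
  using epowr_add[of a r "1 - r"] by simp

lemma measurable_epowr [measurable]: "(\<lambda>a. epowr a r) \<in> borel_measurable borel"
proof -
  have "(\<lambda>a. if a = \<infinity> then \<infinity> else ennreal (enn2real a powr r)) \<in> borel_measurable borel"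
    by measurable
  then show ?thesis by (simp add: epowr_def[abs_def])
qed

lemma epowr_le_iff: "0 < r \<Longrightarrow> epowr a r \<le> epowr b r \<longleftrightarrow> a \<le> b"
  using epowr_mono[of r a b] epowr_mono[of "1/r" "epowr a r" "epowr b r"]
  by (auto simp: epowr_epowr)

text \<open>A sum is at most twice its larger term; this gives the constant \<open>2 powr r\<close>
  for all \<open>r > 0\<close> without separating convex from concave powers.\<close>

lemma epowr_add_le:
  assumes "0 < r" shows "epowr (a + b) r \<le> ennreal (2 powr r) * (epowr a r + epowr b r)"
proof -
  have *: "epowr (a + b) r \<le> ennreal (2 powr r) * (epowr a r + epowr b r)" if "a \<le> b" for a b
  proof -
    have "a + b \<le> 2 * b" using that by (metis add_mono mult_2 order_refl)
    then have "epowr (a + b) r \<le> epowr (ennreal 2 * b) r" by (intro epowr_mono assms) simp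
    also have "\<dots> = ennreal (2 powr r) * epowr b r"
      using assms by (subst epowr_mult) (simp_all del: ennreal_numeral)
    also have "\<dots> \<le> ennreal (2 powr r) * (epowr a r + epowr b r)" by (intro mult_left_mono) auto
    finally show ?thesis .
  qed
  from *[of a b] *[of b a] show ?thesis by (cases "a \<le> b") (auto simp: add.commute)
qed

text \<open>The power is an order isomorphism with inverse exponent \<open>1 / r\<close>, so it
  commutes with every supremum, infinite values included.\<close>

lemma epowr_SUP:
  assumes r: "0 < r" shows "epowr (SUP i. X i) r = (SUP i. epowr (X i) r)"
proof (rule antisym)
  have "epowr (SUP i. X i) r \<le> epowr (epowr (SUP i. epowr (X i) r) (1/r)) r"
  proof (intro epowr_mono r SUP_least)
    fix i
    have "X i = epowr (epowr (X i) r) (1/r)" using r by (simp add: epowr_epowr)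
    also have "\<dots> \<le> epowr (SUP i. epowr (X i) r) (1/r)"
      using r by (intro epowr_mono SUP_upper) auto
    finally show "X i \<le> epowr (SUP i. epowr (X i) r) (1/r)" .
  qed
  then show "epowr (SUP i. X i) r \<le> (SUP i. epowr (X i) r)" using r by (simp add: epowr_epowr)
  show "(SUP i. epowr (X i) r) \<le> epowr (SUP i. X i) r"
    by (intro SUP_least epowr_mono r SUP_upper) auto
qed

section \<open>Inequalities of Young, Hoelder and Jensen\<close>

lemma Young_ennreal:
  assumes "1 < p" "1 < q" "1 / p + 1 / q = 1"
  shows "a * b \<le> ennreal (1 / p) * epowr a p + ennreal (1 / q) * epowr b q"
proof (cases "a = 0 \<or> b = 0")
  case True then show ?thesis by auto
next
  case False
  show ?thesis
  proof (cases "a = top \<or> b = top")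
    case True
    with assms False show ?thesis by (auto simp: ennreal_mult_top)
  next
    case False2: False
    obtain x y where xy: "a = ennreal x" "b = ennreal y" "0 \<le> x" "0 \<le> y"
      using False2 by (cases a; cases b) auto
    have "x * y \<le> x powr p / p + y powr q / q"
      using Youngs_inequality[of p q x y] assms xy by auto
    then show ?thesis using assms
      by (simp add: xy ennreal_mult[symmetric] ennreal_plus[symmetric] del: ennreal_plus)
  qed
qed

text \<open>Young's inequality integrates to a bound by 1 once both factors are divided by their
  norms. The division needs norms that are neither zero nor infinite: a zero norm kills the product
  almost everywhere, and an infinite norm facing a nonzero one makes the right-hand side
  infinite.\<close>

lemma Holder_nn_integral:
  assumes pq: "1 < p" "1 < q" "1 / p + 1 / q = 1"
    and [measurable]: "f \<in> borel_measurable M" "g \<in> borel_measurable M"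
  shows "(\<integral>\<^sup>+x. f x * g x \<partial>M) \<le>
    epowr (\<integral>\<^sup>+x. epowr (f x) p \<partial>M) (1 / p) * epowr (\<integral>\<^sup>+x. epowr (g x) q \<partial>M) (1 / q)"
proof -
  define A where "A = (\<integral>\<^sup>+x. epowr (f x) p \<partial>M)"
  define B where "B = (\<integral>\<^sup>+x. epowr (g x) q \<partial>M)"
  consider "A = 0 \<or> B = 0" | "A \<noteq> 0" "B \<noteq> 0" "A = top \<or> B = top" | "A \<noteq> 0" "B \<noteq> 0" "A \<noteq> top" "B \<noteq> top"
    by blast
  then show ?thesis
  proof cases
    case 1
    then have "AE x in M. f x * g x = 0"
    proof
      assume "A = 0"
      then have "AE x in M. epowr (f x) p = 0" by (simp add: A_def nn_integral_0_iff_AE)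
      then show ?thesis by eventually_elim (simp add: epowr_eq_0_iff)
    next
      assume "B = 0"
      then have "AE x in M. epowr (g x) q = 0" by (simp add: B_def nn_integral_0_iff_AE)
      then show ?thesis by eventually_elim (simp add: epowr_eq_0_iff)
    qed
    then have "(\<integral>\<^sup>+x. f x * g x \<partial>M) = 0" by (simp add: nn_integral_0_iff_AE)
    then show ?thesis by simp
  next
    case 2
    then have "epowr A (1/p) * epowr B (1/q) = top"
      by (auto simp: ennreal_mult_top ennreal_top_mult epowr_eq_0_iff)
    then show ?thesis by (simp add: A_def B_def)
  next
    case 3
    obtain x y where xy: "A = ennreal x" "B = ennreal y" "0 < x" "0 < y"
      using 3 by (cases A; cases B) (auto simp: less_le)
    let ?a = "x powr (1/p)" and ?b = "y powr (1/q)"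
    have ab: "?a > 0" "?b > 0" using xy by auto
    have "(\<integral>\<^sup>+z. (f z * ennreal (1 / ?a)) * (g z * ennreal (1 / ?b)) \<partial>M) \<le>
      (\<integral>\<^sup>+z. ennreal (1 / p) * epowr (f z * ennreal (1 / ?a)) p
           + ennreal (1 / q) * epowr (g z * ennreal (1 / ?b)) q \<partial>M)"
      by (intro nn_integral_mono Young_ennreal pq)
    also have "\<dots> = (\<integral>\<^sup>+z. (ennreal (1 / p) * ennreal (1 / x)) * epowr (f z) p
           + (ennreal (1 / q) * ennreal (1 / y)) * epowr (g z) q \<partial>M)"
      using pq xy by (intro nn_integral_cong) (simp add: epowr_mult powr_divide powr_powr mult_ac)
    also have "\<dots> = ennreal (1 / p) * ennreal (1 / x) * A + ennreal (1 / q) * ennreal (1 / y) * B"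
      by (subst nn_integral_add) (auto simp: A_def B_def nn_integral_cmult)
    also have "\<dots> = 1"
      using pq xy by (simp add: ennreal_mult[symmetric] ennreal_plus[symmetric] del: ennreal_plus)
    finally have le: "(\<integral>\<^sup>+z. (f z * ennreal (1 / ?a)) * (g z * ennreal (1 / ?b)) \<partial>M) \<le> 1" .
    have c: "ennreal (?a * ?b) * (ennreal (1 / ?a) * ennreal (1 / ?b)) = 1"
      using ab by (simp add: ennreal_mult[symmetric])
    have "(\<integral>\<^sup>+z. f z * g z \<partial>M)
      = ennreal (?a * ?b) * (\<integral>\<^sup>+z. (f z * ennreal (1 / ?a)) * (g z * ennreal (1 / ?b)) \<partial>M)"
      apply (subst nn_integral_cmult[symmetric], simp)
      apply (intro nn_integral_cong)
      using c by (metis (no_types, lifting) mult.assoc mult.commute mult.left_commute mult.right_neutral)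
    also have "\<dots> \<le> ennreal (?a * ?b) * 1" by (intro mult_left_mono le) simp
    also have "\<dots> = epowr A (1 / p) * epowr B (1 / q)" using xy by (simp add: ennreal_mult)
    finally show ?thesis by (simp add: A_def B_def)
  qed
qed

text \<open>Hoelder for the splitting \<open>w f = w^(1/q') * (w^(1/q) f)\<close>; of the weight
  only its total mass enters. The semigroup, the averages in time, the Minkowski-type bound and
  Hardy's inequality all get their power bounds from here.\<close>

lemma Jensen_weighted:
  assumes q: "1 \<le> q" and K: "0 < K"
    and [measurable]: "w \<in> borel_measurable M" "f \<in> borel_measurable M"
    and w: "(\<integral>\<^sup>+x. w x \<partial>M) \<le> ennreal K"
  shows "epowr (\<integral>\<^sup>+x. w x * f x \<partial>M) q \<le> ennreal (K powr (q - 1)) * (\<integral>\<^sup>+x. w x * epowr (f x) q \<partial>M)"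
proof (cases "q = 1")
  case True then show ?thesis using K by simp
next
  case False
  then have q1: "1 < q" using q by simp
  define q' where "q' = q / (q - 1)"
  have q': "1 < q'" "1 / q' + 1 / q = 1" "1 / q' * q = q - 1" 
    using q1 by (auto simp: q'_def field_simps)
  have fin: "AE x in M. w x \<noteq> top"
    using nn_integral_PInf_AE[of w M] w by (metis assms(3) ennreal_neq_top infinity_ennreal_def top_unique)
  have "(\<integral>\<^sup>+x. w x * f x \<partial>M) = (\<integral>\<^sup>+x. epowr (w x) (1/q') * (epowr (w x) (1/q) * f x) \<partial>M)"
  proof (rule nn_integral_cong_AE)
    show "AE x in M. w x * f x = epowr (w x) (1/q') * (epowr (w x) (1/q) * f x)"
      using fin
    proof eventually_elim
      case (elim x)
      have "epowr (w x) (1/q') * epowr (w x) (1/q) = w x"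
        using epowr_add[of "w x" "1/q'" "1/q"] q'(2) by simp
      then show ?case by (simp add: mult.assoc[symmetric])
    qed
  qed
  also have "\<dots> \<le> epowr (\<integral>\<^sup>+x. epowr (epowr (w x) (1/q')) q' \<partial>M) (1/q')
        * epowr (\<integral>\<^sup>+x. epowr (epowr (w x) (1/q) * f x) q \<partial>M) (1/q)"
    by (rule Holder_nn_integral) (use q' q1 in auto)
  also have "\<dots> = epowr (\<integral>\<^sup>+x. w x \<partial>M) (1/q') * epowr (\<integral>\<^sup>+x. w x * epowr (f x) q \<partial>M) (1/q)"
    using q' q1 by (simp add: epowr_epowr epowr_mult)
  finally have "epowr (\<integral>\<^sup>+x. w x * f x \<partial>M) q \<le>
     epowr (epowr (\<integral>\<^sup>+x. w x \<partial>M) (1/q') * epowr (\<integral>\<^sup>+x. w x * epowr (f x) q \<partial>M) (1/q)) q"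
    using q1 by (intro epowr_mono) auto
  also have "\<dots> = epowr (\<integral>\<^sup>+x. w x \<partial>M) (q - 1) * (\<integral>\<^sup>+x. w x * epowr (f x) q \<partial>M)"
    using q1 q'(3) by (simp add: epowr_mult epowr_epowr)
  also have "\<dots> \<le> epowr (ennreal K) (q - 1) * (\<integral>\<^sup>+x. w x * epowr (f x) q \<partial>M)"
    using q1 by (intro mult_right_mono epowr_mono w) auto
  finally show ?thesis using K by simp
qed

section \<open>The Hopf maximal inequality\<close>

lemma epowr_numeral [simp]: "epowr (numeral n) r = ennreal (numeral n powr r)"
  using epowr_ennreal[of "numeral n" r] by (simp del: epowr_ennreal)

text \<open>For finite \<open>a\<close> this integrates \<open>r l^(r-1)\<close> over
  \<open>(0, a)\<close>. For infinite \<open>a\<close> the integral dominates the one for the finite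
  value \<open>n^(1/r)\<close>, which is \<open>n\<close>, for every \<open>n\<close>.\<close>

lemma layer_cake_epowr:
  assumes r: "0 < r"
  shows "epowr a r = (\<integral>\<^sup>+l\<in>{0<..}. ennreal (r * l powr (r - 1)) * of_bool (ennreal l < a) \<partial>lborel)"
proof -
  have fin: "(\<integral>\<^sup>+l\<in>{0<..}. ennreal (r * l powr (r - 1)) * of_bool (l < c) \<partial>lborel) = ennreal (c powr r)"
    if c: "0 \<le> c" for c :: real
  proof -
    have "((\<lambda>l. r * l powr (r - 1)) has_integral (r * (c powr (r - 1 + 1) / (r - 1 + 1)))) {0..c}"
      using r c by (intro has_integral_mult_right has_integral_powr_from_0) auto
    then have *: "((\<lambda>l. if l \<in> {0..c} then r * l powr (r - 1) else 0) has_integral (c powr r)) UNIV"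
      using r by (simp only: has_integral_restrict_UNIV) simp
    then have *: "((\<lambda>l. indicator {0..c} l * (r * l powr (r - 1))) has_integral (c powr r)) UNIV"
      by (rule has_integral_eq[rotated]) (auto simp: indicator_def)
    have "(\<integral>\<^sup>+l. ennreal (indicator {0..c} l * (r * l powr (r - 1))) \<partial>lborel) = ennreal (c powr r)"
      by (rule nn_integral_has_integral_lborel[OF _ _ *]) (use r in auto)
    moreover have "(\<integral>\<^sup>+l\<in>{0<..}. ennreal (r * l powr (r - 1)) * of_bool (l < c) \<partial>lborel)
      = (\<integral>\<^sup>+l. ennreal (indicator {0..c} l * (r * l powr (r - 1))) \<partial>lborel)"
      by (rule nn_integral_cong_AE, use AE_lborel_singleton[of c] AE_lborel_singleton[of 0] in eventually_elim)
         (auto simp: indicator_def)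
    ultimately show ?thesis by simp
  qed
  show ?thesis
  proof (cases a)
    case (real c)
    have "(\<integral>\<^sup>+l\<in>{0<..}. ennreal (r * l powr (r - 1)) * of_bool (ennreal l < a) \<partial>lborel)
       = (\<integral>\<^sup>+l\<in>{0<..}. ennreal (r * l powr (r - 1)) * of_bool (l < c) \<partial>lborel)"
      using real by (intro nn_integral_cong) (auto simp: indicator_def ennreal_less_iff)
    then show ?thesis using fin[of c] real by simp
  next
    case top
    have "ennreal (real n) \<le> (\<integral>\<^sup>+l\<in>{0<..}. ennreal (r * l powr (r - 1)) * of_bool (ennreal l < a) \<partial>lborel)" for n
    proof -
      have "ennreal (real n) = (\<integral>\<^sup>+l\<in>{0<..}. ennreal (r * l powr (r - 1)) * of_bool (l < real n powr (1/r)) \<partial>lborel)"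
        using r by (subst fin) (auto simp: powr_powr)
      also have "\<dots> \<le> (\<integral>\<^sup>+l\<in>{0<..}. ennreal (r * l powr (r - 1)) * of_bool (ennreal l < a) \<partial>lborel)"
        using top by (intro nn_integral_mono) (auto simp: indicator_def)
      finally show ?thesis .
    qed
    then have "(SUP n. of_nat n) \<le> (\<integral>\<^sup>+l\<in>{0<..}. ennreal (r * l powr (r - 1)) * of_bool (ennreal l < a) \<partial>lborel)"
      by (intro SUP_least) (simp add: ennreal_of_nat_eq_real_of_nat)
    then have "(\<integral>\<^sup>+l\<in>{0<..}. ennreal (r * l powr (r - 1)) * of_bool (ennreal l < a) \<partial>lborel) = top"
      by (simp add: ennreal_SUP_of_nat_eq_top top_unique)
    then show ?thesis using top by simp
  qed
qed

text \<open>For linear \<open>S\<close> this is \<open>h + S h + ... + S^(n-1) h\<close>. In the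
  nested form the inductions below run on monotonicity and the behaviour on constants.\<close>

primrec ergodic_sum :: "(('a \<Rightarrow> ennreal) \<Rightarrow> 'a \<Rightarrow> ennreal) \<Rightarrow> ('a \<Rightarrow> ennreal) \<Rightarrow> nat \<Rightarrow> 'a \<Rightarrow> ennreal" where
  "ergodic_sum S h 0 = (\<lambda>x. 0)"
| "ergodic_sum S h (Suc n) = (\<lambda>x. h x + S (ergodic_sum S h n) x)"

text \<open>Truncated subtraction makes this the positive part of the maximal partial sum of \<open>h - c\<close>.\<close>

primrec hopf_fun :: "(('a \<Rightarrow> ennreal) \<Rightarrow> 'a \<Rightarrow> ennreal) \<Rightarrow> ('a \<Rightarrow> ennreal) \<Rightarrow> ennreal \<Rightarrow> nat \<Rightarrow> 'a \<Rightarrow> ennreal" where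
  "hopf_fun S h c 0 = (\<lambda>x. 0)"
| "hopf_fun S h c (Suc n) = (\<lambda>x. h x + S (hopf_fun S h c n) x - c)"

text \<open>What Garsia's proof of Hopf's lemma asks of a positive contraction:
  \<open>S_contraction\<close> is the L^1 side, \<open>S_add_const\<close> the L^\<infinity>
  side.\<close>

locale submarkov = sigma_finite_measure M for M :: "'a measure" +
  fixes S :: "('a \<Rightarrow> ennreal) \<Rightarrow> 'a \<Rightarrow> ennreal"
  assumes S_measurable [measurable]: "f \<in> borel_measurable M \<Longrightarrow> S f \<in> borel_measurable M"
    and S_mono: "(\<And>x. f x \<le> g x) \<Longrightarrow> S f x \<le> S g x"
    and S_add_const: "f \<in> borel_measurable M \<Longrightarrow> S (\<lambda>x. f x + c) x \<le> S f x + c"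
    and S_contraction: "f \<in> borel_measurable M \<Longrightarrow> (\<integral>\<^sup>+x. S f x \<partial>M) \<le> (\<integral>\<^sup>+x. f x \<partial>M)"
begin

lemma ergodic_sum_measurable [measurable]:
  "h \<in> borel_measurable M \<Longrightarrow> ergodic_sum S h n \<in> borel_measurable M"
  by (induction n) auto

lemma hopf_fun_measurable [measurable]:
  "h \<in> borel_measurable M \<Longrightarrow> hopf_fun S h c n \<in> borel_measurable M"
  by (induction n) auto

lemma hopf_fun_Suc_mono: "hopf_fun S h c n x \<le> hopf_fun S h c (Suc n) x"
proof (induction n arbitrary: x)
  case (Suc n)
  then have "S (hopf_fun S h c n) x \<le> S (hopf_fun S h c (Suc n)) x" by (intro S_mono)
  then show ?case by (auto intro!: ennreal_minus_mono add_left_mono)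
qed simp

text \<open>Each truncated subtraction loses at most \<open>c\<close>, and \<open>S\<close> passes
  an accumulated constant on without enlarging it. Hence \<open>hopf_fun\<close> is positive
  wherever the average of length \<open>n\<close> exceeds \<open>c\<close>.\<close>

lemma ergodic_sum_le_hopf_fun:
  assumes [measurable]: "h \<in> borel_measurable M"
  shows "ergodic_sum S h n x \<le> hopf_fun S h c n x + of_nat n * c"
proof (induction n arbitrary: x)
  case (Suc n)
  have "ergodic_sum S h (Suc n) x \<le> h x + S (\<lambda>x. hopf_fun S h c n x + of_nat n * c) x"
    using Suc by (auto intro!: add_left_mono S_mono)
  also have "\<dots> \<le> h x + (S (hopf_fun S h c n) x + of_nat n * c)"
    by (intro add_left_mono S_add_const) measurable
  also have "\<dots> \<le> (h x + S (hopf_fun S h c n) x - c + c) + of_nat n * c"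
    unfolding add.assoc[symmetric]
    by (intro add_right_mono) (auto simp: diff_add_self_ennreal not_le less_imp_le)
  finally show ?case by (simp add: algebra_simps)
qed simp

text \<open>Garsia's argument: where \<open>hopf_fun\<close> is positive the truncated subtraction
  is exact, so \<open>F n + c\<close> equals \<open>h + S (F m)\<close> with
  \<open>n = Suc m\<close>; elsewhere \<open>F n = 0\<close>. After integration, the contraction
  property and \<open>F m \<le> F n\<close> let the integrals of \<open>F n\<close> cancel.\<close>

lemma hopf_maximal:
  assumes [measurable]: "h \<in> borel_measurable M" and fin: "(\<integral>\<^sup>+x. h x \<partial>M) < top" and c: "c < top"
  shows "c * emeasure M {x\<in>space M. hopf_fun S h c n x > 0} \<le> (\<integral>\<^sup>+x. h x \<partial>M)"
proof (cases n)
  case (Suc m)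
  let ?F = "hopf_fun S h c"
  \<comment> \<open>The final cancellation of the integral of \<open>F n\<close> is legitimate only
    if that integral is finite.\<close>
  have finF: "(\<integral>\<^sup>+x. ?F n x \<partial>M) < top" for n
  proof (induction n)
    case (Suc n)
    have "(\<integral>\<^sup>+x. ?F (Suc n) x \<partial>M) \<le> (\<integral>\<^sup>+x. h x + S (?F n) x \<partial>M)"
      by (intro nn_integral_mono) (simp add: diff_le_self_ennreal)
    also have "\<dots> = (\<integral>\<^sup>+x. h x \<partial>M) + (\<integral>\<^sup>+x. S (?F n) x \<partial>M)" by (rule nn_integral_add) measurable
    also have "\<dots> \<le> (\<integral>\<^sup>+x. h x \<partial>M) + (\<integral>\<^sup>+x. ?F n x \<partial>M)" by (intro add_left_mono S_contraction) measurable
    also have "\<dots> < top" using Suc fin by simp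
    finally show ?case .
  qed simp
  let ?E = "{x\<in>space M. ?F n x > 0}"
  have "(\<integral>\<^sup>+x. ?F n x \<partial>M) + c * emeasure M ?E = (\<integral>\<^sup>+x. ?F n x + c * indicator ?E x \<partial>M)"
    by (subst nn_integral_add) (auto simp: nn_integral_cmult)
  also have "\<dots> \<le> (\<integral>\<^sup>+x. h x + S (?F m) x \<partial>M)"
  proof (rule nn_integral_mono)
    fix x assume "x \<in> space M"
    show "?F n x + c * indicator ?E x \<le> h x + S (?F m) x"
    proof (cases "?F n x > 0")
      case True
      then have "h x + S (?F m) x - c \<noteq> 0" using Suc by simp
      then have "c \<le> h x + S (?F m) x"
        by (metis diff_eq_0_iff_ennreal leI less_imp_le less_le_trans top_greatest)
      then show ?thesis using Suc True by (auto simp: indicator_def diff_add_cancel_ennreal)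
    qed (simp add: indicator_def)
  qed
  also have "\<dots> = (\<integral>\<^sup>+x. h x \<partial>M) + (\<integral>\<^sup>+x. S (?F m) x \<partial>M)" by (rule nn_integral_add) measurable
  also have "\<dots> \<le> (\<integral>\<^sup>+x. h x \<partial>M) + (\<integral>\<^sup>+x. ?F m x \<partial>M)" by (intro add_left_mono S_contraction) measurable
  also have "\<dots> \<le> (\<integral>\<^sup>+x. h x \<partial>M) + (\<integral>\<^sup>+x. ?F n x \<partial>M)" 
    unfolding Suc by (intro add_left_mono nn_integral_mono hopf_fun_Suc_mono)
  finally have *: "(\<integral>\<^sup>+x. ?F n x \<partial>M) + c * emeasure M ?E \<le> (\<integral>\<^sup>+x. ?F n x \<partial>M) + (\<integral>\<^sup>+x. h x \<partial>M)"
    by (simp add: add.commute)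
  show ?thesis using * finF[of n] by (auto simp: ennreal_add_left_cancel_le)
qed simp

text \<open>The sets where \<open>hopf_fun\<close> is positive increase with \<open>n\<close>, so
  the bound for fixed \<open>n\<close> passes to their union.\<close>

lemma maximal_weak_type:
  assumes [measurable]: "h \<in> borel_measurable M" and c: "c < top"
  shows "c * emeasure M {x\<in>space M. \<exists>n. ergodic_sum S h n x > of_nat n * c} \<le> (\<integral>\<^sup>+x. h x \<partial>M)"
proof (cases "(\<integral>\<^sup>+x. h x \<partial>M) < top")
  case True
  let ?E = "\<lambda>n. {x\<in>space M. hopf_fun S h c n x > 0}"
  have "{x\<in>space M. \<exists>n. ergodic_sum S h n x > of_nat n * c} \<subseteq> (\<Union>n. ?E n)"
  proof safe
    fix x n assume x: "x \<in> space M" "of_nat n * c < ergodic_sum S h n x"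
    note x(2)
    also have "ergodic_sum S h n x \<le> hopf_fun S h c n x + of_nat n * c"
      by (rule ergodic_sum_le_hopf_fun) measurable
    finally have "hopf_fun S h c n x \<noteq> 0" by auto
    then show "x \<in> (\<Union>n. ?E n)" using x by (auto simp: zero_less_iff_neq_zero)
  qed
  then have "emeasure M {x\<in>space M. \<exists>n. ergodic_sum S h n x > of_nat n * c} \<le> emeasure M (\<Union>n. ?E n)"
    by (intro emeasure_mono) auto
  also have "\<dots> = (SUP n. emeasure M (?E n))"
    by (intro SUP_emeasure_incseq[symmetric] incseq_SucI)
       (auto simp del: hopf_fun.simps intro: less_le_trans[OF _ hopf_fun_Suc_mono])
  finally have "c * emeasure M {x\<in>space M. \<exists>n. ergodic_sum S h n x > of_nat n * c}
      \<le> (SUP n. c * emeasure M (?E n))"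
    by (subst SUP_mult_left_ennreal[symmetric]) (rule mult_left_mono, auto)
  also have "\<dots> \<le> (\<integral>\<^sup>+x. h x \<partial>M)"
    by (intro SUP_least hopf_maximal True c) measurable
  finally show ?thesis .
next
  case False
  then show ?thesis by (simp add: less_top[symmetric])
qed

definition ergodic_max :: "('a \<Rightarrow> ennreal) \<Rightarrow> 'a \<Rightarrow> ennreal" where
  "ergodic_max h x = (SUP n. ergodic_sum S h (Suc n) x / of_nat (Suc n))"

lemma ergodic_max_measurable [measurable]:
  assumes [measurable]: "h \<in> borel_measurable M" shows "ergodic_max h \<in> borel_measurable M"
proof -
  have "(\<lambda>x. SUP n. ergodic_sum S h (Suc n) x / of_nat (Suc n)) \<in> borel_measurable M"
    by (intro borel_measurable_SUP borel_measurable_divide_ennreal ergodic_sum_measurable) auto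
  then show ?thesis by (simp only: ergodic_max_def[abs_def])
qed

text \<open>The part of \<open>h\<close> below \<open>l / 2\<close> contributes at most \<open>l / 2\<close> to the averages.\<close>

lemma maximal_weak_type_truncated:
  assumes [measurable]: "h \<in> borel_measurable M" and l: "0 < l"
  shows "emeasure M {x\<in>space M. ennreal l < ergodic_max h x} \<le>
      ennreal (2 / l) * (\<integral>\<^sup>+x. h x * of_bool (ennreal l < 2 * h x) \<partial>M)"
proof -
  define h' where "h' x = h x * of_bool (ennreal l < 2 * h x)" for x
  define c where "c = ennreal (l / 2)"
  have [measurable]: "h' \<in> borel_measurable M" unfolding h'_def by measurable
  have le: "h x \<le> h' x + c" for x
  proof (cases "ennreal l < 2 * h x")
    case False
    then show ?thesis unfolding h'_def c_def using l
      by (cases "h x") (auto simp: not_less ennreal_mult_top ennreal_numeral[symmetric] ennreal_mult[symmetric] simp del: ennreal_numeral)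
  qed (simp add: h'_def)
  have sums: "ergodic_sum S h n x \<le> ergodic_sum S h' n x + of_nat n * c" for n x
  proof (induction n arbitrary: x)
    case (Suc n)
    have "ergodic_sum S h (Suc n) x \<le> h' x + c + S (\<lambda>x. ergodic_sum S h' n x + of_nat n * c) x"
      using Suc le by (auto intro!: add_mono S_mono)
    also have "\<dots> \<le> h' x + c + (S (ergodic_sum S h' n) x + of_nat n * c)"
      by (intro add_left_mono S_add_const) measurable
    finally show ?case by (simp add: algebra_simps)
  qed simp
  \<comment> \<open>Half of the level \<open>l\<close> is used up by the discarded part of
    \<open>h\<close>, at most \<open>c\<close> per summand; the other half is the threshold left for
    \<open>h'\<close>.\<close>
  have c2: "ennreal l = c + c" using l by (simp add: c_def ennreal_plus[symmetric] del: ennreal_plus)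
  have "{x\<in>space M. ennreal l < ergodic_max h x} \<subseteq> {x\<in>space M. \<exists>n. ergodic_sum S h' n x > of_nat n * c}"
  proof safe
    fix x assume "ennreal l < ergodic_max h x"
    then obtain n where n: "ennreal l < ergodic_sum S h (Suc n) x / of_nat (Suc n)"
      by (auto simp: ergodic_max_def less_SUP_iff simp del: ergodic_sum.simps)
    have "of_nat (Suc n) * c + of_nat (Suc n) * c < ergodic_sum S h (Suc n) x"
    proof (rule ccontr)
      assume "\<not> of_nat (Suc n) * c + of_nat (Suc n) * c < ergodic_sum S h (Suc n) x"
      then have "ergodic_sum S h (Suc n) x \<le> of_nat (Suc n) * ennreal l"
        by (simp add: c2 distrib_left not_less del: of_nat_Suc ergodic_sum.simps)
      then have "ergodic_sum S h (Suc n) x / of_nat (Suc n) \<le> of_nat (Suc n) * ennreal l / of_nat (Suc n)"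
        by (rule divide_right_mono_ennreal)
      also have "\<dots> = ennreal l"
        by (metis ennreal_mult_divide_eq mult.commute of_nat_neq_0 ennreal_of_nat_neq_top of_nat_eq_0_iff nat.distinct(1))
      finally show False using n by simp
    qed
    also have "\<dots> \<le> ergodic_sum S h' (Suc n) x + of_nat (Suc n) * c" by (rule sums)
    finally have "of_nat (Suc n) * c < ergodic_sum S h' (Suc n) x"
      by (metis add.commute add_left_mono leD leI)
    then show "\<exists>n. ergodic_sum S h' n x > of_nat n * c" by blast
  qed
  then have "c * emeasure M {x\<in>space M. ennreal l < ergodic_max h x} \<le>
      c * emeasure M {x\<in>space M. \<exists>n. ergodic_sum S h' n x > of_nat n * c}"
    by (intro mult_left_mono emeasure_mono) auto
  also have "\<dots> \<le> (\<integral>\<^sup>+x. h' x \<partial>M)" by (intro maximal_weak_type) (auto simp: c_def)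
  finally have "ennreal (2 / l) * (c * emeasure M {x\<in>space M. ennreal l < ergodic_max h x}) 
     \<le> ennreal (2 / l) * (\<integral>\<^sup>+x. h' x \<partial>M)" by (rule mult_left_mono) simp
  moreover have "ennreal (2 / l) * c = 1" using l by (simp add: c_def ennreal_mult[symmetric])
  ultimately show ?thesis by (simp add: mult.assoc[symmetric] h'_def)
qed

text \<open>The layer-cake formula is used twice: to express the power of the maximal function
  through its level sets and, after the truncated weak-type bound and Fubini, backwards with
  exponent \<open>r - 1\<close> at \<open>2 * h x\<close>. The factor \<open>2 / l\<close> lowers
  the exponent; the constants \<open>2 r / (r - 1)\<close> and \<open>2^(r-1)\<close> multiply to
  the final one.\<close>

lemma maximal_strong_type:
  assumes [measurable]: "h \<in> borel_measurable M" and r: "1 < r"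
  shows "(\<integral>\<^sup>+x. epowr (ergodic_max h x) r \<partial>M) \<le>
      ennreal (2 powr r * r / (r - 1)) * (\<integral>\<^sup>+x. epowr (h x) r \<partial>M)"
proof -
  interpret L: pair_sigma_finite M "lborel :: real measure" by standard
  have "(\<integral>\<^sup>+x. epowr (ergodic_max h x) r \<partial>M) =
     (\<integral>\<^sup>+x. (\<integral>\<^sup>+l\<in>{0<..}. ennreal (r * l powr (r - 1)) * of_bool (ennreal l < ergodic_max h x) \<partial>lborel) \<partial>M)"
    using r by (simp add: layer_cake_epowr)
  also have "\<dots> = (\<integral>\<^sup>+l. \<integral>\<^sup>+x. ennreal (r * l powr (r - 1)) * of_bool (ennreal l < ergodic_max h x) * indicator {0<..} l \<partial>M \<partial>lborel)"
    by (subst L.Fubini') auto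
  also have "\<dots> = (\<integral>\<^sup>+l. (ennreal (r * l powr (r - 1)) * indicator {0<..} l) * emeasure M {x\<in>space M. ennreal l < ergodic_max h x} \<partial>lborel)"
  proof (intro nn_integral_cong)
    fix l :: real
    have "(\<integral>\<^sup>+x. ennreal (r * l powr (r - 1)) * of_bool (ennreal l < ergodic_max h x) * indicator {0<..} l \<partial>M)
      = (\<integral>\<^sup>+x. (ennreal (r * l powr (r - 1)) * indicator {0<..} l) * indicator {x\<in>space M. ennreal l < ergodic_max h x} x \<partial>M)"
      by (intro nn_integral_cong) (auto simp: indicator_def)
    then show "(\<integral>\<^sup>+x. ennreal (r * l powr (r - 1)) * of_bool (ennreal l < ergodic_max h x) * indicator {0<..} l \<partial>M) =
       (ennreal (r * l powr (r - 1)) * indicator {0<..} l) * emeasure M {x\<in>space M. ennreal l < ergodic_max h x}"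
      by (simp add: nn_integral_cmult)
  qed
  also have "\<dots> \<le> (\<integral>\<^sup>+l. (ennreal (r * l powr (r - 1)) * indicator {0<..} l) * 
      (ennreal (2 / l) * (\<integral>\<^sup>+x. h x * of_bool (ennreal l < 2 * h x) \<partial>M)) \<partial>lborel)"
    by (intro nn_integral_mono) (auto simp: indicator_def intro!: mult_left_mono maximal_weak_type_truncated)
  also have "\<dots> = (\<integral>\<^sup>+l. \<integral>\<^sup>+x. ennreal (2 * r / (r - 1)) * h x * (ennreal ((r - 1) * l powr (r - 1 - 1)) * of_bool (ennreal l < 2 * h x) * indicator {0<..} l) \<partial>M \<partial>lborel)"
  proof (rule nn_integral_cong)
    fix l :: real
    show "(ennreal (r * l powr (r - 1)) * indicator {0<..} l) * 
      (ennreal (2 / l) * (\<integral>\<^sup>+x. h x * of_bool (ennreal l < 2 * h x) \<partial>M)) =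
      (\<integral>\<^sup>+x. ennreal (2 * r / (r - 1)) * h x * (ennreal ((r - 1) * l powr (r - 1 - 1)) * of_bool (ennreal l < 2 * h x) * indicator {0<..} l) \<partial>M)"
    proof (cases "0 < l")
      case True
      have "(r * l powr (r - 1)) * (2 / l) = (2 * r / (r - 1)) * ((r - 1) * l powr (r - 1 - 1))"
        using True r by (simp add: powr_diff power2_eq_square)
      then have e: "ennreal (r * l powr (r - 1)) * ennreal (2 / l) = 
         ennreal (2 * r / (r - 1)) * ennreal ((r - 1) * l powr (r - 1 - 1))"
        using r True by (simp add: ennreal_mult[symmetric])
      have "ennreal (r * l powr (r - 1)) * (ennreal (2 / l) * (\<integral>\<^sup>+x. h x * of_bool (ennreal l < 2 * h x) \<partial>M))
        = (\<integral>\<^sup>+x. (ennreal (2 * r / (r - 1)) * ennreal ((r - 1) * l powr (r - 1 - 1))) * (h x * of_bool (ennreal l < 2 * h x)) \<partial>M)"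
        by (subst nn_integral_cmult) (simp_all only: e[symmetric] mult.assoc, measurable)
      then show ?thesis using True by (simp add: mult_ac)
    qed simp
  qed
  also have "\<dots> = (\<integral>\<^sup>+x. \<integral>\<^sup>+l. ennreal (2 * r / (r - 1)) * h x * (ennreal ((r - 1) * l powr (r - 1 - 1)) * of_bool (ennreal l < 2 * h x) * indicator {0<..} l) \<partial>lborel \<partial>M)"
    by (rule L.Fubini') measurable
  also have "\<dots> = (\<integral>\<^sup>+x. ennreal (2 * r / (r - 1)) * h x * epowr (2 * h x) (r - 1) \<partial>M)"
    using r by (intro nn_integral_cong) (simp add: nn_integral_cmult layer_cake_epowr)
  also have "\<dots> = (\<integral>\<^sup>+x. ennreal (2 powr r * r / (r - 1)) * epowr (h x) r \<partial>M)"
  proof (rule nn_integral_cong)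
    fix x
    have 1: "epowr (2 * h x) (r - 1) = ennreal (2 powr (r - 1)) * epowr (h x) (r - 1)"
      using r epowr_mult[of "r - 1" "ennreal 2" "h x"] by simp
    have 2: "h x * epowr (h x) (r - 1) = epowr (h x) r"
      using epowr_add[of "h x" 1 "r - 1"] by simp
    have 3: "ennreal (2 * r / (r - 1)) * ennreal (2 powr (r - 1)) = ennreal (2 powr r * r / (r - 1))"
      using r by (simp add: ennreal_mult[symmetric] powr_diff field_simps)
    show "ennreal (2 * r / (r - 1)) * h x * epowr (2 * h x) (r - 1) = ennreal (2 powr r * r / (r - 1)) * epowr (h x) r"
      unfolding 1 2[symmetric] 3[symmetric] by (simp only: mult_ac)
  qed
  also have "\<dots> = ennreal (2 powr r * r / (r - 1)) * (\<integral>\<^sup>+x. epowr (h x) r \<partial>M)"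
    by (rule nn_integral_cmult) measurable
  finally show ?thesis .
qed

end

section \<open>Gaussian integrals\<close>

lemma nn_integral_lborel_affine:
  fixes f :: "'a::euclidean_space \<Rightarrow> ennreal"
  assumes [measurable]: "f \<in> borel_measurable borel" and c: "c \<noteq> 0"
  shows "(\<integral>\<^sup>+x. f x \<partial>lborel) = ennreal (\<bar>c\<bar> ^ DIM('a)) * (\<integral>\<^sup>+x. f (t + c *\<^sub>R x) \<partial>lborel)"
  by (subst lborel_affine[OF c, of t]) (simp add: nn_integral_density nn_integral_distr nn_integral_cmult)

text \<open>The integrand is \<open>sqrt pi\<close> times the normal density of variance
  \<open>1/2\<close>.\<close>

lemma nn_integral_exp_minus_square: "(\<integral>\<^sup>+x. ennreal (exp (- x\<^sup>2)) \<partial>lborel) = ennreal (sqrt pi)"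
proof -
  interpret prob_space "density lborel (\<lambda>x. ennreal (normal_density 0 (1 / sqrt 2) x))"
    by (rule prob_space_normal_density) simp
  have "(\<integral>\<^sup>+x. ennreal (normal_density 0 (1 / sqrt 2) x) \<partial>lborel) = 1"
    using emeasure_space_1 by (simp add: emeasure_density)
  moreover have "(\<integral>\<^sup>+x. ennreal (exp (- x\<^sup>2)) \<partial>lborel) = 
    (\<integral>\<^sup>+x. ennreal (sqrt pi) * ennreal (normal_density 0 (1 / sqrt 2) x) \<partial>lborel)"
    by (intro nn_integral_cong) (auto simp: normal_density_def ennreal_mult[symmetric] power_divide)
  ultimately show ?thesis by (simp add: nn_integral_cmult)
qed

lemma nn_integral_gaussian:
  "(\<integral>\<^sup>+x. ennreal (exp (- (norm x)\<^sup>2)) \<partial>(lborel :: (real ^ 'd) measure)) = ennreal (pi powr (real CARD('d) / 2))"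
proof -
  have "(\<integral>\<^sup>+x. ennreal (exp (- (norm x)\<^sup>2)) \<partial>(lborel :: (real ^ 'd) measure)) =
     (\<integral>\<^sup>+x. (\<Prod>b\<in>(Basis :: (real ^ 'd) set). ennreal (exp (- (x \<bullet> b)\<^sup>2))) \<partial>(lborel :: (real ^ 'd) measure))"
  proof (rule nn_integral_cong)
    fix x :: "real ^ 'd"
    have "(norm x)\<^sup>2 = (\<Sum>b\<in>Basis. (x \<bullet> b)\<^sup>2)"
      unfolding power2_norm_eq_inner by (subst euclidean_inner) (simp add: power2_eq_square)
    then show "ennreal (exp (- (norm x)\<^sup>2)) = (\<Prod>b\<in>Basis. ennreal (exp (- (x \<bullet> b)\<^sup>2)))"
      by (simp add: exp_sum[symmetric] sum_negf[symmetric] prod_ennreal)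
  qed
  also have "\<dots> = (\<Prod>b\<in>(Basis :: (real ^ 'd) set). ennreal (sqrt pi))"
    by (subst nn_integral_lborel_prod) (auto simp: nn_integral_exp_minus_square)
  also have "\<dots> = ennreal (sqrt pi ^ CARD('d))" by (simp add: ennreal_power)
  also have "sqrt pi ^ CARD('d) = pi powr (real CARD('d) / 2)"
    by (simp add: powr_half_sqrt[symmetric] powr_realpow[symmetric] powr_powr)
  finally show ?thesis .
qed

lemma norm_sq_lincomb:
  fixes b x :: "'a::real_inner"
  shows "(norm (p *\<^sub>R b + q *\<^sub>R x))\<^sup>2 = p\<^sup>2 * (norm b)\<^sup>2 + 2 * p * q * (b \<bullet> x) + q\<^sup>2 * (norm x)\<^sup>2"
  unfolding power2_norm_eq_inner
  by (simp add: inner_add_left inner_add_right inner_commute) (simp add: power2_eq_square algebra_simps)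

text \<open>Completing the square: the substitution recentres at \<open>b / A\<close> and rescales
  by \<open>1 / sqrt A\<close>.\<close>

lemma nn_integral_gaussian_shift:
  fixes b :: "real ^ 'd"
  assumes A: "0 < A"
  shows "(\<integral>\<^sup>+x. ennreal (exp (- A * (norm x)\<^sup>2 + 2 * (x \<bullet> b))) \<partial>lborel) =
    ennreal ((pi / A) powr (real CARD('d) / 2) * exp ((norm b)\<^sup>2 / A))"
proof -
  let ?c = "1 / sqrt A"
  have "(\<integral>\<^sup>+x. ennreal (exp (- A * (norm x)\<^sup>2 + 2 * (x \<bullet> b))) \<partial>lborel) =
    ennreal (\<bar>?c\<bar> ^ DIM(real ^ 'd)) * (\<integral>\<^sup>+x. ennreal (exp (- A * (norm ((1/A) *\<^sub>R b + ?c *\<^sub>R x))\<^sup>2 + 2 * (((1/A) *\<^sub>R b + ?c *\<^sub>R x) \<bullet> b))) \<partial>lborel)"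
    using A by (intro nn_integral_lborel_affine) auto
  also have "(\<lambda>x. - A * (norm ((1/A) *\<^sub>R b + ?c *\<^sub>R x))\<^sup>2 + 2 * (((1/A) *\<^sub>R b + ?c *\<^sub>R x) \<bullet> b))
      = (\<lambda>x. (norm b)\<^sup>2 / A - (norm x)\<^sup>2)"
  proof
    fix x
    have s: "sqrt A * sqrt A = A" "sqrt A > 0" using A by auto
    have "- A * (norm ((1/A) *\<^sub>R b + ?c *\<^sub>R x))\<^sup>2 = - ((norm b)\<^sup>2 / A + 2 * ?c * (b \<bullet> x) + (norm x)\<^sup>2)"
      unfolding norm_sq_lincomb using A by (simp add: field_simps power2_eq_square s)
    then show "- A * (norm ((1/A) *\<^sub>R b + ?c *\<^sub>R x))\<^sup>2 + 2 * (((1/A) *\<^sub>R b + ?c *\<^sub>R x) \<bullet> b) = (norm b)\<^sup>2 / A - (norm x)\<^sup>2"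
      by (simp add: inner_add_left inner_add_right inner_commute dot_square_norm)
  qed
  also have "(\<integral>\<^sup>+x. ennreal (exp ((norm b)\<^sup>2 / A - (norm x)\<^sup>2)) \<partial>(lborel :: (real ^ 'd) measure)) = 
     (\<integral>\<^sup>+x. ennreal (exp ((norm b)\<^sup>2 / A)) * ennreal (exp (- (norm x)\<^sup>2)) \<partial>(lborel :: (real ^ 'd) measure))"
    by (simp add: ennreal_mult[symmetric] exp_add[symmetric])
  also have "\<dots> = ennreal (exp ((norm b)\<^sup>2 / A)) * ennreal (pi powr (real CARD('d) / 2))"
    by (simp add: nn_integral_cmult nn_integral_gaussian)
  also have "ennreal (\<bar>?c\<bar> ^ DIM(real ^ 'd)) * (ennreal (exp ((norm b)\<^sup>2 / A)) * ennreal (pi powr (real CARD('d) / 2)))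
     = ennreal (\<bar>?c\<bar> ^ CARD('d) * pi powr (real CARD('d) / 2) * exp ((norm b)\<^sup>2 / A))"
    by (simp add: ennreal_mult mult_ac)
  also have "\<bar>?c\<bar> ^ CARD('d) = (1 / A) powr (real CARD('d) / 2)"
    using A by (simp add: powr_half_sqrt[symmetric] powr_realpow[symmetric] powr_powr real_sqrt_divide[symmetric] del: real_sqrt_divide)
      (simp add: powr_divide powr_powr powr_half_sqrt[symmetric])
  also have "(1 / A) powr (real CARD('d) / 2) * pi powr (real CARD('d) / 2) = (pi / A) powr (real CARD('d) / 2)"
    using A by (simp add: powr_divide)
  finally show ?thesis .
qed

section \<open>The Gaussian probability measure\<close>

definition gauss_dens :: "real ^ 'd \<Rightarrow> real" where
  "gauss_dens x = pi powr (- real CARD('d) / 2) * exp (- (norm x)\<^sup>2)"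

lemma gauss_dens_pos: "0 < gauss_dens x" by (simp add: gauss_dens_def)

lemma measurable_gauss_dens [measurable]: "gauss_dens \<in> borel_measurable borel"
  unfolding gauss_dens_def by measurable

lemma gauss_measure_eq: "gauss_measure = density lborel (\<lambda>x. ennreal (gauss_dens x))"
  by (simp add: gauss_measure_def gauss_dens_def)

lemma sets_gauss_measure [measurable_cong, simp]: "sets gauss_measure = sets borel"
  by (simp add: gauss_measure_eq)

lemma space_gauss_measure [simp]: "space gauss_measure = UNIV"
  by (simp add: gauss_measure_eq)

lemma nn_integral_gauss:
  "f \<in> borel_measurable borel \<Longrightarrow> (\<integral>\<^sup>+x. f x \<partial>gauss_measure) = (\<integral>\<^sup>+x. ennreal (gauss_dens x) * f x \<partial>lborel)"
  by (simp add: gauss_measure_eq nn_integral_density)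

text \<open>The density adds one to the coefficient of \<open>|x|^2\<close>, hence the range of
  \<open>A\<close>. Negative \<open>A\<close> measures the integrability of
  \<open>exp (e |x|^2)\<close>.\<close>

lemma nn_integral_gauss_exp:
  fixes b :: "real ^ 'd"
  assumes A: "-1 < A"
  shows "(\<integral>\<^sup>+x. ennreal (exp (- A * (norm x)\<^sup>2 + 2 * (x \<bullet> b))) \<partial>gauss_measure) =
    ennreal ((1 + A) powr (- real CARD('d) / 2) * exp ((norm b)\<^sup>2 / (1 + A)))"
proof -
  have "(\<integral>\<^sup>+x. ennreal (exp (- A * (norm x)\<^sup>2 + 2 * (x \<bullet> b))) \<partial>gauss_measure) =
    (\<integral>\<^sup>+x. ennreal (pi powr (- real CARD('d) / 2)) * ennreal (exp (- (1 + A) * (norm x)\<^sup>2 + 2 * (x \<bullet> b))) \<partial>lborel)"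
    by (subst nn_integral_gauss)
       (auto simp: gauss_dens_def ennreal_mult[symmetric] exp_add[symmetric] algebra_simps intro!: nn_integral_cong)
  also have "\<dots> = ennreal (pi powr (- real CARD('d) / 2)) * ennreal ((pi / (1 + A)) powr (real CARD('d) / 2) * exp ((norm b)\<^sup>2 / (1 + A)))"
    using A by (subst nn_integral_cmult, measurable) (subst nn_integral_gaussian_shift, auto)
  also have "\<dots> = ennreal ((1 + A) powr (- real CARD('d) / 2) * exp ((norm b)\<^sup>2 / (1 + A)))"
    using A by (simp add: ennreal_mult[symmetric] powr_divide powr_minus field_simps)
  finally show ?thesis .
qed

lemma prob_space_gauss: "prob_space (gauss_measure :: (real ^ 'd) measure)"
proof
  have "emeasure (gauss_measure :: (real ^ 'd) measure) UNIV = (\<integral>\<^sup>+x. ennreal (exp (- 0 * (norm x)\<^sup>2 + 2 * (x \<bullet> (0 :: real ^ 'd)))) \<partial>gauss_measure)"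
    by simp
  also have "\<dots> = 1" by (subst nn_integral_gauss_exp) auto
  finally show "emeasure (gauss_measure :: (real ^ 'd) measure) (space gauss_measure) = 1" by simp
qed

interpretation gauss: prob_space "gauss_measure :: (real ^ 'd) measure"
  by (rule prob_space_gauss)

interpretation gauss2: pair_sigma_finite "gauss_measure :: (real ^ 'd) measure" "gauss_measure :: (real ^ 'd) measure" ..

interpretation gauss_lborel: pair_sigma_finite "gauss_measure :: (real ^ 'd) measure" "lborel :: real measure" ..

lemma nn_integral_gauss_affine:
  fixes g :: "real ^ 'd \<Rightarrow> ennreal"
  assumes [measurable]: "g \<in> borel_measurable borel" and c: "0 < c"
  shows "(\<integral>\<^sup>+u. g (c *\<^sub>R u + w) \<partial>gauss_measure) =
     ennreal (c powr (- real CARD('d))) * (\<integral>\<^sup>+y. ennreal (gauss_dens ((1 / c) *\<^sub>R (y - w))) * g y \<partial>lborel)"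
proof -
  have "(\<integral>\<^sup>+u. g (c *\<^sub>R u + w) \<partial>gauss_measure) = (\<integral>\<^sup>+u. ennreal (gauss_dens u) * g (c *\<^sub>R u + w) \<partial>lborel)"
    by (rule nn_integral_gauss) measurable
  moreover have "(\<integral>\<^sup>+y. ennreal (gauss_dens ((1 / c) *\<^sub>R (y - w))) * g y \<partial>lborel) =
    ennreal (\<bar>c\<bar> ^ DIM(real ^ 'd)) * (\<integral>\<^sup>+u. ennreal (gauss_dens u) * g (c *\<^sub>R u + w) \<partial>lborel)"
    using c by (subst nn_integral_lborel_affine[of _ c w]) (auto simp: add.commute)
  moreover have "ennreal (c powr (- real CARD('d))) * ennreal (\<bar>c\<bar> ^ DIM(real ^ 'd)) = 1"
    using c by (simp add: ennreal_mult[symmetric] powr_minus powr_realpow)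
  ultimately show ?thesis by (simp add: mult.assoc[symmetric])
qed

text \<open>Rotation invariance: for independent Gaussian \<open>u\<close> and \<open>v\<close>,
  \<open>a u + b v\<close> is distributed like \<open>sqrt (a^2 + b^2) w\<close>. Since
  \<open>a > 0\<close>, the law for fixed \<open>v\<close> has a density, and its Gaussian mean over
  \<open>v\<close> is an integral of the kind just computed.\<close>

lemma nn_integral_gauss_add:
  fixes g :: "real ^ 'd \<Rightarrow> ennreal"
  assumes [measurable]: "g \<in> borel_measurable borel" and a: "0 < a"
  shows "(\<integral>\<^sup>+v. \<integral>\<^sup>+u. g (a *\<^sub>R u + b *\<^sub>R v) \<partial>gauss_measure \<partial>gauss_measure) =
     (\<integral>\<^sup>+w. g (sqrt (a\<^sup>2 + b\<^sup>2) *\<^sub>R w) \<partial>gauss_measure)"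
proof -
  let ?d = "real CARD('d) / 2" and ?s = "sqrt (a\<^sup>2 + b\<^sup>2)"
  have s: "?s > 0" using a by (simp add: add_pos_nonneg)
  have s2: "?s\<^sup>2 = a\<^sup>2 + b\<^sup>2" by simp
  note scale = nn_integral_gauss_affine[OF assms(1)]
  have inner: "(\<integral>\<^sup>+v. ennreal (gauss_dens ((1 / a) *\<^sub>R (y - b *\<^sub>R v))) \<partial>gauss_measure) =
     ennreal ((a / ?s) powr (2 * ?d) * gauss_dens ((1 / ?s) *\<^sub>R y))" for y :: "real ^ 'd"
  proof -
    have e: "gauss_dens ((1 / a) *\<^sub>R (y - b *\<^sub>R v)) = gauss_dens ((1/a) *\<^sub>R y) *
        exp (- (b/a)\<^sup>2 * (norm v)\<^sup>2 + 2 * (v \<bullet> ((b / a\<^sup>2) *\<^sub>R y)))" for v :: "real ^ 'd"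
    proof -
      have "(1 / a) *\<^sub>R (y - b *\<^sub>R v) = (1/a) *\<^sub>R y + (- b / a) *\<^sub>R v"
        by (simp add: scaleR_diff_right)
      have "(norm ((1 / a) *\<^sub>R (y - b *\<^sub>R v)))\<^sup>2 = (norm ((1/a) *\<^sub>R y))\<^sup>2 + (b/a)\<^sup>2 * (norm v)\<^sup>2 - 2 * (v \<bullet> ((b / a\<^sup>2) *\<^sub>R y))"
        unfolding \<open>(1 / a) *\<^sub>R (y - b *\<^sub>R v) = _\<close> norm_sq_lincomb using a by (simp add: inner_commute power_mult_distrib power_divide) (simp add: power2_eq_square)
      then show ?thesis unfolding gauss_dens_def mult.assoc exp_add[symmetric] by simp
    qed
    have A: "1 + (b/a)\<^sup>2 = (?s / a)\<^sup>2" unfolding power_divide s2 using a by (simp add: field_simps)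
    have "(\<integral>\<^sup>+v. ennreal (gauss_dens ((1 / a) *\<^sub>R (y - b *\<^sub>R v))) \<partial>gauss_measure) =
      ennreal (gauss_dens ((1/a) *\<^sub>R y)) * ennreal ((1 + (b/a)\<^sup>2) powr (- real CARD('d) / 2) * exp ((norm ((b / a\<^sup>2) *\<^sub>R y))\<^sup>2 / (1 + (b/a)\<^sup>2)))"
      unfolding e by (subst nn_integral_gauss_exp[symmetric])
        (auto simp: ennreal_mult gauss_dens_pos[THEN less_imp_le] nn_integral_cmult intro: less_le_trans[of _ 0])
    also have "\<dots> = ennreal ((1 + (b/a)\<^sup>2) powr (- real CARD('d) / 2) * (gauss_dens ((1/a) *\<^sub>R y) * exp ((norm ((b / a\<^sup>2) *\<^sub>R y))\<^sup>2 / (1 + (b/a)\<^sup>2))))"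
      by (simp add: ennreal_mult[symmetric] gauss_dens_pos[THEN less_imp_le] mult_ac)
    also have "(1 + (b/a)\<^sup>2) powr (- real CARD('d) / 2) = (a / ?s) powr (2 * ?d)"
    proof -
      have g: "(z\<^sup>2) powr (- e) = (1 / z) powr (2 * e)" if "0 < z" for z e :: real
        using that by (simp add: powr_numeral[symmetric] powr_powr powr_minus powr_divide field_simps del: powr_numeral)
      show ?thesis
        using g[of "?s / a" ?d] a s unfolding A by simp
    qed
    also have "gauss_dens ((1/a) *\<^sub>R y) * exp ((norm ((b / a\<^sup>2) *\<^sub>R y))\<^sup>2 / (1 + (b/a)\<^sup>2)) = gauss_dens ((1 / ?s) *\<^sub>R y)"
    proof -
      have "(norm ((b / a\<^sup>2) *\<^sub>R y))\<^sup>2 / (1 + (b/a)\<^sup>2) = (norm y)\<^sup>2 * (1 / a\<^sup>2 - 1 / ?s\<^sup>2)"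
        unfolding A s2 power_divide using a s by (simp add: power_mult_distrib power_divide power2_eq_square field_simps)
      moreover have "(norm ((1/a) *\<^sub>R y))\<^sup>2 = (norm y)\<^sup>2 * (1 / a\<^sup>2)" "(norm ((1/?s) *\<^sub>R y))\<^sup>2 = (norm y)\<^sup>2 * (1 / ?s\<^sup>2)"
        using a s by (simp_all add: power_mult_distrib power_divide)
      ultimately show ?thesis unfolding gauss_dens_def mult.assoc exp_add[symmetric] by (simp add: algebra_simps)
    qed
    finally show ?thesis .
  qed
  have "(\<integral>\<^sup>+v. \<integral>\<^sup>+u. g (a *\<^sub>R u + b *\<^sub>R v) \<partial>gauss_measure \<partial>gauss_measure) =
    (\<integral>\<^sup>+v. ennreal (a powr (- real CARD('d))) * (\<integral>\<^sup>+y. ennreal (gauss_dens ((1 / a) *\<^sub>R (y - b *\<^sub>R v))) * g y \<partial>lborel) \<partial>gauss_measure)"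
    by (simp only: scale[OF a])
  also have "\<dots> = ennreal (a powr (- real CARD('d))) * (\<integral>\<^sup>+v. \<integral>\<^sup>+y. ennreal (gauss_dens ((1 / a) *\<^sub>R (y - b *\<^sub>R v))) * g y \<partial>lborel \<partial>gauss_measure)"
    by (rule nn_integral_cmult) measurable
  also have "(\<integral>\<^sup>+v. \<integral>\<^sup>+y. ennreal (gauss_dens ((1 / a) *\<^sub>R (y - b *\<^sub>R v))) * g y \<partial>lborel \<partial>gauss_measure) =
     (\<integral>\<^sup>+y. \<integral>\<^sup>+v. ennreal (gauss_dens ((1 / a) *\<^sub>R (y - b *\<^sub>R v))) * g y \<partial>gauss_measure \<partial>lborel)"
  proof -
    interpret p: pair_sigma_finite "lborel :: (real ^ 'd) measure" "gauss_measure :: (real ^ 'd) measure" ..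
    show ?thesis by (rule p.Fubini') measurable
  qed
  also have "\<dots> = (\<integral>\<^sup>+y. ennreal ((a / ?s) powr (2 * ?d)) * (ennreal (gauss_dens ((1 / ?s) *\<^sub>R (y - 0))) * g y) \<partial>lborel)"
    by (simp add: nn_integral_multc inner ennreal_mult gauss_dens_pos[THEN less_imp_le] mult.assoc)
  also have "\<dots> = ennreal ((a / ?s) powr (2 * ?d)) * (\<integral>\<^sup>+y. ennreal (gauss_dens ((1 / ?s) *\<^sub>R (y - 0))) * g y \<partial>lborel)"
    by (rule nn_integral_cmult) measurable
  also have "ennreal (a powr (- real CARD('d))) * \<dots> = ennreal (?s powr (- real CARD('d))) * (\<integral>\<^sup>+y. ennreal (gauss_dens ((1 / ?s) *\<^sub>R (y - 0))) * g y \<partial>lborel)"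
  proof -
    have "a powr (- real CARD('d)) * (a / ?s) powr (2 * ?d) = ?s powr (- real CARD('d))"
      using a s by (simp add: powr_divide powr_minus field_simps)
    then show ?thesis by (simp add: ennreal_mult[symmetric] mult.assoc[symmetric])
  qed
  also have "\<dots> = (\<integral>\<^sup>+w. g (?s *\<^sub>R w + 0) \<partial>gauss_measure)" by (rule scale[OF s, symmetric])
  finally show ?thesis by simp
qed

section \<open>The Ornstein-Uhlenbeck semigroup\<close>

text \<open>The semigroup on nonnegative functions, where Fubini and symmetry hold without
  integrability assumptions; signed functions are controlled by \<open>nnT\<close> of their absolute
  value.\<close>

definition nnT :: "real \<Rightarrow> (real ^ 'd \<Rightarrow> ennreal) \<Rightarrow> real ^ 'd \<Rightarrow> ennreal" where
  "nnT t g x = (\<integral>\<^sup>+u. g (sqrt (1 - exp (- 2 * t)) *\<^sub>R u + exp (- t) *\<^sub>R x) \<partial>gauss_measure)"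

text \<open>Joint in the time, the point and a parameter of the function itself, so that expressions
  like \<open>nnT t (G t) x\<close> inside iterated integrals are measurable automatically.\<close>

lemma measurable_nnT [measurable (raw)]:
  assumes f: "(\<lambda>(w, y). f w y) \<in> borel_measurable (N \<Otimes>\<^sub>M borel)"
    and [measurable]: "t \<in> borel_measurable N" "x \<in> N \<rightarrow>\<^sub>M borel"
  shows "(\<lambda>w. nnT (t w) (f w) (x w)) \<in> borel_measurable N"
proof -
  have "(\<lambda>p. (fst p, sqrt (1 - exp (- 2 * t (fst p))) *\<^sub>R snd p + exp (- t (fst p)) *\<^sub>R x (fst p))) \<in> N \<Otimes>\<^sub>M gauss_measure \<rightarrow>\<^sub>M N \<Otimes>\<^sub>M borel"
    by measurable
  from measurable_compose[OF this f]
  have "(\<lambda>(w, u). f w (sqrt (1 - exp (- 2 * t w)) *\<^sub>R u + exp (- t w) *\<^sub>R x w)) \<in> borel_measurable (N \<Otimes>\<^sub>M gauss_measure)"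
    by (simp add: case_prod_beta')
  then show ?thesis unfolding nnT_def by (rule gauss.borel_measurable_nn_integral)
qed

lemma measurable_ou_semigroup [measurable (raw)]:
  assumes f: "(\<lambda>(w, y). f w y) \<in> borel_measurable (N \<Otimes>\<^sub>M borel)"
    and [measurable]: "t \<in> borel_measurable N" "x \<in> N \<rightarrow>\<^sub>M borel"
  shows "(\<lambda>w. ou_semigroup (t w) (f w) (x w)) \<in> borel_measurable N"
proof -
  have "(\<lambda>p. (fst p, sqrt (1 - exp (- 2 * t (fst p))) *\<^sub>R snd p + exp (- t (fst p)) *\<^sub>R x (fst p))) \<in> N \<Otimes>\<^sub>M gauss_measure \<rightarrow>\<^sub>M N \<Otimes>\<^sub>M borel"
    by measurable
  from measurable_compose[OF this f]
  have "(\<lambda>(w, u). f w (sqrt (1 - exp (- 2 * t w)) *\<^sub>R u + exp (- t w) *\<^sub>R x w)) \<in> borel_measurable (N \<Otimes>\<^sub>M gauss_measure)"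
    by (simp add: case_prod_beta')
  then show ?thesis unfolding ou_semigroup_def by (rule gauss.borel_measurable_lebesgue_integral)
qed

lemma emeasure_gauss_UNIV [simp]: "emeasure gauss_measure UNIV = 1"
  using gauss.emeasure_space_1 by simp

lemma nnT_mono: "(\<And>x. f x \<le> g x) \<Longrightarrow> nnT t f x \<le> nnT t g x"
  unfolding nnT_def by (intro nn_integral_mono) auto

lemma nnT_const [simp]: "nnT t (\<lambda>x. c) x = c"
  by (simp add: nnT_def)

lemma nnT_add:
  assumes [measurable]: "f \<in> borel_measurable borel" "g \<in> borel_measurable borel"
  shows "nnT t (\<lambda>x. f x + g x) x = nnT t f x + nnT t g x"
  unfolding nnT_def by (rule nn_integral_add) measurable

lemma nnT_cmult:
  assumes [measurable]: "f \<in> borel_measurable borel"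
  shows "nnT t (\<lambda>x. c * f x) x = c * nnT t f x"
  unfolding nnT_def by (rule nn_integral_cmult) measurable

lemma nnT_0 [simp]: "nnT 0 f x = f x"
  by (simp add: nnT_def)

lemma epowr_nnT_le:
  assumes [measurable]: "f \<in> borel_measurable borel" and q: "1 \<le> q"
  shows "epowr (nnT t f x) q \<le> nnT t (\<lambda>x. epowr (f x) q) x"
  using Jensen_weighted[OF q, of 1 "\<lambda>_. 1" gauss_measure "\<lambda>u. f (sqrt (1 - exp (- 2 * t)) *\<^sub>R u + exp (- t) *\<^sub>R x)"]
  unfolding nnT_def by simp

text \<open>The kernel relative to the Gaussian measure instead of Lebesgue measure; in this form it
  is symmetric in \<open>x\<close> and \<open>y\<close>.\<close>

definition mehler :: "real \<Rightarrow> real ^ 'd \<Rightarrow> real ^ 'd \<Rightarrow> real" where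
  "mehler t x y = sqrt (1 - exp (- 2 * t)) powr (- real CARD('d)) *
     exp ((2 * exp (- t) * (x \<bullet> y) - (exp (- t))\<^sup>2 * ((norm x)\<^sup>2 + (norm y)\<^sup>2)) / (1 - exp (- 2 * t)))"

lemma mehler_nonneg: "0 \<le> mehler t x y" by (simp add: mehler_def)

lemma mehler_commute: "mehler t x y = mehler t y x"
  by (simp add: mehler_def inner_commute add.commute)

lemma measurable_mehler [measurable]: "(\<lambda>(x, y). mehler t x y) \<in> borel_measurable (borel \<Otimes>\<^sub>M borel)"
  unfolding mehler_def by measurable

text \<open>The law of the argument of \<open>g\<close> is Gaussian with centre
  \<open>exp (- t) x\<close> and scale \<open>sqrt (1 - exp (- 2 t))\<close>; dividing its density
  by \<open>gauss_dens y\<close> leaves the kernel. At \<open>t = 0\<close> the law is a point mass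
  and has no kernel.\<close>

lemma nnT_mehler:
  fixes g :: "real ^ 'd \<Rightarrow> ennreal"
  assumes [measurable]: "g \<in> borel_measurable borel" and t: "0 < t"
  shows "nnT t g x = (\<integral>\<^sup>+y. ennreal (mehler t x y) * g y \<partial>gauss_measure)"
proof -
  let ?r = "exp (- t)" and ?c = "sqrt (1 - exp (- 2 * t))"
  have c: "0 < ?c" using t by simp
  have c2: "?c\<^sup>2 = 1 - ?r\<^sup>2" "1 - exp (- 2 * t) = 1 - ?r\<^sup>2" using t by (auto simp: power2_eq_square exp_add[symmetric])
  have c3: "1 - ?r\<^sup>2 > 0" using c c2 by (metis real_sqrt_gt_0_iff)
  have e: "?c powr (- real CARD('d)) * gauss_dens ((1 / ?c) *\<^sub>R (y - ?r *\<^sub>R x)) = gauss_dens y * mehler t x y" for y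
  proof -
    have "(1 / ?c) *\<^sub>R (y - ?r *\<^sub>R x) = (1 / ?c) *\<^sub>R y + (- ?r / ?c) *\<^sub>R x" by (simp add: scaleR_diff_right)
    then have "(norm ((1 / ?c) *\<^sub>R (y - ?r *\<^sub>R x)))\<^sup>2 = ((norm y)\<^sup>2 - 2 * ?r * (x \<bullet> y) + ?r\<^sup>2 * (norm x)\<^sup>2) / (1 - ?r\<^sup>2)"
      unfolding c2(1)[symmetric] using c
      by (simp only: norm_sq_lincomb) (simp add: power_divide power2_eq_square inner_commute add_divide_distrib diff_divide_distrib)
    also have "- \<dots> = - (norm y)\<^sup>2 + (2 * ?r * (x \<bullet> y) - ?r\<^sup>2 * ((norm x)\<^sup>2 + (norm y)\<^sup>2)) / (1 - ?r\<^sup>2)"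
      using c3 by (simp add: field_simps)
    finally show ?thesis unfolding gauss_dens_def mehler_def c2(2) by (simp add: exp_add[symmetric])
  qed
  have "nnT t g x = (\<integral>\<^sup>+y. ennreal (?c powr (- real CARD('d))) * (ennreal (gauss_dens ((1 / ?c) *\<^sub>R (y - ?r *\<^sub>R x))) * g y) \<partial>lborel)"
    unfolding nnT_def by (subst nn_integral_gauss_affine[OF _ c], measurable) (rule nn_integral_cmult[symmetric], measurable)
  also have "\<dots> = (\<integral>\<^sup>+y. ennreal (gauss_dens y) * (ennreal (mehler t x y) * g y) \<partial>lborel)"
    unfolding mult.assoc[symmetric] ennreal_mult[symmetric, OF less_imp_le[OF gauss_dens_pos] mehler_nonneg] e[symmetric]
    by (simp add: ennreal_mult less_imp_le[OF gauss_dens_pos])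
  also have "\<dots> = (\<integral>\<^sup>+y. ennreal (mehler t x y) * g y \<partial>gauss_measure)"
    by (rule nn_integral_gauss[symmetric]) measurable
  finally show ?thesis .
qed

lemma distr_gauss_mehler:
  fixes x :: "real ^ 'd"
  assumes t: "0 < t"
  shows "distr gauss_measure borel (\<lambda>u. sqrt (1 - exp (- 2 * t)) *\<^sub>R u + exp (- t) *\<^sub>R x) =
     density gauss_measure (\<lambda>y. ennreal (mehler t x y))" (is "?L = ?R")
proof (rule measure_eqI)
  fix A assume "A \<in> sets ?L"
  then have [measurable]: "A \<in> sets borel" by simp
  have "emeasure ?L A = (\<integral>\<^sup>+y. indicator A y \<partial>?L)" by simp
  also have "\<dots> = nnT t (indicator A) x" by (subst nn_integral_distr) (auto simp: nnT_def)
  also have "\<dots> = emeasure ?R A" using t by (subst nnT_mehler) (auto simp: emeasure_density)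
  finally show "emeasure ?L A = emeasure ?R A" .
qed simp

lemma ou_semigroup_mehler:
  fixes f :: "real ^ 'd \<Rightarrow> real"
  assumes [measurable]: "f \<in> borel_measurable borel" and t: "0 < t"
  shows "ou_semigroup t f x = (\<integral>y. mehler t x y * f y \<partial>gauss_measure)"
proof -
  have "ou_semigroup t f x = (\<integral>y. f y \<partial>distr gauss_measure borel (\<lambda>u. sqrt (1 - exp (- 2 * t)) *\<^sub>R u + exp (- t) *\<^sub>R x))"
    unfolding ou_semigroup_def by (subst integral_distr) auto
  also have "\<dots> = (\<integral>y. mehler t x y * f y \<partial>gauss_measure)"
    unfolding distr_gauss_mehler[OF t] by (subst integral_real_density) (auto simp: mehler_nonneg)
  finally show ?thesis .
qed

lemma nnT_symmetric:
  fixes f g :: "real ^ 'd \<Rightarrow> ennreal"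
  assumes [measurable]: "f \<in> borel_measurable borel" "g \<in> borel_measurable borel" and t: "0 \<le> t"
  shows "(\<integral>\<^sup>+x. f x * nnT t g x \<partial>gauss_measure) = (\<integral>\<^sup>+x. nnT t f x * g x \<partial>gauss_measure)"
proof (cases "t = 0")
  case False
  then have t: "0 < t" using t by simp
  have "(\<integral>\<^sup>+x. f x * nnT t g x \<partial>gauss_measure) = (\<integral>\<^sup>+x. \<integral>\<^sup>+y. f x * (ennreal (mehler t x y) * g y) \<partial>gauss_measure \<partial>gauss_measure)"
    by (simp add: nnT_mehler[OF _ t] nn_integral_cmult)
  also have "\<dots> = (\<integral>\<^sup>+y. \<integral>\<^sup>+x. f x * (ennreal (mehler t x y) * g y) \<partial>gauss_measure \<partial>gauss_measure)"
    by (rule gauss2.Fubini') measurable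
  also have "\<dots> = (\<integral>\<^sup>+y. \<integral>\<^sup>+x. (ennreal (mehler t y x) * f x) * g y \<partial>gauss_measure \<partial>gauss_measure)"
    by (simp add: mehler_commute[of t] mult_ac)
  also have "\<dots> = (\<integral>\<^sup>+y. nnT t f y * g y \<partial>gauss_measure)"
    by (simp add: nnT_mehler[OF _ t] nn_integral_multc)
  finally show ?thesis .
qed simp

lemma nn_integral_nnT:
  assumes [measurable]: "g \<in> borel_measurable borel" and t: "0 \<le> t"
  shows "(\<integral>\<^sup>+x. nnT t g x \<partial>gauss_measure) = (\<integral>\<^sup>+x. g x \<partial>gauss_measure)"
  using nnT_symmetric[of "\<lambda>_. 1" g t] t by simp

lemma nnT_semigroup:
  assumes [measurable]: "g \<in> borel_measurable borel" and s: "0 \<le> s" and t: "0 \<le> t"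
  shows "nnT s (nnT t g) x = nnT (s + t) g x"
proof (cases "t = 0")
  case True
  have "nnT 0 g = g" by auto
  then show ?thesis using True by simp
next
  case False
  define c where "c t = sqrt (1 - exp (- 2 * t))" for t :: real
  have c: "c t > 0" using False t by (simp add: c_def)
  \<comment> \<open>The variances add up:
    \<open>(1 - e^(-2t)) + e^(-2t) (1 - e^(-2s)) = 1 - e^(-2(s+t))\<close>.\<close>
  have "(c t)\<^sup>2 + (exp (- t) * c s)\<^sup>2 = 1 - exp (- 2 * (s + t))"
    using s t by (simp add: c_def power_mult_distrib algebra_simps power2_eq_square[of "exp _"] exp_add[symmetric])
  then have cs: "sqrt ((c t)\<^sup>2 + (exp (- t) * c s)\<^sup>2) = c (s + t)" by (simp add: c_def)
  have "nnT s (nnT t g) x = (\<integral>\<^sup>+v. \<integral>\<^sup>+u. g (c t *\<^sub>R u + exp (- t) *\<^sub>R (c s *\<^sub>R v + exp (- s) *\<^sub>R x)) \<partial>gauss_measure \<partial>gauss_measure)"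
    by (simp add: nnT_def c_def)
  also have "\<dots> = (\<integral>\<^sup>+v. \<integral>\<^sup>+u. (\<lambda>y. g (y + exp (- (s + t)) *\<^sub>R x)) (c t *\<^sub>R u + (exp (- t) * c s) *\<^sub>R v) \<partial>gauss_measure \<partial>gauss_measure)"
    by (simp add: scaleR_add_right add.assoc exp_add[symmetric] algebra_simps)
  also have "\<dots> = (\<integral>\<^sup>+w. (\<lambda>y. g (y + exp (- (s + t)) *\<^sub>R x)) (sqrt ((c t)\<^sup>2 + (exp (- t) * c s)\<^sup>2) *\<^sub>R w) \<partial>gauss_measure)"
    by (rule nn_integral_gauss_add) (use c in measurable)
  also have "\<dots> = nnT (s + t) g x" unfolding cs by (simp add: nnT_def c_def)
  finally show ?thesis .
qed

lemma submarkov_nnT: "0 \<le> t \<Longrightarrow> submarkov (gauss_measure :: (real ^ 'd) measure) (nnT t)"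
  by unfold_locales (auto intro: nnT_mono simp: nnT_add nn_integral_nnT)

lemma AE_nnT_finite:
  assumes [measurable]: "g \<in> borel_measurable borel" and t: "0 \<le> t" and fin: "(\<integral>\<^sup>+x. g x \<partial>gauss_measure) < top"
  shows "AE x in gauss_measure. nnT t g x < top"
proof -
  have "(\<integral>\<^sup>+x. nnT t g x \<partial>gauss_measure) \<noteq> \<infinity>" using nn_integral_nnT[of g t] t fin by simp
  from nn_integral_PInf_AE[OF _ this] show ?thesis by (auto simp: less_top)
qed

text \<open>Without integrability the Bochner integral is 0 by convention, so the inequality holds
  at every point.\<close>

lemma abs_ou_semigroup_le:
  assumes [measurable]: "f \<in> borel_measurable borel"
  shows "ennreal \<bar>ou_semigroup t f x\<bar> \<le> nnT t (\<lambda>y. ennreal \<bar>f y\<bar>) x"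
proof (cases "integrable gauss_measure (\<lambda>u. f (sqrt (1 - exp (- 2 * t)) *\<^sub>R u + exp (- t) *\<^sub>R x))")
  case True
  from integral_norm_bound_ennreal[OF this] show ?thesis by (simp add: ou_semigroup_def nnT_def)
qed (simp add: ou_semigroup_def not_integrable_integral_eq)

lemma integrable_ou_iff:
  assumes [measurable]: "f \<in> borel_measurable borel"
  shows "integrable gauss_measure (\<lambda>u. f (sqrt (1 - exp (- 2 * t)) *\<^sub>R u + exp (- t) *\<^sub>R x)) \<longleftrightarrow>
     nnT t (\<lambda>y. ennreal \<bar>f y\<bar>) x < top"
  by (subst integrable_iff_bounded) (simp add: nnT_def)

lemma ou_semigroup_lincomb:
  assumes [measurable]: "f \<in> borel_measurable borel" "g \<in> borel_measurable borel"
    and "nnT t (\<lambda>y. ennreal \<bar>f y\<bar>) x < top" "nnT t (\<lambda>y. ennreal \<bar>g y\<bar>) x < top"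
  shows "ou_semigroup t (\<lambda>y. a * f y + b * g y) x = a * ou_semigroup t f x + b * ou_semigroup t g x"
  using assms(3,4) unfolding integrable_ou_iff[symmetric, OF assms(1)] integrable_ou_iff[symmetric, OF assms(2)]
  by (simp add: ou_semigroup_def)

section \<open>The maximal function and its averages\<close>

interpretation lborel_gauss: pair_sigma_finite "lborel :: real measure" "gauss_measure :: (real ^ 'd) measure" ..

text \<open>The continuous-time counterpart of an ergodic sum; divided by \<open>s\<close> it is the
  mean of the semigroup over \<open>(0, s]\<close>.\<close>

definition ou_int :: "(real ^ 'd \<Rightarrow> ennreal) \<Rightarrow> real \<Rightarrow> real ^ 'd \<Rightarrow> ennreal" where
  "ou_int h s x = (\<integral>\<^sup>+r. indicator {0<..s} r * nnT r h x \<partial>lborel)"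

lemma measurable_ou_int [measurable]:
  assumes [measurable]: "h \<in> borel_measurable borel"
  shows "(\<lambda>(s, x). ou_int h s x) \<in> borel_measurable (borel \<Otimes>\<^sub>M borel)"
proof -
  have *: "indicator {0<..s} r = (of_bool (0 < r \<and> r \<le> s) :: ennreal)" for s r :: real
    by (auto simp: indicator_def)
  show ?thesis unfolding ou_int_def * by measurable
qed

text \<open>Additivity over consecutive intervals, with the semigroup carrying the second one back
  to time 0. It turns \<open>ou_int\<close> over \<open>n\<close> steps into an ergodic sum of the
  single operator \<open>nnT d\<close>.\<close>

lemma ou_int_add:
  assumes [measurable]: "h \<in> borel_measurable borel" and d: "0 \<le> d" and s: "0 \<le> s"
  shows "ou_int h (d + s) x = ou_int h d x + nnT d (ou_int h s) x"
proof -
  have "nnT d (ou_int h s) x = (\<integral>\<^sup>+r. \<integral>\<^sup>+u. indicator {0<..s} r * nnT r h (sqrt (1 - exp (- 2 * d)) *\<^sub>R u + exp (- d) *\<^sub>R x) \<partial>gauss_measure \<partial>lborel)"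
    unfolding nnT_def[of d] ou_int_def by (rule lborel_gauss.Fubini') measurable
  also have "\<dots> = (\<integral>\<^sup>+r. indicator {0<..s} r * nnT (d + r) h x \<partial>lborel)"
    using d by (intro nn_integral_cong)
      (auto simp: nn_integral_cmult nnT_semigroup[symmetric] nnT_def[of d] indicator_def)
  also have "\<dots> = (\<integral>\<^sup>+r. indicator {d<..d + s} r * nnT r h x \<partial>lborel)"
    by (subst nn_integral_real_affine[where c = 1 and t = d]) (auto simp: indicator_def intro!: nn_integral_cong)
  finally have "ou_int h d x + nnT d (ou_int h s) x = 
      (\<integral>\<^sup>+r. indicator {0<..d} r * nnT r h x + indicator {d<..d + s} r * nnT r h x \<partial>lborel)"
    unfolding ou_int_def[of h d] by (subst nn_integral_add) auto
  also have "\<dots> = ou_int h (d + s) x"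
    unfolding ou_int_def using d s by (intro nn_integral_cong) (auto simp: indicator_def)
  finally show ?thesis ..
qed

lemma ergodic_sum_ou_int:
  assumes [measurable]: "h \<in> borel_measurable borel" and d: "0 \<le> d"
  shows "ergodic_sum (nnT d) (\<lambda>x. c * ou_int h d x) n x = c * ou_int h (real n * d) x"
proof (induction n arbitrary: x)
  case 0 then show ?case by (simp add: ou_int_def)
next
  case (Suc n)
  have "ergodic_sum (nnT d) (\<lambda>x. c * ou_int h d x) (Suc n) x = c * ou_int h d x + nnT d (\<lambda>x. c * ou_int h (real n * d) x) x"
    using Suc[abs_def] by simp
  also have "\<dots> = c * ou_int h (d + real n * d) x"
    using d by (subst nnT_cmult, measurable) (simp add: ou_int_add distrib_left)
  finally show ?case by (simp add: algebra_simps)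
qed

text \<open>Jensen for the weight, the power inequality for \<open>nnT r\<close>, and invariance of
  the Gaussian measure under \<open>nnT r\<close>: every average in time is bounded by the total
  mass of its weight.\<close>

lemma nn_integral_ou_average:
  fixes h :: "real ^ 'd \<Rightarrow> ennreal"
  assumes [measurable]: "h \<in> borel_measurable borel" "w \<in> borel_measurable borel"
    and q: "1 \<le> q" and K: "0 < K" and w: "(\<integral>\<^sup>+r. indicator {0<..} r * w r \<partial>lborel) \<le> ennreal K"
  shows "(\<integral>\<^sup>+x. epowr (\<integral>\<^sup>+r. indicator {0<..} r * w r * nnT r h x \<partial>lborel) q \<partial>gauss_measure) \<le>
     ennreal (K powr q) * (\<integral>\<^sup>+x. epowr (h x) q \<partial>gauss_measure)"
proof -
  have "(\<integral>\<^sup>+x. epowr (\<integral>\<^sup>+r. indicator {0<..} r * w r * nnT r h x \<partial>lborel) q \<partial>gauss_measure) \<le>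
     (\<integral>\<^sup>+x. ennreal (K powr (q - 1)) * (\<integral>\<^sup>+r. indicator {0<..} r * w r * nnT r (\<lambda>y. epowr (h y) q) x \<partial>lborel) \<partial>gauss_measure)"
  proof (intro nn_integral_mono)
    fix x :: "real ^ 'd"
    have "epowr (\<integral>\<^sup>+r. indicator {0<..} r * w r * nnT r h x \<partial>lborel) q \<le> 
       ennreal (K powr (q - 1)) * (\<integral>\<^sup>+r. indicator {0<..} r * w r * epowr (nnT r h x) q \<partial>lborel)"
      by (rule Jensen_weighted) (use q K w in auto)
    also have "\<dots> \<le> ennreal (K powr (q - 1)) * (\<integral>\<^sup>+r. indicator {0<..} r * w r * nnT r (\<lambda>y. epowr (h y) q) x \<partial>lborel)"
      by (intro mult_left_mono nn_integral_mono epowr_nnT_le q) auto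
    finally show "epowr (\<integral>\<^sup>+r. indicator {0<..} r * w r * nnT r h x \<partial>lborel) q \<le>
       ennreal (K powr (q - 1)) * (\<integral>\<^sup>+r. indicator {0<..} r * w r * nnT r (\<lambda>y. epowr (h y) q) x \<partial>lborel)" .
  qed
  also have "\<dots> = ennreal (K powr (q - 1)) * (\<integral>\<^sup>+x. \<integral>\<^sup>+r. indicator {0<..} r * w r * nnT r (\<lambda>y. epowr (h y) q) x \<partial>lborel \<partial>gauss_measure)"
    by (rule nn_integral_cmult) measurable
  also have "(\<integral>\<^sup>+x. \<integral>\<^sup>+r. indicator {0<..} r * w r * nnT r (\<lambda>y. epowr (h y) q) x \<partial>lborel \<partial>gauss_measure)
     = (\<integral>\<^sup>+r. \<integral>\<^sup>+x. indicator {0<..} r * w r * nnT r (\<lambda>y. epowr (h y) q) x \<partial>gauss_measure \<partial>lborel)"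
    by (rule gauss_lborel.Fubini'[symmetric]) measurable
  also have "\<dots> = (\<integral>\<^sup>+r. indicator {0<..} r * w r * (\<integral>\<^sup>+x. epowr (h x) q \<partial>gauss_measure) \<partial>lborel)"
    by (intro nn_integral_cong) (auto simp: nn_integral_cmult nn_integral_nnT indicator_def)
  also have "\<dots> = (\<integral>\<^sup>+r. indicator {0<..} r * w r \<partial>lborel) * (\<integral>\<^sup>+x. epowr (h x) q \<partial>gauss_measure)"
    by (rule nn_integral_multc) measurable
  also have "ennreal (K powr (q - 1)) * ((\<integral>\<^sup>+r. indicator {0<..} r * w r \<partial>lborel) * (\<integral>\<^sup>+x. epowr (h x) q \<partial>gauss_measure))
      \<le> ennreal (K powr (q - 1)) * (ennreal K * (\<integral>\<^sup>+x. epowr (h x) q \<partial>gauss_measure))"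
    by (intro mult_left_mono mult_right_mono w) auto
  finally have "(\<integral>\<^sup>+x. epowr (\<integral>\<^sup>+r. indicator {0<..} r * w r * nnT r h x \<partial>lborel) q \<partial>gauss_measure) \<le>
     ennreal (K powr (q - 1)) * (ennreal K * (\<integral>\<^sup>+x. epowr (h x) q \<partial>gauss_measure))" .
  moreover have "ennreal (K powr (q - 1)) * ennreal K = ennreal (K powr q)"
    using K by (simp add: ennreal_mult[symmetric] powr_diff)
  ultimately show ?thesis by (simp add: mult.assoc[symmetric])
qed

text \<open>Only the lengths \<open>(n + 1) / 2^m\<close> occur. For fixed \<open>m\<close> these
  are ergodic averages of \<open>nnT (1 / 2^m)\<close>, and countably many lengths keep the supremum
  measurable.\<close>

definition ou_max_level :: "nat \<Rightarrow> (real ^ 'd \<Rightarrow> ennreal) \<Rightarrow> real ^ 'd \<Rightarrow> ennreal" where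
  "ou_max_level m h x = (SUP n. ennreal (2 ^ m / real (Suc n)) * ou_int h (real (Suc n) / 2 ^ m) x)"

definition ou_max :: "(real ^ 'd \<Rightarrow> ennreal) \<Rightarrow> real ^ 'd \<Rightarrow> ennreal" where
  "ou_max h x = (SUP m. ou_max_level m h x)"

lemma measurable_ou_max_level [measurable]:
  assumes [measurable]: "h \<in> borel_measurable borel"
  shows "ou_max_level m h \<in> borel_measurable borel"
  unfolding ou_max_level_def by measurable

lemma measurable_ou_max [measurable]:
  assumes [measurable]: "h \<in> borel_measurable borel"
  shows "ou_max h \<in> borel_measurable borel"
  unfolding ou_max_def by measurable

lemma ou_max_level_mono: "ou_max_level m h x \<le> ou_max_level (Suc m) h x"
  unfolding ou_max_level_def
proof (intro SUP_least)
  fix n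
  \<comment> \<open>The length \<open>(n + 1) / 2^m\<close> reappears at level \<open>m + 1\<close>
    with index \<open>2 n + 1\<close>, since indices are shifted by one.\<close>
  have "2 ^ m / real (Suc n) = 2 ^ Suc m / real (Suc (2 * n + 1))" by (simp add: field_simps)
  moreover have "real (Suc n) / 2 ^ m = real (Suc (2 * n + 1)) / 2 ^ Suc m" by (simp add: field_simps)
  ultimately show "ennreal (2 ^ m / real (Suc n)) * ou_int h (real (Suc n) / 2 ^ m) x
    \<le> (SUP n. ennreal (2 ^ Suc m / real (Suc n)) * ou_int h (real (Suc n) / 2 ^ Suc m) x)"
    by (simp only:) (rule SUP_upper, simp)
qed

text \<open>The maximal theorem is applied not to \<open>h\<close> but to its mean over
  \<open>(0, 1 / 2^m]\<close>, whose norm is at most that of \<open>h\<close>; hence the constant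
  does not depend on \<open>m\<close>.\<close>

lemma ou_max_level_strong:
  fixes h :: "real ^ 'd \<Rightarrow> ennreal"
  assumes [measurable]: "h \<in> borel_measurable borel" and r: "1 < r"
  shows "(\<integral>\<^sup>+x. epowr (ou_max_level m h x) r \<partial>gauss_measure) \<le>
      ennreal (2 powr r * r / (r - 1)) * (\<integral>\<^sup>+x. epowr (h x) r \<partial>gauss_measure)"
proof -
  define d :: real where "d = 1 / 2 ^ m"
  define h' where "h' x = ennreal (2 ^ m) * ou_int h d x" for x
  have d: "0 \<le> d" by (simp add: d_def)
  interpret submarkov "gauss_measure :: (real ^ 'd) measure" "nnT d" by (rule submarkov_nnT[OF d])
  have [measurable]: "h' \<in> borel_measurable borel" unfolding h'_def by measurable
  have eq: "ou_max_level m h = ergodic_max h'"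
  proof (intro ext)
    fix x
    have "ergodic_sum (nnT d) h' (Suc n) x / of_nat (Suc n) = ennreal (2 ^ m / real (Suc n)) * ou_int h (real (Suc n) / 2 ^ m) x" for n
    proof -
      have "ergodic_sum (nnT d) h' (Suc n) x = ennreal (2 ^ m) * ou_int h (real (Suc n) * d) x"
        unfolding h'_def[abs_def] by (rule ergodic_sum_ou_int) (auto simp: d)
      then have "ergodic_sum (nnT d) h' (Suc n) x / of_nat (Suc n) = ennreal (2 ^ m) / ennreal (real (Suc n)) * ou_int h (real (Suc n) * d) x"
        by (simp only: ennreal_of_nat_eq_real_of_nat divide_ennreal_def mult_ac)
      also have "ennreal (2 ^ m) / ennreal (real (Suc n)) = ennreal (2 ^ m / real (Suc n))"
        by (rule divide_ennreal) auto
      finally show ?thesis by (simp add: d_def)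
    qed
    then show "ou_max_level m h x = ergodic_max h' x"
      unfolding ou_max_level_def ergodic_max_def by (simp only:)
  qed
  have "(\<integral>\<^sup>+x. epowr (ou_max_level m h x) r \<partial>gauss_measure) \<le> ennreal (2 powr r * r / (r - 1)) * (\<integral>\<^sup>+x. epowr (h' x) r \<partial>gauss_measure)"
    unfolding eq by (rule maximal_strong_type) (use r in auto)
  also have "ennreal (2 powr r * r / (r - 1)) * (\<integral>\<^sup>+x. epowr (h' x) r \<partial>gauss_measure) \<le>
      ennreal (2 powr r * r / (r - 1)) * (ennreal (1 powr r) * (\<integral>\<^sup>+x. epowr (h x) r \<partial>gauss_measure))"
  proof (rule mult_left_mono)
    have "h' x = (\<integral>\<^sup>+r. indicator {0<..} r * (ennreal (2 ^ m) * indicator {..d} r) * nnT r h x \<partial>lborel)" for x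
      unfolding h'_def ou_int_def by (subst nn_integral_cmult[symmetric]) (auto intro!: nn_integral_cong simp: indicator_def)
    moreover have "(\<integral>\<^sup>+r. indicator {0<..} r * (ennreal (2 ^ m) * indicator {..d} r) \<partial>lborel) \<le> ennreal 1"
    proof -
      have "(\<integral>\<^sup>+r. indicator {0<..} r * (ennreal (2 ^ m) * indicator {..d} r) \<partial>lborel) = (\<integral>\<^sup>+r. ennreal (2 ^ m) * indicator {0<..d} r \<partial>lborel)"
        by (intro nn_integral_cong) (auto simp: indicator_def)
      also have "\<dots> = ennreal (2 ^ m) * ennreal d" using d by (simp add: nn_integral_cmult_indicator)
      also have "\<dots> = 1" unfolding d_def by (subst ennreal_mult[symmetric]) auto
      finally show ?thesis by simp
    qed
    ultimately show "(\<integral>\<^sup>+x. epowr (h' x) r \<partial>gauss_measure) \<le> ennreal (1 powr r) * (\<integral>\<^sup>+x. epowr (h x) r \<partial>gauss_measure)"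
      using r by (simp only:) (intro nn_integral_ou_average, auto)
  qed simp
  finally show ?thesis by simp
qed

lemma ou_max_strong:
  fixes h :: "real ^ 'd \<Rightarrow> ennreal"
  assumes [measurable]: "h \<in> borel_measurable borel" and r: "1 < r"
  shows "(\<integral>\<^sup>+x. epowr (ou_max h x) r \<partial>gauss_measure) \<le>
      ennreal (2 powr r * r / (r - 1)) * (\<integral>\<^sup>+x. epowr (h x) r \<partial>gauss_measure)"
proof -
  have "(\<integral>\<^sup>+x. epowr (ou_max h x) r \<partial>gauss_measure) = (\<integral>\<^sup>+x. (SUP m. epowr (ou_max_level m h x) r) \<partial>gauss_measure)"
    unfolding ou_max_def using r by (subst epowr_SUP) auto
  also have "\<dots> = (SUP m. \<integral>\<^sup>+x. epowr (ou_max_level m h x) r \<partial>gauss_measure)"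
    using r by (intro nn_integral_monotone_convergence_SUP incseq_SucI le_funI epowr_mono ou_max_level_mono) auto
  also have "\<dots> \<le> ennreal (2 powr r * r / (r - 1)) * (\<integral>\<^sup>+x. epowr (h x) r \<partial>gauss_measure)"
    by (intro SUP_least ou_max_level_strong r) measurable
  finally show ?thesis .
qed

text \<open>Rounding \<open>s\<close> up to a dyadic length \<open>u\<close> with
  \<open>s \<le> u \<le> 2 s\<close> costs the factor 2.\<close>

lemma ou_int_le_max:
  assumes s: "0 < s"
  shows "ou_int h s x \<le> ennreal (2 * s) * ou_max h x"
proof -
  obtain m where m: "inverse (2 ^ m) < s" using real_arch_pow_inv[of s "1/2"] s by (auto simp: power_one_over inverse_eq_divide)
  define n where "n = nat \<lceil>s * 2 ^ m\<rceil> - 1"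
  have "0 < \<lceil>s * 2 ^ m\<rceil>" using s by simp
  then have "real (Suc n) = real_of_int \<lceil>s * 2 ^ m\<rceil>" unfolding n_def by (simp add: of_nat_diff)
  then have n: "s * 2 ^ m \<le> real (Suc n)" "real (Suc n) \<le> s * 2 ^ m + 1" by linarith+
  have "1 \<le> s * 2 ^ m" using m by (simp add: field_simps)
  define u where "u = real (Suc n) / 2 ^ m"
  have u: "s \<le> u" "u \<le> 2 * s" using n \<open>1 \<le> s * 2 ^ m\<close> by (auto simp: u_def field_simps)
  have "ou_int h s x \<le> ou_int h u x" unfolding ou_int_def
    using u by (intro nn_integral_mono mult_right_mono) (auto simp: indicator_def)
  also have "\<dots> = ennreal u * (ennreal (1 / u) * ou_int h u x)"
    using u s by (simp add: mult.assoc[symmetric] ennreal_mult[symmetric])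
  also have "ennreal (1 / u) * ou_int h u x \<le> ou_max h x"
  proof -
    have "ennreal (1 / u) * ou_int h u x = ennreal (2 ^ m / real (Suc n)) * ou_int h (real (Suc n) / 2 ^ m) x"
      by (simp add: u_def)
    also have "\<dots> \<le> ou_max_level m h x" unfolding ou_max_level_def by (rule SUP_upper) simp
    also have "\<dots> \<le> ou_max h x" unfolding ou_max_def by (rule SUP_upper) simp
    finally show ?thesis .
  qed
  finally have "ou_int h s x \<le> ennreal u * ou_max h x" by (simp add: mult_left_mono)
  also have "\<dots> \<le> ennreal (2 * s) * ou_max h x" using u by (intro mult_right_mono ennreal_leI) auto
  finally show ?thesis .
qed

text \<open>Used twice: to bound the total mass of the averaging weight, and as the test function in
  duality at exponent 1.\<close>

lemma ou_max_1 [simp]: "ou_max (\<lambda>x. 1) x = 1"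
proof -
  have "ennreal (2 ^ m / real (Suc n)) * ou_int (\<lambda>x. 1) (real (Suc n) / 2 ^ m) x = 1" for m n
    unfolding ou_int_def by (simp add: ennreal_mult[symmetric] del: of_nat_Suc)
  then show ?thesis by (simp add: ou_max_def ou_max_level_def del: of_nat_Suc)
qed

section \<open>The averaging operator that dominates the Poisson derivatives\<close>

lemma nn_integral_powr_tail:
  assumes a: "0 < a" and c: "0 < c"
  shows "(\<integral>\<^sup>+s. ennreal (c * s powr (- c - 1)) * indicator {a..} s \<partial>lborel) = ennreal (a powr - c)"
proof -
  have "(\<integral>\<^sup>+s. ennreal (c * s powr (- c - 1)) * indicator {a..} s \<partial>lborel) = ennreal (0 - (- (a powr - c)))"
  proof (rule nn_integral_FTC_atLeast)
    show "DERIV (\<lambda>s. - (s powr - c)) x :> c * x powr (- c - 1)" if "a \<le> x" for x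
      using that a by (auto intro!: derivative_eq_intros simp: powr_diff)
    have "((\<lambda>s. - (s powr - c)) \<longlongrightarrow> - 0) at_top"
      using c by (intro tendsto_minus tendsto_neg_powr filterlim_ident) auto
    then show "((\<lambda>s. - (s powr - c)) \<longlongrightarrow> 0) at_top" by simp
  qed (use c in auto)
  then show ?thesis by simp
qed

text \<open>For \<open>t > 0\<close> this is \<open>t^(-2)\<close> up to \<open>r = t^2\<close> and
  \<open>t r^(-3/2)\<close> beyond. The tail is that of the subordination density
  \<open>t r^(-3/2) exp (- t^2 / (4 r)) / (2 sqrt pi)\<close>; the plateau makes the weight
  nonincreasing in \<open>r\<close>, which a bound by the maximal function requires.\<close>

definition avg_weight :: "real \<Rightarrow> real \<Rightarrow> real" where
  "avg_weight t r = t * max r (t\<^sup>2) powr (- 3 / 2)"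

lemma measurable_avg_weight [measurable]: "(\<lambda>(t, r). avg_weight t r) \<in> borel_measurable (borel \<Otimes>\<^sub>M borel)"
  unfolding avg_weight_def by measurable

text \<open>This operator dominates all \<open>t\<^sup>k \<partial>\<^sub>t\<^sup>k P\<^sub>t\<close>; it is positive and symmetric.\<close>

definition avg_op :: "real \<Rightarrow> (real ^ 'd \<Rightarrow> ennreal) \<Rightarrow> real ^ 'd \<Rightarrow> ennreal" where
  "avg_op t g x = (\<integral>\<^sup>+r. indicator {0<..} r * ennreal (avg_weight t r) * nnT r g x \<partial>lborel)"

lemma measurable_avg_op [measurable (raw)]:
  assumes f: "(\<lambda>(w, y). f w y) \<in> borel_measurable (N \<Otimes>\<^sub>M borel)"
    and [measurable]: "t \<in> borel_measurable N" "x \<in> N \<rightarrow>\<^sub>M borel"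
  shows "(\<lambda>w. avg_op (t w) (f w) (x w)) \<in> borel_measurable N"
proof -
  have "(\<lambda>q. (fst (fst q), snd q)) \<in> (N \<Otimes>\<^sub>M lborel) \<Otimes>\<^sub>M borel \<rightarrow>\<^sub>M N \<Otimes>\<^sub>M borel" by measurable
  from measurable_compose[OF this f]
  have [measurable]: "(\<lambda>(p, y). f (fst p) y) \<in> borel_measurable ((N \<Otimes>\<^sub>M lborel) \<Otimes>\<^sub>M borel)"
    by (simp add: case_prod_beta')
  have "(\<lambda>p. indicator {0<..} (snd p) * ennreal (avg_weight (t (fst p)) (snd p)) * nnT (snd p) (f (fst p)) (x (fst p)))
      \<in> borel_measurable (N \<Otimes>\<^sub>M lborel)" by measurable
  then show ?thesis unfolding avg_op_def
    by (intro lborel.borel_measurable_nn_integral) (simp add: case_prod_beta')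
qed

text \<open>A nonincreasing weight is a mixture of indicators of \<open>(0, s]\<close>, so the
  average is a mixture of the \<open>ou_int g s\<close>, each at most \<open>2 s\<close> times the
  maximal function. The bound is free of \<open>t\<close>: the integral of
  \<open>3 t s^(-3/2)\<close> over \<open>s \<ge> t^2\<close> is 6.\<close>

lemma avg_op_le_max:
  assumes [measurable]: "g \<in> borel_measurable borel"
  shows "avg_op t g x \<le> 6 * ou_max g x"
proof (cases "0 < t")
  case True
  \<comment> \<open>The power of \<open>max r (t^2)\<close> is the integral of
    \<open>3/2 s^(-5/2)\<close> over all \<open>s\<close> beyond both \<open>r\<close> and
    \<open>t^2\<close>.\<close>
  have k: "ennreal (avg_weight t r) = (\<integral>\<^sup>+s. ennreal t * (ennreal (3/2 * s powr (-3/2 - 1)) * indicator {max r (t\<^sup>2)..} s) \<partial>lborel)" for r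
  proof -
    have "0 < max r (t\<^sup>2)" using True by (simp add: less_max_iff_disj)
    from nn_integral_powr_tail[OF this, of "3/2"] show ?thesis
      using True by (subst nn_integral_cmult) (auto simp: avg_weight_def ennreal_mult)
  qed
  have "avg_op t g x = (\<integral>\<^sup>+r. \<integral>\<^sup>+s. ennreal t * (ennreal (3/2 * s powr (-3/2 - 1)) * indicator {max r (t\<^sup>2)..} s) * (indicator {0<..} r * nnT r g x) \<partial>lborel \<partial>lborel)"
    unfolding avg_op_def k by (subst nn_integral_multc) (auto simp: mult_ac)
  also have "\<dots> = (\<integral>\<^sup>+s. \<integral>\<^sup>+r. ennreal t * (ennreal (3/2 * s powr (-3/2 - 1)) * indicator {max r (t\<^sup>2)..} s) * (indicator {0<..} r * nnT r g x) \<partial>lborel \<partial>lborel)"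
  proof -
    have *: "indicator {max r (t\<^sup>2)..} s = (of_bool (max r (t\<^sup>2) \<le> s) :: ennreal)" for r s
      by (auto simp: indicator_def)
    show ?thesis unfolding * by (rule lborel_pair.Fubini') measurable
  qed
  also have "\<dots> = (\<integral>\<^sup>+s. ennreal t * (ennreal (3/2 * s powr (-3/2 - 1)) * indicator {t\<^sup>2..} s) * ou_int g s x \<partial>lborel)"
    unfolding ou_int_def by (intro nn_integral_cong, subst nn_integral_cmult[symmetric])
      (auto intro!: nn_integral_cong simp: indicator_def)
  also have "\<dots> \<le> (\<integral>\<^sup>+s. (ennreal (6 * t) * ou_max g x) * (ennreal (1/2 * s powr (-(1/2) - 1)) * indicator {t\<^sup>2..} s) \<partial>lborel)"
  proof (intro nn_integral_mono)
    fix s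
    show "ennreal t * (ennreal (3/2 * s powr (-3/2 - 1)) * indicator {t\<^sup>2..} s) * ou_int g s x \<le>
      (ennreal (6 * t) * ou_max g x) * (ennreal (1/2 * s powr (-(1/2) - 1)) * indicator {t\<^sup>2..} s)"
    proof (cases "t\<^sup>2 \<le> s")
      case s: True
      have s0: "0 < s" using True s by (smt (verit) zero_less_power)
      have "t * (3/2 * s powr (-3/2 - 1)) * (2 * s) = 6 * t * (1/2 * s powr (-(1/2) - 1))"
        using s0 powr_add[of s "-5/2" 1] by simp
      then have e: "ennreal t * ennreal (3/2 * s powr (-3/2 - 1)) * ennreal (2 * s) = ennreal (6 * t) * ennreal (1/2 * s powr (-(1/2) - 1))"
        using s0 True by (simp add: ennreal_mult[symmetric])
      have "ennreal t * ennreal (3/2 * s powr (-3/2 - 1)) * ou_int g s x \<le> ennreal t * ennreal (3/2 * s powr (-3/2 - 1)) * (ennreal (2 * s) * ou_max g x)"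
        by (intro mult_left_mono ou_int_le_max s0) simp
      also have "\<dots> = ennreal (6 * t) * ennreal (1/2 * s powr (-(1/2) - 1)) * ou_max g x"
        unfolding e[symmetric] by (simp only: mult_ac)
      finally show ?thesis using s by (simp add: mult_ac)
    qed simp
  qed
  also have "\<dots> = (ennreal (6 * t) * ou_max g x) * ennreal (t\<^sup>2 powr - (1/2))"
    using True by (subst nn_integral_cmult, measurable) (subst nn_integral_powr_tail, auto)
  also have "t\<^sup>2 powr - (1/2) = 1 / t" using True by (simp add: powr_minus powr_half_sqrt inverse_eq_divide)
  also have "(ennreal (6 * t) * ou_max g x) * ennreal (1 / t) = (ennreal (6 * t) * ennreal (1 / t)) * ou_max g x"
    by (simp only: mult_ac)
  also have "ennreal (6 * t) * ennreal (1 / t) = 6" using True by (simp add: ennreal_mult[symmetric])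
  finally show ?thesis .
next
  case False
  \<comment> \<open>Here the weight is not positive and \<open>ennreal\<close> turns it into
    0.\<close>
  then have "avg_weight t r \<le> 0" for r by (simp add: avg_weight_def mult_nonpos_nonneg)
  then show ?thesis by (simp add: avg_op_def ennreal_neg)
qed

text \<open>The maximal bound for the constant function 1, on which \<open>nnT\<close> and
  \<open>ou_max\<close> both give 1.\<close>

lemma avg_weight_integral_le: "(\<integral>\<^sup>+r. indicator {0<..} r * ennreal (avg_weight t r) \<partial>lborel) \<le> ennreal 6"
  using avg_op_le_max[of "\<lambda>_. 1" t 0] by (simp add: avg_op_def)

lemma epowr_avg_op_le:
  assumes [measurable]: "g \<in> borel_measurable borel" and q: "1 \<le> q"
  shows "epowr (avg_op t g x) q \<le> ennreal (6 powr (q - 1)) * avg_op t (\<lambda>y. epowr (g y) q) x"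
proof -
  have "epowr (avg_op t g x) q \<le> ennreal (6 powr (q - 1)) * (\<integral>\<^sup>+r. indicator {0<..} r * ennreal (avg_weight t r) * epowr (nnT r g x) q \<partial>lborel)"
    unfolding avg_op_def by (rule Jensen_weighted[OF q]) (use avg_weight_integral_le[of t] in auto)
  also have "\<dots> \<le> ennreal (6 powr (q - 1)) * avg_op t (\<lambda>y. epowr (g y) q) x"
    unfolding avg_op_def by (intro mult_left_mono nn_integral_mono epowr_nnT_le q) auto
  finally show ?thesis .
qed

lemma avg_op_bounded:
  assumes [measurable]: "g \<in> borel_measurable borel" and p: "1 \<le> p"
  shows "(\<integral>\<^sup>+x. epowr (avg_op t g x) p \<partial>gauss_measure) \<le> ennreal (6 powr p) * (\<integral>\<^sup>+x. epowr (g x) p \<partial>gauss_measure)"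
  unfolding avg_op_def by (rule nn_integral_ou_average) (use p avg_weight_integral_le in auto)

lemma avg_op_symmetric:
  fixes f g :: "real ^ 'd \<Rightarrow> ennreal"
  assumes [measurable]: "f \<in> borel_measurable borel" "g \<in> borel_measurable borel"
  shows "(\<integral>\<^sup>+x. f x * avg_op t g x \<partial>gauss_measure) = (\<integral>\<^sup>+x. avg_op t f x * g x \<partial>gauss_measure)"
proof -
  have "(\<integral>\<^sup>+x. f x * avg_op t g x \<partial>gauss_measure) =
     (\<integral>\<^sup>+x. \<integral>\<^sup>+r. f x * (indicator {0<..} r * ennreal (avg_weight t r) * nnT r g x) \<partial>lborel \<partial>gauss_measure)"
    unfolding avg_op_def by (subst nn_integral_cmult) auto
  also have "\<dots> = (\<integral>\<^sup>+r. \<integral>\<^sup>+x. f x * (indicator {0<..} r * ennreal (avg_weight t r) * nnT r g x) \<partial>gauss_measure \<partial>lborel)"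
    by (rule gauss_lborel.Fubini'[symmetric]) measurable
  also have "\<dots> = (\<integral>\<^sup>+r. \<integral>\<^sup>+x. (indicator {0<..} r * ennreal (avg_weight t r) * nnT r f x) * g x \<partial>gauss_measure \<partial>lborel)"
  proof (rule nn_integral_cong)
    fix r :: real
    show "(\<integral>\<^sup>+x. f x * (indicator {0<..} r * ennreal (avg_weight t r) * nnT r g x) \<partial>gauss_measure) =
       (\<integral>\<^sup>+x. (indicator {0<..} r * ennreal (avg_weight t r) * nnT r f x) * g x \<partial>gauss_measure)"
    proof (cases "0 < r")
      case True
      have "(\<integral>\<^sup>+x. f x * (indicator {0<..} r * ennreal (avg_weight t r) * nnT r g x) \<partial>gauss_measure) =
        ennreal (avg_weight t r) * (\<integral>\<^sup>+x. f x * nnT r g x \<partial>gauss_measure)"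
        using True by (subst nn_integral_cmult[symmetric]) (auto simp: mult_ac)
      also have "(\<integral>\<^sup>+x. f x * nnT r g x \<partial>gauss_measure) = (\<integral>\<^sup>+x. nnT r f x * g x \<partial>gauss_measure)"
        using True by (intro nnT_symmetric) auto
      also have "ennreal (avg_weight t r) * \<dots> = (\<integral>\<^sup>+x. (indicator {0<..} r * ennreal (avg_weight t r) * nnT r f x) * g x \<partial>gauss_measure)"
        using True by (subst nn_integral_cmult[symmetric]) (auto simp: mult_ac)
      finally show ?thesis .
    qed simp
  qed
  also have "\<dots> = (\<integral>\<^sup>+x. \<integral>\<^sup>+r. (indicator {0<..} r * ennreal (avg_weight t r) * nnT r f x) * g x \<partial>lborel \<partial>gauss_measure)"
    by (rule gauss_lborel.Fubini') measurable
  also have "\<dots> = (\<integral>\<^sup>+x. avg_op t f x * g x \<partial>gauss_measure)"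
    unfolding avg_op_def by (subst nn_integral_multc) auto
  finally show ?thesis .
qed

section \<open>Vector-valued estimates\<close>

text \<open>Dividing by \<open>epowr X (1 - 1 / r)\<close> is allowed because \<open>X\<close> is
  neither 0 nor infinite. The finiteness is the reason why the duality arguments run on
  truncations.\<close>

lemma ennreal_absorb_power:
  assumes X: "X < top" and le: "X \<le> Y * epowr X (1 - 1 / r)" and r: "1 \<le> r"
  shows "X \<le> epowr Y r"
proof (cases "X = 0")
  case False
  have e: "epowr X (1 / r) * epowr X (1 - 1 / r) = X" using epowr_minus_self[of X "1/r"] X by simp
  have 0: "epowr X (1 - 1 / r) \<noteq> 0" "epowr X (1 - 1 / r) < top" using False X by (auto simp: epowr_eq_0_iff)
  have "epowr X (1 / r) * epowr X (1 - 1 / r) \<le> Y * epowr X (1 - 1 / r)" using e le by simp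
  then have "epowr X (1 / r) \<le> Y"
    using 0 by (metis ennreal_mult_le_mult_iff less_top mult.commute)
  then have "epowr (epowr X (1 / r)) r \<le> epowr Y r" using r by (intro epowr_mono) auto
  then show ?thesis using r by (simp add: epowr_epowr)
qed simp

text \<open>Testing against \<open>h = \<Phi>\<^sup>r\<^sup>-\<^sup>1\<close>, truncated so that its norm can be absorbed.\<close>

lemma max_duality:
  fixes \<Phi> F :: "real ^ 'd \<Rightarrow> ennreal"
  assumes r: "1 \<le> r" and c: "0 \<le> c"
  shows "\<exists>C\<ge>0. \<forall>\<Phi> F :: real ^ 'd \<Rightarrow> ennreal. \<Phi> \<in> borel_measurable borel \<longrightarrow> F \<in> borel_measurable borel \<longrightarrow>
    (\<forall>h\<in>borel_measurable borel. (\<integral>\<^sup>+x. \<Phi> x * h x \<partial>gauss_measure) \<le> ennreal c * (\<integral>\<^sup>+x. F x * ou_max h x \<partial>gauss_measure))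
    \<longrightarrow> (\<integral>\<^sup>+x. epowr (\<Phi> x) r \<partial>gauss_measure) \<le> ennreal C * (\<integral>\<^sup>+x. epowr (F x) r \<partial>gauss_measure)"
proof (cases "r = 1")
  case True
  show ?thesis
  proof (intro exI[of _ c] conjI allI impI c)
    fix \<Phi> F :: "real ^ 'd \<Rightarrow> ennreal"
    assume "\<forall>h\<in>borel_measurable borel. (\<integral>\<^sup>+x. \<Phi> x * h x \<partial>gauss_measure) \<le> ennreal c * (\<integral>\<^sup>+x. F x * ou_max h x \<partial>gauss_measure)"
    \<comment> \<open>At exponent 1 the constant test function 1 suffices, as it is its own maximal
      function.\<close>
    then have "(\<integral>\<^sup>+x. \<Phi> x * 1 \<partial>gauss_measure) \<le> ennreal c * (\<integral>\<^sup>+x. F x * ou_max (\<lambda>_. 1) x \<partial>gauss_measure)"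
      by (rule bspec) simp
    then show "(\<integral>\<^sup>+x. epowr (\<Phi> x) r \<partial>gauss_measure) \<le> ennreal c * (\<integral>\<^sup>+x. epowr (F x) r \<partial>gauss_measure)"
      using True by simp
  qed
next
  case False
  then have r1: "1 < r" using r by simp
  define r' where "r' = r / (r - 1)"
  have r': "1 < r'" "1 / r + 1 / r' = 1" "(r - 1) * r' = r" "1 / r' = 1 - 1 / r"
    using r1 by (auto simp: r'_def field_simps)
  define D where "D = 2 powr r' * r' / (r' - 1)"
  have D: "0 \<le> D" using r' by (simp add: D_def)
  define C where "C = (c * D powr (1 / r')) powr r"
  show ?thesis
  proof (intro exI[of _ C] conjI allI impI)
    show "0 \<le> C" by (simp add: C_def)
    fix \<Phi> F :: "real ^ 'd \<Rightarrow> ennreal"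
    assume [measurable]: "\<Phi> \<in> borel_measurable borel" "F \<in> borel_measurable borel"
      and H: "\<forall>h\<in>borel_measurable borel. (\<integral>\<^sup>+x. \<Phi> x * h x \<partial>gauss_measure) \<le> ennreal c * (\<integral>\<^sup>+x. F x * ou_max h x \<partial>gauss_measure)"
    define A where "A = (\<integral>\<^sup>+x. epowr (F x) r \<partial>gauss_measure)"
    have *: "(\<integral>\<^sup>+x. epowr (min (\<Phi> x) (of_nat n)) r \<partial>gauss_measure) \<le> ennreal C * A" for n :: nat
    proof -
      define \<Psi> where "\<Psi> x = min (\<Phi> x) (of_nat n)" for x
      define X where "X = (\<integral>\<^sup>+x. epowr (\<Psi> x) r \<partial>gauss_measure)"
      have [measurable]: "\<Psi> \<in> borel_measurable borel" unfolding \<Psi>_def by measurable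
      have "X \<le> (\<integral>\<^sup>+x. epowr (of_nat n) r \<partial>(gauss_measure :: (real ^ 'd) measure))"
        unfolding X_def \<Psi>_def using r1 by (intro nn_integral_mono epowr_mono) auto
      also have "\<dots> < top" by (simp add: ennreal_of_nat_eq_real_of_nat)
      finally have X: "X < top" .
      \<comment> \<open>One factor \<open>\<Psi>\<close> is enlarged to \<open>\<Phi>\<close> so
        that the hypothesis applies, while the test function keeps the truncation; Hoelder and the
        maximal theorem with exponent \<open>r'\<close> then return a power of \<open>X\<close>
        itself.\<close>
      have "X = (\<integral>\<^sup>+x. \<Psi> x * epowr (\<Psi> x) (r - 1) \<partial>gauss_measure)"
        unfolding X_def using epowr_add[of _ 1 "r - 1"] by simp
      also have "\<dots> \<le> (\<integral>\<^sup>+x. \<Phi> x * epowr (\<Psi> x) (r - 1) \<partial>gauss_measure)"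
        by (intro nn_integral_mono mult_right_mono) (auto simp: \<Psi>_def)
      also have "\<dots> \<le> ennreal c * (\<integral>\<^sup>+x. F x * ou_max (\<lambda>x. epowr (\<Psi> x) (r - 1)) x \<partial>gauss_measure)"
        by (rule H[rule_format]) measurable
      also have "\<dots> \<le> ennreal c * (epowr A (1 / r) * epowr (\<integral>\<^sup>+x. epowr (ou_max (\<lambda>x. epowr (\<Psi> x) (r - 1)) x) r' \<partial>gauss_measure) (1 / r'))"
        unfolding A_def by (intro mult_left_mono Holder_nn_integral r1 r') auto
      also have "\<dots> \<le> ennreal c * (epowr A (1 / r) * epowr (ennreal D * (\<integral>\<^sup>+x. epowr (epowr (\<Psi> x) (r - 1)) r' \<partial>gauss_measure)) (1 / r'))"
        unfolding D_def using r'(1) by (intro mult_left_mono epowr_mono ou_max_strong) auto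
      also have "(\<integral>\<^sup>+x. epowr (epowr (\<Psi> x) (r - 1)) r' \<partial>gauss_measure) = X"
        unfolding X_def epowr_epowr r' ..
      also have "ennreal c * (epowr A (1 / r) * epowr (ennreal D * X) (1 / r')) = ennreal (c * D powr (1 / r')) * epowr A (1 / r) * epowr X (1 - 1 / r)"
        unfolding r'(4)[symmetric] using r'(1) D c by (simp add: epowr_mult ennreal_mult mult_ac)
      finally have "X \<le> epowr (ennreal (c * D powr (1 / r')) * epowr A (1 / r)) r"
        by (intro ennreal_absorb_power X) (use r in auto)
      also have "\<dots> = ennreal C * A"
        using r1 c D by (simp add: epowr_mult epowr_epowr C_def)
      finally show ?thesis unfolding X_def \<Psi>_def .
    qed
    have sup: "\<Phi> x = (SUP n. min (\<Phi> x) (of_nat n))" for x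
    proof (rule antisym)
      show "\<Phi> x \<le> (SUP n. min (\<Phi> x) (of_nat n))"
      proof (cases "\<Phi> x = top")
        case True then show ?thesis by (simp add: ennreal_SUP_of_nat_eq_top)
      next
        case False
        then obtain n where "\<Phi> x < of_nat n" using ennreal_Ex_less_of_nat[of "\<Phi> x"] by (auto simp: less_top)
        then have "\<Phi> x = min (\<Phi> x) (of_nat n)" by (simp add: min_absorb1 less_imp_le)
        also have "\<dots> \<le> (SUP n. min (\<Phi> x) (of_nat n))" by (rule SUP_upper) simp
        finally show ?thesis .
      qed
    qed (auto intro: SUP_least)
    have "(\<integral>\<^sup>+x. epowr (\<Phi> x) r \<partial>gauss_measure) = (\<integral>\<^sup>+x. (SUP n. epowr (min (\<Phi> x) (of_nat n)) r) \<partial>gauss_measure)"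
      using r1 by (subst sup) (simp add: epowr_SUP)
    also have "\<dots> = (SUP n. \<integral>\<^sup>+x. epowr (min (\<Phi> x) (of_nat n)) r \<partial>gauss_measure)"
      using r1 by (intro nn_integral_monotone_convergence_SUP incseq_SucI le_funI epowr_mono min.mono) auto
    also have "\<dots> \<le> ennreal C * A" using * by (intro SUP_least) auto
    finally show "(\<integral>\<^sup>+x. epowr (\<Phi> x) r \<partial>gauss_measure) \<le> ennreal C * (\<integral>\<^sup>+x. epowr (F x) r \<partial>gauss_measure)"
      unfolding A_def .
  qed
qed

text \<open>The \<open>p\<close>-th power of the norm of \<open>L\<^sup>p(L\<^sup>q(\<mu>))\<close>;
  leaving out the outer root keeps it a plain integral.\<close>

definition vec_norm :: "real measure \<Rightarrow> real \<Rightarrow> real \<Rightarrow> (real \<Rightarrow> real ^ 'd \<Rightarrow> ennreal) \<Rightarrow> ennreal" where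
  "vec_norm \<mu> p q G = (\<integral>\<^sup>+x. epowr (\<integral>\<^sup>+t. epowr (G t x) q \<partial>\<mu>) (p / q) \<partial>gauss_measure)"

locale time_measure = sigma_finite_measure \<mu> for \<mu> :: "real measure" +
  assumes sets_mu [measurable_cong, simp]: "sets \<mu> = sets borel"
begin

sublocale tg: pair_sigma_finite \<mu> "gauss_measure :: (real ^ 'd) measure" ..

sublocale gt: pair_sigma_finite "gauss_measure :: (real ^ 'd) measure" \<mu> ..

lemma space_mu [simp]: "space \<mu> = UNIV"
  using sets_eq_imp_space_eq[OF sets_mu] by simp

end

text \<open>The exponent \<open>p / q\<close> is at least 1, so \<open>max_duality\<close> applies
  to the inner integral. Jensen moves the power \<open>q\<close> inside \<open>avg_op\<close>,
  symmetry moves \<open>avg_op t\<close> onto the test function \<open>h\<close>, and the bound of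
  \<open>avg_op t h\<close> by the maximal function no longer depends on \<open>t\<close>, so the
  time integral recombines.\<close>

lemma vector_avg_le:
  assumes q: "1 \<le> q" "q \<le> p"
  shows "\<exists>C\<ge>0. \<forall>\<mu> (G :: real \<Rightarrow> real ^ 'd \<Rightarrow> ennreal). time_measure \<mu> \<longrightarrow>
    (\<lambda>(t, x). G t x) \<in> borel_measurable (borel \<Otimes>\<^sub>M borel) \<longrightarrow>
    vec_norm \<mu> p q (\<lambda>t. avg_op t (G t)) \<le> ennreal C * vec_norm \<mu> p q G"
proof -
  \<comment> \<open>Jensen costs \<open>6 powr (q - 1)\<close>, the maximal bound another 6.\<close>
  define c :: real where "c = 6 powr (q - 1) * 6"
  have "1 \<le> p / q" "0 \<le> c" using q by (auto simp: c_def)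
  from max_duality[OF this] obtain C where C: "0 \<le> C" and D: "\<And>\<Phi> F :: real ^ 'd \<Rightarrow> ennreal. \<lbrakk> \<Phi> \<in> borel_measurable borel; F \<in> borel_measurable borel;
    \<And>h. h\<in>borel_measurable borel \<Longrightarrow> (\<integral>\<^sup>+x. \<Phi> x * h x \<partial>gauss_measure) \<le> ennreal c * (\<integral>\<^sup>+x. F x * ou_max h x \<partial>gauss_measure) \<rbrakk>
    \<Longrightarrow> (\<integral>\<^sup>+x. epowr (\<Phi> x) (p / q) \<partial>gauss_measure) \<le> ennreal C * (\<integral>\<^sup>+x. epowr (F x) (p / q) \<partial>gauss_measure)"
    by blast
  show ?thesis
  proof (intro exI[of _ C] conjI allI impI C)
    fix \<mu> and G :: "real \<Rightarrow> real ^ 'd \<Rightarrow> ennreal"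
    assume "time_measure \<mu>" and [measurable]: "(\<lambda>(t, x). G t x) \<in> borel_measurable (borel \<Otimes>\<^sub>M borel)"
    then interpret time_measure \<mu> by simp
    show "vec_norm \<mu> p q (\<lambda>t. avg_op t (G t)) \<le> ennreal C * vec_norm \<mu> p q G"
      unfolding vec_norm_def
    proof (rule D)
      fix h :: "real ^ 'd \<Rightarrow> ennreal" assume [measurable]: "h \<in> borel_measurable borel"
      have "(\<integral>\<^sup>+x. (\<integral>\<^sup>+t. epowr (avg_op t (G t) x) q \<partial>\<mu>) * h x \<partial>gauss_measure) =
        (\<integral>\<^sup>+x. \<integral>\<^sup>+t. epowr (avg_op t (G t) x) q * h x \<partial>\<mu> \<partial>gauss_measure)"
        by (subst nn_integral_multc) auto
      also have "\<dots> = (\<integral>\<^sup>+t. \<integral>\<^sup>+x. epowr (avg_op t (G t) x) q * h x \<partial>gauss_measure \<partial>\<mu>)"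
        by (rule gt.Fubini'[symmetric]) measurable
      also have "\<dots> \<le> (\<integral>\<^sup>+t. \<integral>\<^sup>+x. ennreal c * (epowr (G t x) q * ou_max h x) \<partial>gauss_measure \<partial>\<mu>)"
      proof (rule nn_integral_mono)
        fix t :: real
        have "(\<integral>\<^sup>+x. epowr (avg_op t (G t) x) q * h x \<partial>gauss_measure) \<le>
          (\<integral>\<^sup>+x. ennreal (6 powr (q - 1)) * avg_op t (\<lambda>y. epowr (G t y) q) x * h x \<partial>gauss_measure)"
          by (intro nn_integral_mono mult_right_mono epowr_avg_op_le q) auto
        also have "\<dots> = ennreal (6 powr (q - 1)) * (\<integral>\<^sup>+x. avg_op t (\<lambda>y. epowr (G t y) q) x * h x \<partial>gauss_measure)"
          by (subst nn_integral_cmult[symmetric]) (auto simp: mult_ac)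
        also have "(\<integral>\<^sup>+x. avg_op t (\<lambda>y. epowr (G t y) q) x * h x \<partial>gauss_measure) = 
          (\<integral>\<^sup>+x. epowr (G t x) q * avg_op t h x \<partial>gauss_measure)"
          by (rule avg_op_symmetric[symmetric]) measurable
        also have "ennreal (6 powr (q - 1)) * \<dots> \<le> ennreal (6 powr (q - 1)) * (\<integral>\<^sup>+x. epowr (G t x) q * (6 * ou_max h x) \<partial>gauss_measure)"
          by (intro mult_left_mono nn_integral_mono avg_op_le_max) auto
        also have "\<dots> = (\<integral>\<^sup>+x. ennreal (6 powr (q - 1)) * (epowr (G t x) q * (6 * ou_max h x)) \<partial>gauss_measure)"
          by (rule nn_integral_cmult[symmetric]) measurable
        also have "\<dots> = (\<integral>\<^sup>+x. ennreal c * (epowr (G t x) q * ou_max h x) \<partial>gauss_measure)"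
          by (simp add: c_def ennreal_mult mult_ac)
        finally show "(\<integral>\<^sup>+x. epowr (avg_op t (G t) x) q * h x \<partial>gauss_measure) \<le> (\<integral>\<^sup>+x. ennreal c * (epowr (G t x) q * ou_max h x) \<partial>gauss_measure)" .
      qed
      also have "\<dots> = (\<integral>\<^sup>+x. \<integral>\<^sup>+t. ennreal c * (epowr (G t x) q * ou_max h x) \<partial>\<mu> \<partial>gauss_measure)"
        by (rule gt.Fubini') measurable
      also have "\<dots> = ennreal c * (\<integral>\<^sup>+x. (\<integral>\<^sup>+t. epowr (G t x) q \<partial>\<mu>) * ou_max h x \<partial>gauss_measure)"
        by (simp add: nn_integral_cmult nn_integral_multc)
      finally show "(\<integral>\<^sup>+x. (\<integral>\<^sup>+t. epowr (avg_op t (G t) x) q \<partial>\<mu>) * h x \<partial>gauss_measure) \<le>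
         ennreal c * (\<integral>\<^sup>+x. (\<integral>\<^sup>+t. epowr (G t x) q \<partial>\<mu>) * ou_max h x \<partial>gauss_measure)" .
    qed measurable
  qed
qed

text \<open>Dual to the previous case: the dual extremizer \<open>H = K\<^sup>q\<^sup>-\<^sup>1 \<parallel>K\<parallel>\<^sub>q\<^sup>p\<^sup>-\<^sup>q\<close> of a truncation \<open>K\<close> has
  conjugate exponents \<open>q' \<le> p'\<close>.\<close>

lemma vector_avg_ge:
  assumes p: "1 < p" "p \<le> q"
  shows "\<exists>C\<ge>0. \<forall>\<mu> (G :: real \<Rightarrow> real ^ 'd \<Rightarrow> ennreal). time_measure \<mu> \<longrightarrow>
    (\<lambda>(t, x). G t x) \<in> borel_measurable (borel \<Otimes>\<^sub>M borel) \<longrightarrow>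
    vec_norm \<mu> p q (\<lambda>t. avg_op t (G t)) \<le> ennreal C * vec_norm \<mu> p q G"
proof -
  have q: "1 < q" using p by simp
  define p' where "p' = p / (p - 1)"
  define q' where "q' = q / (q - 1)"
  have p': "1 < p'" "1 / p + 1 / p' = 1" "1 / p' = 1 - 1 / p" using p by (auto simp: p'_def field_simps)
  have q': "1 < q'" "1 / q + 1 / q' = 1" "(q - 1) * q' = q" using q by (auto simp: q'_def field_simps)
  have "q' \<le> p'" using p q by (simp add: p'_def q'_def field_simps)
  \<comment> \<open>This identity of exponents makes the dual norm of the extremizer
    \<open>H\<close> equal to \<open>X\<close> again, so that \<open>X\<close> can be
    absorbed.\<close>
  have ex: "(q + (p - q) * q') * (p' / q') = p"
  proof -
    have "q + (p - q) * q' = q * (p - 1) / (q - 1)" using q by (simp add: q'_def field_simps)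
    moreover have "p' / q' = p * (q - 1) / ((p - 1) * q)" by (simp add: p'_def q'_def)
    ultimately show ?thesis using p q by simp
  qed
  from vector_avg_le[OF less_imp_le[OF q'(1)] \<open>q' \<le> p'\<close>] obtain D where D: "0 \<le> D" and
    dual: "\<And>\<mu> (G :: real \<Rightarrow> real ^ 'd \<Rightarrow> ennreal). time_measure \<mu> \<Longrightarrow>
    (\<lambda>(t, x). G t x) \<in> borel_measurable (borel \<Otimes>\<^sub>M borel) \<Longrightarrow>
    vec_norm \<mu> p' q' (\<lambda>t. avg_op t (G t)) \<le> ennreal D * vec_norm \<mu> p' q' G" by blast
  define C where "C = (D powr (1 / p')) powr p"
  show ?thesis
  proof (intro exI[of _ C] conjI allI impI)
    show "0 \<le> C" by (simp add: C_def)
    fix \<mu> and G :: "real \<Rightarrow> real ^ 'd \<Rightarrow> ennreal"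
    assume "time_measure \<mu>" and Gm [measurable]: "(\<lambda>(t, x). G t x) \<in> borel_measurable (borel \<Otimes>\<^sub>M borel)"
    then interpret time_measure \<mu> by simp
    obtain E :: "nat \<Rightarrow> real set" where E: "range E \<subseteq> sets \<mu>" "(\<Union>i. E i) = space \<mu>" "\<And>i. emeasure \<mu> (E i) \<noteq> \<infinity>" "incseq E"
      using sigma_finite_incseq by blast
    have [measurable]: "E n \<in> sets borel" for n using E(1) by auto
    define Th where "Th t x = avg_op t (G t) x" for t x
    have [measurable]: "(\<lambda>(t, x). Th t x) \<in> borel_measurable (borel \<Otimes>\<^sub>M borel)"
      unfolding Th_def by measurable
    \<comment> \<open>Cutting off both height and time makes \<open>X\<close> finite; monotone
      convergence removes both cut-offs at the end.\<close>
    define K where "K n t x = min (Th t x) (of_nat n) * indicator (E n) t" for n :: nat and t x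
    have Km [measurable]: "(\<lambda>(t, x). K n t x) \<in> borel_measurable (borel \<Otimes>\<^sub>M borel)" for n
      unfolding K_def by measurable
    define Y where "Y = vec_norm \<mu> p q G"
    have main: "vec_norm \<mu> p q (K n) \<le> ennreal C * Y" for n
    proof -
      define Q where "Q x = (\<integral>\<^sup>+t. epowr (K n t x) q \<partial>\<mu>)" for x
      have [measurable]: "Q \<in> borel_measurable borel" unfolding Q_def by measurable
      define X where "X = vec_norm \<mu> p q (K n)"
      have X_eq: "X = (\<integral>\<^sup>+x. epowr (Q x) (p / q) \<partial>gauss_measure)" unfolding X_def vec_norm_def Q_def ..
      \<comment> \<open>The exponent of \<open>Q x\<close> is at most 0. Because
        \<open>epowr 0 r = 0\<close> for every \<open>r\<close>, \<open>H\<close> simply vanishes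
        where \<open>Q\<close> does.\<close>
      define H where "H t x = epowr (K n t x) (q - 1) * epowr (Q x) ((p - q) / q)" for t x
      have Hm [measurable]: "(\<lambda>(t, x). H t x) \<in> borel_measurable (borel \<Otimes>\<^sub>M borel)"
        unfolding H_def by measurable
      define M where "M = epowr (of_nat n) q * emeasure \<mu> (E n)"
      have QM: "Q x \<le> M" for x
      proof -
        have "Q x \<le> (\<integral>\<^sup>+t. epowr (of_nat n) q * indicator (E n) t \<partial>\<mu>)"
          unfolding Q_def K_def using q by (intro nn_integral_mono) (auto simp: indicator_def intro!: epowr_mono)
        then show ?thesis by (simp add: M_def nn_integral_cmult)
      qed
      have M: "M < top" unfolding M_def using E(3)[of n] 
        by (auto simp: ennreal_mult_less_top less_top ennreal_of_nat_eq_real_of_nat)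
      have "X \<le> (\<integral>\<^sup>+x. epowr M (p / q) \<partial>(gauss_measure :: (real ^ 'd) measure))"
        unfolding X_eq using p q QM by (intro nn_integral_mono epowr_mono) auto
      then have X: "X < top" using M by (auto intro: le_less_trans)
      have "X = (\<integral>\<^sup>+x. \<integral>\<^sup>+t. K n t x * H t x \<partial>\<mu> \<partial>gauss_measure)"
        unfolding X_eq
      proof (rule nn_integral_cong)
        fix x
        have "(\<integral>\<^sup>+t. K n t x * H t x \<partial>\<mu>) = (\<integral>\<^sup>+t. epowr (K n t x) q * epowr (Q x) ((p - q) / q) \<partial>\<mu>)"
          unfolding H_def using epowr_add[of _ 1 "q - 1"] by (simp add: mult.assoc[symmetric])
        also have "\<dots> = epowr (Q x) 1 * epowr (Q x) ((p - q) / q)"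
          by (subst nn_integral_multc) (auto simp: Q_def)
        also have "\<dots> = epowr (Q x) (p / q)"
          unfolding epowr_add[symmetric] using q by (simp add: field_simps)
        finally show "epowr (Q x) (p / q) = (\<integral>\<^sup>+t. K n t x * H t x \<partial>\<mu>)" ..
      qed
      also have "\<dots> \<le> (\<integral>\<^sup>+x. \<integral>\<^sup>+t. H t x * Th t x \<partial>\<mu> \<partial>gauss_measure)"
        unfolding mult.commute[of "H _ _"]
        by (intro nn_integral_mono mult_right_mono) (auto simp: K_def indicator_def)
      also have "\<dots> = (\<integral>\<^sup>+t. \<integral>\<^sup>+x. H t x * Th t x \<partial>gauss_measure \<partial>\<mu>)"
        by (rule gt.Fubini'[symmetric]) measurable
      also have "\<dots> = (\<integral>\<^sup>+t. \<integral>\<^sup>+x. G t x * avg_op t (H t) x \<partial>gauss_measure \<partial>\<mu>)"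
        unfolding Th_def by (subst avg_op_symmetric) (auto simp: mult.commute)
      also have "\<dots> = (\<integral>\<^sup>+x. \<integral>\<^sup>+t. G t x * avg_op t (H t) x \<partial>\<mu> \<partial>gauss_measure)"
        by (rule gt.Fubini') measurable
      also have "\<dots> \<le> (\<integral>\<^sup>+x. epowr (\<integral>\<^sup>+t. epowr (G t x) q \<partial>\<mu>) (1 / q) * epowr (\<integral>\<^sup>+t. epowr (avg_op t (H t) x) q' \<partial>\<mu>) (1 / q') \<partial>gauss_measure)"
        by (intro nn_integral_mono Holder_nn_integral q q') auto
      also have "\<dots> \<le> epowr (\<integral>\<^sup>+x. epowr (epowr (\<integral>\<^sup>+t. epowr (G t x) q \<partial>\<mu>) (1 / q)) p \<partial>gauss_measure) (1 / p) *
           epowr (\<integral>\<^sup>+x. epowr (epowr (\<integral>\<^sup>+t. epowr (avg_op t (H t) x) q' \<partial>\<mu>) (1 / q')) p' \<partial>gauss_measure) (1 / p')"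
        by (intro Holder_nn_integral p p') auto
      also have "\<dots> = epowr Y (1 / p) * epowr (vec_norm \<mu> p' q' (\<lambda>t. avg_op t (H t))) (1 / p')"
        by (simp add: epowr_epowr Y_def vec_norm_def)
      also have "\<dots> \<le> epowr Y (1 / p) * epowr (ennreal D * vec_norm \<mu> p' q' H) (1 / p')"
        using p'(1) by (intro mult_left_mono epowr_mono dual Hm \<open>time_measure \<mu>\<close>) auto
      also have "vec_norm \<mu> p' q' H = X"
      proof -
        have "(\<integral>\<^sup>+t. epowr (H t x) q' \<partial>\<mu>) = epowr (Q x) ((q + (p - q) * q') / q)" for x
        proof -
          have "(\<integral>\<^sup>+t. epowr (H t x) q' \<partial>\<mu>) = (\<integral>\<^sup>+t. epowr (K n t x) q * epowr (Q x) ((p - q) / q * q') \<partial>\<mu>)"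
            unfolding H_def using q' by (simp add: epowr_mult epowr_epowr)
          also have "\<dots> = epowr (Q x) 1 * epowr (Q x) ((p - q) / q * q')"
            by (subst nn_integral_multc) (auto simp: Q_def)
          also have "\<dots> = epowr (Q x) ((q + (p - q) * q') / q)"
            unfolding epowr_add[symmetric] using q by (simp add: add_divide_distrib)
          finally show ?thesis .
        qed
        moreover have "(q + (p - q) * q') / q * (p' / q') = p / q" using ex by (metis times_divide_eq_left)
        ultimately show ?thesis unfolding vec_norm_def X_eq by (simp add: epowr_epowr)
      qed
      also have "epowr Y (1 / p) * epowr (ennreal D * X) (1 / p') = (ennreal (D powr (1 / p')) * epowr Y (1 / p)) * epowr X (1 - 1 / p)"
        unfolding p'(3)[symmetric] using p'(1) D by (simp add: epowr_mult mult_ac)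
      finally have "X \<le> epowr (ennreal (D powr (1 / p')) * epowr Y (1 / p)) p"
        by (intro ennreal_absorb_power X) (use p in auto)
      also have "\<dots> = ennreal C * Y" using p by (simp add: epowr_mult epowr_epowr C_def)
      finally show ?thesis unfolding X_def .
    qed
    have mono: "K n t x \<le> K (Suc n) t x" for n t x
      unfolding K_def using incseqD[OF E(4), of n "Suc n"]
      by (intro mult_mono min.mono) (auto simp: indicator_def)
    have sup: "Th t x = (SUP n. K n t x)" for t x
    proof (rule antisym)
      obtain m where m: "t \<in> E m" using E(2) by auto
      have K': "K n t x = min (Th t x) (of_nat n)" if "m \<le> n" for n
        using incseqD[OF E(4) that] m by (auto simp: K_def)
      show "Th t x \<le> (SUP n. K n t x)"
      proof (cases "Th t x = top")
        case True
        have "(SUP n. of_nat n :: ennreal) \<le> (SUP n. K n t x)"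
        proof (rule SUP_mono)
          fix n show "\<exists>k\<in>UNIV. of_nat n \<le> K k t x"
            by (rule bexI[of _ "max m n"]) (auto simp: K' True)
        qed
        then have "(SUP n. K n t x) = top" unfolding ennreal_SUP_of_nat_eq_top by (rule top_le)
        then show ?thesis by (simp only: top_greatest)
      next
        case False
        then obtain n where n: "Th t x < of_nat n" using ennreal_Ex_less_of_nat[of "Th t x"] by (auto simp: less_top)
        then have "Th t x < of_nat (max m n)" by (rule less_le_trans) simp
        then have "Th t x = K (max m n) t x" by (simp add: K' min_absorb1 less_imp_le)
        also have "\<dots> \<le> (SUP n. K n t x)" by (rule SUP_upper) simp
        finally show ?thesis .
      qed
    qed (auto intro!: SUP_least simp: K_def indicator_def)
    have "vec_norm \<mu> p q Th = (\<integral>\<^sup>+x. (SUP n. epowr (\<integral>\<^sup>+t. epowr (K n t x) q \<partial>\<mu>) (p / q)) \<partial>gauss_measure)"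
      unfolding vec_norm_def
    proof (rule nn_integral_cong)
      fix x
      have "(\<integral>\<^sup>+t. epowr (Th t x) q \<partial>\<mu>) = (\<integral>\<^sup>+t. (SUP n. epowr (K n t x) q) \<partial>\<mu>)"
        using q by (simp add: sup epowr_SUP)
      also have "\<dots> = (SUP n. \<integral>\<^sup>+t. epowr (K n t x) q \<partial>\<mu>)"
        using q by (intro nn_integral_monotone_convergence_SUP incseq_SucI le_funI epowr_mono mono) auto
      finally show "epowr (\<integral>\<^sup>+t. epowr (Th t x) q \<partial>\<mu>) (p / q) = (SUP n. epowr (\<integral>\<^sup>+t. epowr (K n t x) q \<partial>\<mu>) (p / q))"
        using p q by (simp add: epowr_SUP)
    qed
    also have "\<dots> = (SUP n. vec_norm \<mu> p q (K n))"
      unfolding vec_norm_def using p q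
      by (intro nn_integral_monotone_convergence_SUP incseq_SucI le_funI epowr_mono nn_integral_mono mono) auto
    also have "\<dots> \<le> ennreal C * Y" by (intro SUP_least main)
    finally show "vec_norm \<mu> p q (\<lambda>t. avg_op t (G t)) \<le> ennreal C * vec_norm \<mu> p q G"
      by (simp add: Th_def[abs_def] Y_def)
  qed
qed

lemma vector_avg:
  assumes "1 < p" "1 \<le> q"
  obtains C where "0 \<le> C" "\<And>\<mu> (G :: real \<Rightarrow> real ^ 'd \<Rightarrow> ennreal). time_measure \<mu> \<Longrightarrow>
    (\<lambda>(t, x). G t x) \<in> borel_measurable (borel \<Otimes>\<^sub>M borel) \<Longrightarrow>
    vec_norm \<mu> p q (\<lambda>t. avg_op t (G t)) \<le> ennreal C * vec_norm \<mu> p q G"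
  using vector_avg_le[of q p] vector_avg_ge[of p q] assms by (metis linear)

section \<open>Subordination densities\<close>

text \<open>By the mean value theorem each difference quotient is a value of \<open>f'\<close>
  inside the interval, so \<open>w\<close> dominates it, and dominated convergence applies along
  every sequence tending to \<open>t0\<close>.\<close>

lemma has_real_derivative_integral:
  fixes f f' :: "real \<Rightarrow> 'a \<Rightarrow> real"
  assumes t0: "t0 \<in> {a<..<b}"
    and int: "\<And>t. t \<in> {a<..<b} \<Longrightarrow> integrable M (f t)"
    and der: "\<And>t x. t \<in> {a<..<b} \<Longrightarrow> x \<in> space M \<Longrightarrow> ((\<lambda>t. f t x) has_real_derivative f' t x) (at t)"
    and bound: "\<And>t x. t \<in> {a<..<b} \<Longrightarrow> x \<in> space M \<Longrightarrow> \<bar>f' t x\<bar> \<le> w x"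
    and w: "integrable M w" and meas: "f' t0 \<in> borel_measurable M"
  shows "((\<lambda>t. \<integral>x. f t x \<partial>M) has_real_derivative (\<integral>x. f' t0 x \<partial>M)) (at t0)"
proof -
  have "((\<lambda>t. ((\<integral>x. f t x \<partial>M) - (\<integral>x. f t0 x \<partial>M)) / (t - t0)) \<longlongrightarrow> (\<integral>x. f' t0 x \<partial>M)) (at t0 within {a<..<b})"
    unfolding tendsto_at_iff_sequentially
  proof (intro allI impI)
    fix X :: "nat \<Rightarrow> real" assume X: "\<forall>i. X i \<in> {a<..<b} - {t0}" "X \<longlonglongrightarrow> t0"
    have Xi: "X i \<in> {a<..<b}" "X i \<noteq> t0" for i using X by auto
    have eq: "((\<integral>x. f (X i) x \<partial>M) - (\<integral>x. f t0 x \<partial>M)) / (X i - t0) = (\<integral>x. (f (X i) x - f t0 x) / (X i - t0) \<partial>M)" for i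
      using int[OF Xi(1)] int[OF t0] by simp
    have "(\<lambda>i. \<integral>x. (f (X i) x - f t0 x) / (X i - t0) \<partial>M) \<longlonglongrightarrow> (\<integral>x. f' t0 x \<partial>M)"
    proof (rule integral_dominated_convergence[where w = w])
      show "f' t0 \<in> borel_measurable M" "integrable M w" by fact+
      show "(\<lambda>x. (f (X i) x - f t0 x) / (X i - t0)) \<in> borel_measurable M" for i
        using borel_measurable_integrable[OF int[OF Xi(1)]] borel_measurable_integrable[OF int[OF t0]] by measurable
      show "AE x in M. (\<lambda>i. (f (X i) x - f t0 x) / (X i - t0)) \<longlonglongrightarrow> f' t0 x"
      proof (rule AE_I2)
        fix x assume "x \<in> space M"
        from der[OF t0 this] have "((\<lambda>t. (f t x - f t0 x) / (t - t0)) \<longlongrightarrow> f' t0 x) (at t0)"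
          by (simp add: has_field_derivative_iff)
        moreover have "filterlim X (at t0) sequentially" using X by (auto simp: filterlim_at)
        ultimately show "(\<lambda>i. (f (X i) x - f t0 x) / (X i - t0)) \<longlonglongrightarrow> f' t0 x"
          by (rule filterlim_compose)
      qed
      show "AE x in M. norm ((f (X i) x - f t0 x) / (X i - t0)) \<le> w x" for i
      proof (rule AE_I2)
        fix x assume x: "x \<in> space M"
        have "\<exists>s\<in>{a<..<b}. (f (X i) x - f t0 x) / (X i - t0) = f' s x"
        proof (cases "X i < t0")
          case True
          have "DERIV (\<lambda>t. f t x) s :> f' s x" if "X i \<le> s" "s \<le> t0" for s
            using that Xi[of i] t0 by (intro der x) auto
          from MVT2[OF True this] obtain z where "X i < z" "z < t0" "f t0 x - f (X i) x = (t0 - X i) * f' z x" by blast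
          then show ?thesis using Xi[of i] t0 by (intro bexI[of _ z]) (auto simp: field_simps)
        next
          case False
          then have "t0 < X i" using Xi[of i] by auto
          have "DERIV (\<lambda>t. f t x) s :> f' s x" if "t0 \<le> s" "s \<le> X i" for s
            using that Xi[of i] t0 by (intro der x) auto
          from MVT2[OF \<open>t0 < X i\<close> this] obtain z where "t0 < z" "z < X i" "f (X i) x - f t0 x = (X i - t0) * f' z x" by blast
          then show ?thesis using Xi[of i] t0 by (intro bexI[of _ z]) (auto simp: field_simps)
        qed
        then obtain s where s: "s \<in> {a<..<b}" "(f (X i) x - f t0 x) / (X i - t0) = f' s x" by blast
        show "norm ((f (X i) x - f t0 x) / (X i - t0)) \<le> w x"
          unfolding s(2) real_norm_def by (rule bound[OF s(1) x])
      qed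
    qed
    then show "((\<lambda>t. ((\<integral>x. f t x \<partial>M) - (\<integral>x. f t0 x \<partial>M)) / (t - t0)) \<circ> X) \<longlonglongrightarrow> (\<integral>x. f' t0 x \<partial>M)"
      by (simp add: o_def eq)
  qed
  moreover have "at t0 within {a<..<b} = at t0" by (rule at_within_open[OF t0]) simp
  ultimately show ?thesis by (simp only: has_field_derivative_iff)
qed

text \<open>The recursion comes from differentiating a polynomial times \<open>exp (- y^2)\<close>;
  the normalization is the physicists' one, with \<open>2 y\<close> in degree 1.\<close>

primrec hermite_poly :: "nat \<Rightarrow> real poly" where
  "hermite_poly 0 = 1"
| "hermite_poly (Suc n) = [:0, 2:] * hermite_poly n - pderiv (hermite_poly n)"

definition gauss_deriv :: "nat \<Rightarrow> real \<Rightarrow> real" where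
  "gauss_deriv n y = (- 1) ^ n * poly (hermite_poly n) y * exp (- (y\<^sup>2))"

lemma measurable_gauss_deriv [measurable]: "gauss_deriv n \<in> borel_measurable borel"
  unfolding gauss_deriv_def by (intro borel_measurable_continuous_onI continuous_intros)

lemma DERIV_gauss_deriv: "(gauss_deriv n has_real_derivative gauss_deriv (Suc n) y) (at y)"
  unfolding gauss_deriv_def
  by (auto intro!: derivative_eq_intros simp: algebra_simps)

lemma DERIV_gauss_deriv_chain:
  "(f has_real_derivative f') (at x within S) \<Longrightarrow>
    ((\<lambda>x. gauss_deriv n (f x)) has_real_derivative gauss_deriv (Suc n) (f x) * f') (at x within S)"
  by (rule DERIV_chain2[OF DERIV_gauss_deriv])

lemma higher_deriv_gauss: "(deriv ^^ n) (\<lambda>y::real. exp (- (y\<^sup>2))) = gauss_deriv n"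
proof (induction n)
  case 0 show ?case by (simp add: gauss_deriv_def)
next
  case (Suc n)
  have "deriv (gauss_deriv n) = gauss_deriv (Suc n)"
    by (intro ext DERIV_imp_deriv DERIV_gauss_deriv)
  then show ?case using Suc by simp
qed

lemma hermite_eq:
  "hermite \<nu> x = (2 ^ mi_abs \<nu> * (\<Prod>i\<in>UNIV. fact (\<nu> i))) powr (- 1 / 2) *
     (\<Prod>i\<in>UNIV. poly (hermite_poly (\<nu> i)) (x $ i))"
proof -
  have "(- 1) ^ \<nu> i * exp ((x $ i)\<^sup>2) * (deriv ^^ \<nu> i) (\<lambda>y::real. exp (- (y\<^sup>2))) (x $ i) = poly (hermite_poly (\<nu> i)) (x $ i)" for i
  proof -
    have *: "(s * E) * (s * P * F) = (s * s) * (E * F) * P" for s E P F :: real by simp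
    show ?thesis unfolding higher_deriv_gauss gauss_deriv_def *
      by (simp add: power_mult_distrib[symmetric] exp_add[symmetric])
  qed
  then show ?thesis unfolding hermite_def by simp
qed

text \<open>Induction on the polynomial: half of \<open>\<delta>\<close> absorbs the new factor
  \<open>y\<close>, the other half goes to the induction hypothesis.\<close>

lemma poly_le_exp_square:
  fixes p :: "real poly"
  shows "0 < \<delta> \<Longrightarrow> \<exists>C\<ge>0. \<forall>y. \<bar>poly p y\<bar> \<le> C * exp (\<delta> * y\<^sup>2)"
proof (induction p arbitrary: \<delta>)
  case 0 then show ?case by (intro exI[of _ 0]) auto
next
  case (pCons a p)
  obtain C where C: "0 \<le> C" "\<And>y. \<bar>poly p y\<bar> \<le> C * exp (\<delta> / 2 * y\<^sup>2)" using pCons.IH[of "\<delta> / 2"] pCons.prems by auto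
  let ?D = "1 + 2 / \<delta>"
  show ?case
  proof (intro exI[of _ "\<bar>a\<bar> + ?D * C"] conjI allI)
    show "0 \<le> \<bar>a\<bar> + ?D * C" using C pCons.prems by simp
    fix y :: real
    have "\<bar>y\<bar> \<le> 1 + y\<^sup>2" 
      using zero_le_power2[of "\<bar>y\<bar> - 1"] zero_le_power2[of y] unfolding power2_diff power2_abs one_power2 by linarith
    also have "\<dots> \<le> ?D * (1 + \<delta> / 2 * y\<^sup>2)" using pCons.prems by (simp add: field_simps)
    also have "\<dots> \<le> ?D * exp (\<delta> / 2 * y\<^sup>2)" using pCons.prems by (intro mult_left_mono exp_ge_add_one_self) auto
    finally have y: "\<bar>y\<bar> \<le> ?D * exp (\<delta> / 2 * y\<^sup>2)" .
    have "\<bar>poly (pCons a p) y\<bar> \<le> \<bar>a\<bar> * 1 + \<bar>y\<bar> * \<bar>poly p y\<bar>" by (simp add: abs_mult[symmetric])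
    also have "\<dots> \<le> \<bar>a\<bar> * exp (\<delta> * y\<^sup>2) + (?D * exp (\<delta> / 2 * y\<^sup>2)) * (C * exp (\<delta> / 2 * y\<^sup>2))"
      using pCons.prems C y by (intro add_mono mult_left_mono mult_mono) auto
    also have "\<dots> = (\<bar>a\<bar> + ?D * C) * exp (\<delta> * y\<^sup>2)" by (simp add: algebra_simps exp_add[symmetric])
    finally show "\<bar>poly (pCons a p) y\<bar> \<le> (\<bar>a\<bar> + ?D * C) * exp (\<delta> * y\<^sup>2)" .
  qed
qed

lemma poly_exp_bounded:
  fixes p :: "real poly"
  obtains C where "0 \<le> C" "\<And>y. \<bar>poly p y\<bar> * exp (- (y\<^sup>2)) \<le> C"
proof -
  obtain C where C: "0 \<le> C" "\<And>y. \<bar>poly p y\<bar> \<le> C * exp (1 * y\<^sup>2)" using poly_le_exp_square[of 1 p] by auto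
  have "\<bar>poly p y\<bar> * exp (- (y\<^sup>2)) \<le> C" for y
    using mult_right_mono[OF C(2)[of y], of "exp (- (y\<^sup>2))"] by (simp add: mult.assoc exp_add[symmetric])
  with C show ?thesis using that by blast
qed

text \<open>The \<open>j\<close>-th time derivative of \<open>(\<pi> r)\<^sup>-\<^sup>1\<^sup>/\<^sup>2 exp (- t\<^sup>2 / 4r)\<close>; the subordination density
  is minus the first one.\<close>

definition heat_deriv :: "nat \<Rightarrow> real \<Rightarrow> real \<Rightarrow> real" where
  "heat_deriv j t r = 1 / (sqrt pi * sqrt r) * (1 / (2 * sqrt r)) ^ j * gauss_deriv j (t / (2 * sqrt r))"

lemma measurable_heat_deriv [measurable]: "(\<lambda>(t, r). heat_deriv j t r) \<in> borel_measurable (borel \<Otimes>\<^sub>M borel)"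
  unfolding heat_deriv_def by measurable

lemma DERIV_heat_deriv: "0 < r \<Longrightarrow> ((\<lambda>t. heat_deriv j t r) has_real_derivative heat_deriv (Suc j) t r) (at t)"
proof -
  assume r: "0 < r"
  have "((\<lambda>t. t / (2 * sqrt r)) has_real_derivative 1 / (2 * sqrt r)) (at t)"
    by (rule DERIV_cdivide[OF DERIV_ident])
  from DERIV_cmult[OF DERIV_gauss_deriv_chain[OF this, of j], of "1 / (sqrt pi * sqrt r) * (1 / (2 * sqrt r)) ^ j"] show ?thesis
    unfolding heat_deriv_def by (simp only: power_Suc mult_ac)
qed

text \<open>In the variable \<open>y = t / (2 sqrt r)\<close> the ratio \<open>t^3 / r^(3/2)\<close>
  is \<open>8 y^3\<close>, so comparing a kernel with the weight becomes a bound by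
  \<open>min 1 (8 y^3)\<close>.\<close>

lemma avg_weight_eq:
  assumes "0 < t" "0 < r"
  shows "avg_weight t r = 1 / t\<^sup>2 * min 1 (8 * (t / (2 * sqrt r)) ^ 3)"
proof -
  have sr: "sqrt r > 0" using assms by simp
  have p: "r powr (- 3 / 2) = 1 / sqrt r ^ 3" if "0 < r" for r :: real
  proof -
    have "sqrt r ^ 3 = sqrt r powr real 3" using that by (subst powr_realpow) auto
    also have "\<dots> = r powr (3 / 2)" using that by (simp add: powr_half_sqrt[symmetric] powr_powr)
    finally show ?thesis using powr_minus_divide[of r "3/2"] by simp
  qed
  have "max r (t\<^sup>2) > 0" using assms by (simp add: less_max_iff_disj)
  from p[OF this] have e: "avg_weight t r = t * (1 / sqrt (max r (t\<^sup>2)) ^ 3)" by (simp add: avg_weight_def)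
  show ?thesis
  proof (cases "r \<le> t\<^sup>2")
    case True
    then have "sqrt r \<le> t" using assms by (simp add: real_le_lsqrt)
    then have "sqrt r ^ 3 \<le> t ^ 3" using sr by (intro power_mono) auto
    then have "1 \<le> 8 * (t / (2 * sqrt r)) ^ 3" using sr by (simp add: power_divide power_mult_distrib)
    moreover have "avg_weight t r = t * (1 / t ^ 3)" unfolding e using True assms by (simp add: max_def)
    ultimately show ?thesis using assms by (simp add: power2_eq_square power3_eq_cube)
  next
    case False
    then have "t \<le> sqrt r" using assms by (simp add: real_le_rsqrt)
    then have "t ^ 3 \<le> sqrt r ^ 3" using assms by (intro power_mono) auto
    then have "8 * (t / (2 * sqrt r)) ^ 3 \<le> 1" using sr by (simp add: power_divide power_mult_distrib)
    moreover have "avg_weight t r = t * (1 / sqrt r ^ 3)" unfolding e using False by (simp add: max_def)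
    ultimately show ?thesis using assms sr by (simp add: power_divide power_mult_distrib power2_eq_square power3_eq_cube)
  qed
qed

lemma avg_weight_nonneg: "0 < t \<Longrightarrow> 0 \<le> avg_weight t r"
  by (simp add: avg_weight_def)

text \<open>In the variable \<open>y = t / (2 sqrt r)\<close> the kernel is
  \<open>2 / sqrt pi * t^(-(m+2)) * y^(m+2)\<close> times \<open>gauss_deriv (Suc m) y\<close>.
  Besides boundedness this needs a factor \<open>y^3\<close> for small \<open>y\<close>: for
  \<open>m \<ge> 1\<close> the power \<open>y^(m+2)\<close> contains it, and for
  \<open>m = 0\<close> the missing \<open>y\<close> comes from the Hermite polynomial
  \<open>2 y\<close>.\<close>

lemma heat_deriv_bound:
  obtains C where "0 \<le> C"
    "\<And>t r. 0 < t \<Longrightarrow> 0 < r \<Longrightarrow> \<bar>heat_deriv (Suc m) t r\<bar> \<le> C / t ^ m * avg_weight t r"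
proof -
  \<comment> \<open>\<open>R\<close> is what remains of \<open>y^(m+2)\<close> times the Hermite
    polynomial after taking out \<open>y^3\<close>.\<close>
  define R :: "real poly" where "R = (if m = 0 then [:2:] else monom 1 (m - 1) * hermite_poly (Suc m))"
  have R: "y ^ (m + 2) * poly (hermite_poly (Suc m)) y = y ^ 3 * poly R y" for y
  proof (cases m)
    case 0 then show ?thesis by (simp add: R_def power3_eq_cube power2_eq_square pderiv_1)
  next
    case (Suc n) 
    then have "m + 2 = 3 + n" by simp
    then have "y ^ (m + 2) = y ^ 3 * y ^ n" by (simp only: power_add)
    then show ?thesis using Suc by (simp add: R_def poly_monom power3_eq_cube del: hermite_poly.simps)
  qed
  obtain C1 where C1: "0 \<le> C1" "\<And>y. \<bar>poly R y\<bar> * exp (- (y\<^sup>2)) \<le> C1" using poly_exp_bounded by blast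
  obtain C2 where C2: "0 \<le> C2" "\<And>y. \<bar>poly (monom 1 3 * R) y\<bar> * exp (- (y\<^sup>2)) \<le> C2" using poly_exp_bounded by blast
  define C where "C = 2 * max C1 C2"
  have key: "y ^ (m + 2) * \<bar>gauss_deriv (Suc m) y\<bar> \<le> max C1 C2 * min 1 (8 * y ^ 3)" if y: "0 < y" for y
  proof -
    have e: "y ^ (m + 2) * \<bar>gauss_deriv (Suc m) y\<bar> = y ^ 3 * (\<bar>poly R y\<bar> * exp (- (y\<^sup>2)))"
    proof -
      have "y ^ (m + 2) * \<bar>gauss_deriv (Suc m) y\<bar> = \<bar>y ^ (m + 2) * poly (hermite_poly (Suc m)) y\<bar> * exp (- (y\<^sup>2))"
        using y by (simp add: gauss_deriv_def abs_mult power_abs mult_ac del: hermite_poly.simps)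
      then show ?thesis unfolding R using y by (simp add: abs_mult)
    qed
    have "y ^ 3 * (\<bar>poly R y\<bar> * exp (- (y\<^sup>2))) \<le> y ^ 3 * C1" using y by (intro mult_left_mono C1) auto
    also have "\<dots> \<le> max C1 C2 * (8 * y ^ 3)" using y C1 by (simp add: max_def field_simps)
    finally have 1: "y ^ (m + 2) * \<bar>gauss_deriv (Suc m) y\<bar> \<le> max C1 C2 * (8 * y ^ 3)" unfolding e .
    have "y ^ 3 * (\<bar>poly R y\<bar> * exp (- (y\<^sup>2))) = \<bar>poly (monom 1 3 * R) y\<bar> * exp (- (y\<^sup>2))"
      using y by (simp add: poly_monom abs_mult)
    also have "\<dots> \<le> max C1 C2 * 1" using C2(2)[of y] by simp
    finally have 2: "y ^ (m + 2) * \<bar>gauss_deriv (Suc m) y\<bar> \<le> max C1 C2 * 1" unfolding e .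
    show ?thesis using 1 2 by (simp add: min_def)
  qed
  show ?thesis
  proof
    show "0 \<le> C" using C1 by (simp add: C_def)
    fix t r :: real assume t: "0 < t" and r: "0 < r"
    define y where "y = t / (2 * sqrt r)"
    have y: "0 < y" using t r by (simp add: y_def)
    have ys: "1 / (2 * sqrt r) = y / t" "1 / sqrt r = 2 * (y / t)" using t by (auto simp: y_def)
    have "\<bar>heat_deriv (Suc m) t r\<bar> = 1 / sqrt pi * (1 / sqrt r) * (1 / (2 * sqrt r)) ^ Suc m * \<bar>gauss_deriv (Suc m) y\<bar>"
      using t r by (simp add: heat_deriv_def abs_mult y_def)
    also have "\<dots> = 2 / sqrt pi / t ^ (m + 2) * (y ^ (m + 2) * \<bar>gauss_deriv (Suc m) y\<bar>)"
      unfolding ys using t by (simp add: power_divide field_simps)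
    also have "\<dots> \<le> 2 / sqrt pi / t ^ (m + 2) * (max C1 C2 * min 1 (8 * y ^ 3))"
      using t by (intro mult_left_mono key y) auto
    also have "\<dots> \<le> 2 / 1 / t ^ (m + 2) * (max C1 C2 * min 1 (8 * y ^ 3))"
    proof -
      have "1 \<le> sqrt pi" using pi_gt3 by simp
      then show ?thesis using t y C1 by (intro mult_right_mono divide_right_mono divide_left_mono) (auto simp: le_max_iff_disj)
    qed
    also have "\<dots> = C / t ^ m * avg_weight t r"
      unfolding avg_weight_eq[OF t r] C_def y_def[symmetric] using t by (simp add: power_add power2_eq_square mult_ac)
    finally show "\<bar>heat_deriv (Suc m) t r\<bar> \<le> C / t ^ m * avg_weight t r" .
  qed
qed

text \<open>On a compact interval of positive times all weights are bounded by a multiple of the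
  weight at time 1, so integrability against that one weight gives domination locally uniformly in
  \<open>t\<close>.\<close>

lemma avg_weight_le_avg_weight_1:
  assumes a: "0 < a" "a \<le> t" "t \<le> b" and r: "0 < r"
  shows "avg_weight t r \<le> b * min 1 (a\<^sup>2) powr (- 3 / 2) * avg_weight 1 r"
proof -
  have mx: "0 < max r 1" "0 < max r (t\<^sup>2)" "0 < min 1 (a\<^sup>2)" using r a by auto
  have "min 1 (a\<^sup>2) * max r 1 \<le> max r (t\<^sup>2)"
  proof (cases "r \<le> 1")
    case True
    have "min 1 (a\<^sup>2) \<le> t\<^sup>2" using a power_mono[of a t 2] by linarith
    then have "min 1 (a\<^sup>2) \<le> max r (t\<^sup>2)" by (rule max.coboundedI2)
    then show ?thesis using True by (simp add: max_absorb2)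
  next
    case False
    have "min 1 (a\<^sup>2) * r \<le> 1 * r" using r by (intro mult_right_mono) auto
    then have "min 1 (a\<^sup>2) * r \<le> max r (t\<^sup>2)" by (simp add: max.coboundedI1)
    then show ?thesis using False by (simp add: max_absorb1)
  qed
  then have "max r (t\<^sup>2) powr (- 3 / 2) \<le> (min 1 (a\<^sup>2) * max r 1) powr (- 3 / 2)"
    using mx by (intro powr_mono2') auto
  also have "\<dots> = min 1 (a\<^sup>2) powr (- 3 / 2) * max r 1 powr (- 3 / 2)" by (rule powr_mult)
  finally have "t * max r (t\<^sup>2) powr (- 3 / 2) \<le> b * (min 1 (a\<^sup>2) powr (- 3 / 2) * max r 1 powr (- 3 / 2))"
    using a by (intro mult_mono) auto
  then show ?thesis by (simp add: avg_weight_def mult_ac)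
qed

text \<open>A condition at time 1 alone. It implies integrability against every
  \<open>heat_deriv (Suc m) t\<close> with \<open>t > 0\<close>, which lets a single null set of
  points serve all times and all orders.\<close>

definition admissible :: "(real \<Rightarrow> real) \<Rightarrow> bool" where
  "admissible \<phi> \<longleftrightarrow> \<phi> \<in> borel_measurable borel \<and>
     (\<integral>\<^sup>+r. indicator {0<..} r * ennreal (avg_weight 1 r) * ennreal \<bar>\<phi> r\<bar> \<partial>lborel) < top"

definition heat_int :: "nat \<Rightarrow> (real \<Rightarrow> real) \<Rightarrow> real \<Rightarrow> real" where
  "heat_int j \<phi> t = (\<integral>r. indicator {0<..} r * (heat_deriv j t r * \<phi> r) \<partial>lborel)"

lemma admissible_integrable_weight:
  assumes "admissible \<phi>"
  shows "integrable lborel (\<lambda>r. indicator {0<..} r * (avg_weight 1 r * \<bar>\<phi> r\<bar>))"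
proof -
  have [measurable]: "\<phi> \<in> borel_measurable borel" using assms by (simp add: admissible_def)
  have "(\<integral>\<^sup>+r. ennreal (norm (indicator {0<..} r * (avg_weight 1 r * \<bar>\<phi> r\<bar>))) \<partial>lborel) =
    (\<integral>\<^sup>+r. indicator {0<..} r * ennreal (avg_weight 1 r) * ennreal \<bar>\<phi> r\<bar> \<partial>lborel)"
    by (intro nn_integral_cong) (auto simp: indicator_def abs_mult avg_weight_nonneg ennreal_mult)
  also have "\<dots> < \<infinity>" using assms by (simp add: admissible_def)
  finally show ?thesis by (intro integrableI_bounded) auto
qed

lemma heat_deriv_dominated:
  assumes a: "0 < a" "a \<le> b"
  obtains C where "0 \<le> C" "\<And>t r. a \<le> t \<Longrightarrow> t \<le> b \<Longrightarrow> 0 < r \<Longrightarrow> \<bar>heat_deriv (Suc m) t r\<bar> \<le> C * avg_weight 1 r"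
proof -
  obtain C where C: "0 \<le> C" "\<And>t r. 0 < t \<Longrightarrow> 0 < r \<Longrightarrow> \<bar>heat_deriv (Suc m) t r\<bar> \<le> C / t ^ m * avg_weight t r"
    using heat_deriv_bound by blast
  let ?K = "b * min 1 (a\<^sup>2) powr (- 3 / 2)"
  show ?thesis
  proof
    show "0 \<le> C / a ^ m * ?K" using C a by simp
    fix t r :: real assume t: "a \<le> t" "t \<le> b" and r: "0 < r"
    have "\<bar>heat_deriv (Suc m) t r\<bar> \<le> C / t ^ m * avg_weight t r" using C(2)[of t r] a t r by simp
    also have "\<dots> \<le> C / a ^ m * avg_weight t r"
      using a t C by (intro mult_right_mono divide_left_mono power_mono avg_weight_nonneg) auto
    also have "\<dots> \<le> C / a ^ m * (?K * avg_weight 1 r)"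
      using a t r C by (intro mult_left_mono avg_weight_le_avg_weight_1) auto
    finally show "\<bar>heat_deriv (Suc m) t r\<bar> \<le> C / a ^ m * ?K * avg_weight 1 r" by (simp add: mult_ac)
  qed
qed

lemma integrable_heat_deriv:
  assumes adm: "admissible \<phi>" and t: "0 < t"
  shows "integrable lborel (\<lambda>r. indicator {0<..} r * (heat_deriv (Suc m) t r * \<phi> r))"
proof -
  have [measurable]: "\<phi> \<in> borel_measurable borel" using adm by (simp add: admissible_def)
  obtain C where C: "0 \<le> C" "\<And>s r. t \<le> s \<Longrightarrow> s \<le> t \<Longrightarrow> 0 < r \<Longrightarrow> \<bar>heat_deriv (Suc m) s r\<bar> \<le> C * avg_weight 1 r"
    using heat_deriv_dominated[OF t order_refl] by blast
  show ?thesis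
  proof (rule Bochner_Integration.integrable_bound)
    show "integrable lborel (\<lambda>r. C * (indicator {0<..} r * (avg_weight 1 r * \<bar>\<phi> r\<bar>)))"
      by (intro integrable_mult_right admissible_integrable_weight adm)
    show "AE r in lborel. norm (indicator {0<..} r * (heat_deriv (Suc m) t r * \<phi> r)) \<le> norm (C * (indicator {0<..} r * (avg_weight 1 r * \<bar>\<phi> r\<bar>)))"
    proof (rule AE_I2)
      fix r
      show "norm (indicator {0<..} r * (heat_deriv (Suc m) t r * \<phi> r)) \<le> norm (C * (indicator {0<..} r * (avg_weight 1 r * \<bar>\<phi> r\<bar>)))"
        using mult_right_mono[OF C(2)[of t r], of "\<bar>\<phi> r\<bar>"] C(1)
        by (cases "0 < r") (auto simp: abs_mult avg_weight_nonneg mult.assoc)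
    qed
  qed measurable
qed

text \<open>Integrability at order \<open>j\<close> is a separate hypothesis because the kernel of
  order 0 decays only like \<open>r^(-1/2)\<close> and is not controlled by admissibility; for
  higher orders it follows from it.\<close>

lemma DERIV_heat_int:
  assumes adm: "admissible \<phi>" and t: "0 < t"
    and int: "\<And>t. 0 < t \<Longrightarrow> integrable lborel (\<lambda>r. indicator {0<..} r * (heat_deriv j t r * \<phi> r))"
  shows "(heat_int j \<phi> has_real_derivative heat_int (Suc j) \<phi> t) (at t)"
proof -
  have [measurable]: "\<phi> \<in> borel_measurable borel" using adm by (simp add: admissible_def)
  obtain C where C: "0 \<le> C" "\<And>s r. t / 2 \<le> s \<Longrightarrow> s \<le> 2 * t \<Longrightarrow> 0 < r \<Longrightarrow> \<bar>heat_deriv (Suc j) s r\<bar> \<le> C * avg_weight 1 r"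
    using heat_deriv_dominated[of "t/2" "2 * t"] t by auto
  show ?thesis unfolding heat_int_def[abs_def]
  proof (rule has_real_derivative_integral[where a = "t/2" and b = "2*t" and w = "\<lambda>r. C * (indicator {0<..} r * (avg_weight 1 r * \<bar>\<phi> r\<bar>))"])
    show "integrable lborel (\<lambda>r. C * (indicator {0<..} r * (avg_weight 1 r * \<bar>\<phi> r\<bar>)))"
      by (intro integrable_mult_right admissible_integrable_weight adm)
    fix s assume s: "s \<in> {t/2<..<2*t}"
    then show "integrable lborel (\<lambda>r. indicator {0<..} r * (heat_deriv j s r * \<phi> r))" using t by (intro int) auto
    fix r :: real
    show "((\<lambda>s. indicator {0<..} r * (heat_deriv j s r * \<phi> r)) has_real_derivative indicator {0<..} r * (heat_deriv (Suc j) s r * \<phi> r)) (at s)"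
      by (cases "0 < r") (auto intro!: derivative_eq_intros DERIV_heat_deriv)
    show "\<bar>indicator {0<..} r * (heat_deriv (Suc j) s r * \<phi> r)\<bar> \<le> C * (indicator {0<..} r * (avg_weight 1 r * \<bar>\<phi> r\<bar>))"
      using mult_right_mono[OF C(2)[of s r], of "\<bar>\<phi> r\<bar>"] C(1) s
      by (cases "0 < r") (auto simp: abs_mult mult.assoc)
  qed (use t in auto)
qed

lemma DERIV_heat_int_Suc:
  "admissible \<phi> \<Longrightarrow> 0 < t \<Longrightarrow> (heat_int (Suc m) \<phi> has_real_derivative heat_int (Suc (Suc m)) \<phi> t) (at t)"
  by (intro DERIV_heat_int integrable_heat_deriv)

section \<open>Time derivatives of the Poisson-Hermite semigroup\<close>

text \<open>The substitution \<open>r = t^2 / (4 u)\<close> turns the integral that defines the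
  Poisson semigroup into one against the subordination density, which is minus the first time
  derivative of the heat kernel.\<close>

lemma subordination_substitution:
  fixes \<phi> :: "real \<Rightarrow> real"
  assumes [measurable]: "\<phi> \<in> borel_measurable borel" and t: "0 < t"
    and int: "integrable lborel (\<lambda>r. indicator {0<..} r * (heat_deriv 1 t r * \<phi> r))"
  shows "1 / sqrt pi * (LINT u:{0<..}|lborel. exp (- u) / sqrt u * \<phi> (t\<^sup>2 / (4 * u))) = - heat_int 1 \<phi> t"
proof -
  define f where "f r = - heat_deriv 1 t r * \<phi> r" for r
  define g where "g u = t\<^sup>2 / (4 * u)" for u :: real
  define g' where "g' u = - t\<^sup>2 / (4 * u\<^sup>2)" for u :: real
  have [measurable]: "f \<in> borel_measurable borel" unfolding f_def by measurable
  have der: "(g has_field_derivative g' u) (at u within {0<..})" if "u \<in> {0<..}" for u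
    unfolding g_def g'_def using that by (auto intro!: derivative_eq_intros simp: power2_eq_square)
  have inj: "inj_on g {0<..}" using t by (auto simp: inj_on_def g_def)
  have img: "g ` {0<..} = {0<..}"
  proof (intro equalityI subsetI)
    fix r :: real assume "r \<in> {0<..}"
    then have "r = g (t\<^sup>2 / (4 * r))" "t\<^sup>2 / (4 * r) \<in> {0<..}" using t by (auto simp: g_def)
    then show "r \<in> g ` {0<..}" by blast
  qed (use t in \<open>auto simp: g_def\<close>)
  have set_int: "set_integrable lborel {0<..} f"
    unfolding set_integrable_def f_def using integrable_minus[OF int] by (simp add: indicator_def if_distrib cong: if_cong)
  \<comment> \<open>The change of variables takes place over the completed measure
    \<open>lebesgue\<close>; the set integrals are translated there and back.\<close>
  then have leb: "set_integrable lebesgue {0<..} f"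
    unfolding set_integrable_def by (subst integrable_completion) auto
  from has_absolute_integral_change_of_variables_1'[OF _ der inj, where f = f and b = "integral {0<..} f"] img leb
  have cv: "(\<lambda>u. \<bar>g' u\<bar> * f (g u)) absolutely_integrable_on {0<..}" "integral {0<..} (\<lambda>u. \<bar>g' u\<bar> * f (g u)) = integral {0<..} f"
    by auto
  have eq: "\<bar>g' u\<bar> * f (g u) = 1 / sqrt pi * (exp (- u) / sqrt u * \<phi> (t\<^sup>2 / (4 * u)))" if u: "0 < u" for u
  proof -
    define s where "s = sqrt u"
    have s: "0 < s" "u = s\<^sup>2" using u by (auto simp: s_def)
    have sg: "sqrt (g u) = t / (2 * s)" unfolding g_def s(2) using s(1) t by (simp add: real_sqrt_divide real_sqrt_mult)
    have h: "heat_deriv 1 t (g u) = - (1 / (sqrt pi * (t / (2 * s))) * (s / t) * (2 * s * exp (- (s\<^sup>2))))"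
      unfolding heat_deriv_def sg gauss_deriv_def using s t by (simp add: pderiv_1)
    show ?thesis unfolding f_def h g'_def g_def[symmetric] s_def[symmetric] using s t
      by (simp add: s(2) abs_mult power2_eq_square field_simps)
  qed
  have "(LBINT u:{0<..}. exp (- u) / sqrt u * \<phi> (t\<^sup>2 / (4 * u))) = (LBINT u:{0<..}. sqrt pi * (\<bar>g' u\<bar> * f (g u)))"
    unfolding set_lebesgue_integral_def by (intro Bochner_Integration.integral_cong) (auto simp: eq indicator_def)
  also have "\<dots> = sqrt pi * (LBINT u:{0<..}. \<bar>g' u\<bar> * f (g u))" by simp
  also have "(LBINT u:{0<..}. \<bar>g' u\<bar> * f (g u)) = set_lebesgue_integral lebesgue {0<..} (\<lambda>u. \<bar>g' u\<bar> * f (g u))"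
    unfolding set_lebesgue_integral_def g'_def g_def by (subst integral_completion) auto
  also have "\<dots> = integral {0<..} f"
    using set_lebesgue_integral_eq_integral(2)[OF cv(1)] cv(2) by simp
  also have "\<dots> = set_lebesgue_integral lebesgue {0<..} f"
    using set_lebesgue_integral_eq_integral(2)[OF leb] by simp
  also have "\<dots> = (LBINT r:{0<..}. f r)"
    unfolding set_lebesgue_integral_def by (subst integral_completion) auto
  also have "\<dots> = - heat_int 1 \<phi> t"
    unfolding set_lebesgue_integral_def heat_int_def f_def by (subst Bochner_Integration.integral_minus[symmetric]) (auto intro!: Bochner_Integration.integral_cong)
  finally show ?thesis by simp
qed

lemma admissible_bounded:
  assumes [measurable]: "\<phi> \<in> borel_measurable borel" and b: "\<And>r. 0 < r \<Longrightarrow> \<bar>\<phi> r\<bar> \<le> B"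
  shows "admissible \<phi>"
  unfolding admissible_def
proof
  have "0 \<le> B" using b[of 1] by simp
  have "(\<integral>\<^sup>+r. indicator {0<..} r * ennreal (avg_weight 1 r) * ennreal \<bar>\<phi> r\<bar> \<partial>lborel) \<le>
     (\<integral>\<^sup>+r. (indicator {0<..} r * ennreal (avg_weight 1 r)) * ennreal B \<partial>lborel)"
    using b by (intro nn_integral_mono) (auto simp: indicator_def intro!: mult_left_mono ennreal_leI)
  also have "\<dots> = (\<integral>\<^sup>+r. (indicator {0<..} r * ennreal (avg_weight 1 r)) \<partial>lborel) * ennreal B"
    by (rule nn_integral_multc) measurable
  also have "\<dots> \<le> ennreal 6 * ennreal B" by (intro mult_right_mono avg_weight_integral_le) simp
  also have "\<dots> < top" by (simp add: ennreal_mult_less_top)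
  finally show "(\<integral>\<^sup>+r. indicator {0<..} r * ennreal (avg_weight 1 r) * ennreal \<bar>\<phi> r\<bar> \<partial>lborel) < top" .
qed fact

lemma Gamma_half_integral:
  "set_integrable lborel {0<..} (\<lambda>u::real. exp (- u) / sqrt u)" "(LINT u:{0<..}|lborel. exp (- u) / sqrt u) = sqrt pi"
proof -
  have "((\<lambda>u::real. u powr (1/2 - 1) / exp u) has_integral Gamma (1/2)) {0..}" by (rule Gamma_integral_real) simp
  then have "((\<lambda>u::real. if u \<in> {0..} then u powr (1/2 - 1) / exp u else 0) has_integral sqrt pi) UNIV"
    by (simp only: has_integral_restrict_UNIV Gamma_one_half_real)
  then have *: "((\<lambda>u::real. indicator {0<..} u * (exp (- u) / sqrt u)) has_integral sqrt pi) UNIV"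
    by (rule has_integral_eq[rotated])
       (auto simp: indicator_def powr_minus powr_half_sqrt exp_minus field_simps)
  have "has_bochner_integral lborel (\<lambda>u::real. indicator {0<..} u * (exp (- u) / sqrt u)) (sqrt pi)"
  proof (rule has_bochner_integral_nn_integral)
    show "(\<integral>\<^sup>+u. ennreal (indicator {0<..} u * (exp (- u) / sqrt u)) \<partial>lborel) = ennreal (sqrt pi)"
      by (rule nn_integral_has_integral_lborel[OF _ _ *]) (auto simp: indicator_def)
  qed (auto simp: indicator_def)
  then show "set_integrable lborel {0<..} (\<lambda>u::real. exp (- u) / sqrt u)" "(LINT u:{0<..}|lborel. exp (- u) / sqrt u) = sqrt pi"
    by (auto simp: set_integrable_def set_lebesgue_integral_def has_bochner_integral_iff)
qed

lemma admissible_exp: "0 \<le> c \<Longrightarrow> admissible (\<lambda>r. exp (- (c * r)))"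
  by (rule admissible_bounded[where B = 1]) auto

text \<open>The Laplace transform of the subordination density, found from a differential equation.
  With \<open>K = heat_int 0\<close> and \<open>y = - heat_int 1\<close>, differentiation gives
  \<open>K' = - y\<close>, while rescaling \<open>r\<close> by \<open>c\<close> gives
  \<open>K = y / sqrt c\<close>. Hence \<open>y' = - sqrt c * y\<close>, and \<open>y\<close> tends
  to 1 as \<open>t\<close> tends to 0.\<close>

lemma heat_int_exp:
  assumes c: "0 \<le> c" and t: "0 < t"
  shows "heat_int 1 (\<lambda>r. exp (- (c * r))) t = - exp (- (sqrt c * t))"
proof -
  define y where "y t = - heat_int 1 (\<lambda>r. exp (- (c * r))) t" for t
  have adm: "admissible (\<lambda>r. exp (- (c * r)))" using c by (rule admissible_exp)
  have y: "y t = 1 / sqrt pi * (LINT u:{0<..}|lborel. exp (- u) / sqrt u * exp (- (c * (t\<^sup>2 / (4 * u)))))" if "0 < t" for t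
    unfolding y_def using integrable_heat_deriv[OF adm that, of 0] that
    by (intro subordination_substitution[symmetric]) auto
  show ?thesis
  proof (cases "c = 0")
    case True
    then show ?thesis using y[OF t] Gamma_half_integral(2) by (simp add: y_def)
  next
    case False
    with c have c: "0 < c" by simp
    define K where "K = heat_int 0 (\<lambda>r. exp (- (c * r)))"
    let ?h = "\<lambda>t u. indicator {0<..} u * (exp (- u) / sqrt u * exp (- (c * (t\<^sup>2 / (4 * u)))))"
    have K_scale: "(\<lambda>r. indicator {0<..} r * (heat_deriv 0 t r * exp (- (c * r)))) = (\<lambda>r. sqrt c / sqrt pi * ?h t (0 + c * r))" if "0 < t" for t
    proof
      fix r :: real
      show "indicator {0<..} r * (heat_deriv 0 t r * exp (- (c * r))) = sqrt c / sqrt pi * ?h t (0 + c * r)"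
      proof (cases "0 < r")
        case True
        have "(t / (2 * sqrt r))\<^sup>2 = c * (t\<^sup>2 / (4 * (c * r)))" using c True by (simp add: power_divide power_mult_distrib)
        then show ?thesis using c True
          by (simp add: heat_deriv_def gauss_deriv_def real_sqrt_mult field_simps)
      qed (use c in \<open>auto simp: indicator_def zero_less_mult_iff\<close>)
    qed
    have int_h: "integrable lborel (?h t)" for t
    proof (rule Bochner_Integration.integrable_bound)
      show "integrable lborel (\<lambda>u::real. indicator {0<..} u * (exp (- u) / sqrt u))"
        using Gamma_half_integral(1) by (simp add: set_integrable_def)
      show "AE u in lborel. norm (?h t u) \<le> norm (indicator {0<..} u * (exp (- u) / sqrt u))"
        using c by (intro AE_I2) (auto simp: indicator_def mult_le_cancel_left1 divide_le_eq intro!: mult_left_le)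
    qed measurable
    \<comment> \<open>The factor \<open>exp (- (c * r))\<close> with \<open>c > 0\<close> supplies
      the integrability at order 0 that admissibility does not give.\<close>
    have int0: "integrable lborel (\<lambda>r. indicator {0<..} r * (heat_deriv 0 t r * exp (- (c * r))))" if "0 < t" for t
      unfolding K_scale[OF that] using c by (intro integrable_mult_right lborel_integrable_real_affine int_h) auto
    have Ky: "K t = y t / sqrt c" if "0 < t" for t
    proof -
      have "(\<integral>u. ?h t u \<partial>lborel) = \<bar>c\<bar> *\<^sub>R (\<integral>r. ?h t (0 + c * r) \<partial>lborel)"
        using c by (intro lborel_integral_real_affine) auto
      moreover have "K t = sqrt c / sqrt pi * (\<integral>r. ?h t (0 + c * r) \<partial>lborel)"
        unfolding K_def heat_int_def K_scale[OF that] by (rule integral_mult_right_zero)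
      moreover have "y t = 1 / sqrt pi * (\<integral>u. ?h t u \<partial>lborel)"
        unfolding y[OF that] set_lebesgue_integral_def by simp
      moreover have "sqrt c / sqrt pi * I = (1 / sqrt pi * (\<bar>c\<bar> *\<^sub>R I)) / sqrt c" for I
        using c by (simp add: field_simps)
      ultimately show ?thesis by (simp only:)
    qed
    have dK: "(K has_real_derivative - y t) (at t)" if "0 < t" for t
      unfolding K_def y_def using DERIV_heat_int[OF adm that int0] by simp
    have dy: "(y has_real_derivative - sqrt c * y t) (at t)" if "0 < t" for t
    proof -
      have "((\<lambda>t. sqrt c * K t) has_real_derivative sqrt c * - y t) (at t)" by (intro DERIV_cmult dK that)
      then have "((\<lambda>t. sqrt c * K t) has_real_derivative - sqrt c * y t) (at t)" by simp
      then show ?thesis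
        by (rule has_field_derivative_transform_within_open[where S = "{0<..}"]) (use that c Ky in auto)
    qed
    have "((\<lambda>t. y t * exp (sqrt c * t)) has_real_derivative 0) (at t within {0<..})" if "t \<in> {0<..}" for t
    proof -
      have e: "((\<lambda>t. exp (sqrt c * t)) has_real_derivative exp (sqrt c * t) * sqrt c) (at t)"
        by (auto intro!: derivative_eq_intros)
      from that have "0 < t" by simp
      from DERIV_mult[OF dy[OF this] e] have "((\<lambda>t. y t * exp (sqrt c * t)) has_real_derivative 0) (at t)" by simp
      then show ?thesis by (rule has_field_derivative_at_within)
    qed
    then have "\<exists>C. \<forall>t\<in>{0<..}. y t * exp (sqrt c * t) = C"
      by (intro has_field_derivative_zero_constant) auto
    then obtain C where C: "\<And>t. 0 < t \<Longrightarrow> y t * exp (sqrt c * t) = C" by auto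
    \<comment> \<open>The constant is evaluated by approaching time 0 along \<open>T n\<close> under
      dominated convergence.\<close>
    define T where "T n = 1 / real (Suc n)" for n
    have T: "0 < T n" "T \<longlonglongrightarrow> 0" for n unfolding T_def using LIMSEQ_inverse_real_of_nat by (auto simp: inverse_eq_divide)
    have "(\<lambda>n. \<integral>u. ?h (T n) u \<partial>lborel) \<longlonglongrightarrow> (\<integral>u. indicator {0<..} u * (exp (- u) / sqrt u) \<partial>(lborel :: real measure))"
    proof (rule integral_dominated_convergence[where w = "\<lambda>u. indicator {0<..} u * (exp (- u) / sqrt u)"])
      show "integrable lborel (\<lambda>u::real. indicator {0<..} u * (exp (- u) / sqrt u))"
        using Gamma_half_integral(1) by (simp add: set_integrable_def)
      show "AE u in lborel. norm (?h (T n) u) \<le> indicator {0<..} u * (exp (- u) / sqrt u)" for n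
        using c by (intro AE_I2) (auto simp: indicator_def mult_le_cancel_left1 divide_le_eq intro!: mult_left_le)
      show "AE u in lborel. (\<lambda>n. ?h (T n) u) \<longlonglongrightarrow> indicator {0<..} u * (exp (- u) / sqrt u)"
      proof (rule AE_I2)
        fix u :: real
        have "(\<lambda>n. ?h (T n) u) \<longlonglongrightarrow> indicator {0<..} u * (exp (- u) / sqrt u * exp (- (c * (0\<^sup>2 / (4 * u)))))"
        proof (cases "0 < u")
          case True
          then show ?thesis by (intro tendsto_intros T) auto
        qed simp
        then show "(\<lambda>n. ?h (T n) u) \<longlonglongrightarrow> indicator {0<..} u * (exp (- u) / sqrt u)" by simp
      qed
    qed measurable
    then have "(\<lambda>n. 1 / sqrt pi * (\<integral>u. ?h (T n) u \<partial>lborel) * exp (sqrt c * T n)) \<longlonglongrightarrow> 1 / sqrt pi * sqrt pi * exp (sqrt c * 0)"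
      using Gamma_half_integral(2) by (intro tendsto_intros T) (simp add: set_lebesgue_integral_def)
    moreover have "1 / sqrt pi * (\<integral>u. ?h (T n) u \<partial>lborel) * exp (sqrt c * T n) = C" for n
      using C[OF T(1)[of n]] y[OF T(1)[of n]] by (simp add: set_lebesgue_integral_def)
    ultimately have "C = 1" by (simp add: LIMSEQ_const_iff)
    then have "y t * exp (sqrt c * t) = 1" using C[OF t] by simp
    then have "y t = exp (- (sqrt c * t))" by (simp add: exp_minus field_simps)
    then show ?thesis by (simp add: y_def)
  qed
qed

lemma heat_int_exp_Suc:
  assumes c: "0 \<le> c" and t: "0 < t"
  shows "heat_int (Suc m) (\<lambda>r. exp (- (c * r))) t = - ((- sqrt c) ^ m * exp (- (sqrt c * t)))"
  using t
proof (induction m arbitrary: t)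
  case 0 then show ?case using heat_int_exp[OF c] by simp
next
  case (Suc m)
  have "(heat_int (Suc m) (\<lambda>r. exp (- (c * r))) has_real_derivative heat_int (Suc (Suc m)) (\<lambda>r. exp (- (c * r))) t) (at t)"
    by (intro DERIV_heat_int_Suc admissible_exp c Suc.prems)
  moreover have "((\<lambda>t. - ((- sqrt c) ^ m * exp (- (sqrt c * t)))) has_real_derivative - ((- sqrt c) ^ Suc m * exp (- (sqrt c * t)))) (at t)"
    by (auto intro!: derivative_eq_intros)
  then have "(heat_int (Suc m) (\<lambda>r. exp (- (c * r))) has_real_derivative - ((- sqrt c) ^ Suc m * exp (- (sqrt c * t)))) (at t)"
    by (rule has_field_derivative_transform_within_open[where S = "{0<..}"]) (use Suc in auto)
  ultimately show ?case by (rule DERIV_unique)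
qed

text \<open>The integral formula for the \<open>m\<close>-th time derivative of the Poisson
  semigroup. One heat derivative more than \<open>m\<close> appears because the subordination
  density is already the first. For \<open>f\<close> in L^p it agrees with the iterated
  \<open>deriv\<close> off a null set of points.\<close>

definition poisson_deriv :: "nat \<Rightarrow> real \<Rightarrow> (real ^ 'd \<Rightarrow> real) \<Rightarrow> real ^ 'd \<Rightarrow> real" where
  "poisson_deriv m t f x = - heat_int (Suc m) (\<lambda>r. ou_semigroup r f x) t"

lemma measurable_poisson_deriv [measurable]:
  assumes [measurable]: "f \<in> borel_measurable borel"
  shows "(\<lambda>(t, x). poisson_deriv m t f x) \<in> borel_measurable (borel \<Otimes>\<^sub>M borel)"
  unfolding poisson_deriv_def heat_int_def by measurable

lemma admissible_ou:
  assumes [measurable]: "f \<in> borel_measurable borel" and fin: "avg_op 1 (\<lambda>y. ennreal \<bar>f y\<bar>) x < top"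
  shows "admissible (\<lambda>r. ou_semigroup r f x)"
  unfolding admissible_def
proof
  have "(\<integral>\<^sup>+r. indicator {0<..} r * ennreal (avg_weight 1 r) * ennreal \<bar>ou_semigroup r f x\<bar> \<partial>lborel) \<le> avg_op 1 (\<lambda>y. ennreal \<bar>f y\<bar>) x"
    unfolding avg_op_def by (intro nn_integral_mono mult_left_mono abs_ou_semigroup_le) auto
  with fin show "(\<integral>\<^sup>+r. indicator {0<..} r * ennreal (avg_weight 1 r) * ennreal \<bar>ou_semigroup r f x\<bar> \<partial>lborel) < top"
    by (rule le_less_trans[rotated])
qed measurable

text \<open>Finiteness at time 1 makes \<open>ou_semigroup r f x\<close> admissible as a function of
  \<open>r\<close>; the formula can then be differentiated at every \<open>t > 0\<close> to every
  order.\<close>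

lemma higher_deriv_poisson:
  assumes [measurable]: "f \<in> borel_measurable borel" and fin: "avg_op 1 (\<lambda>y. ennreal \<bar>f y\<bar>) x < top" and t: "0 < t"
  shows "(deriv ^^ m) (\<lambda>s. poisson_hermite s f x) t = poisson_deriv m t f x"
  using t
proof (induction m arbitrary: t)
  case 0
  have "poisson_hermite t f x = - heat_int 1 (\<lambda>r. ou_semigroup r f x) t"
    unfolding poisson_hermite_def using 0 integrable_heat_deriv[OF admissible_ou[OF assms(1,2)] 0, of 0]
    by (simp only: less_irrefl if_False less_imp_neq[THEN not_sym])
       (intro subordination_substitution, auto)
  then show ?case by (simp add: poisson_deriv_def)
next
  case (Suc m)
  have "((\<lambda>t. poisson_deriv m t f x) has_real_derivative poisson_deriv (Suc m) t f x) (at t)"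
    unfolding poisson_deriv_def by (intro DERIV_minus DERIV_heat_int_Suc admissible_ou Suc.prems fin) measurable
  then have "((deriv ^^ m) (\<lambda>s. poisson_hermite s f x) has_real_derivative poisson_deriv (Suc m) t f x) (at t)"
    by (rule has_field_derivative_transform_within_open[where S = "{0<..}"]) (use Suc in auto)
  then show ?case by (simp add: DERIV_imp_deriv)
qed

text \<open>The kernel bound, integrated. It holds at every point, because a divergent Bochner
  integral is 0.\<close>

lemma poisson_deriv_bound:
  obtains C where "0 \<le> C"
    "\<And>t (f :: real ^ 'd \<Rightarrow> real) x. 0 < t \<Longrightarrow> f \<in> borel_measurable borel \<Longrightarrow>
       ennreal \<bar>poisson_deriv m t f x\<bar> \<le> ennreal (C / t ^ m) * avg_op t (\<lambda>y. ennreal \<bar>f y\<bar>) x"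
proof -
  obtain C where C: "0 \<le> C" "\<And>t r. 0 < t \<Longrightarrow> 0 < r \<Longrightarrow> \<bar>heat_deriv (Suc m) t r\<bar> \<le> C / t ^ m * avg_weight t r"
    using heat_deriv_bound by blast
  have "ennreal \<bar>poisson_deriv m t f x\<bar> \<le> ennreal (C / t ^ m) * avg_op t (\<lambda>y. ennreal \<bar>f y\<bar>) x"
    if t: "0 < t" and [measurable]: "f \<in> borel_measurable borel" for t x and f :: "real ^ 'd \<Rightarrow> real"
  proof -
    let ?g = "\<lambda>r. indicator {0<..} r * (heat_deriv (Suc m) t r * ou_semigroup r f x)"
    have "ennreal \<bar>poisson_deriv m t f x\<bar> \<le> (\<integral>\<^sup>+r. ennreal \<bar>?g r\<bar> \<partial>lborel)"
    proof (cases "integrable lborel ?g")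
      case True
      from integral_norm_bound_ennreal[OF this] show ?thesis by (simp add: poisson_deriv_def heat_int_def)
    qed (simp add: poisson_deriv_def heat_int_def not_integrable_integral_eq)
    also have "\<dots> \<le> (\<integral>\<^sup>+r. ennreal (C / t ^ m) * (indicator {0<..} r * ennreal (avg_weight t r) * nnT r (\<lambda>y. ennreal \<bar>f y\<bar>) x) \<partial>lborel)"
    proof (rule nn_integral_mono)
      fix r :: real
      show "ennreal \<bar>?g r\<bar> \<le> ennreal (C / t ^ m) * (indicator {0<..} r * ennreal (avg_weight t r) * nnT r (\<lambda>y. ennreal \<bar>f y\<bar>) x)"
      proof (cases "0 < r")
        case True
        have "ennreal \<bar>?g r\<bar> = ennreal \<bar>heat_deriv (Suc m) t r\<bar> * ennreal \<bar>ou_semigroup r f x\<bar>"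
          using True by (simp add: abs_mult ennreal_mult)
        also have "\<dots> \<le> ennreal (C / t ^ m * avg_weight t r) * nnT r (\<lambda>y. ennreal \<bar>f y\<bar>) x"
          using C(2)[OF t True] by (intro mult_mono ennreal_leI abs_ou_semigroup_le) auto
        also have "\<dots> = ennreal (C / t ^ m) * (indicator {0<..} r * ennreal (avg_weight t r) * nnT r (\<lambda>y. ennreal \<bar>f y\<bar>) x)"
          using True t C(1) by (subst ennreal_mult) (auto simp: avg_weight_nonneg mult.assoc)
        finally show ?thesis .
      qed simp
    qed
    also have "\<dots> = ennreal (C / t ^ m) * avg_op t (\<lambda>y. ennreal \<bar>f y\<bar>) x"
      unfolding avg_op_def by (rule nn_integral_cmult) measurable
    finally show ?thesis .
  qed
  with C(1) show ?thesis using that by blast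
qed

lemma poisson_deriv_lincomb:
  assumes [measurable]: "f \<in> borel_measurable borel" "g \<in> borel_measurable borel"
    and fin: "avg_op 1 (\<lambda>y. ennreal \<bar>f y\<bar>) x < top" "avg_op 1 (\<lambda>y. ennreal \<bar>g y\<bar>) x < top" and t: "0 < t"
  shows "poisson_deriv m t (\<lambda>y. a * f y + b * g y) x = a * poisson_deriv m t f x + b * poisson_deriv m t g x"
proof -
  \<comment> \<open>Finiteness of \<open>avg_op\<close> at \<open>x\<close> makes
    \<open>nnT r\<close> finite for almost every \<open>r\<close> only, which is enough under the
    integral.\<close>
  have AE: "AE r in lborel. 0 < r \<longrightarrow> nnT r (\<lambda>y. ennreal \<bar>h y\<bar>) x < top"
    if [measurable]: "h \<in> borel_measurable borel" and "avg_op 1 (\<lambda>y. ennreal \<bar>h y\<bar>) x < top" for h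
  proof -
    have "AE r in lborel. indicator {0<..} r * ennreal (avg_weight 1 r) * nnT r (\<lambda>y. ennreal \<bar>h y\<bar>) x \<noteq> \<infinity>"
      using that(2) unfolding avg_op_def by (intro nn_integral_PInf_AE) auto
    then show ?thesis
    proof eventually_elim
      case (elim r)
      have "0 < avg_weight 1 r" by (simp add: avg_weight_def less_max_iff_disj)
      then show ?case using elim by (auto simp: ennreal_mult_eq_top_iff less_top)
    qed
  qed
  let ?I = "\<lambda>h r. indicator {0<..} r * (heat_deriv (Suc m) t r * ou_semigroup r h x)"
  have "(\<integral>r. ?I (\<lambda>y. a * f y + b * g y) r \<partial>lborel) = (\<integral>r. a * ?I f r + b * ?I g r \<partial>lborel)"
  proof (rule integral_cong_AE)
    show "AE r in lborel. ?I (\<lambda>y. a * f y + b * g y) r = a * ?I f r + b * ?I g r"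
      using AE[OF assms(1) fin(1)] AE[OF assms(2) fin(2)]
    proof eventually_elim
      case (elim r)
      then show ?case by (cases "0 < r") (auto simp: ou_semigroup_lincomb algebra_simps)
    qed
  qed measurable
  also have "\<dots> = a * (\<integral>r. ?I f r \<partial>lborel) + b * (\<integral>r. ?I g r \<partial>lborel)"
    using integrable_heat_deriv[OF admissible_ou[OF assms(1) fin(1)] t] integrable_heat_deriv[OF admissible_ou[OF assms(2) fin(2)] t]
    by simp
  finally show ?thesis by (simp add: poisson_deriv_def heat_int_def)
qed

section \<open>Hermite polynomials as eigenfunctions\<close>

lemma integral_lborel_prod:
  fixes f :: "'a::euclidean_space \<Rightarrow> real \<Rightarrow> real"
  assumes int: "\<And>b. b \<in> Basis \<Longrightarrow> integrable lborel (f b)"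
  shows "(\<integral>x. (\<Prod>b\<in>Basis. f b (x \<bullet> b)) \<partial>lborel) = (\<Prod>b\<in>Basis. \<integral>y. f b y \<partial>lborel)"
proof -
  interpret product_sigma_finite "\<lambda>_::'a. lborel :: real measure" ..
  have [measurable]: "f b \<in> borel_measurable borel" if "b \<in> Basis" for b
    using borel_measurable_integrable[OF int[OF that]] by simp
  have "(\<integral>x. (\<Prod>b\<in>Basis. f b (x \<bullet> b)) \<partial>(lborel :: 'a measure)) =
    (\<integral>g. (\<Prod>b\<in>Basis. f b ((\<Sum>c\<in>Basis. g c *\<^sub>R c) \<bullet> b)) \<partial>(\<Pi>\<^sub>M b\<in>(Basis :: 'a set). lborel))"
    by (subst lborel_eq, subst integral_distr) auto
  also have "\<dots> = (\<integral>g. (\<Prod>b\<in>Basis. f b (g b)) \<partial>(\<Pi>\<^sub>M b\<in>(Basis :: 'a set). lborel))"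
    by simp
  also have "\<dots> = (\<Prod>b\<in>Basis. \<integral>y. f b y \<partial>lborel)"
    by (rule product_integral_prod) (auto intro: int)
  finally show ?thesis .
qed

lemma integral_lborel_prod_vec:
  fixes f :: "'d::finite \<Rightarrow> real \<Rightarrow> real"
  assumes int: "\<And>i. integrable lborel (f i)"
  shows "(\<integral>x. (\<Prod>i\<in>UNIV. f i (x $ i)) \<partial>(lborel :: (real ^ 'd) measure)) = (\<Prod>i\<in>UNIV. \<integral>y. f i y \<partial>lborel)"
proof -
  define e :: "'d \<Rightarrow> real ^ 'd" where "e i = axis i 1" for i
  have inj: "inj e" by (auto simp: inj_def e_def axis_eq_axis)
  have B: "(Basis :: (real ^ 'd) set) = e ` UNIV" by (auto simp: Basis_vec_def e_def)
  have xe: "x \<bullet> e i = x $ i" for x i by (simp add: e_def inner_axis)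
  have reindex: "(\<Prod>b\<in>Basis. g (inv e b) b) = (\<Prod>i\<in>UNIV. g i (e i))" for g :: "'d \<Rightarrow> real ^ 'd \<Rightarrow> real"
    unfolding B by (subst prod.reindex[OF inj]) (simp add: inj)
  have "(\<integral>x. (\<Prod>b\<in>Basis. f (inv e b) (x \<bullet> b)) \<partial>(lborel :: (real ^ 'd) measure)) = (\<Prod>b\<in>Basis. \<integral>y. f (inv e b) y \<partial>lborel)"
    by (rule integral_lborel_prod) (rule int)
  then show ?thesis
    using reindex[of "\<lambda>i b. \<integral>y. f i y \<partial>lborel"] reindex[of "\<lambda>i b. f i (_ \<bullet> b)"] by (simp add: xe)
qed

section \<open>Polynomials against the one-dimensional Gaussian\<close>

lemma integrable_exp_half_square: "integrable lborel (\<lambda>u::real. exp (- (u\<^sup>2) / 2))"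
proof -
  have "integrable lborel (\<lambda>u::real. sqrt (2 * pi) * normal_density 0 1 u)" by simp
  then show ?thesis by (simp add: normal_density_def)
qed

lemma integrable_poly_gauss: "integrable lborel (\<lambda>u::real. exp (- (u\<^sup>2)) * poly p u)"
proof -
  obtain C where C: "0 \<le> C" "\<And>y. \<bar>poly p y\<bar> \<le> C * exp (1 / 2 * y\<^sup>2)" using poly_le_exp_square[of "1/2" p] by auto
  show ?thesis
  proof (rule Bochner_Integration.integrable_bound)
    show "integrable lborel (\<lambda>u::real. C * exp (- (u\<^sup>2) / 2))" by (intro integrable_mult_right integrable_exp_half_square)
    show "AE u in lborel. norm (exp (- (u\<^sup>2)) * poly p u) \<le> norm (C * exp (- (u\<^sup>2) / 2))"
    proof (rule AE_I2)
      fix u :: real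
      have "exp (- (u\<^sup>2)) * \<bar>poly p u\<bar> \<le> exp (- (u\<^sup>2)) * (C * exp (1 / 2 * u\<^sup>2))" by (intro mult_left_mono C) simp
      also have "\<dots> = C * (exp (- (u\<^sup>2)) * exp (1 / 2 * u\<^sup>2))" by simp
      also have "exp (- (u\<^sup>2)) * exp (1 / 2 * u\<^sup>2) = exp (- (u\<^sup>2) / 2)" unfolding exp_add[symmetric] by simp
      finally show "norm (exp (- (u\<^sup>2)) * poly p u) \<le> norm (C * exp (- (u\<^sup>2) / 2))" using C by (simp add: abs_mult)
    qed
  qed (simp, intro borel_measurable_continuous_onI continuous_intros)
qed

lemma tendsto_poly_gauss:
  assumes "filterlim (\<lambda>u. u\<^sup>2 :: real) at_top F"
  shows "((\<lambda>u::real. exp (- (u\<^sup>2)) * poly p u) \<longlongrightarrow> 0) F"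
proof -
  obtain C where C: "0 \<le> C" "\<And>y. \<bar>poly p y\<bar> \<le> C * exp (1 / 2 * y\<^sup>2)" using poly_le_exp_square[of "1/2" p] by auto
  have "((\<lambda>z::real. C * exp (- (1 / 2 * z))) \<longlongrightarrow> C * 0) at_top"
  proof -
    have "LIM z at_top. 1 / 2 * (z::real) :> at_top"
      by (rule filterlim_tendsto_pos_mult_at_top[OF tendsto_const _ filterlim_ident]) simp
    then have "LIM z at_top. - (1 / 2 * (z::real)) :> at_bot" by (simp add: filterlim_uminus_at_bot)
    from filterlim_compose[OF exp_at_bot this] show ?thesis by (intro tendsto_mult tendsto_const)
  qed
  from filterlim_compose[OF this assms] have "((\<lambda>u. C * exp (- (1 / 2 * u\<^sup>2))) \<longlongrightarrow> 0) F" by simp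
  then show ?thesis
  proof (rule Lim_null_comparison[rotated])
    show "\<forall>\<^sub>F u in F. norm (exp (- (u\<^sup>2)) * poly p u) \<le> C * exp (- (1 / 2 * u\<^sup>2))"
    proof (rule always_eventually, rule allI)
      fix u :: real
      have "exp (- (u\<^sup>2)) * \<bar>poly p u\<bar> \<le> exp (- (u\<^sup>2)) * (C * exp (1 / 2 * u\<^sup>2))" by (intro mult_left_mono C) simp
      also have "\<dots> = C * (exp (- (u\<^sup>2)) * exp (1 / 2 * u\<^sup>2))" by simp
      also have "exp (- (u\<^sup>2)) * exp (1 / 2 * u\<^sup>2) = exp (- (1 / 2 * u\<^sup>2))" unfolding exp_add[symmetric] by simp
      finally show "norm (exp (- (u\<^sup>2)) * poly p u) \<le> C * exp (- (1 / 2 * u\<^sup>2))" by (simp add: abs_mult)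
    qed
  qed
qed

definition gint :: "real poly \<Rightarrow> real" where
  "gint p = (\<integral>u. exp (- (u\<^sup>2)) * poly p u \<partial>lborel)"

lemma gint_add: "gint (p + q) = gint p + gint q"
  using integrable_poly_gauss[of p] integrable_poly_gauss[of q] by (simp add: gint_def distrib_left)

lemma gint_smult: "gint (smult c p) = c * gint p"
  unfolding gint_def by (subst integral_mult_right_zero[symmetric]) (simp add: mult_ac)

lemma gint_diff: "gint (p - q) = gint p - gint q"
  using gint_add[of p "smult (-1) q"] gint_smult[of "-1" q] by simp

lemma gint_1: "gint 1 = sqrt pi"
proof -
  have "integral\<^sup>L lborel (\<lambda>u::real. exp (- u\<^sup>2)) = sqrt pi"
    by (rule integral_eq_nn_integral[THEN trans]) (auto simp: nn_integral_exp_minus_square)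
  then show ?thesis by (simp add: gint_def)
qed

text \<open>The derivative of \<open>exp (- u^2) p\<close> is
  \<open>exp (- u^2) (p' - 2 u p)\<close>, and the boundary terms vanish.\<close>

lemma gint_by_parts: "gint ([:0, 2:] * p) = gint (pderiv p)"
proof -
  let ?F = "\<lambda>u::real. exp (- (u\<^sup>2)) * poly p u"
  let ?f = "\<lambda>u::real. exp (- (u\<^sup>2)) * poly (pderiv p - [:0, 2:] * p) u"
  have "(LBINT u=-\<infinity>..\<infinity>. ?f u) = 0 - 0"
  proof (rule interval_integral_FTC_integrable)
    show "(?F has_vector_derivative ?f u) (at u)" for u
      unfolding has_real_derivative_iff_has_vector_derivative[symmetric]
      by (auto intro!: derivative_eq_intros simp: algebra_simps)
    show "isCont ?f u" for u by (intro continuous_intros)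
    show "set_integrable lborel (einterval (-\<infinity>) \<infinity>) ?f"
      using integrable_poly_gauss[of "pderiv p - [:0, 2:] * p"] by (simp add: set_integrable_def einterval_def)
    have 1: "(?F \<longlongrightarrow> 0) at_bot"
      by (intro tendsto_poly_gauss filterlim_pow_at_bot_even[OF _ filterlim_ident]) auto
    have 2: "(?F \<longlongrightarrow> 0) at_top"
      by (intro tendsto_poly_gauss filterlim_pow_at_top[OF _ filterlim_ident]) auto
    show "((?F \<circ> real_of_ereal) \<longlongrightarrow> 0) (at_right (-\<infinity>))" "((?F \<circ> real_of_ereal) \<longlongrightarrow> 0) (at_left \<infinity>)"
      using 1 2 by (simp_all add: ereal_tendsto_simps)
  qed auto
  then have "gint (pderiv p - [:0, 2:] * p) = 0" unfolding gint_def by (simp add: interval_lebesgue_integral_def einterval_def set_lebesgue_integral_def)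
  then show ?thesis by (simp only: gint_diff)
qed

lemma pderiv_hermite_poly: "pderiv (hermite_poly (Suc n)) = smult (2 * real (Suc n)) (hermite_poly n)"
proof (induction n)
  case 0 show ?case by (simp add: pderiv_mult pderiv_pCons pderiv_1)
next
  case (Suc n)
  have "pderiv (hermite_poly (Suc (Suc n))) = [:2:] * hermite_poly (Suc n) + [:0, 2:] * pderiv (hermite_poly (Suc n)) - pderiv (pderiv (hermite_poly (Suc n)))"
  proof -
    have pd: "pderiv [:0, 2:] = [:2::real:]" by (simp add: pderiv_pCons)
    show ?thesis
      unfolding hermite_poly.simps(2)[of "Suc n"] pderiv_diff pderiv_mult pd by (simp only: add.commute mult.commute)
  qed
  also have "\<dots> = [:2:] * hermite_poly (Suc n) + smult (2 * real (Suc n)) ([:0, 2:] * hermite_poly n - pderiv (hermite_poly n))"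
    unfolding Suc pderiv_smult by (simp add: smult_diff_right mult_smult_right del: hermite_poly.simps(2) of_nat_Suc)
  also have "\<dots> = smult (2 * real (Suc (Suc n))) (hermite_poly (Suc n))"
    unfolding hermite_poly.simps(2)[symmetric] by (simp add: smult_add_left[symmetric] del: hermite_poly.simps(2))
  finally show ?case .
qed

text \<open>The one-dimensional eigenvalue identity. After the recursion and integration by parts,
  the chain rule contributes \<open>c^2\<close> and the subtracted derivative 1; as
  \<open>c^2 - 1 = - r^2\<close>, the two terms with the derivative of \<open>hermite_poly m\<close>
  merge into one with factor \<open>r^2\<close>, and the recursion reassembles at
  \<open>x\<close>.\<close>

lemma gint_hermite:
  assumes cr: "c\<^sup>2 + r\<^sup>2 = 1"
  shows "gint (pcompose (hermite_poly n) [:r * x, c:]) = sqrt pi * (r ^ n * poly (hermite_poly n) x)"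
proof (induction n rule: less_induct)
  case (less n)
  show ?case
  proof (cases n)
    case 0 then show ?thesis using gint_1 by (simp add: gint_def poly_pcompose)
  next
    case (Suc m)
    let ?H = "hermite_poly m" and ?q = "[:r * x, c:]"
    let ?G = "pcompose ?H ?q"
    \<comment> \<open>The derivative lowers the degree once more, so the induction is strong; the
      factor \<open>r^2\<close> makes up for the two missing powers of \<open>r\<close>.\<close>
    have d: "gint (pcompose (pderiv ?H) ?q) * r\<^sup>2 = sqrt pi * (r ^ Suc m * poly (pderiv ?H) x)"
    proof (cases m)
      case 0 then show ?thesis by (simp add: gint_def pderiv_1)
    next
      case (Suc k)
      then have "k < n" using \<open>n = Suc m\<close> by simp
      show ?thesis unfolding Suc pderiv_hermite_poly
        by (simp add: pcompose_smult gint_smult less.IH[OF \<open>k < n\<close>] power2_eq_square del: hermite_poly.simps of_nat_Suc)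
    qed
    have "pcompose (hermite_poly n) ?q = smult c ([:0, 2:] * ?G) + smult (2 * (r * x)) ?G - pcompose (pderiv ?H) ?q"
      unfolding Suc hermite_poly.simps pcompose_diff pcompose_mult
      by (simp add: pcompose_pCons algebra_simps)
    then have "gint (pcompose (hermite_poly n) ?q) = c * gint (pderiv ?G) + 2 * (r * x) * gint ?G - gint (pcompose (pderiv ?H) ?q)"
      by (simp only: gint_add gint_diff gint_smult gint_by_parts)
    also have "pderiv ?G = smult c (pcompose (pderiv ?H) ?q)"
      by (simp add: pderiv_pcompose pderiv_pCons)
    also have "c * gint (smult c (pcompose (pderiv ?H) ?q)) + 2 * (r * x) * gint ?G - gint (pcompose (pderiv ?H) ?q)
       = 2 * (r * x) * gint ?G - gint (pcompose (pderiv ?H) ?q) * r\<^sup>2"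
    proof -
      have "r\<^sup>2 = 1 - c * c" using cr by (simp add: power2_eq_square)
      then show ?thesis by (simp only: gint_smult) (simp add: algebra_simps)
    qed
    also have "gint ?G = sqrt pi * (r ^ m * poly ?H x)" using Suc by (intro less.IH) simp
    finally show ?thesis unfolding d Suc by (simp add: algebra_simps)
  qed
qed

text \<open>Density and polynomial both factor over the coordinates, which leaves the
  one-dimensional identity with \<open>r = exp (- t)\<close> and
  \<open>c = sqrt (1 - r^2)\<close>.\<close>

lemma ou_semigroup_hermite:
  fixes x :: "real ^ 'd"
  assumes t: "0 \<le> t"
  shows "ou_semigroup t (hermite \<nu>) x = exp (- (real (mi_abs \<nu>) * t)) * hermite \<nu> x"
proof -
  define c where "c = sqrt (1 - exp (- 2 * t))"
  define r where "r = exp (- t)"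
  have cr: "c\<^sup>2 + r\<^sup>2 = 1" using t by (simp add: c_def r_def power2_eq_square[of "exp _"] exp_add[symmetric])
  define K :: real where "K = (2 ^ mi_abs \<nu> * (\<Prod>i\<in>UNIV. fact (\<nu> i))) powr (- 1 / 2)"
  define f where "f i y = exp (- (y\<^sup>2)) * poly (pcompose (hermite_poly (\<nu> i)) [:r * x $ i, c:]) y" for i y
  have int: "integrable lborel (f i)" for i unfolding f_def by (rule integrable_poly_gauss)
  have pos: "0 < pi powr (- real CARD('d) / 2)" by simp
  have "ou_semigroup t (hermite \<nu>) x = (\<integral>u. K * (\<Prod>i\<in>UNIV. poly (hermite_poly (\<nu> i)) ((c *\<^sub>R u + r *\<^sub>R x) $ i)) \<partial>gauss_measure)"
    unfolding ou_semigroup_def hermite_eq K_def c_def r_def ..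
  also have "\<dots> = (\<integral>u. gauss_dens u *\<^sub>R (K * (\<Prod>i\<in>UNIV. poly (hermite_poly (\<nu> i)) ((c *\<^sub>R u + r *\<^sub>R x) $ i))) \<partial>lborel)"
    unfolding gauss_measure_eq by (rule integral_density)
      (auto intro!: borel_measurable_continuous_onI continuous_intros simp: gauss_dens_pos[THEN less_imp_le])
  also have "\<dots> = (\<integral>u. (pi powr (- real CARD('d) / 2) * K) * (\<Prod>i\<in>UNIV. f i (u $ i)) \<partial>lborel)"
  proof (rule Bochner_Integration.integral_cong[OF refl])
    fix u :: "real ^ 'd"
    have "(norm u)\<^sup>2 = (\<Sum>i\<in>UNIV. (u $ i)\<^sup>2)" unfolding power2_norm_eq_inner by (simp add: inner_vec_def power2_eq_square)
    then have "exp (- (norm u)\<^sup>2) = (\<Prod>i\<in>UNIV. exp (- ((u $ i)\<^sup>2)))" by (simp add: exp_sum[symmetric] sum_negf)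
    then have "gauss_dens u = pi powr (- real CARD('d) / 2) * (\<Prod>i\<in>UNIV. exp (- ((u $ i)\<^sup>2)))" by (simp add: gauss_dens_def)
    moreover have "(\<Prod>i\<in>UNIV. f i (u $ i)) = (\<Prod>i\<in>UNIV. exp (- ((u $ i)\<^sup>2))) * (\<Prod>i\<in>UNIV. poly (hermite_poly (\<nu> i)) ((c *\<^sub>R u + r *\<^sub>R x) $ i))"
      unfolding f_def prod.distrib by (simp add: poly_pcompose algebra_simps)
    ultimately show "gauss_dens u *\<^sub>R (K * (\<Prod>i\<in>UNIV. poly (hermite_poly (\<nu> i)) ((c *\<^sub>R u + r *\<^sub>R x) $ i))) =
      (pi powr (- real CARD('d) / 2) * K) * (\<Prod>i\<in>UNIV. f i (u $ i))" by simp
  qed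
  also have "\<dots> = (pi powr (- real CARD('d) / 2) * K) * (\<Prod>i\<in>UNIV. \<integral>y. f i y \<partial>lborel)"
    by (simp add: integral_lborel_prod_vec[OF int])
  also have "(\<Prod>i\<in>UNIV. \<integral>y. f i y \<partial>lborel) = (\<Prod>i\<in>UNIV. sqrt pi * (r ^ \<nu> i * poly (hermite_poly (\<nu> i)) (x $ i)))"
    unfolding f_def gint_def[symmetric] gint_hermite[OF cr] ..
  also have "\<dots> = sqrt pi ^ CARD('d) * (r ^ mi_abs \<nu> * (\<Prod>i\<in>UNIV. poly (hermite_poly (\<nu> i)) (x $ i)))"
    unfolding prod.distrib mi_abs_def by (simp add: power_sum)
  also have "sqrt pi ^ CARD('d) = pi powr (real CARD('d) / 2)"
    by (simp add: powr_half_sqrt[symmetric] powr_realpow[symmetric] powr_powr)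
  also have "(pi powr (- real CARD('d) / 2) * K) * (pi powr (real CARD('d) / 2) * (r ^ mi_abs \<nu> * (\<Prod>i\<in>UNIV. poly (hermite_poly (\<nu> i)) (x $ i))))
     = r ^ mi_abs \<nu> * hermite \<nu> x"
    unfolding hermite_eq K_def[symmetric] using pos by (simp add: powr_minus field_simps)
  also have "r ^ mi_abs \<nu> = exp (- (real (mi_abs \<nu>) * t))"
    by (simp add: r_def exp_of_nat_mult[symmetric])
  finally show ?thesis .
qed

section \<open>Density of the Hermite polynomials\<close>

definition lp_int :: "real \<Rightarrow> (real ^ 'd \<Rightarrow> ennreal) \<Rightarrow> ennreal" where
  "lp_int p G = (\<integral>\<^sup>+x. epowr (G x) p \<partial>gauss_measure)"

abbreviation absf :: "(real ^ 'd \<Rightarrow> real) \<Rightarrow> real ^ 'd \<Rightarrow> ennreal" where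
  "absf f \<equiv> (\<lambda>x. ennreal \<bar>f x\<bar>)"

lemma gLp_norm_eq: "gLp_norm p G = epowr (lp_int p G) (1 / p)"
  by (simp add: gLp_norm_def lp_int_def)

lemma gLp_iff: "f \<in> gLp p \<longleftrightarrow> f \<in> borel_measurable borel \<and> lp_int p (absf f) < top"
  by (simp add: gLp_def gLp_norm_eq)

lemma gLp_measurable: "f \<in> gLp p \<Longrightarrow> f \<in> borel_measurable borel"
  by (simp add: gLp_iff)

lemma gLp_norm_le_iff:
  assumes p: "0 < p" and C: "0 \<le> C"
  shows "gLp_norm p F \<le> ennreal C * gLp_norm p G \<longleftrightarrow> lp_int p F \<le> ennreal (C powr p) * lp_int p G"
proof -
  have "ennreal C * gLp_norm p G = epowr (ennreal (C powr p) * lp_int p G) (1 / p)"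
    using p C by (simp add: gLp_norm_eq epowr_mult powr_powr)
  then show ?thesis unfolding gLp_norm_eq using p by (simp add: epowr_le_iff)
qed

lemma lp_int_mono: "0 < p \<Longrightarrow> (\<And>x. F x \<le> G x) \<Longrightarrow> lp_int p F \<le> lp_int p G"
  unfolding lp_int_def by (intro nn_integral_mono epowr_mono)

lemma lp_int_add_le:
  assumes [measurable]: "F \<in> borel_measurable borel" "G \<in> borel_measurable borel" and p: "0 < p"
  shows "lp_int p (\<lambda>x. F x + G x) \<le> ennreal (2 powr p) * (lp_int p F + lp_int p G)"
proof -
  have "lp_int p (\<lambda>x. F x + G x) \<le> (\<integral>\<^sup>+x. ennreal (2 powr p) * (epowr (F x) p + epowr (G x) p) \<partial>gauss_measure)"
    unfolding lp_int_def by (intro nn_integral_mono epowr_add_le p)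
  also have "\<dots> = ennreal (2 powr p) * (lp_int p F + lp_int p G)"
    unfolding lp_int_def by (simp add: nn_integral_cmult nn_integral_add)
  finally show ?thesis .
qed

lemma lp_int_cmult:
  assumes [measurable]: "F \<in> borel_measurable borel" and p: "0 < p" and c: "0 \<le> c"
  shows "lp_int p (\<lambda>x. ennreal c * F x) = ennreal (c powr p) * lp_int p F"
  unfolding lp_int_def using p c by (simp add: epowr_mult nn_integral_cmult)

lemma absf_lincomb_le: "absf (\<lambda>y. a * f y + b * g y) x \<le> ennreal \<bar>a\<bar> * absf f x + ennreal \<bar>b\<bar> * absf g x"
  by (simp add: ennreal_mult[symmetric] ennreal_plus[symmetric] abs_mult[symmetric] abs_triangle_ineq ennreal_leI del: ennreal_plus)

lemma gLp_lincomb: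
  assumes p: "0 < p" and f: "f \<in> gLp p" and g: "g \<in> gLp p"
  shows "(\<lambda>y. a * f y + b * g y) \<in> gLp p"
proof -
  have [measurable]: "f \<in> borel_measurable borel" "g \<in> borel_measurable borel" using f g by (auto simp: gLp_iff)
  have "lp_int p (absf (\<lambda>y. a * f y + b * g y)) \<le> lp_int p (\<lambda>x. ennreal \<bar>a\<bar> * absf f x + ennreal \<bar>b\<bar> * absf g x)"
    by (intro lp_int_mono p absf_lincomb_le)
  also have "\<dots> \<le> ennreal (2 powr p) * (lp_int p (\<lambda>x. ennreal \<bar>a\<bar> * absf f x) + lp_int p (\<lambda>x. ennreal \<bar>b\<bar> * absf g x))"
    by (intro lp_int_add_le p) measurable
  also have "\<dots> < top" using f g p
    by (simp add: lp_int_cmult gLp_iff ennreal_mult_less_top)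
  finally show ?thesis by (simp add: gLp_iff)
qed

lemma gLp_dominated:
  assumes p: "0 < p" and "f \<in> borel_measurable borel" and g: "g \<in> gLp p" and le: "\<And>x. \<bar>f x\<bar> \<le> \<bar>g x\<bar>"
  shows "f \<in> gLp p"
proof -
  have "lp_int p (absf f) \<le> lp_int p (absf g)" using le by (intro lp_int_mono p ennreal_leI)
  then show ?thesis using assms by (auto simp: gLp_iff)
qed

lemma gLp_imp_L1:
  assumes p: "1 \<le> p" and f: "f \<in> gLp p"
  shows "(\<integral>\<^sup>+x. absf f x \<partial>gauss_measure) < top"
proof -
  have [measurable]: "f \<in> borel_measurable borel" using f by (auto simp: gLp_iff)
  have "epowr (\<integral>\<^sup>+x. 1 * absf f x \<partial>gauss_measure) p \<le> ennreal (1 powr (p - 1)) * (\<integral>\<^sup>+x. 1 * epowr (absf f x) p \<partial>gauss_measure)"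
    by (rule Jensen_weighted) (use p in auto)
  then have "epowr (\<integral>\<^sup>+x. absf f x \<partial>gauss_measure) p \<le> lp_int p (absf f)" by (simp add: lp_int_def)
  also have "\<dots> < top" using f by (simp add: gLp_iff)
  finally show ?thesis by simp
qed

text \<open>Functions of this growth serve as L^p majorants for polynomials, exponentials and the
  Mehler kernel.\<close>

lemma exp_norm_gLp:
  assumes e: "p * e < 1" and p: "0 < p"
  shows "(\<lambda>x :: real ^ 'd. c * exp (e * (norm x)\<^sup>2)) \<in> gLp p"
proof -
  have "lp_int p (absf (\<lambda>x :: real ^ 'd. c * exp (e * (norm x)\<^sup>2))) =
    (\<integral>\<^sup>+x. ennreal (\<bar>c\<bar> powr p) * ennreal (exp (- (- (p * e)) * (norm x)\<^sup>2 + 2 * (x \<bullet> (0 :: real ^ 'd)))) \<partial>gauss_measure)"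
    unfolding lp_int_def
  proof (rule nn_integral_cong)
    fix x :: "real ^ 'd"
    have "(\<bar>c\<bar> * exp (e * (norm x)\<^sup>2)) powr p = \<bar>c\<bar> powr p * exp (p * e * (norm x)\<^sup>2)"
      by (simp add: powr_mult exp_powr_real mult_ac)
    then show "epowr (absf (\<lambda>x. c * exp (e * (norm x)\<^sup>2)) x) p =
        ennreal (\<bar>c\<bar> powr p) * ennreal (exp (- (- (p * e)) * (norm x)\<^sup>2 + 2 * (x \<bullet> (0 :: real ^ 'd))))"
      by (subst epowr_ennreal) (auto simp: abs_mult ennreal_mult[symmetric])
  qed
  also have "\<dots> < top" using e by (subst nn_integral_cmult, measurable) (subst nn_integral_gauss_exp, auto simp: ennreal_mult_less_top)
  finally show ?thesis by (simp add: gLp_iff)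
qed

lemma const_gLp: "0 < p \<Longrightarrow> (\<lambda>x. c) \<in> gLp p"
  using exp_norm_gLp[of p 0 c] by simp

lemma hermite_measurable [measurable]: "hermite \<nu> \<in> borel_measurable borel"
  unfolding hermite_eq[abs_def] by (intro borel_measurable_continuous_onI continuous_intros)

lemma hermite_bound:
  assumes e: "0 < e"
  obtains C where "0 \<le> C" "\<And>x :: real ^ 'd. \<bar>hermite \<nu> x\<bar> \<le> C * exp (e * (norm x)\<^sup>2)"
proof -
  have "\<forall>i. \<exists>C\<ge>0. \<forall>y. \<bar>poly (hermite_poly (\<nu> i)) y\<bar> \<le> C * exp (e * y\<^sup>2)" using poly_le_exp_square[OF e] by blast
  then obtain C where C: "\<And>i. 0 \<le> C i" "\<And>i y. \<bar>poly (hermite_poly (\<nu> i)) y\<bar> \<le> C i * exp (e * y\<^sup>2)" by metis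
  let ?K = "(2 ^ mi_abs \<nu> * (\<Prod>i\<in>UNIV. fact (\<nu> i))) powr (- 1 / 2) :: real"
  show ?thesis
  proof
    show "0 \<le> ?K * (\<Prod>i\<in>UNIV. C i)" by (simp add: prod_nonneg C)
    fix x :: "real ^ 'd"
    have "\<bar>hermite \<nu> x\<bar> = ?K * (\<Prod>i\<in>UNIV. \<bar>poly (hermite_poly (\<nu> i)) (x $ i)\<bar>)"
      unfolding hermite_eq by (simp add: abs_mult abs_prod)
    also have "\<dots> \<le> ?K * (\<Prod>i\<in>UNIV. C i * exp (e * (x $ i)\<^sup>2))"
      by (intro mult_left_mono prod_mono) (auto simp: C)
    also have "(\<Prod>i\<in>UNIV. C i * exp (e * (x $ i)\<^sup>2)) = (\<Prod>i\<in>UNIV. C i) * exp (e * (norm x)\<^sup>2)"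
      unfolding prod.distrib power2_norm_eq_inner by (simp add: exp_sum[symmetric] inner_vec_def sum_distrib_left power2_eq_square)
    finally show "\<bar>hermite \<nu> x\<bar> \<le> ?K * (\<Prod>i\<in>UNIV. C i) * exp (e * (norm x)\<^sup>2)" by (simp add: mult_ac)
  qed
qed

lemma hermite_gLp: assumes p: "0 < p" shows "hermite \<nu> \<in> gLp p"
proof -
  obtain C where C: "0 \<le> C" "\<And>x :: real ^ 'a. \<bar>hermite \<nu> x\<bar> \<le> C * exp (1 / (2 * p) * (norm x)\<^sup>2)"
    using hermite_bound[of "1 / (2 * p)" \<nu>] p by auto
  show ?thesis
    by (rule gLp_dominated[OF p _ exp_norm_gLp[of p "1 / (2 * p)" C]]) (use p C in auto)
qed

text \<open>Density as a closure principle: a class with these properties contains all of L^p. It is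
  instantiated with the set on which two operators agree. The inclusion climbs from polynomials
  through trigonometric functions and bounded continuous functions to indicators and simple
  functions.\<close>

locale gLp_density =
  fixes p :: real and H :: "(real ^ 'd \<Rightarrow> real) set"
  assumes p: "0 < p"
    and hermite_mem: "hermite \<nu> \<in> H"
    and lincomb_mem: "f \<in> H \<Longrightarrow> g \<in> H \<Longrightarrow> (\<lambda>x. a * f x + b * g x) \<in> H"
    and limit_mem: "(\<And>n. F n \<in> H) \<Longrightarrow> (\<And>x. (\<lambda>n. F n x) \<longlonglongrightarrow> f x) \<Longrightarrow> (\<And>n x. \<bar>F n x\<bar> \<le> G x) \<Longrightarrow> G \<in> gLp p \<Longrightarrow> f \<in> H"
begin

definition hprod :: "('d \<Rightarrow> nat) \<Rightarrow> real ^ 'd \<Rightarrow> real" where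
  "hprod \<nu> x = (\<Prod>i\<in>UNIV. poly (hermite_poly (\<nu> i)) (x $ i))"

inductive_set hspan :: "(real ^ 'd \<Rightarrow> real) set" where
  hprod: "hprod \<nu> \<in> hspan"
| lin: "f \<in> hspan \<Longrightarrow> g \<in> hspan \<Longrightarrow> (\<lambda>x. a * f x + b * g x) \<in> hspan"

lemma hprod_mem: "hprod \<nu> \<in> H"
proof -
  let ?K = "(2 ^ mi_abs \<nu> * (\<Prod>i\<in>UNIV. fact (\<nu> i))) powr (- 1 / 2) :: real"
  have "?K > 0" by (simp add: prod_pos)
  then have "hprod \<nu> = (\<lambda>x. (1 / ?K) * hermite \<nu> x + 0 * hermite \<nu> x)"
    unfolding hermite_eq hprod_def by (auto simp del: powr_gt_zero)
  then show ?thesis using lincomb_mem[OF hermite_mem[of \<nu>] hermite_mem[of \<nu>], of "1 / ?K" 0] by simp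
qed

lemma hspan_mem: "f \<in> hspan \<Longrightarrow> f \<in> H"
  by (induction rule: hspan.induct) (auto intro: hprod_mem lincomb_mem)

lemma hspan_scale: "f \<in> hspan \<Longrightarrow> (\<lambda>x. c * f x) \<in> hspan"
  using hspan.lin[of f f c 0] by simp

lemma hspan_add: "f \<in> hspan \<Longrightarrow> g \<in> hspan \<Longrightarrow> (\<lambda>x. f x + g x) \<in> hspan"
  using hspan.lin[of f g 1 1] by simp

lemma hprod_upd: "hprod (\<nu>(i := k)) x = poly (hermite_poly k) (x $ i) * (\<Prod>j\<in>UNIV - {i}. poly (hermite_poly (\<nu> j)) (x $ j))"
  unfolding hprod_def by (subst prod.remove[of UNIV i]) (auto intro!: prod.cong)

text \<open>The three-term recurrence \<open>y H_n = H_(n+1) / 2 + n H_(n-1)\<close> in one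
  coordinate; at \<open>n = 0\<close> the coefficient 0 removes the term whose index is
  truncated.\<close>

lemma hspan_coord: "f \<in> hspan \<Longrightarrow> (\<lambda>x. x $ i * f x) \<in> hspan"
proof (induction rule: hspan.induct)
  case (hprod \<nu>)
  have "(\<lambda>x. x $ i * hprod \<nu> x) = (\<lambda>x. 1 / 2 * hprod (\<nu>(i := Suc (\<nu> i))) x + real (\<nu> i) * hprod (\<nu>(i := \<nu> i - 1)) x)"
  proof
    fix x
    have "x $ i * poly (hermite_poly (\<nu> i)) (x $ i) = 1 / 2 * poly (hermite_poly (Suc (\<nu> i))) (x $ i) + real (\<nu> i) * poly (hermite_poly (\<nu> i - 1)) (x $ i)"
    proof (cases "\<nu> i")
      case 0 then show ?thesis by (simp add: pderiv_1)
    next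
      case (Suc n)
      have "poly (hermite_poly (Suc (Suc n))) y = 2 * y * poly (hermite_poly (Suc n)) y - 2 * real (Suc n) * poly (hermite_poly n) y" for y
        unfolding hermite_poly.simps(2)[of "Suc n"] pderiv_hermite_poly by (simp del: hermite_poly.simps(2) of_nat_Suc)
      then show ?thesis unfolding Suc by (simp add: field_simps del: hermite_poly.simps(2) of_nat_Suc)
    qed
    moreover have "hprod \<nu> x = poly (hermite_poly (\<nu> i)) (x $ i) * (\<Prod>j\<in>UNIV - {i}. poly (hermite_poly (\<nu> j)) (x $ j))"
      using hprod_upd[of \<nu> i "\<nu> i" x] by simp
    ultimately show "x $ i * hprod \<nu> x = 1 / 2 * hprod (\<nu>(i := Suc (\<nu> i))) x + real (\<nu> i) * hprod (\<nu>(i := \<nu> i - 1)) x"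
      unfolding hprod_upd by (simp only: mult.assoc[symmetric]) (simp only: distrib_right)
  qed
  then show ?case by (simp only:) (intro hspan.intros)
next
  case (lin f g a b)
  then show ?case using hspan.lin[OF lin.IH(1) lin.IH(2), of a b] by (simp add: algebra_simps)
qed

lemma hspan_one: "(\<lambda>x. 1) \<in> hspan"
proof -
  have "hprod (\<lambda>_. 0) = (\<lambda>x. 1)" by (auto simp: hprod_def)
  then show ?thesis using hspan.hprod[of "\<lambda>_. 0"] by simp
qed

lemma hspan_inner: assumes f: "f \<in> hspan" shows "(\<lambda>x. (a \<bullet> x) * f x) \<in> hspan"
proof -
  have "(\<lambda>x. (\<Sum>i\<in>S. a $ i * (x $ i * f x))) \<in> hspan" if "finite S" for S
    using that
  proof (induction S)
    case empty then show ?case using hspan_scale[OF hspan_one, of 0] by simp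
  next
    case (insert i S)
    then show ?case using hspan_add[OF hspan_scale[OF hspan_coord[OF f], of "a $ i" i] insert.IH] by simp
  qed
  from this[of UNIV] show ?thesis by (simp add: inner_vec_def sum_distrib_right mult.assoc)
qed

lemma hspan_inner_power: "(\<lambda>x. (a \<bullet> x) ^ n) \<in> hspan"
  by (induction n) (auto simp: hspan_one hspan_inner)

text \<open>\<open>|a| |x| \<le> |a|^2 / (4 e) + e |x|^2\<close>, with \<open>e = 1 / (2 p)\<close>
  so that \<open>p * e < 1\<close>.\<close>

lemma exp_inner_gLp: obtains G where "G \<in> gLp p" "\<And>x :: real ^ 'd. exp \<bar>a \<bullet> x\<bar> \<le> G x"
proof -
  let ?e = "1 / (2 * p)"
  show ?thesis
  proof
    show "(\<lambda>x :: real ^ 'd. exp ((norm a)\<^sup>2 / (4 * ?e)) * exp (?e * (norm x)\<^sup>2)) \<in> gLp p"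
      using p by (intro exp_norm_gLp) auto
    fix x :: "real ^ 'd"
    have "\<bar>a \<bullet> x\<bar> \<le> norm a * norm x" by (rule Cauchy_Schwarz_ineq2)
    also have "\<dots> \<le> (norm a)\<^sup>2 / (4 * ?e) + ?e * (norm x)\<^sup>2"
    proof -
      have "0 \<le> ?e * (norm x - norm a / (2 * ?e))\<^sup>2" using p by simp
      also have "\<dots> = ?e * (norm x)\<^sup>2 - norm a * norm x + (norm a)\<^sup>2 / (4 * ?e)"
        using p by (simp add: power2_eq_square field_simps)
      finally show ?thesis by simp
    qed
    finally show "exp \<bar>a \<bullet> x\<bar> \<le> exp ((norm a)\<^sup>2 / (4 * ?e)) * exp (?e * (norm x)\<^sup>2)"
      unfolding exp_add[symmetric] by simp
  qed
qed

text \<open>All partial sums are dominated by the exponential of \<open>|a . x|\<close>, which lies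
  below an L^p function. Here polynomials yield bounded functions, namely cosine and sine.\<close>

lemma power_series_mem:
  assumes c: "\<And>n. \<bar>c n\<bar> \<le> 1 / fact n"
  shows "(\<lambda>x. \<Sum>n. c n * (a \<bullet> x) ^ n) \<in> H"
proof -
  obtain G where G: "G \<in> gLp p" "\<And>x :: real ^ 'd. exp \<bar>a \<bullet> x\<bar> \<le> G x" by (rule exp_inner_gLp[of a]) blast
  have exps: "(\<lambda>n. \<bar>y\<bar> ^ n / fact n) sums exp \<bar>y\<bar>" for y :: real
    using exp_converges[of "\<bar>y\<bar>"] by (simp add: divide_inverse mult.commute scaleR_conv_of_real)
  have le: "\<bar>c n * y ^ n\<bar> \<le> \<bar>y\<bar> ^ n / fact n" for y :: real and n
    using mult_right_mono[OF c[of n], of "\<bar>y ^ n\<bar>"] by (simp add: abs_mult power_abs)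
  have summ: "summable (\<lambda>n. c n * y ^ n)" for y
    by (rule summable_comparison_test'[OF sums_summable[OF exps[of y]]]) (use le in auto)
  show ?thesis
  proof (rule limit_mem[where F = "\<lambda>N x. \<Sum>n<N. c n * (a \<bullet> x) ^ n"])
    show "G \<in> gLp p" by fact
    show "(\<lambda>N. \<Sum>n<N. c n * (a \<bullet> x) ^ n) \<longlonglongrightarrow> (\<Sum>n. c n * (a \<bullet> x) ^ n)" for x
      by (rule summable_LIMSEQ[OF summ])
    show "\<bar>\<Sum>n<N. c n * (a \<bullet> x) ^ n\<bar> \<le> G x" for N x
    proof -
      have "\<bar>\<Sum>n<N. c n * (a \<bullet> x) ^ n\<bar> \<le> (\<Sum>n<N. \<bar>a \<bullet> x\<bar> ^ n / fact n)"
        by (rule order_trans[OF sum_abs]) (intro sum_mono le)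
      also have "\<dots> \<le> exp \<bar>a \<bullet> x\<bar>"
        unfolding sums_unique[OF exps] by (intro sum_le_suminf sums_summable[OF exps]) auto
      finally show ?thesis using G(2)[of x] by simp
    qed
    show "(\<lambda>x. \<Sum>n<N. c n * (a \<bullet> x) ^ n) \<in> H" for N
    proof (rule hspan_mem, induction N)
      case 0 then show ?case using hspan_scale[OF hspan_one, of 0] by simp
    next
      case (Suc N) then show ?case using hspan_add[OF Suc hspan_scale[OF hspan_inner_power]] by simp
    qed
  qed
qed

lemma cos_mem: "(\<lambda>x. cos (a \<bullet> x + b)) \<in> H"
proof -
  have "(\<lambda>x. cos (a \<bullet> x)) \<in> H"
    using power_series_mem[of cos_coeff a] by (simp add: cos_def cos_coeff_def)
  moreover have "(\<lambda>x. sin (a \<bullet> x)) \<in> H"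
    using power_series_mem[of sin_coeff a] by (simp add: sin_def sin_coeff_def)
  ultimately show ?thesis
    using lincomb_mem[of "\<lambda>x. cos (a \<bullet> x)" "\<lambda>x. sin (a \<bullet> x)" "cos b" "- sin b"] by (simp add: cos_add mult.commute)
qed

text \<open>The product formula for cosines makes this span an algebra. Its elements are bounded, so
  constants serve as majorants in later limits.\<close>

inductive_set trig :: "(real ^ 'd \<Rightarrow> real) set" where
  cosine: "(\<lambda>x. cos (a \<bullet> x + b)) \<in> trig"
| lin: "f \<in> trig \<Longrightarrow> g \<in> trig \<Longrightarrow> (\<lambda>x. a * f x + b * g x) \<in> trig"

lemma trig_mem: "f \<in> trig \<Longrightarrow> f \<in> H"
  by (induction rule: trig.induct) (auto intro: cos_mem lincomb_mem)

lemma trig_const: "(\<lambda>x. c) \<in> trig"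
  using trig.lin[OF trig.cosine[of 0 0] trig.cosine[of 0 0], of c 0] by simp

lemma trig_add: "f \<in> trig \<Longrightarrow> g \<in> trig \<Longrightarrow> (\<lambda>x. f x + g x) \<in> trig"
  using trig.lin[of f g 1 1] by simp

lemma trig_cos_mult: "g \<in> trig \<Longrightarrow> (\<lambda>x. cos (a \<bullet> x + b) * g x) \<in> trig"
proof (induction rule: trig.induct)
  case (cosine c d)
  have "(\<lambda>x. cos (a \<bullet> x + b) * cos (c \<bullet> x + d)) = (\<lambda>x. 1/2 * cos ((a - c) \<bullet> x + (b - d)) + 1/2 * cos ((a + c) \<bullet> x + (b + d)))"
    by (simp add: cos_times_cos inner_diff_left inner_add_left algebra_simps add_divide_distrib)
  then show ?case by (simp only:) (intro trig.intros)
next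
  case (lin f g c d)
  then show ?case using trig.lin[OF lin.IH, of c d] by (simp add: algebra_simps)
qed

lemma trig_mult: "f \<in> trig \<Longrightarrow> g \<in> trig \<Longrightarrow> (\<lambda>x. f x * g x) \<in> trig"
proof (induction rule: trig.induct)
  case (cosine a b) then show ?case by (rule trig_cos_mult)
next
  case (lin f h c d)
  then show ?case using trig.lin[OF lin.IH, of c d] by (simp add: algebra_simps)
qed

lemma trig_bounded: "f \<in> trig \<Longrightarrow> \<exists>B. \<forall>x. \<bar>f x\<bar> \<le> B"
proof (induction rule: trig.induct)
  case (cosine a b) then show ?case by (intro exI[of _ 1]) auto
next
  case (lin f g a b)
  then obtain B C where B: "\<And>x. \<bar>f x\<bar> \<le> B" and C: "\<And>x. \<bar>g x\<bar> \<le> C" by auto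
  have "\<bar>a * f x + b * g x\<bar> \<le> \<bar>a\<bar> * B + \<bar>b\<bar> * C" for x
    by (rule order_trans[OF abs_triangle_ineq]) (auto simp: abs_mult intro!: add_mono mult_left_mono B C)
  then show ?case by blast
qed

lemma trig_continuous: "f \<in> trig \<Longrightarrow> continuous_on S f"
  by (induction rule: trig.induct) (auto intro!: continuous_intros)

lemma trig_poly: assumes g: "g \<in> trig" shows "(\<lambda>x. \<Sum>i\<le>n. c i * g x ^ i) \<in> trig"
proof -
  have pw: "(\<lambda>x. g x ^ i) \<in> trig" for i
    by (induction i) (auto simp: trig_const intro: trig_mult g)
  show ?thesis
  proof (induction n)
    case 0 show ?case using trig_const by simp
  next
    case (Suc n)
    then show ?case using trig_add[OF Suc trig_mult[OF trig_const[of "c (Suc n)"] pw[of "Suc n"]]] by simp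
  qed
qed

text \<open>Weierstrass on the bounded range of \<open>g\<close>; polynomials in \<open>g\<close>
  stay in the algebra. It makes truncations of trigonometric functions available.\<close>

lemma compose_trig_mem:
  assumes g: "g \<in> trig" and \<phi>: "continuous_on UNIV (\<phi> :: real \<Rightarrow> real)"
  shows "(\<lambda>x. \<phi> (g x)) \<in> H"
proof -
  obtain B where B: "\<And>x. \<bar>g x\<bar> \<le> B" using trig_bounded[OF g] by blast
  have cont: "continuous_on {-B..B} \<phi>" using \<phi> by (rule continuous_on_subset) simp
  have "\<exists>P. real_polynomial_function P \<and> (\<forall>y\<in>{-B..B}. \<bar>\<phi> y - P y\<bar> < 1 / real (Suc n))" for n
  proof -
    have "0 < 1 / real (Suc n)" by simp
    from Stone_Weierstrass_real_polynomial_function[OF compact_Icc cont this] show ?thesis by metis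
  qed
  then obtain P where P: "\<And>n. real_polynomial_function (P n)" "\<And>n y. y \<in> {-B..B} \<Longrightarrow> \<bar>\<phi> y - P n y\<bar> < 1 / real (Suc n)" by metis
  have gB: "g x \<in> {-B..B}" for x using B[of x] by auto
  have "bounded (\<phi> ` {-B..B})" by (intro compact_imp_bounded compact_continuous_image cont compact_Icc)
  then obtain M where "\<forall>z\<in>\<phi> ` {-B..B}. norm z \<le> M" unfolding bounded_iff by blast
  then have M: "\<bar>\<phi> y\<bar> \<le> M" if "y \<in> {-B..B}" for y using that by auto
  show ?thesis
  proof (rule limit_mem[where F = "\<lambda>n x. P n (g x)"])
    show "(\<lambda>x. M + 1) \<in> gLp p" using p by (rule const_gLp)
    show "(\<lambda>x. P n (g x)) \<in> H" for n
    proof -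
      obtain a m where "P n = (\<lambda>x. \<Sum>i\<le>m. a i * x ^ i)" using P(1)[of n] unfolding real_polynomial_function_iff_sum by auto
      then show ?thesis using trig_mem[OF trig_poly[OF g, of a m]] by simp
    qed
    show "\<bar>P n (g x)\<bar> \<le> M + 1" for n x
    proof -
      have "1 / real (Suc n) \<le> 1" by simp
      then show ?thesis using P(2)[OF gB[of x], of n] M[OF gB[of x]] by linarith
    qed
    show "(\<lambda>n. P n (g x)) \<longlonglongrightarrow> \<phi> (g x)" for x
    proof (rule LIMSEQ_I)
      fix e :: real assume "0 < e"
      then obtain N where N: "1 / real (Suc N) < e" by (metis nat_approx_posE)
      have "norm (P n (g x) - \<phi> (g x)) < e" if "N \<le> n" for n
      proof -
        have "1 / real (Suc n) \<le> 1 / real (Suc N)" using that by (intro divide_left_mono) auto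
        then show ?thesis using P(2)[OF gB[of x], of n] N by (simp add: abs_minus_commute)
      qed
      then show "\<exists>N. \<forall>n\<ge>N. norm (P n (g x) - \<phi> (g x)) < e" by blast
    qed
  qed
qed

text \<open>Stone-Weierstrass works on balls only, and outside them the approximants are
  uncontrolled. Composing with the projection \<open>\<phi>\<close> onto \<open>[-M, M]\<close>
  restores a constant majorant without increasing the distance to \<open>f\<close>.\<close>

lemma bounded_continuous_mem:
  assumes f: "continuous_on UNIV f" and M: "\<And>x. \<bar>f x\<bar> \<le> M"
  shows "f \<in> H"
proof -
  have "\<exists>g\<in>trig. \<forall>x\<in>cball 0 (real n). \<bar>f x - g x\<bar> < 1 / real (Suc n)" for n
  proof -
    interpret function_ring_on trig "cball 0 (real n)"
    proof
      fix x y :: "real ^ 'd" assume "x \<noteq> y"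
      \<comment> \<open>Then \<open>a . (x - y) = pi\<close>, and a shifted cosine takes the values
        -1 at \<open>x\<close> and 1 at \<open>y\<close>.\<close>
      define a where "a = (pi / (norm (x - y))\<^sup>2) *\<^sub>R (x - y)"
      have "a \<bullet> (x - y) = pi" unfolding a_def using \<open>x \<noteq> y\<close> by (simp add: power2_norm_eq_inner[symmetric])
      then have "cos (a \<bullet> x + - (a \<bullet> y)) = - 1" "cos (a \<bullet> y + - (a \<bullet> y)) = 1" by (auto simp: inner_diff_right)
      then show "\<exists>f\<in>trig. f x \<noteq> f y" by (intro bexI[OF _ trig.cosine[of a "- (a \<bullet> y)"]]) simp
    qed (auto intro: trig_continuous trig_add trig_mult trig_const)
    show ?thesis by (rule Stone_Weierstrass_basic) (use f in \<open>auto intro: continuous_on_subset\<close>)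
  qed
  then obtain g where g: "\<And>n. g n \<in> trig" "\<And>n x. norm x \<le> real n \<Longrightarrow> \<bar>f x - g n x\<bar> < 1 / real (Suc n)"
    by (metis mem_cball_0)
  define \<phi> where "\<phi> y = max (- M) (min M y)" for y :: real
  have "continuous_on UNIV \<phi>" unfolding \<phi>_def by (intro continuous_intros)
  have M0: "0 \<le> M" using M[of 0] by simp
  have close: "\<bar>\<phi> y - f x\<bar> \<le> \<bar>y - f x\<bar>" for x y using M[of x] unfolding \<phi>_def by linarith
  show ?thesis
  proof (rule limit_mem[where F = "\<lambda>n x. \<phi> (g n x)"])
    show "(\<lambda>x. M) \<in> gLp p" using p by (rule const_gLp)
    show "(\<lambda>x. \<phi> (g n x)) \<in> H" for n by (rule compose_trig_mem) fact+
    show "\<bar>\<phi> (g n x)\<bar> \<le> M" for n x using M0 by (auto simp: \<phi>_def)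
    show "(\<lambda>n. \<phi> (g n x)) \<longlonglongrightarrow> f x" for x
    proof (rule LIMSEQ_I)
      fix e :: real assume "0 < e"
      then obtain N where N: "1 / real (Suc N) < e" by (metis nat_approx_posE)
      obtain K where K: "norm x \<le> real K" using real_arch_simple by blast
      have "norm (\<phi> (g n x) - f x) < e" if "max N K \<le> n" for n
      proof -
        have "1 / real (Suc n) \<le> 1 / real (Suc N)" using that by (intro divide_left_mono) auto
        moreover have "norm x \<le> real n" using K that by linarith
        ultimately show ?thesis using g(2)[of x n] N close[of "g n x" x] by (simp add: abs_minus_commute)
      qed
      then show "\<exists>N. \<forall>n\<ge>N. norm (\<phi> (g n x) - f x) < e" by blast
    qed
  qed
qed

lemma indicator_open_mem:
  assumes U: "open U" shows "(indicator U :: real ^ 'd \<Rightarrow> real) \<in> H"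
proof (cases "U = UNIV")
  \<comment> \<open>The distance to an empty complement is 0 by convention, so the full space is
    treated apart.\<close>
  case True
  then show ?thesis using bounded_continuous_mem[of "\<lambda>x. 1" 1] by (simp add: indicator_def[abs_def])
next
  case False
  let ?d = "\<lambda>x. infdist x (- U)"
  show ?thesis
  proof (rule limit_mem[where F = "\<lambda>n x. min 1 (real n * ?d x)"])
    show "(\<lambda>x. 1) \<in> gLp p" using p by (rule const_gLp)
    show "(\<lambda>x. min 1 (real n * ?d x)) \<in> H" for n
    proof (rule bounded_continuous_mem[of _ 1])
      show "continuous_on UNIV (\<lambda>x. min 1 (real n * ?d x))"
        by (intro continuous_on_min continuous_on_mult continuous_on_const continuous_on_infdist continuous_on_id)
    qed (simp add: infdist_nonneg min_def)
    show "\<bar>min 1 (real n * ?d x)\<bar> \<le> 1" for n x by (simp add: infdist_nonneg min_def)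
    show "(\<lambda>n. min 1 (real n * ?d x)) \<longlonglongrightarrow> indicator U x" for x
    proof (cases "x \<in> U")
      case True
      then have "?d x \<noteq> 0" using U False in_closed_iff_infdist_zero[of "- U" x] by auto
      then have d: "0 < ?d x" using infdist_nonneg[of x "- U"] by simp
      obtain N :: nat where N: "1 / ?d x \<le> real N" using real_arch_simple by blast
      have "min 1 (real n * ?d x) = 1" if "N \<le> n" for n
      proof -
        have "1 / ?d x \<le> real n" using N that by linarith
        then have "1 \<le> real n * ?d x" using d by (simp add: field_simps)
        then show ?thesis by simp
      qed
      then have "\<forall>\<^sub>F n in sequentially. min 1 (real n * ?d x) = indicator U x"
        using True by (auto simp: eventually_sequentially)
      then show ?thesis by (rule tendsto_eventually)
    next
      case x: False
      then have "?d x = 0" by simp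
      then show ?thesis using x by simp
    qed
  qed
qed

text \<open>A pi-lambda argument from the open sets: complements are linear combinations, countable
  disjoint unions are dominated limits.\<close>

lemma indicator_mem:
  assumes "A \<in> sets borel" shows "(indicator A :: real ^ 'd \<Rightarrow> real) \<in> H"
proof -
  have "A \<in> sigma_sets UNIV {U. open U}" using assms by (simp add: borel_def)
  have "Int_stable {U :: (real ^ 'd) set. open U}" "{U :: (real ^ 'd) set. open U} \<subseteq> Pow UNIV"
    by (auto simp: Int_stable_def)
  from this \<open>A \<in> sigma_sets UNIV {U. open U}\<close> show ?thesis
  proof (induction rule: sigma_sets_induct_disjoint)
    case (basic A) then show ?case by (auto intro: indicator_open_mem)
  next
    case empty show ?case by (rule indicator_open_mem[OF open_empty])
  next
    case (compl A)
    have "indicator (UNIV - A) = (\<lambda>x. 1 * indicator UNIV x + (- 1) * (indicator A x :: real))" by (auto simp: indicator_def)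
    then show ?case using lincomb_mem[OF indicator_open_mem[of UNIV] compl(2), of 1 "-1"] by simp
  next
    case (union A)
    show ?case
    proof (rule limit_mem[where F = "\<lambda>n x. \<Sum>i<n. indicator (A i) x"])
      show "(\<lambda>x. 1) \<in> gLp p" using p by (rule const_gLp)
      have eq: "(\<Sum>i<n. indicator (A i) x :: real) = indicator (\<Union>i<n. A i) x" for n x
        using union(1) by (intro indicator_UN_disjoint[symmetric]) (auto intro: disjoint_family_on_mono)
      show "\<bar>\<Sum>i<n. indicator (A i) x :: real\<bar> \<le> 1" for n x unfolding eq by (simp add: indicator_def)
      show "(\<lambda>x. \<Sum>i<n. indicator (A i) x) \<in> H" for n
      proof (induction n)
        case 0 show ?case using trig_mem[OF trig_const[of 0]] by simp
      next
        case (Suc n) then show ?case using lincomb_mem[OF Suc union(3)[of n], of 1 1] by simp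
      qed
      show "(\<lambda>n. \<Sum>i<n. indicator (A i) x) \<longlonglongrightarrow> (indicator (\<Union>i. A i) x :: real)" for x
        unfolding eq by (rule LIMSEQ_indicator_UN)
    qed
  qed
qed

lemma gLp_mem:
  assumes f: "f \<in> gLp p" shows "f \<in> H"
proof -
  have [measurable]: "f \<in> borel_measurable borel" using f by (rule gLp_measurable)
  from borel_measurable_implies_sequence_metric[of f borel 0] obtain F where
    F: "\<And>i. simple_function borel (F i)" "\<And>x. (\<lambda>i. F i x) \<longlonglongrightarrow> f x" "\<And>i x. \<bar>F i x\<bar> \<le> 2 * \<bar>f x\<bar>"
    by (auto simp: dist_real_def)
  have simple: "g \<in> H" if g: "simple_function borel g" for g :: "real ^ 'd \<Rightarrow> real"
  proof -
    have sums: "(\<lambda>x. \<Sum>y\<in>Y. indicator (g -` {y}) x * y) \<in> H" if "finite Y" for Y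
      using that
    proof (induction Y)
      case empty show ?case using trig_mem[OF trig_const[of 0]] by simp
    next
      case (insert y Y)
      have "g -` {y} \<in> sets borel" using simple_functionD(2)[OF g, of "{y}"] by simp
      from lincomb_mem[OF indicator_mem[OF this] insert.IH, of y 1] show ?case
        unfolding sum.insert[OF insert(1,2)] mult_1_left mult.commute[of y] .
    qed
    have "finite (range g)" using simple_functionD(1)[OF g] by simp
    note sums[OF this]
    moreover have "g = (\<lambda>x. \<Sum>y\<in>range g. indicator (g -` {y}) x * y)"
    proof
      fix x show "g x = (\<Sum>y\<in>range g. indicator (g -` {y}) x * y)"
        using simple_function_indicator_representation_banach[OF g, of x]
        by (simp only: space_borel UNIV_I Int_UNIV_right real_scaleR_def)
    qed
    ultimately show ?thesis by (simp only:)
  qed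
  show ?thesis
  proof (rule limit_mem[where F = F])
    show "(\<lambda>x. 2 * \<bar>f x\<bar>) \<in> gLp p"
      by (rule gLp_dominated[OF p _ gLp_lincomb[OF p f f, of 2 0]]) auto
  qed (use F simple in auto)
qed

end

section \<open>Bounded operators on Gaussian Lebesgue spaces\<close>

text \<open>Linearity is asked almost everywhere, since operators act on representatives; the bound
  compares \<open>p\<close>-th powers of norms.\<close>

definition lp_bounded :: "real \<Rightarrow> ((real ^ 'd \<Rightarrow> real) \<Rightarrow> real ^ 'd \<Rightarrow> real) \<Rightarrow> bool" where
  "lp_bounded p J \<longleftrightarrow>
     (\<forall>f\<in>gLp p. J f \<in> gLp p) \<and>
     (\<forall>f\<in>gLp p. \<forall>g\<in>gLp p. \<forall>a b.
        AE x in gauss_measure. J (\<lambda>y. a * f y + b * g y) x = a * J f x + b * J g x) \<and>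
     (\<exists>C\<ge>0. \<forall>f\<in>gLp p. lp_int p (absf (J f)) \<le> ennreal C * lp_int p (absf f))"

lemma is_riesz_extension_iff:
  assumes p: "0 < p"
  shows "is_riesz_extension p \<beta> J \<longleftrightarrow> lp_bounded p J \<and>
     (\<forall>\<nu>. AE x in gauss_measure. J (hermite \<nu>) x =
          (if mi_abs \<nu> = 0 then 0 else real (mi_abs \<nu>) powr (- \<beta> / 2) * hermite \<nu> x))"
proof -
  have "(\<exists>C\<ge>0. \<forall>f\<in>gLp p. gLp_norm p (absf (J f)) \<le> ennreal C * gLp_norm p (absf f)) \<longleftrightarrow>
    (\<exists>C\<ge>0. \<forall>f\<in>gLp p. lp_int p (absf (J f)) \<le> ennreal C * lp_int p (absf f))"
  proof
    assume "\<exists>C\<ge>0. \<forall>f\<in>gLp p. gLp_norm p (absf (J f)) \<le> ennreal C * gLp_norm p (absf f)"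
    then obtain C where "0 \<le> C" "\<forall>f\<in>gLp p. gLp_norm p (absf (J f)) \<le> ennreal C * gLp_norm p (absf f)" by blast
    then show "\<exists>C\<ge>0. \<forall>f\<in>gLp p. lp_int p (absf (J f)) \<le> ennreal C * lp_int p (absf f)"
      using p by (intro exI[of _ "C powr p"]) (simp add: gLp_norm_le_iff)
  next
    assume "\<exists>C\<ge>0. \<forall>f\<in>gLp p. lp_int p (absf (J f)) \<le> ennreal C * lp_int p (absf f)"
    then obtain C where "0 \<le> C" "\<forall>f\<in>gLp p. lp_int p (absf (J f)) \<le> ennreal C * lp_int p (absf f)" by blast
    then show "\<exists>C\<ge>0. \<forall>f\<in>gLp p. gLp_norm p (absf (J f)) \<le> ennreal C * gLp_norm p (absf f)"
      using p by (intro exI[of _ "C powr (1 / p)"]) (simp add: gLp_norm_le_iff powr_powr)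
  qed
  then show ?thesis unfolding is_riesz_extension_def lp_bounded_def by simp
qed

lemma lp_int_eq_0: "0 < p \<Longrightarrow> f \<in> borel_measurable borel \<Longrightarrow> lp_int p (absf f) = 0 \<longleftrightarrow> (AE x in gauss_measure. f x = 0)"
  unfolding lp_int_def by (subst nn_integral_0_iff_AE) (auto simp: epowr_eq_0_iff)

lemma lp_int_cong_AE: "AE x in gauss_measure. F x = G x \<Longrightarrow> lp_int p F = lp_int p G"
  unfolding lp_int_def by (intro nn_integral_cong_AE) auto

text \<open>\<open>J\<close> may treat representatives differently, so compatibility with null sets
  is derived: the difference has norm 0, hence so has its image, and linearity splits that
  image.\<close>

lemma lp_bounded_cong:
  fixes J :: "(real ^ 'd \<Rightarrow> real) \<Rightarrow> real ^ 'd \<Rightarrow> real"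
  assumes J: "lp_bounded p J" and p: "0 < p" and f: "f \<in> gLp p" and g: "g \<in> gLp p"
    and eq: "AE x in gauss_measure. f x = g x"
  shows "AE x in gauss_measure. J f x = J g x"
proof -
  let ?d = "\<lambda>y. 1 * f y + (- 1) * g y"
  have d: "?d \<in> gLp p" by (rule gLp_lincomb[OF p f g])
  obtain C where C: "0 \<le> C" "\<forall>f\<in>gLp p. lp_int p (absf (J f)) \<le> ennreal C * lp_int p (absf f)"
    using J by (auto simp: lp_bounded_def)
  have "lp_int p (absf ?d) = 0"
    using p d eq by (subst lp_int_eq_0) (auto simp: gLp_iff)
  then have "lp_int p (absf (J ?d)) = 0" using C(2) d by (metis le_zero_eq mult_zero_right)
  moreover have "J ?d \<in> gLp p" using J d by (auto simp: lp_bounded_def)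
  ultimately have "AE x in gauss_measure. J ?d x = 0" using p lp_int_eq_0[of p "J ?d"] by (auto simp: gLp_iff)
  moreover have "AE x in gauss_measure. J ?d x = 1 * J f x + (- 1) * J g x"
    using J f g unfolding lp_bounded_def by blast
  ultimately show ?thesis by eventually_elim simp
qed

lemma lp_bounded_compose:
  fixes A B :: "(real ^ 'd \<Rightarrow> real) \<Rightarrow> real ^ 'd \<Rightarrow> real"
  assumes A: "lp_bounded p A" and B: "lp_bounded p B" and p: "0 < p"
  shows "lp_bounded p (\<lambda>f. A (B f))"
  unfolding lp_bounded_def
proof (intro conjI ballI allI)
  show "A (B f) \<in> gLp p" if "f \<in> gLp p" for f :: "real ^ 'd \<Rightarrow> real" using A B that by (auto simp: lp_bounded_def)
next
  fix f g :: "real ^ 'd \<Rightarrow> real" and a b assume f: "f \<in> gLp p" and g: "g \<in> gLp p"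
  have Bf: "B f \<in> gLp p" "B g \<in> gLp p" and "B (\<lambda>y. a * f y + b * g y) \<in> gLp p"
    using B f g gLp_lincomb[OF p f g] by (auto simp: lp_bounded_def)
  moreover have "AE x in gauss_measure. B (\<lambda>y. a * f y + b * g y) x = a * B f x + b * B g x"
    using B f g by (auto simp: lp_bounded_def)
  ultimately have "AE x in gauss_measure. A (B (\<lambda>y. a * f y + b * g y)) x = A (\<lambda>y. a * B f y + b * B g y) x"
    by (intro lp_bounded_cong[OF A p] gLp_lincomb p)
  moreover have "AE x in gauss_measure. A (\<lambda>y. a * B f y + b * B g y) x = a * A (B f) x + b * A (B g) x"
    using A Bf by (auto simp: lp_bounded_def)
  ultimately show "AE x in gauss_measure. A (B (\<lambda>y. a * f y + b * g y)) x = a * A (B f) x + b * A (B g) x"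
    by eventually_elim simp
next
  obtain C where C: "0 \<le> C" "\<forall>f\<in>gLp p. lp_int p (absf (A f)) \<le> ennreal C * lp_int p (absf f)"
    using A by (auto simp: lp_bounded_def)
  obtain D where D: "0 \<le> D" "\<forall>f\<in>gLp p. lp_int p (absf (B f)) \<le> ennreal D * lp_int p (absf f)"
    using B by (auto simp: lp_bounded_def)
  show "\<exists>C\<ge>0. \<forall>f\<in>gLp p. lp_int p (absf (A (B f))) \<le> ennreal C * lp_int p (absf f)"
  proof (intro exI[of _ "C * D"] conjI ballI)
    fix f :: "real ^ 'd \<Rightarrow> real" assume f: "f \<in> gLp p"
    then have "B f \<in> gLp p" using B by (auto simp: lp_bounded_def)
    then have "lp_int p (absf (A (B f))) \<le> ennreal C * lp_int p (absf (B f))" using C by blast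
    also have "\<dots> \<le> ennreal C * (ennreal D * lp_int p (absf f))" using D f by (intro mult_left_mono) auto
    finally show "lp_int p (absf (A (B f))) \<le> ennreal (C * D) * lp_int p (absf f)"
      using C D by (simp add: ennreal_mult mult.assoc)
  qed (use C D in auto)
qed

text \<open>The principle behind the operator identities below, which thereby reduce to eigenvalues.
  For the limit condition, \<open>A f - B f\<close> equals \<open>A (f - F n) - B (f - F n)\<close>
  almost everywhere, and its norm tends to 0 with that of \<open>f - F n\<close>.\<close>

lemma lp_bounded_unique:
  fixes A B :: "(real ^ 'd \<Rightarrow> real) \<Rightarrow> real ^ 'd \<Rightarrow> real"
  assumes A: "lp_bounded p A" and B: "lp_bounded p B" and p: "0 < p"
    and eq: "\<And>\<nu>. AE x in gauss_measure. A (hermite \<nu>) x = B (hermite \<nu>) x"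
    and f: "f \<in> gLp p"
  shows "AE x in gauss_measure. A f x = B f x"
proof -
  define H where "H = {f \<in> gLp p. AE x in gauss_measure. A f x = B f x}"
  obtain C where C: "0 \<le> C" "\<And>f. f\<in>gLp p \<Longrightarrow> lp_int p (absf (A f)) \<le> ennreal C * lp_int p (absf f)"
    using A by (auto simp: lp_bounded_def)
  obtain D where D: "0 \<le> D" "\<And>f. f\<in>gLp p \<Longrightarrow> lp_int p (absf (B f)) \<le> ennreal D * lp_int p (absf f)"
    using B by (auto simp: lp_bounded_def)
  have linA: "AE x in gauss_measure. A (\<lambda>y. a * f y + b * g y) x = a * A f x + b * A g x" if "f \<in> gLp p" "g \<in> gLp p" for f g a b
    using A that unfolding lp_bounded_def by blast
  have linB: "AE x in gauss_measure. B (\<lambda>y. a * f y + b * g y) x = a * B f x + b * B g x" if "f \<in> gLp p" "g \<in> gLp p" for f g a b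
    using B that unfolding lp_bounded_def by blast
  have mem: "A f \<in> gLp p" "B f \<in> gLp p" if "f \<in> gLp p" for f using A B that by (auto simp: lp_bounded_def)
  interpret gLp_density p H
  proof
    show "0 < p" by fact
    show "hermite \<nu> \<in> H" for \<nu> unfolding H_def using eq hermite_gLp[OF p] by auto
    show "(\<lambda>x. a * f x + b * g x) \<in> H" if "f \<in> H" "g \<in> H" for f g a b
    proof -
      have fg: "f \<in> gLp p" "g \<in> gLp p" using that by (auto simp: H_def)
      have "AE x in gauss_measure. A f x = B f x" "AE x in gauss_measure. A g x = B g x" using that by (auto simp: H_def)
      with linA[OF fg, of a b] linB[OF fg, of a b]
      have "AE x in gauss_measure. A (\<lambda>x. a * f x + b * g x) x = B (\<lambda>x. a * f x + b * g x) x" by eventually_elim simp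
      then show ?thesis using gLp_lincomb[OF p fg] by (simp add: H_def)
    qed
    fix F :: "nat \<Rightarrow> real ^ 'd \<Rightarrow> real" and f G :: "real ^ 'd \<Rightarrow> real"
    assume F: "\<And>n. F n \<in> H" and lim: "\<And>x. (\<lambda>n. F n x) \<longlonglongrightarrow> f x" and bd: "\<And>n x. \<bar>F n x\<bar> \<le> G x" and G: "G \<in> gLp p"
    have Fg: "F n \<in> gLp p" and Feq: "AE x in gauss_measure. A (F n) x = B (F n) x" for n using F by (auto simp: H_def)
    have [measurable]: "F n \<in> borel_measurable borel" "G \<in> borel_measurable borel" for n using Fg G by (auto simp: gLp_iff)
    have [measurable]: "f \<in> borel_measurable borel" by (rule borel_measurable_LIMSEQ_real[OF lim]) measurable
    have fG: "\<bar>f x\<bar> \<le> G x" for x by (rule LIMSEQ_le_const2[OF tendsto_rabs[OF lim]]) (use bd in auto)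
    have f: "f \<in> gLp p" by (rule gLp_dominated[OF p _ G]) (use fG in \<open>auto intro: order_trans[OF _ abs_ge_self]\<close>)
    let ?d = "\<lambda>n y. 1 * f y + (- 1) * F n y"
    have d: "?d n \<in> gLp p" for n by (rule gLp_lincomb[OF p f Fg])
    have d0: "(\<lambda>n. lp_int p (absf (?d n))) \<longlonglongrightarrow> lp_int p (absf (\<lambda>_ :: real ^ 'd. 0))"
      unfolding lp_int_def
    proof (rule nn_integral_dominated_convergence[where w = "\<lambda>x. epowr (absf (\<lambda>x. 2 * G x + 0 * G x) x) p"])
      show "AE x in gauss_measure. epowr (absf (?d n) x) p \<le> epowr (absf (\<lambda>x. 2 * G x + 0 * G x) x) p" for n
      proof (rule AE_I2, rule epowr_mono[OF p], rule ennreal_leI)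
        fix x show "\<bar>?d n x\<bar> \<le> \<bar>2 * G x + 0 * G x\<bar>" using fG[of x] bd[of n x] by simp
      qed
      show "(\<integral>\<^sup>+x. epowr (absf (\<lambda>x. 2 * G x + 0 * G x) x) p \<partial>gauss_measure) < \<infinity>"
        using gLp_lincomb[OF p G G, of 2 0] by (simp add: gLp_iff lp_int_def)
      show "AE x in gauss_measure. (\<lambda>n. epowr (absf (?d n) x) p) \<longlonglongrightarrow> epowr (absf (\<lambda>_ :: real ^ 'd. 0) x) p"
      proof (rule AE_I2)
        fix x
        have "(\<lambda>n. \<bar>1 * f x + (- 1) * F n x\<bar> powr p) \<longlonglongrightarrow> \<bar>1 * f x + (- 1) * f x\<bar> powr p"
          by (intro tendsto_powr' tendsto_rabs tendsto_add tendsto_mult tendsto_const lim) (use p in auto)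
        from tendsto_ennrealI[OF this] show "(\<lambda>n. epowr (absf (?d n) x) p) \<longlonglongrightarrow> epowr (absf (\<lambda>_ :: real ^ 'd. 0) x) p"
          by simp
      qed
    qed measurable
    let ?E = "\<lambda>x. 1 * A f x + (- 1) * B f x"
    have E: "?E \<in> gLp p" by (intro gLp_lincomb p mem f)
    have "lp_int p (absf ?E) \<le> ennreal (2 powr p) * ((ennreal C + ennreal D) * lp_int p (absf (?d n)))" for n
    proof -
      have [measurable]: "A (?d n) \<in> borel_measurable borel" "B (?d n) \<in> borel_measurable borel" using mem[OF d] by (auto simp: gLp_iff)
      have "AE x in gauss_measure. ?E x = A (?d n) x - B (?d n) x"
        using linA[OF f Fg, of 1 "-1" n] linB[OF f Fg, of 1 "-1" n] Feq[of n] by eventually_elim simp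
      then have "lp_int p (absf ?E) = lp_int p (absf (\<lambda>x. A (?d n) x - B (?d n) x))" by (intro lp_int_cong_AE) auto
      also have "\<dots> \<le> lp_int p (\<lambda>x. absf (A (?d n)) x + absf (B (?d n)) x)"
        by (intro lp_int_mono p) (simp add: ennreal_plus[symmetric] ennreal_leI abs_triangle_ineq4 del: ennreal_plus)
      also have "\<dots> \<le> ennreal (2 powr p) * (lp_int p (absf (A (?d n))) + lp_int p (absf (B (?d n))))"
        by (intro lp_int_add_le p) measurable
      also have "\<dots> \<le> ennreal (2 powr p) * (ennreal C * lp_int p (absf (?d n)) + ennreal D * lp_int p (absf (?d n)))"
        by (intro mult_left_mono add_mono C D d) auto
      finally show ?thesis by (simp add: distrib_right)
    qed
    moreover have "(\<lambda>n. ennreal (2 powr p) * ((ennreal C + ennreal D) * lp_int p (absf (?d n)))) \<longlonglongrightarrow> ennreal (2 powr p) * ((ennreal C + ennreal D) * lp_int p (absf (\<lambda>_ :: real ^ 'd. 0)))"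
      by (intro tendsto_mult_ennreal tendsto_const d0) (auto simp: lp_int_def)
    ultimately have "lp_int p (absf ?E) \<le> ennreal (2 powr p) * ((ennreal C + ennreal D) * lp_int p (absf (\<lambda>_ :: real ^ 'd. 0)))"
      by (intro LIMSEQ_le_const) auto
    then have "lp_int p (absf ?E) = 0" by (simp add: lp_int_def)
    then have "AE x in gauss_measure. ?E x = 0" using lp_int_eq_0[OF p gLp_measurable[OF E]] by simp
    then have "AE x in gauss_measure. A f x = B f x" by eventually_elim simp
    then show "f \<in> H" using f by (simp add: H_def)
  qed
  show ?thesis using gLp_mem[OF f] by (simp add: H_def)
qed

text \<open>With a bound \<open>L\<close> uniform in \<open>s\<close>, Jensen and Fubini give the
  same constant as Minkowski's integral inequality.\<close>

lemma Minkowski_weighted: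
  fixes K :: "'s \<Rightarrow> real ^ 'd \<Rightarrow> ennreal"
  assumes M: "sigma_finite_measure M" and p: "1 \<le> p" and k: "0 < k"
    and [measurable]: "w \<in> borel_measurable M" "(\<lambda>(s, x). K s x) \<in> borel_measurable (M \<Otimes>\<^sub>M borel)"
    and w: "(\<integral>\<^sup>+s. w s \<partial>M) \<le> ennreal k" and L: "\<And>s. s \<in> space M \<Longrightarrow> lp_int p (K s) \<le> L"
  shows "lp_int p (\<lambda>x. \<integral>\<^sup>+s. w s * K s x \<partial>M) \<le> ennreal (k powr p) * L"
proof -
  interpret M: sigma_finite_measure M by fact
  interpret P: pair_sigma_finite M "gauss_measure :: (real ^ 'd) measure" ..
  interpret P': pair_sigma_finite "gauss_measure :: (real ^ 'd) measure" M ..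
  have "lp_int p (\<lambda>x. \<integral>\<^sup>+s. w s * K s x \<partial>M) \<le> (\<integral>\<^sup>+x. ennreal (k powr (p - 1)) * (\<integral>\<^sup>+s. w s * epowr (K s x) p \<partial>M) \<partial>gauss_measure)"
    unfolding lp_int_def by (intro nn_integral_mono Jensen_weighted p k w) auto
  also have "\<dots> = ennreal (k powr (p - 1)) * (\<integral>\<^sup>+x. \<integral>\<^sup>+s. w s * epowr (K s x) p \<partial>M \<partial>gauss_measure)"
    by (rule nn_integral_cmult) measurable
  also have "(\<integral>\<^sup>+x. \<integral>\<^sup>+s. w s * epowr (K s x) p \<partial>M \<partial>gauss_measure) = (\<integral>\<^sup>+s. \<integral>\<^sup>+x. w s * epowr (K s x) p \<partial>gauss_measure \<partial>M)"
    by (rule P'.Fubini'[symmetric]) measurable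
  also have "\<dots> = (\<integral>\<^sup>+s. w s * lp_int p (K s) \<partial>M)"
    unfolding lp_int_def by (intro nn_integral_cong nn_integral_cmult) auto
  also have "ennreal (k powr (p - 1)) * (\<integral>\<^sup>+s. w s * lp_int p (K s) \<partial>M) \<le> ennreal (k powr (p - 1)) * (\<integral>\<^sup>+s. w s * L \<partial>M)"
    by (intro mult_left_mono nn_integral_mono L) auto
  also have "(\<integral>\<^sup>+s. w s * L \<partial>M) = (\<integral>\<^sup>+s. w s \<partial>M) * L" by (rule nn_integral_multc) measurable
  also have "ennreal (k powr (p - 1)) * ((\<integral>\<^sup>+s. w s \<partial>M) * L) \<le> ennreal (k powr (p - 1)) * (ennreal k * L)"
    by (intro mult_left_mono mult_right_mono w) auto
  also have "\<dots> = ennreal (k powr p) * L"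
    using k by (simp add: mult.assoc[symmetric] ennreal_mult[symmetric] powr_diff)
  finally show ?thesis .
qed

text \<open>The bound on the absolute integral makes \<open>Q s f x\<close> integrable in
  \<open>s\<close> for almost every \<open>x\<close>. Fubini turns linearity off an
  \<open>s\<close>-dependent null set into linearity for almost every \<open>s\<close> at almost
  every \<open>x\<close>, which can be integrated.\<close>

lemma lp_bounded_integral:
  fixes Q :: "'s \<Rightarrow> (real ^ 'd \<Rightarrow> real) \<Rightarrow> real ^ 'd \<Rightarrow> real"
  assumes M: "sigma_finite_measure M" and p: "0 < p" and C: "0 \<le> C"
    and meas: "\<And>f. f \<in> gLp p \<Longrightarrow> (\<lambda>(s, x). Q s f x) \<in> borel_measurable (M \<Otimes>\<^sub>M borel)"
    and lin: "\<And>f g a b s. f \<in> gLp p \<Longrightarrow> g \<in> gLp p \<Longrightarrow> s \<in> space M \<Longrightarrow>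
       AE x in gauss_measure. Q s (\<lambda>y. a * f y + b * g y) x = a * Q s f x + b * Q s g x"
    and bd: "\<And>f. f \<in> gLp p \<Longrightarrow> lp_int p (\<lambda>x. \<integral>\<^sup>+s. ennreal \<bar>Q s f x\<bar> \<partial>M) \<le> ennreal C * lp_int p (absf f)"
  shows "lp_bounded p (\<lambda>f x. \<integral>s. Q s f x \<partial>M)"
proof -
  interpret M: sigma_finite_measure M by fact
  interpret P: pair_sigma_finite M "gauss_measure :: (real ^ 'd) measure" ..
  have le: "absf (\<lambda>x. \<integral>s. Q s f x \<partial>M) x \<le> (\<integral>\<^sup>+s. ennreal \<bar>Q s f x\<bar> \<partial>M)" for f x
  proof (cases "integrable M (\<lambda>s. Q s f x)")
    case True from integral_norm_bound_ennreal[OF this] show ?thesis by simp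
  qed (simp add: not_integrable_integral_eq)
  have bound: "lp_int p (absf (\<lambda>x. \<integral>s. Q s f x \<partial>M)) \<le> ennreal C * lp_int p (absf f)" if "f \<in> gLp p" for f
    using lp_int_mono[OF p le] bd[OF that] by (rule order_trans)
  have int: "AE x in gauss_measure. integrable M (\<lambda>s. Q s f x)" if f: "f \<in> gLp p" for f :: "real ^ 'd \<Rightarrow> real"
  proof -
    note meas[OF f, measurable]
    have "lp_int p (\<lambda>x. \<integral>\<^sup>+s. ennreal \<bar>Q s f x\<bar> \<partial>M) < top"
      using bd[OF f] f by (auto simp: gLp_iff ennreal_mult_less_top intro: le_less_trans)
    then have "AE x in gauss_measure. epowr (\<integral>\<^sup>+s. ennreal \<bar>Q s f x\<bar> \<partial>M) p \<noteq> \<infinity>"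
      unfolding lp_int_def by (intro nn_integral_PInf_AE) auto
    then show ?thesis
      by eventually_elim (auto intro!: integrableI_bounded simp: less_top)
  qed
  show ?thesis
    unfolding lp_bounded_def
  proof (intro conjI ballI allI)
    fix f :: "real ^ 'd \<Rightarrow> real" assume f: "f \<in> gLp p"
    note meas[OF f, measurable]
    have "(\<lambda>x. \<integral>s. Q s f x \<partial>M) \<in> borel_measurable borel" by measurable
    then show "(\<lambda>x. \<integral>s. Q s f x \<partial>M) \<in> gLp p"
      using bound[OF f] f by (auto simp: gLp_iff ennreal_mult_less_top intro: le_less_trans)
  next
    fix f g :: "real ^ 'd \<Rightarrow> real" and a b assume f: "f \<in> gLp p" and g: "g \<in> gLp p"
    have h: "(\<lambda>y. a * f y + b * g y) \<in> gLp p" by (rule gLp_lincomb[OF p f g])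
    note meas[OF f, measurable] meas[OF g, measurable] meas[OF h, measurable]
    have "AE s in M. AE x in gauss_measure. Q s (\<lambda>y. a * f y + b * g y) x = a * Q s f x + b * Q s g x"
      by (rule AE_I2) (rule lin[OF f g])
    then have "AE x in gauss_measure. AE s in M. Q s (\<lambda>y. a * f y + b * g y) x = a * Q s f x + b * Q s g x"
      by (subst (asm) P.AE_commute) measurable
    with int[OF f] int[OF g]
    show "AE x in gauss_measure. (\<integral>s. Q s (\<lambda>y. a * f y + b * g y) x \<partial>M) = a * (\<integral>s. Q s f x \<partial>M) + b * (\<integral>s. Q s g x \<partial>M)"
    proof eventually_elim
      case (elim x)
      have "(\<integral>s. Q s (\<lambda>y. a * f y + b * g y) x \<partial>M) = (\<integral>s. a * Q s f x + b * Q s g x \<partial>M)"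
        using elim(3) by (intro integral_cong_AE) auto
      then show ?case using elim by simp
    qed
  qed (use bound C in blast)
qed

text \<open>One null set that serves all times and all orders of differentiation.\<close>

lemma AE_avg_op_finite:
  assumes p: "1 \<le> p" and f: "f \<in> gLp p"
  shows "AE x in gauss_measure. avg_op 1 (absf f) x < top"
proof -
  have [measurable]: "f \<in> borel_measurable borel" using f by (rule gLp_measurable)
  have "lp_int p (avg_op 1 (absf f)) \<le> ennreal (6 powr p) * lp_int p (absf f)"
    unfolding lp_int_def by (rule avg_op_bounded) (use p in auto)
  also have "\<dots> < top" using f by (auto simp: gLp_iff ennreal_mult_less_top)
  finally have "AE x in gauss_measure. epowr (avg_op 1 (absf f) x) p \<noteq> \<infinity>"
    unfolding lp_int_def by (intro nn_integral_PInf_AE) auto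
  then show ?thesis by eventually_elim (auto simp: less_top)
qed

lemma poisson_deriv_lincomb_AE:
  assumes p: "1 \<le> p" and f: "f \<in> gLp p" and g: "g \<in> gLp p" and t: "0 < t"
  shows "AE x in gauss_measure. poisson_deriv m t (\<lambda>y. a * f y + b * g y) x = a * poisson_deriv m t f x + b * poisson_deriv m t g x"
  using AE_avg_op_finite[OF p f] AE_avg_op_finite[OF p g]
  by eventually_elim (rule poisson_deriv_lincomb[OF gLp_measurable[OF f] gLp_measurable[OF g] _ _ t])

lemma lp_bounded_poisson_deriv:
  assumes p: "1 \<le> p" and t: "0 < t"
  shows "lp_bounded p (\<lambda>f :: real ^ 'd \<Rightarrow> real. poisson_deriv m t f)"
proof -
  obtain C where C: "0 \<le> C" "\<And>t (f :: real ^ 'd \<Rightarrow> real) x. 0 < t \<Longrightarrow> f \<in> borel_measurable borel \<Longrightarrow>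
       absf (poisson_deriv m t f) x \<le> ennreal (C / t ^ m) * avg_op t (absf f) x" using poisson_deriv_bound by blast
  have p0: "0 < p" using p by simp
  have bound: "lp_int p (absf (poisson_deriv m t f)) \<le> ennreal ((C / t ^ m) powr p * 6 powr p) * lp_int p (absf f)" if f: "f \<in> gLp p" for f :: "real ^ 'd \<Rightarrow> real"
  proof -
    have [measurable]: "f \<in> borel_measurable borel" using f by (rule gLp_measurable)
    have "lp_int p (absf (poisson_deriv m t f)) \<le> lp_int p (\<lambda>x. ennreal (C / t ^ m) * avg_op t (absf f) x)"
      by (intro lp_int_mono p0 C t) measurable
    also have "\<dots> = ennreal ((C / t ^ m) powr p) * lp_int p (avg_op t (absf f))"
      using C t by (intro lp_int_cmult p0) auto
    also have "\<dots> \<le> ennreal ((C / t ^ m) powr p) * (ennreal (6 powr p) * lp_int p (absf f))"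
      unfolding lp_int_def by (intro mult_left_mono avg_op_bounded p) auto
    finally show ?thesis by (simp add: ennreal_mult mult.assoc)
  qed
  show ?thesis unfolding lp_bounded_def
  proof (intro conjI ballI allI)
    fix f :: "real ^ 'd \<Rightarrow> real" assume f: "f \<in> gLp p"
    have [measurable]: "f \<in> borel_measurable borel" using f by (rule gLp_measurable)
    have "poisson_deriv m t f \<in> borel_measurable borel" by measurable
    then show "poisson_deriv m t f \<in> gLp p"
      using bound[OF f] f by (auto simp: gLp_iff ennreal_mult_less_top intro: le_less_trans)
  next
    show "\<exists>C\<ge>0. \<forall>f :: real ^ 'd \<Rightarrow> real\<in>gLp p. lp_int p (absf (poisson_deriv m t f)) \<le> ennreal C * lp_int p (absf f)"
      using bound by (intro exI[of _ "(C / t ^ m) powr p * 6 powr p"]) auto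
  next
    fix f g :: "real ^ 'd \<Rightarrow> real" and a b assume "f \<in> gLp p" "g \<in> gLp p"
    then show "AE x in gauss_measure. poisson_deriv m t (\<lambda>y. a * f y + b * g y) x = a * poisson_deriv m t f x + b * poisson_deriv m t g x"
      by (rule poisson_deriv_lincomb_AE[OF p _ _ t])
  qed
qed

lemma poisson_deriv_hermite:
  assumes t: "0 < t"
  shows "poisson_deriv m t (\<lambda>y. c * hermite \<nu> y) x =
    (- sqrt (real (mi_abs \<nu>))) ^ m * exp (- (sqrt (real (mi_abs \<nu>)) * t)) * (c * hermite \<nu> x)"
proof -
  let ?n = "real (mi_abs \<nu>)"
  have ou: "ou_semigroup r (\<lambda>y. c * hermite \<nu> y) x = c * hermite \<nu> x * exp (- (?n * r))" if "0 \<le> r" for r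
    using ou_semigroup_hermite[OF that, of \<nu> x] by (simp add: ou_semigroup_def)
  have "heat_int (Suc m) (\<lambda>r. ou_semigroup r (\<lambda>y. c * hermite \<nu> y) x) t = (\<integral>r. c * hermite \<nu> x * (indicator {0<..} r * (heat_deriv (Suc m) t r * exp (- (?n * r)))) \<partial>lborel)"
    unfolding heat_int_def by (intro Bochner_Integration.integral_cong) (auto simp: ou indicator_def)
  also have "\<dots> = c * hermite \<nu> x * heat_int (Suc m) (\<lambda>r. exp (- (?n * r))) t"
    unfolding heat_int_def by (rule integral_mult_right_zero)
  also have "\<dots> = c * hermite \<nu> x * - ((- sqrt ?n) ^ m * exp (- (sqrt ?n * t)))"
    by (subst heat_int_exp_Suc) (use t in auto)
  finally show ?thesis by (simp add: poisson_deriv_def)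
qed

text \<open>On \<open>hermite \<nu>\<close> both sides multiply by
  \<open>(- l)^(j+k) exp (- l (s + t))\<close> with \<open>l = sqrt |\<nu>|\<close>; uniqueness of
  bounded operators does the rest.\<close>

lemma poisson_deriv_semigroup:
  fixes f :: "real ^ 'd \<Rightarrow> real"
  assumes p: "1 \<le> p" and f: "f \<in> gLp p" and s: "0 < s" and t: "0 < t"
  shows "AE x in gauss_measure. poisson_deriv (j + k) (s + t) f x = poisson_deriv j s (poisson_deriv k t f) x"
proof (rule lp_bounded_unique[OF _ _ _ _ f])
  show "lp_bounded p (\<lambda>f :: real ^ 'd \<Rightarrow> real. poisson_deriv (j + k) (s + t) f)"
    using s t by (intro lp_bounded_poisson_deriv p) auto
  show "lp_bounded p (\<lambda>f :: real ^ 'd \<Rightarrow> real. poisson_deriv j s (poisson_deriv k t f))"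
    by (rule lp_bounded_compose[OF lp_bounded_poisson_deriv[OF p s] lp_bounded_poisson_deriv[OF p t]]) (use p in auto)
  show "AE x in gauss_measure. poisson_deriv (j + k) (s + t) (hermite \<nu>) x = poisson_deriv j s (poisson_deriv k t (hermite \<nu> :: real ^ 'd \<Rightarrow> real)) x" for \<nu>
  proof (rule AE_I2)
    fix x :: "real ^ 'd"
    let ?c = "(- sqrt (real (mi_abs \<nu>))) ^ k * exp (- (sqrt (real (mi_abs \<nu>)) * t))"
    have "poisson_deriv k t (hermite \<nu>) = (\<lambda>y. ?c * hermite \<nu> y)"
      using poisson_deriv_hermite[OF t, of k 1 \<nu>] by auto
    then have "poisson_deriv j s (poisson_deriv k t (hermite \<nu>)) x = 
      (- sqrt (real (mi_abs \<nu>))) ^ j * exp (- (sqrt (real (mi_abs \<nu>)) * s)) * (?c * hermite \<nu> x)"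
      by (simp only: poisson_deriv_hermite[OF s])
    moreover have "poisson_deriv (j + k) (s + t) (hermite \<nu>) x = (- sqrt (real (mi_abs \<nu>))) ^ (j + k) * exp (- (sqrt (real (mi_abs \<nu>)) * (s + t))) * hermite \<nu> x"
      using poisson_deriv_hermite[of "s + t" "j + k" 1 \<nu> x] s t by simp
    moreover have "exp (- ((s + t) * c)) = exp (- (s * c)) * exp (- (t * c))" for c
      unfolding exp_add[symmetric] by (simp add: algebra_simps)
    ultimately show "poisson_deriv (j + k) (s + t) (hermite \<nu>) x = poisson_deriv j s (poisson_deriv k t (hermite \<nu>)) x"
      by (simp only: power_add mult_ac)
  qed
qed (use p in auto)

section \<open>Existence of the Riesz potential\<close>

text \<open>\<open>s^(\<beta>-1)\<close> is integrable at 0, and at infinity the total exponent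
  \<open>\<beta> - 1 - M\<close> lies below -1.\<close>

lemma nn_integral_beta_weight_finite:
  fixes \<beta> M t :: real
  assumes b: "0 < \<beta>" "\<beta> < M" and t: "0 < t"
  shows "(\<integral>\<^sup>+s. indicator {0<..} s * ennreal (s powr (\<beta> - 1) * (t + s) powr - M) \<partial>lborel) < top"
proof -
  let ?A = "\<lambda>s. ennreal (t powr - M / \<beta>) * ((ennreal (\<beta> * s powr (\<beta> - 1)) * of_bool (ennreal s < 1)) * indicator {0<..} s)"
  let ?B = "\<lambda>s. ennreal (1 / (M - \<beta>)) * (ennreal ((M - \<beta>) * s powr (- (M - \<beta>) - 1)) * indicator {1..} s)"
  have "(\<integral>\<^sup>+s. indicator {0<..} s * ennreal (s powr (\<beta> - 1) * (t + s) powr - M) \<partial>lborel) \<le> (\<integral>\<^sup>+s. ?A s + ?B s \<partial>lborel)"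
  proof (rule nn_integral_mono)
    fix s :: real
    consider "s \<le> 0" | "0 < s" "s < 1" | "1 \<le> s" by linarith
    then show "indicator {0<..} s * ennreal (s powr (\<beta> - 1) * (t + s) powr - M) \<le> ?A s + ?B s"
    proof cases
      case 2
      have "(t + s) powr - M \<le> t powr - M" using 2 b t by (intro powr_mono2') auto
      then have "s powr (\<beta> - 1) * (t + s) powr - M \<le> t powr - M / \<beta> * (\<beta> * s powr (\<beta> - 1))"
        using b mult_left_mono[of "(t + s) powr - M" "t powr - M" "s powr (\<beta> - 1)"] by (simp add: mult.commute)
      then have "ennreal (s powr (\<beta> - 1) * (t + s) powr - M) \<le> ennreal (t powr - M / \<beta>) * ennreal (\<beta> * s powr (\<beta> - 1))"
        using b by (subst ennreal_mult[symmetric]) (auto intro: ennreal_leI)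
      moreover have "ennreal s < 1" using 2 ennreal_lessI[of 1 s] by simp
      ultimately show ?thesis using 2 by simp
    next
      case 3
      have "s powr (\<beta> - 1) * (t + s) powr - M \<le> s powr (\<beta> - 1) * s powr - M"
        using 3 b t by (intro mult_left_mono powr_mono2') auto
      also have "\<dots> = s powr (- (M - \<beta>) - 1)" unfolding powr_add[symmetric] by (simp add: algebra_simps)
      also have "\<dots> = 1 / (M - \<beta>) * ((M - \<beta>) * s powr (- (M - \<beta>) - 1))" using b by simp
      finally have "ennreal (s powr (\<beta> - 1) * (t + s) powr - M) \<le> ennreal (1 / (M - \<beta>)) * ennreal ((M - \<beta>) * s powr (- (M - \<beta>) - 1))"
        using b by (subst ennreal_mult[symmetric]) (auto intro: ennreal_leI)
      then have "ennreal (s powr (\<beta> - 1) * (t + s) powr - M) \<le> ?B s" using 3 by simp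
      then show ?thesis using 3 by (simp add: add_increasing)
    qed simp
  qed
  also have "\<dots> = (\<integral>\<^sup>+s. ?A s \<partial>lborel) + (\<integral>\<^sup>+s. ?B s \<partial>lborel)" by (rule nn_integral_add) measurable
  also have "(\<integral>\<^sup>+s. ?A s \<partial>lborel) = ennreal (t powr - M / \<beta>) * epowr 1 \<beta>"
    by (subst nn_integral_cmult, measurable) (subst layer_cake_epowr[OF b(1)], rule refl)
  also have "(\<integral>\<^sup>+s. ?B s \<partial>lborel) = ennreal (1 / (M - \<beta>)) * ennreal (1 powr - (M - \<beta>))"
    using b by (subst nn_integral_cmult, measurable) (subst nn_integral_powr_tail, auto)
  finally show ?thesis by (auto intro: le_less_trans simp: ennreal_mult_less_top)
qed

lemma has_bochner_integral_Gamma: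
  fixes \<beta> l :: real
  assumes b: "0 < \<beta>" and l: "0 < l"
  shows "has_bochner_integral lborel (\<lambda>s. indicator {0<..} s * (s powr (\<beta> - 1) * exp (- (l * s)))) (Gamma \<beta> * l powr - \<beta>)"
proof -
  let ?f = "\<lambda>u::real. indicator {0<..} u * (u powr (\<beta> - 1) * exp (- u))"
  have "((\<lambda>u::real. if u \<in> {0..} then u powr (\<beta> - 1) / exp u else 0) has_integral Gamma \<beta>) UNIV"
    using Gamma_integral_real[OF b] by (simp only: has_integral_restrict_UNIV)
  then have *: "(?f has_integral Gamma \<beta>) UNIV"
    by (rule has_integral_eq[rotated]) (auto simp: indicator_def exp_minus field_simps)
  have "has_bochner_integral lborel ?f (Gamma \<beta>)"
  proof (rule has_bochner_integral_nn_integral)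
    show "(\<integral>\<^sup>+u. ennreal (?f u) \<partial>lborel) = ennreal (Gamma \<beta>)"
      by (rule nn_integral_has_integral_lborel[OF _ _ *]) (auto simp: indicator_def)
  qed (use b in \<open>auto simp: indicator_def Gamma_real_pos less_imp_le\<close>)
  then have "has_bochner_integral lborel (\<lambda>s. ?f (0 + l * s)) (Gamma \<beta> /\<^sub>R \<bar>l\<bar>)"
    using l by (subst (asm) lborel_has_bochner_integral_real_affine_iff[of l _ _ 0]) auto
  then have "has_bochner_integral lborel (\<lambda>s. l powr (1 - \<beta>) * ?f (0 + l * s)) (l powr (1 - \<beta>) * (Gamma \<beta> /\<^sub>R \<bar>l\<bar>))"
    by (rule has_bochner_integral_mult_right)
  also have "(\<lambda>s. l powr (1 - \<beta>) * ?f (0 + l * s)) = (\<lambda>s. indicator {0<..} s * (s powr (\<beta> - 1) * exp (- (l * s))))"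
  proof
    fix s :: real
    have "l powr (1 - \<beta>) * (l * s) powr (\<beta> - 1) = s powr (\<beta> - 1)" if "0 < s"
    proof -
      have "l powr (1 - \<beta>) * (l * s) powr (\<beta> - 1) = (l powr (1 - \<beta>) * l powr (\<beta> - 1)) * s powr (\<beta> - 1)"
        by (simp add: powr_mult)
      also have "l powr (1 - \<beta>) * l powr (\<beta> - 1) = 1" unfolding powr_add[symmetric] using l by simp
      finally show ?thesis by simp
    qed
    then show "l powr (1 - \<beta>) * ?f (0 + l * s) = indicator {0<..} s * (s powr (\<beta> - 1) * exp (- (l * s)))"
      using l by (auto simp: indicator_def zero_less_mult_iff)
  qed
  also have "l powr (1 - \<beta>) * (Gamma \<beta> /\<^sub>R \<bar>l\<bar>) = Gamma \<beta> * l powr - \<beta>"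
    using l by (simp add: powr_diff powr_minus field_simps)
  finally show ?thesis .
qed

lemma abs_exp_minus_1_le: "\<bar>exp z - 1\<bar> \<le> \<bar>z\<bar> * exp \<bar>z\<bar>" for z :: real
proof (cases "0 \<le> z")
  case True
  have "(1 - z) * exp z \<le> exp (- z) * exp z" using exp_ge_add_one_self[of "- z"] by (intro mult_right_mono) auto
  then show ?thesis using True by (simp add: exp_minus field_simps)
next
  case False
  have "1 - exp z \<le> \<bar>z\<bar> * 1" using exp_ge_add_one_self[of z] False by linarith
  also have "\<dots> \<le> \<bar>z\<bar> * exp \<bar>z\<bar>" by (intro mult_left_mono) auto
  finally show ?thesis using False by simp
qed

text \<open>With \<open>r = exp (- t)\<close> and \<open>s = |x|^2 + |y|^2\<close> the kernel is
  \<open>exp th\<close> with \<open>|th| \<le> r (d + 4 s)\<close>. Then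
  \<open>|exp z - 1| \<le> |z| exp |z|\<close> keeps one factor \<open>r\<close>; half of
  \<open>\<epsilon>\<close> absorbs the factor linear in \<open>s\<close>, the other half the
  exponential.\<close>

lemma mehler_decay:
  assumes e: "0 < \<epsilon>"
  obtains C t0 where "0 \<le> C" "0 < t0"
    "\<And>t (x :: real ^ 'd) y. t0 \<le> t \<Longrightarrow> \<bar>mehler t x y - 1\<bar> \<le> C * exp (- t) * exp (\<epsilon> * ((norm x)\<^sup>2 + (norm y)\<^sup>2))"
proof
  define d where "d = real CARD('d)"
  have d: "0 \<le> d" by (simp add: d_def)
  show "0 \<le> (d + 8 / \<epsilon>) * exp d" using d e by simp
  \<comment> \<open>This \<open>t0\<close> ensures \<open>r \<le> 1/2\<close>, which keeps
    \<open>1 - r^2\<close> away from 0, and \<open>4 r \<le> \<epsilon> / 2\<close>, which fits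
    \<open>4 r s\<close> into half of \<open>\<epsilon> s\<close>.\<close>
  show "0 < 1 + \<bar>ln (\<epsilon> / 8)\<bar>" by simp
  fix t and x y :: "real ^ 'd" assume t: "1 + \<bar>ln (\<epsilon> / 8)\<bar> \<le> t"
  define r where "r = exp (- t)"
  define s where "s = (norm x)\<^sup>2 + (norm y)\<^sup>2"
  have s: "0 \<le> s" by (simp add: s_def)
  have r0: "0 < r" by (simp add: r_def)
  have "r \<le> exp (- 1)" unfolding r_def using t by simp
  also have "exp (- 1) \<le> (1 / 2 :: real)" using exp_ge_add_one_self[of "1::real"] by (simp add: exp_minus field_simps)
  finally have r1: "r \<le> 1 / 2" .
  have "r \<le> exp (ln (\<epsilon> / 8))" unfolding r_def using t by simp
  then have r2: "4 * r \<le> \<epsilon> / 2" using e by simp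
  have rr: "r\<^sup>2 \<le> 1 / 4" using r0 r1 power_mono[of r "1/2" 2] by (simp add: power2_eq_square)
  have rr': "r\<^sup>2 \<le> r" using r0 r1 by (simp add: power2_eq_square)
  have e2: "exp (- 2 * t) = r\<^sup>2" by (simp add: r_def power2_eq_square exp_add[symmetric])
  define th where "th = - (d / 2) * ln (1 - r\<^sup>2) + (2 * r * (x \<bullet> y) - r\<^sup>2 * s) / (1 - r\<^sup>2)"
  have m: "mehler t x y = exp th"
  proof -
    have "sqrt (1 - r\<^sup>2) powr (- d) = exp (- (d / 2) * ln (1 - r\<^sup>2))"
      using rr by (simp add: powr_def ln_sqrt)
    then show ?thesis unfolding mehler_def e2 th_def exp_add by (simp add: d_def r_def s_def)
  qed
  have "\<bar>th\<bar> \<le> r * (d + 4 * s)"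
  proof -
    have "- ln (1 - r\<^sup>2) = ln (1 / (1 - r\<^sup>2))" using rr by (simp add: ln_div)
    also have "\<dots> \<le> 1 / (1 - r\<^sup>2) - 1" using rr by (intro ln_le_minus_one) auto
    also have "\<dots> \<le> 2 * r\<^sup>2"
    proof -
      have "1 \<le> (1 + 2 * r\<^sup>2) * (1 - r\<^sup>2)"
        using rr mult_mono[of "r\<^sup>2" "1/2" "r\<^sup>2" "r\<^sup>2"] by (simp add: algebra_simps)
      then show ?thesis using rr by (simp add: field_simps)
    qed
    finally have l: "- ln (1 - r\<^sup>2) \<le> 2 * r" using rr' by simp
    have l0: "ln (1 - r\<^sup>2) \<le> 0" using rr by simp
    have "\<bar>- (d / 2) * ln (1 - r\<^sup>2)\<bar> = d / 2 * (- ln (1 - r\<^sup>2))" using l0 d by (simp add: abs_mult)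
    also have "\<dots> \<le> d / 2 * (2 * r)" using l d by (intro mult_left_mono) auto
    finally have 1: "\<bar>- (d / 2) * ln (1 - r\<^sup>2)\<bar> \<le> r * d" by (simp add: mult.commute)
    have xy: "2 * \<bar>x \<bullet> y\<bar> \<le> s"
    proof -
      have "\<bar>x \<bullet> y\<bar> \<le> norm x * norm y" by (rule Cauchy_Schwarz_ineq2)
      moreover have "0 \<le> (norm x - norm y)\<^sup>2" by simp
      ultimately show ?thesis unfolding s_def power2_diff by linarith
    qed
    have "\<bar>2 * r * (x \<bullet> y) - r\<^sup>2 * s\<bar> \<le> r * (2 * \<bar>x \<bullet> y\<bar>) + r\<^sup>2 * s"
      using abs_triangle_ineq4[of "2 * r * (x \<bullet> y)" "r\<^sup>2 * s"] r0 s by (simp add: abs_mult)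
    also have "\<dots> \<le> r * s + r * s" using xy r0 rr' s by (intro add_mono mult_left_mono mult_right_mono) auto
    finally have n: "\<bar>2 * r * (x \<bullet> y) - r\<^sup>2 * s\<bar> \<le> 2 * (r * s)" by simp
    have "\<bar>(2 * r * (x \<bullet> y) - r\<^sup>2 * s) / (1 - r\<^sup>2)\<bar> = \<bar>2 * r * (x \<bullet> y) - r\<^sup>2 * s\<bar> / (1 - r\<^sup>2)" using rr by simp
    also have "\<dots> \<le> 2 * (r * s) / (1 / 2)" using n rr r0 s by (intro frac_le) auto
    finally have 2: "\<bar>(2 * r * (x \<bullet> y) - r\<^sup>2 * s) / (1 - r\<^sup>2)\<bar> \<le> r * (4 * s)" by simp
    show ?thesis using 1 2 unfolding th_def distrib_left
      by (intro order_trans[OF abs_triangle_ineq] add_mono)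
  qed
  then have "\<bar>mehler t x y - 1\<bar> \<le> (r * (d + 4 * s)) * exp (r * (d + 4 * s))"
    unfolding m using d s r0 by (intro order_trans[OF abs_exp_minus_1_le] mult_mono) auto
  also have "\<dots> \<le> (r * ((d + 8 / \<epsilon>) * exp (\<epsilon> / 2 * s))) * exp (d + \<epsilon> / 2 * s)"
  proof (intro mult_mono mult_left_mono)
    have "r * d \<le> 1 * d" by (rule mult_right_mono) (use r1 d in auto)
    moreover have "(4 * r) * s \<le> \<epsilon> / 2 * s" by (rule mult_right_mono[OF r2 s])
    ultimately have "r * (d + 4 * s) \<le> d + \<epsilon> / 2 * s" by (simp add: algebra_simps)
    then show "exp (r * (d + 4 * s)) \<le> exp (d + \<epsilon> / 2 * s)" by simp
    have "d + 4 * s \<le> (d + 8 / \<epsilon>) * (1 + \<epsilon> / 2 * s)" using d s e by (simp add: field_simps)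
    also have "\<dots> \<le> (d + 8 / \<epsilon>) * exp (\<epsilon> / 2 * s)" using d e by (intro mult_left_mono exp_ge_add_one_self) auto
    finally show "d + 4 * s \<le> (d + 8 / \<epsilon>) * exp (\<epsilon> / 2 * s)" .
  qed (use r0 d e s in auto)
  also have "\<dots> = (d + 8 / \<epsilon>) * exp d * r * exp (\<epsilon> * s)"
    by (simp add: exp_add[symmetric] mult.assoc)
  finally show "\<bar>mehler t x y - 1\<bar> \<le> (d + 8 / \<epsilon>) * exp d * exp (- t) * exp (\<epsilon> * ((norm x)\<^sup>2 + (norm y)\<^sup>2))"
    by (simp add: r_def s_def)
qed

lemma gLp_integrable: "1 \<le> p \<Longrightarrow> f \<in> gLp p \<Longrightarrow> integrable gauss_measure f"
  using gLp_imp_L1[of p f] gLp_measurable[of f p] by (intro integrableI_bounded) auto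

text \<open>The kernel estimate replaces a spectral gap: it gives exponential convergence to the mean
  on all \<open>L\<^sup>p\<close> at once.\<close>

lemma ou_semigroup_decay:
  assumes p: "1 < p"
  obtains C t0 \<epsilon> where "0 \<le> C" "0 < t0" "p * \<epsilon> < 1"
    "\<And>t (f :: real ^ 'd \<Rightarrow> real) x. t0 \<le> t \<Longrightarrow> f \<in> gLp p \<Longrightarrow>
       ennreal \<bar>ou_semigroup t f x - (\<integral>y. f y \<partial>gauss_measure)\<bar> \<le>
       ennreal (C * exp (- t) * exp (\<epsilon> * (norm x)\<^sup>2)) * epowr (lp_int p (absf f)) (1 / p)"
proof -
  define p' where "p' = p / (p - 1)"
  have p': "1 < p'" "1 / p' + 1 / p = 1" using p by (auto simp: p'_def field_simps)
  \<comment> \<open>Small enough for \<open>exp (\<epsilon> |y|^2)\<close> to have a finite norm of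
    exponent \<open>p'\<close>, as Hoelder in \<open>y\<close> demands, and for
    \<open>exp (\<epsilon> |x|^2)\<close> to lie in L^p afterwards.\<close>
  define \<epsilon> where "\<epsilon> = 1 / (2 * (p + p'))"
  have e: "0 < \<epsilon>" "p * \<epsilon> < 1" "p' * \<epsilon> < 1" using p p' by (auto simp: \<epsilon>_def field_simps)
  obtain C t0 where C: "0 \<le> C" "0 < t0" and
    K: "\<And>t (x :: real ^ 'd) y. t0 \<le> t \<Longrightarrow> \<bar>mehler t x y - 1\<bar> \<le> C * exp (- t) * exp (\<epsilon> * ((norm x)\<^sup>2 + (norm y)\<^sup>2))"
    using mehler_decay[OF e(1)] by blast
  define D where "D = epowr (lp_int p' (absf (\<lambda>y :: real ^ 'd. 1 * exp (\<epsilon> * (norm y)\<^sup>2)))) (1 / p')"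
  have "D < top" unfolding D_def using exp_norm_gLp[of p' \<epsilon> 1] e p' by (simp add: gLp_iff)
  then obtain D' where D': "D = ennreal D'" "0 \<le> D'" by (cases D) auto
  have "ennreal \<bar>ou_semigroup t f x - (\<integral>y. f y \<partial>gauss_measure)\<bar> \<le>
       ennreal ((C * D') * exp (- t) * exp (\<epsilon> * (norm x)\<^sup>2)) * epowr (lp_int p (absf f)) (1 / p)"
    if t: "t0 \<le> t" and f: "f \<in> gLp p" for t x and f :: "real ^ 'd \<Rightarrow> real"
  proof -
    have [measurable]: "f \<in> borel_measurable borel" using f by (rule gLp_measurable)
    let ?c = "C * exp (- t) * exp (\<epsilon> * (norm x)\<^sup>2)"
    have bound: "(\<integral>\<^sup>+y. ennreal \<bar>(mehler t x y - 1) * f y\<bar> \<partial>gauss_measure) \<le> ennreal ?c * (D * epowr (lp_int p (absf f)) (1 / p))"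
    proof -
      have "(\<integral>\<^sup>+y. ennreal \<bar>(mehler t x y - 1) * f y\<bar> \<partial>gauss_measure) \<le>
        (\<integral>\<^sup>+y. ennreal ?c * (absf (\<lambda>y. 1 * exp (\<epsilon> * (norm y)\<^sup>2)) y * absf f y) \<partial>gauss_measure)"
      proof (rule nn_integral_mono)
        fix y :: "real ^ 'd"
        have "\<bar>(mehler t x y - 1) * f y\<bar> \<le> C * exp (- t) * exp (\<epsilon> * ((norm x)\<^sup>2 + (norm y)\<^sup>2)) * \<bar>f y\<bar>"
          unfolding abs_mult by (intro mult_right_mono K t) auto
        also have "\<dots> = ?c * (exp (\<epsilon> * (norm y)\<^sup>2) * \<bar>f y\<bar>)" by (simp add: distrib_left exp_add)
        finally show "ennreal \<bar>(mehler t x y - 1) * f y\<bar> \<le> ennreal ?c * (absf (\<lambda>y. 1 * exp (\<epsilon> * (norm y)\<^sup>2)) y * absf f y)"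
          using C by (simp add: ennreal_mult[symmetric] ennreal_leI)
      qed
      also have "\<dots> = ennreal ?c * (\<integral>\<^sup>+y. absf (\<lambda>y. 1 * exp (\<epsilon> * (norm y)\<^sup>2)) y * absf f y \<partial>gauss_measure)"
        by (rule nn_integral_cmult) measurable
      also have "\<dots> \<le> ennreal ?c * (D * epowr (lp_int p (absf f)) (1 / p))"
        unfolding D_def lp_int_def by (intro mult_left_mono Holder_nn_integral p p') auto
      finally show ?thesis .
    qed
    have fin: "ennreal ?c * (D * epowr (lp_int p (absf f)) (1 / p)) < top"
      using f D' by (auto simp: gLp_iff ennreal_mult_less_top)
    have int: "integrable gauss_measure (\<lambda>y. (mehler t x y - 1) * f y)"
      using le_less_trans[OF bound fin] by (intro integrableI_bounded) auto
    have intf: "integrable gauss_measure f" using f p by (intro gLp_integrable) auto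
    have "(\<integral>y. (mehler t x y - 1) * f y + f y \<partial>gauss_measure) = (\<integral>y. (mehler t x y - 1) * f y \<partial>gauss_measure) + (\<integral>y. f y \<partial>gauss_measure)"
      using int intf by (rule Bochner_Integration.integral_add)
    then have "ou_semigroup t f x - (\<integral>y. f y \<partial>gauss_measure) = (\<integral>y. (mehler t x y - 1) * f y \<partial>gauss_measure)"
      using C t by (subst ou_semigroup_mehler) (auto simp: left_diff_distrib)
    then have "ennreal \<bar>ou_semigroup t f x - (\<integral>y. f y \<partial>gauss_measure)\<bar> \<le> ennreal ?c * (D * epowr (lp_int p (absf f)) (1 / p))"
      using integral_norm_bound_ennreal[OF int] bound by simp
    also have "\<dots> = ennreal ((C * D') * exp (- t) * exp (\<epsilon> * (norm x)\<^sup>2)) * epowr (lp_int p (absf f)) (1 / p)"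
      using C D' by (simp add: ennreal_mult mult_ac)
    finally show ?thesis .
  qed
  then show ?thesis using that[of "C * D'" t0 \<epsilon>] C D' e by auto
qed

lemma ou_semigroup_lincomb_AE:
  assumes p: "1 \<le> p" and f: "f \<in> gLp p" and g: "g \<in> gLp p" and t: "0 \<le> t"
  shows "AE x in gauss_measure. ou_semigroup t (\<lambda>y. a * f y + b * g y) x = a * ou_semigroup t f x + b * ou_semigroup t g x"
proof -
  have [measurable]: "f \<in> borel_measurable borel" "g \<in> borel_measurable borel" using f g by (auto simp: gLp_iff)
  have "AE x in gauss_measure. nnT t (absf f) x < top" "AE x in gauss_measure. nnT t (absf g) x < top"
    using t gLp_imp_L1[OF p f] gLp_imp_L1[OF p g] by (auto intro!: AE_nnT_finite)
  then show ?thesis by eventually_elim (rule ou_semigroup_lincomb, auto)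
qed

lemma lp_int_nnT_le:
  assumes [measurable]: "g \<in> borel_measurable borel" and p: "1 \<le> p" and t: "0 \<le> t"
  shows "lp_int p (nnT t g) \<le> lp_int p g"
proof -
  have "lp_int p (nnT t g) \<le> (\<integral>\<^sup>+x. nnT t (\<lambda>x. epowr (g x) p) x \<partial>gauss_measure)"
    unfolding lp_int_def by (intro nn_integral_mono epowr_nnT_le p) measurable
  also have "\<dots> = lp_int p g" unfolding lp_int_def by (rule nn_integral_nnT[OF _ t]) measurable
  finally show ?thesis .
qed

lemma lp_int_mean_le:
  fixes g :: "real ^ 'd \<Rightarrow> ennreal"
  assumes [measurable]: "g \<in> borel_measurable borel" and p: "1 \<le> p"
  shows "lp_int p (\<lambda>_ :: real ^ 'd. \<integral>\<^sup>+x. g x \<partial>gauss_measure) \<le> lp_int p g"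
  using Jensen_weighted[OF p, of 1 "\<lambda>_. 1" gauss_measure g] by (simp add: lp_int_def)

text \<open>The semigroup multiplies the polynomial by a decaying exponential and also converges to
  its mean; comparing both limits at the point 0 shows that the mean vanishes.\<close>

lemma integral_hermite_eq_0:
  fixes \<nu> :: "'d::finite \<Rightarrow> nat"
  assumes n: "0 < mi_abs \<nu>"
  shows "(\<integral>y. hermite \<nu> y \<partial>gauss_measure) = 0"
proof -
  obtain C t0 \<epsilon> where C: "0 \<le> C" "0 < t0" and
    D: "\<And>t (f :: real ^ 'd \<Rightarrow> real) x. t0 \<le> t \<Longrightarrow> f \<in> gLp 2 \<Longrightarrow>
       ennreal \<bar>ou_semigroup t f x - (\<integral>y. f y \<partial>gauss_measure)\<bar> \<le>
       ennreal (C * exp (- t) * exp (\<epsilon> * (norm x)\<^sup>2)) * epowr (lp_int 2 (absf f)) (1 / 2)"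
    by (rule ou_semigroup_decay[of 2]) (simp, blast)
  have h: "(hermite \<nu> :: real ^ 'd \<Rightarrow> real) \<in> gLp 2" by (rule hermite_gLp) simp
  then have "epowr (lp_int 2 (absf (hermite \<nu> :: real ^ 'd \<Rightarrow> real))) (1 / 2) < top" by (simp add: gLp_iff)
  then obtain N where N: "epowr (lp_int 2 (absf (hermite \<nu> :: real ^ 'd \<Rightarrow> real))) (1 / 2) = ennreal N" "0 \<le> N"
    by (cases "epowr (lp_int 2 (absf (hermite \<nu> :: real ^ 'd \<Rightarrow> real))) (1 / 2)") auto
  let ?E = "\<integral>y. hermite \<nu> y \<partial>(gauss_measure :: (real ^ 'd) measure)" and ?h0 = "hermite \<nu> (0 :: real ^ 'd)"
  have le: "\<bar>exp (- (real (mi_abs \<nu>) * t)) * ?h0 - ?E\<bar> \<le> C * exp (- t) * N" if "t0 \<le> t" for t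
  proof -
    have "ennreal \<bar>exp (- (real (mi_abs \<nu>) * t)) * ?h0 - ?E\<bar> \<le> ennreal (C * exp (- t) * N)"
      using D[OF that h, of 0] C that by (simp add: ou_semigroup_hermite N ennreal_mult)
    then show ?thesis using C N by (subst (asm) ennreal_le_iff) auto
  qed
  have ex: "((\<lambda>t::real. exp (- (c * t))) \<longlongrightarrow> 0) at_top" if "0 < c" for c
  proof -
    have "LIM t at_top. c * (t::real) :> at_top"
      by (rule filterlim_tendsto_pos_mult_at_top[OF tendsto_const that filterlim_ident])
    then have "LIM t at_top. - (c * (t::real)) :> at_bot" by (simp add: filterlim_uminus_at_bot)
    from filterlim_compose[OF exp_at_bot this] show ?thesis .
  qed
  have "((\<lambda>t. \<bar>exp (- (real (mi_abs \<nu>) * t)) * ?h0 - ?E\<bar>) \<longlongrightarrow> \<bar>0 * ?h0 - ?E\<bar>) at_top"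
    using n by (intro tendsto_intros ex) auto
  moreover have "((\<lambda>t. C * exp (- (1 * t)) * N) \<longlongrightarrow> C * 0 * N) at_top"
    by (intro tendsto_intros ex) auto
  moreover have "\<forall>\<^sub>F t in at_top. \<bar>exp (- (real (mi_abs \<nu>) * t)) * ?h0 - ?E\<bar> \<le> C * exp (- (1 * t)) * N"
    using le by (auto intro: eventually_at_top_linorderI)
  ultimately have "\<bar>0 * ?h0 - ?E\<bar> \<le> C * 0 * N" by (intro tendsto_le[of at_top]) auto
  then show ?thesis by simp
qed

text \<open>\<open>J\<close> is the Gamma integral of \<open>ou_semigroup s f - m f\<close> with
  exponent \<open>b = \<beta> / 2\<close>, as the semigroup has the eigenvalues
  \<open>exp (- s |\<nu>|)\<close>; subtracting the mean makes \<open>J\<close> vanish on constants.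
  For small \<open>s\<close> the weight \<open>s^(b-1)\<close> is integrable and the semigroup
  contracts; from \<open>t0\<close> on the decay estimate applies.\<close>

lemma riesz_extension_exists:
  fixes p \<beta> :: real
  assumes p: "1 < p" and \<beta>: "0 < \<beta>"
  shows "\<exists>J :: (real ^ 'd \<Rightarrow> real) \<Rightarrow> real ^ 'd \<Rightarrow> real. is_riesz_extension p \<beta> J"
proof -
  define b where "b = \<beta> / 2"
  have b: "0 < b" using \<beta> by (simp add: b_def)
  have G: "0 < Gamma b" using b by (rule Gamma_real_pos)
  define m where "m f = (\<integral>y. f y \<partial>gauss_measure)" for f :: "real ^ 'd \<Rightarrow> real"
  define Q where "Q s f x = indicator {0<..} s * (s powr (b - 1) / Gamma b * (ou_semigroup s f x - m f))" for s x and f :: "real ^ 'd \<Rightarrow> real"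
  define J where "J f x = (\<integral>s. Q s f x \<partial>lborel)" for f x
  have p0: "0 < p" "1 \<le> p" using p by auto
  obtain C t0 \<epsilon> where C: "0 \<le> C" "0 < t0" "p * \<epsilon> < 1" and
    D: "\<And>t (f :: real ^ 'd \<Rightarrow> real) x. t0 \<le> t \<Longrightarrow> f \<in> gLp p \<Longrightarrow>
       ennreal \<bar>ou_semigroup t f x - (\<integral>y. f y \<partial>gauss_measure)\<bar> \<le>
       ennreal (C * exp (- t) * exp (\<epsilon> * (norm x)\<^sup>2)) * epowr (lp_int p (absf f)) (1 / p)"
    using ou_semigroup_decay[OF p] by auto
  \<comment> \<open>\<open>w\<close> covers the times below \<open>t0\<close>, which lead to the
    term \<open>A\<close>; the exponential decay afterwards leads to \<open>B\<close>.\<close>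
  define w where "w s = indicator {0<..} s * ennreal (s powr (b - 1)) * of_bool (s < t0)" for s
  have [measurable]: "w \<in> borel_measurable borel" unfolding w_def by measurable
  have wfin: "(\<integral>\<^sup>+s. w s \<partial>lborel) < top"
  proof -
    have "ennreal b * (\<integral>\<^sup>+s. w s \<partial>lborel) = (\<integral>\<^sup>+s. (ennreal (b * s powr (b - 1)) * of_bool (ennreal s < ennreal t0)) * indicator {0<..} s \<partial>lborel)"
      using b C by (subst nn_integral_cmult[symmetric], measurable)
        (auto simp: w_def indicator_def ennreal_mult ennreal_less_iff intro!: nn_integral_cong)
    also have "\<dots> = epowr (ennreal t0) b" by (rule layer_cake_epowr[OF b, symmetric])
    also have "\<dots> < top" by simp
    finally show ?thesis using b by (auto simp: ennreal_mult_less_top)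
  qed
  define k where "k = enn2real (\<integral>\<^sup>+s. w s \<partial>lborel) + 1"
  have k: "0 < k" "(\<integral>\<^sup>+s. w s \<partial>lborel) \<le> ennreal k"
    using wfin by (auto simp: k_def add_nonneg_pos)
  have "lp_int p (absf (\<lambda>x :: real ^ 'd. C * exp (\<epsilon> * (norm x)\<^sup>2))) < top"
    using exp_norm_gLp[of p \<epsilon> C] C(3) p0 by (simp add: gLp_iff)
  then obtain L where L: "lp_int p (absf (\<lambda>x :: real ^ 'd. C * exp (\<epsilon> * (norm x)\<^sup>2))) = ennreal L" "0 \<le> L"
    by (cases "lp_int p (absf (\<lambda>x :: real ^ 'd. C * exp (\<epsilon> * (norm x)\<^sup>2)))") (blast, simp only: less_irrefl)
  \<comment> \<open>The outer \<open>2 powr p\<close> separates \<open>A\<close> from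
    \<open>B\<close>. The inner \<open>2 powr p * 2\<close> belongs to \<open>A\<close>, where the
    semigroup and the mean each contribute the norm of \<open>f\<close>.\<close>
  define K where "K = 2 powr p * ((1 / Gamma b) powr p * (k powr p * (2 powr p * 2)) + L)"
  have bdd: "lp_bounded p (\<lambda>f x. \<integral>s. Q s f x \<partial>lborel)"
  proof (rule lp_bounded_integral[where C = K])
    show "sigma_finite_measure (lborel :: real measure)" by (rule lborel.sigma_finite_measure_axioms)
    show "0 < p" "0 \<le> K" using p0 L by (auto simp: K_def)
    fix f :: "real ^ 'd \<Rightarrow> real" assume f: "f \<in> gLp p"
    have [measurable]: "f \<in> borel_measurable borel" using f by (rule gLp_measurable)
    show "(\<lambda>(s, x). Q s f x) \<in> borel_measurable (lborel \<Otimes>\<^sub>M borel)" unfolding Q_def by measurable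
    define N where "N = epowr (lp_int p (absf f)) (1 / p)"
    define E where "E = (\<integral>\<^sup>+x. absf f x \<partial>gauss_measure)"
    have mE: "ennreal \<bar>m f\<bar> \<le> E"
      unfolding m_def E_def using integral_norm_bound_ennreal[OF gLp_integrable[OF p0(2) f]] by simp
    define A where "A x = ennreal (1 / Gamma b) * (\<integral>\<^sup>+s. w s * (indicator {0<..} s * (nnT s (absf f) x + E)) \<partial>lborel)" for x :: "real ^ 'd"
    define B where "B x = absf (\<lambda>x. C * exp (\<epsilon> * (norm x)\<^sup>2)) x * N" for x :: "real ^ 'd"
    have [measurable]: "A \<in> borel_measurable borel" "B \<in> borel_measurable borel" unfolding A_def B_def by measurable
    have AB: "(\<integral>\<^sup>+s. ennreal \<bar>Q s f x\<bar> \<partial>lborel) \<le> A x + B x" for x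
    proof -
      have "(\<integral>\<^sup>+s. ennreal \<bar>Q s f x\<bar> \<partial>lborel) \<le> 
        (\<integral>\<^sup>+s. ennreal (1 / Gamma b) * (w s * (indicator {0<..} s * (nnT s (absf f) x + E))) +
           ennreal (1 / Gamma b * (indicator {0<..} s * (s powr (b - 1) * exp (- (1 * s))))) * B x \<partial>lborel)"
      proof (rule nn_integral_mono)
        fix s :: real
        let ?g = "ennreal \<bar>ou_semigroup s f x - m f\<bar>"
        consider "s \<le> 0" | "0 < s" "s < t0" | "0 < s" "t0 \<le> s" by linarith
        then show "ennreal \<bar>Q s f x\<bar> \<le> ennreal (1 / Gamma b) * (w s * (indicator {0<..} s * (nnT s (absf f) x + E))) +
           ennreal (1 / Gamma b * (indicator {0<..} s * (s powr (b - 1) * exp (- (1 * s))))) * B x"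
        proof cases
          case 1 then show ?thesis by (simp add: Q_def)
        next
          case 2
          have "ennreal \<bar>Q s f x\<bar> = ennreal (1 / Gamma b) * ennreal (s powr (b - 1)) * ?g"
            using 2 G by (simp add: Q_def abs_mult ennreal_mult[symmetric])
          also have "?g \<le> nnT s (absf f) x + E"
          proof -
            have "?g \<le> ennreal \<bar>ou_semigroup s f x\<bar> + ennreal \<bar>m f\<bar>"
              by (simp add: ennreal_plus[symmetric] ennreal_leI abs_triangle_ineq4 del: ennreal_plus)
            also have "\<dots> \<le> nnT s (absf f) x + E" by (intro add_mono abs_ou_semigroup_le mE) measurable
            finally show ?thesis .
          qed
          finally have "ennreal \<bar>Q s f x\<bar> \<le> ennreal (1 / Gamma b) * ennreal (s powr (b - 1)) * (nnT s (absf f) x + E)"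
            by (simp add: mult_left_mono)
          then show ?thesis using 2 by (simp add: w_def mult.assoc add_increasing2)
        next
          case 3
          have "ennreal \<bar>Q s f x\<bar> = ennreal (1 / Gamma b * s powr (b - 1)) * ?g"
            using 3 G by (simp add: Q_def abs_mult ennreal_mult[symmetric])
          also have "\<dots> \<le> ennreal (1 / Gamma b * s powr (b - 1)) * (ennreal (C * exp (- s) * exp (\<epsilon> * (norm x)\<^sup>2)) * N)"
            unfolding m_def N_def by (intro mult_left_mono D 3 f) auto
          also have "\<dots> = ennreal (1 / Gamma b * (indicator {0<..} s * (s powr (b - 1) * exp (- (1 * s))))) * B x"
            unfolding B_def using 3 G C by (simp add: mult.assoc[symmetric] ennreal_mult[symmetric]) (simp add: mult_ac)
          finally show ?thesis by (simp add: add_increasing)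
        qed
      qed
      also have "\<dots> = A x + (\<integral>\<^sup>+s. ennreal (1 / Gamma b * (indicator {0<..} s * (s powr (b - 1) * exp (- (1 * s))))) \<partial>lborel) * B x"
        unfolding A_def by (subst nn_integral_add, measurable) (simp add: nn_integral_cmult nn_integral_multc)
      also have "(\<integral>\<^sup>+s. ennreal (1 / Gamma b * (indicator {0<..} s * (s powr (b - 1) * exp (- (1 * s))))) \<partial>lborel) = ennreal (1 / Gamma b * (Gamma b * 1 powr - b))"
        using has_bochner_integral_mult_right[OF has_bochner_integral_Gamma[OF b zero_less_one], of "1 / Gamma b"] G
        by (subst nn_integral_eq_integral) (auto simp: has_bochner_integral_iff indicator_def)
      also have "1 / Gamma b * (Gamma b * 1 powr - b) = 1" using G by simp
      finally show ?thesis by simp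
    qed
    have lpA: "lp_int p A \<le> ennreal ((1 / Gamma b) powr p * (k powr p * (2 powr p * 2))) * lp_int p (absf f)"
    proof -
      have "lp_int p A = ennreal ((1 / Gamma b) powr p) * lp_int p (\<lambda>x. \<integral>\<^sup>+s. w s * (indicator {0<..} s * (nnT s (absf f) x + E)) \<partial>lborel)"
        unfolding A_def[abs_def] using p0 G by (intro lp_int_cmult) auto
      also have "\<dots> \<le> ennreal ((1 / Gamma b) powr p) * (ennreal (k powr p) * (ennreal (2 powr p * 2) * lp_int p (absf f)))"
      proof (intro mult_left_mono Minkowski_weighted k p0)
        fix s :: real
        show "lp_int p (\<lambda>x. indicator {0<..} s * (nnT s (absf f) x + E)) \<le> ennreal (2 powr p * 2) * lp_int p (absf f)"
        proof (cases "0 < s")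
          case True
          have "lp_int p (\<lambda>x. indicator {0<..} s * (nnT s (absf f) x + E)) = lp_int p (\<lambda>x. nnT s (absf f) x + E)" using True by simp
          also have "\<dots> \<le> ennreal (2 powr p) * (lp_int p (nnT s (absf f)) + lp_int p (\<lambda>_ :: real ^ 'd. E))"
            by (intro lp_int_add_le p0) measurable
          also have "\<dots> \<le> ennreal (2 powr p) * (lp_int p (absf f) + lp_int p (absf f))"
            unfolding E_def using True by (intro mult_left_mono add_mono lp_int_nnT_le lp_int_mean_le p0) auto
          also have "\<dots> = ennreal (2 powr p * 2) * lp_int p (absf f)" by (simp add: ennreal_mult mult_2[symmetric] mult.assoc)
          finally show ?thesis .
        qed (simp add: lp_int_def)
      qed (auto intro: lborel.sigma_finite_measure_axioms)
      finally show ?thesis by (simp add: ennreal_mult mult.assoc)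
    qed
    have lpB: "lp_int p B = ennreal L * lp_int p (absf f)"
    proof -
      have "lp_int p B = (\<integral>\<^sup>+x. epowr (absf (\<lambda>x :: real ^ 'd. C * exp (\<epsilon> * (norm x)\<^sup>2)) x) p * lp_int p (absf f) \<partial>gauss_measure)"
        unfolding lp_int_def[of p B] B_def N_def using p0 by (simp add: epowr_mult epowr_epowr)
      also have "\<dots> = ennreal L * lp_int p (absf f)"
        unfolding L(1)[symmetric] by (subst nn_integral_multc) (auto simp: lp_int_def)
      finally show ?thesis .
    qed
    have "lp_int p (\<lambda>x. \<integral>\<^sup>+s. ennreal \<bar>Q s f x\<bar> \<partial>lborel) \<le> lp_int p (\<lambda>x. A x + B x)" by (intro lp_int_mono p0 AB)
    also have "\<dots> \<le> ennreal (2 powr p) * (lp_int p A + lp_int p B)" by (intro lp_int_add_le p0) measurable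
    also have "\<dots> \<le> ennreal (2 powr p) * (ennreal ((1 / Gamma b) powr p * (k powr p * (2 powr p * 2))) * lp_int p (absf f) + ennreal L * lp_int p (absf f))"
      unfolding lpB by (intro mult_left_mono add_mono lpA) auto
    also have "\<dots> = ennreal K * lp_int p (absf f)"
      unfolding K_def using L by (simp only: ennreal_mult ennreal_plus distrib_right mult.assoc powr_ge_zero mult_nonneg_nonneg zero_le_numeral add_nonneg_nonneg)
    finally show "lp_int p (\<lambda>x. \<integral>\<^sup>+s. ennreal \<bar>Q s f x\<bar> \<partial>lborel) \<le> ennreal K * lp_int p (absf f)" .
  next
    fix f g :: "real ^ 'd \<Rightarrow> real" and a c s assume f: "f \<in> gLp p" and g: "g \<in> gLp p"
    show "AE x in gauss_measure. Q s (\<lambda>y. a * f y + c * g y) x = a * Q s f x + c * Q s g x"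
    proof (cases "0 < s")
      case True
      have m: "m (\<lambda>y. a * f y + c * g y) = a * m f + c * m g"
        unfolding m_def using gLp_integrable[OF p0(2) f] gLp_integrable[OF p0(2) g] by simp
      show ?thesis using ou_semigroup_lincomb_AE[OF p0(2) f g less_imp_le[OF True], of a c]
        by eventually_elim (simp add: Q_def m algebra_simps add_divide_distrib diff_divide_distrib)
    qed (simp add: Q_def)
  qed
  have herm: "J (hermite \<nu>) x = (if mi_abs \<nu> = 0 then 0 else real (mi_abs \<nu>) powr (- \<beta> / 2) * hermite \<nu> x)" for \<nu> :: "'d \<Rightarrow> nat" and x
  proof (cases "mi_abs \<nu> = 0")
    case True
    then have "\<nu> i = 0" for i by (simp add: mi_abs_def)
    then have one: "hermite \<nu> = (\<lambda>x. 1)" unfolding hermite_eq[abs_def] by (simp add: True)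
    then have "Q s (hermite \<nu>) x = 0" for s by (simp add: Q_def m_def ou_semigroup_def)
    then show ?thesis using True by (simp add: J_def)
  next
    case False
    let ?n = "real (mi_abs \<nu>)"
    have n: "0 < mi_abs \<nu>" using False by simp
    have "J (hermite \<nu>) x = (\<integral>s. (hermite \<nu> x / Gamma b) * (indicator {0<..} s * (s powr (b - 1) * exp (- (?n * s)))) \<partial>lborel)"
      unfolding J_def Q_def m_def using integral_hermite_eq_0[OF n]
      by (intro Bochner_Integration.integral_cong) (auto simp: indicator_def ou_semigroup_hermite)
    also have "\<dots> = (hermite \<nu> x / Gamma b) * (Gamma b * ?n powr - b)"
      using has_bochner_integral_mult_right[OF has_bochner_integral_Gamma[OF b, of ?n], of "hermite \<nu> x / Gamma b"] n
      by (simp add: has_bochner_integral_iff)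
    finally show ?thesis using False G by (simp add: b_def)
  qed
  show ?thesis
    by (rule exI[of _ J]) (use p0 bdd herm in \<open>auto simp: is_riesz_extension_iff J_def[abs_def]\<close>)
qed

section \<open>The Triebel-Lizorkin seminorm\<close>

text \<open>\<open>dt / t\<close> on the positive half-line. Its dilation invariance is used in
  Hardy's inequality and to replace \<open>t / 2\<close> by \<open>t\<close>.\<close>

definition haar :: "real measure" where
  "haar = density lborel (\<lambda>t. indicator {0<..} t * ennreal (1 / t))"

lemma sets_haar [measurable_cong, simp]: "sets haar = sets borel"
  by (simp add: haar_def)

lemma nn_integral_haar:
  "f \<in> borel_measurable borel \<Longrightarrow> (\<integral>\<^sup>+t. f t \<partial>haar) = (\<integral>\<^sup>+t. indicator {0<..} t * ennreal (1 / t) * f t \<partial>lborel)"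
  unfolding haar_def by (rule nn_integral_density) auto

interpretation haar: time_measure haar
proof -
  have "sigma_finite_measure haar"
    unfolding haar_def by (subst sigma_finite_measure.sigma_finite_iff_density_finite[OF lborel.sigma_finite_measure_axioms]) (auto simp: indicator_def)
  then interpret sigma_finite_measure haar .
  show "time_measure haar" by unfold_locales simp
qed

lemma AE_haarI: "(\<And>t. 0 < t \<Longrightarrow> P t) \<Longrightarrow> AE t in haar. P t"
  unfolding haar_def by (subst AE_density) (auto simp: indicator_def split: if_splits)

lemma nn_integral_haar_scale:
  assumes [measurable]: "f \<in> borel_measurable borel" and c: "0 < c"
  shows "(\<integral>\<^sup>+t. f (c * t) \<partial>haar) = (\<integral>\<^sup>+t. f t \<partial>haar)"
proof -
  have "(\<integral>\<^sup>+t. f t \<partial>haar) = (\<integral>\<^sup>+t. indicator {0<..} t * ennreal (1 / t) * f t \<partial>lborel)"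
    by (rule nn_integral_haar) measurable
  also have "\<dots> = ennreal \<bar>c\<bar> * (\<integral>\<^sup>+t. indicator {0<..} (0 + c * t) * ennreal (1 / (0 + c * t)) * f (0 + c * t) \<partial>lborel)"
    using c by (intro nn_integral_real_affine) auto
  also have "\<dots> = (\<integral>\<^sup>+t. ennreal c * (indicator {0<..} (0 + c * t) * ennreal (1 / (0 + c * t)) * f (0 + c * t)) \<partial>lborel)"
    using c by (subst nn_integral_cmult) auto
  also have "\<dots> = (\<integral>\<^sup>+t. indicator {0<..} t * ennreal (1 / t) * f (c * t) \<partial>lborel)"
  proof (rule nn_integral_cong)
    fix t :: real
    show "ennreal c * (indicator {0<..} (0 + c * t) * ennreal (1 / (0 + c * t)) * f (0 + c * t)) = indicator {0<..} t * ennreal (1 / t) * f (c * t)"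
    proof (cases "0 < t")
      case True
      have "ennreal c * ennreal (1 / (c * t)) = ennreal (1 / t)" using c True by (simp add: ennreal_mult[symmetric])
      then show ?thesis using True c by (simp add: mult.assoc[symmetric])
    qed (use c in \<open>auto simp: zero_less_mult_iff\<close>)
  qed
  also have "\<dots> = (\<integral>\<^sup>+t. f (c * t) \<partial>haar)" by (rule nn_integral_haar[symmetric]) measurable
  finally show ?thesis ..
qed

lemma ennreal_le_real: "x < top \<Longrightarrow> \<exists>k>0. x \<le> ennreal k"
proof -
  assume x: "x < top"
  then have "x = ennreal (enn2real x)" by simp
  also have "\<dots> \<le> ennreal (enn2real x + 1)" by (intro ennreal_leI) simp
  finally show ?thesis by (intro exI[of _ "enn2real x + 1"]) (auto simp: add_nonneg_pos)
qed

text \<open>Replacing \<open>s\<close> by \<open>t s\<close> writes the quantity under the power as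
  an average of \<open>r^(a+\<beta>) \<phi> r\<close> at \<open>r = (1 + s) t\<close>, with the
  weight \<open>s^(\<beta>-1) (1 + s)^(-(a+\<beta>))\<close>, whose mass is finite because
  \<open>\<beta> > 0\<close> and \<open>a > 0\<close>. Jensen moves the power inside, and dilation
  invariance makes the integral over \<open>t\<close> independent of \<open>s\<close>.\<close>

lemma Hardy_inequality:
  fixes a \<beta> q :: real
  assumes a: "0 < a" and b: "0 < \<beta>" and q: "1 \<le> q"
  obtains C where "0 \<le> C" "\<And>\<phi> :: real \<Rightarrow> ennreal. \<phi> \<in> borel_measurable borel \<Longrightarrow>
    (\<integral>\<^sup>+t. epowr (ennreal (t powr a) * (\<integral>\<^sup>+s. indicator {0<..} s * ennreal (s powr (\<beta> - 1)) * \<phi> (t + s) \<partial>lborel)) q \<partial>haar)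
    \<le> ennreal C * (\<integral>\<^sup>+r. epowr (ennreal (r powr (a + \<beta>)) * \<phi> r) q \<partial>haar)"
proof -
  define w where "w s = indicator {0<..} s * ennreal (s powr (\<beta> - 1) * (1 + s) powr - (a + \<beta>))" for s :: real
  have [measurable]: "w \<in> borel_measurable borel" unfolding w_def by measurable
  have "(\<integral>\<^sup>+s. w s \<partial>lborel) < top" unfolding w_def using a b by (intro nn_integral_beta_weight_finite) auto
  then obtain k where k: "0 < k" "(\<integral>\<^sup>+s. w s \<partial>lborel) \<le> ennreal k" using ennreal_le_real by blast
  have main: "(\<integral>\<^sup>+t. epowr (ennreal (t powr a) * (\<integral>\<^sup>+s. indicator {0<..} s * ennreal (s powr (\<beta> - 1)) * \<phi> (t + s) \<partial>lborel)) q \<partial>haar)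
    \<le> ennreal (k powr (q - 1) * k) * (\<integral>\<^sup>+r. epowr (ennreal (r powr (a + \<beta>)) * \<phi> r) q \<partial>haar)"
    if [measurable]: "\<phi> \<in> borel_measurable borel" for \<phi> :: "real \<Rightarrow> ennreal"
  proof -
    define \<psi> where "\<psi> r = epowr (ennreal (r powr (a + \<beta>)) * \<phi> r) q" for r
    have [measurable]: "\<psi> \<in> borel_measurable borel" unfolding \<psi>_def by measurable
    have "AE t in haar. epowr (ennreal (t powr a) * (\<integral>\<^sup>+s. indicator {0<..} s * ennreal (s powr (\<beta> - 1)) * \<phi> (t + s) \<partial>lborel)) q
       \<le> ennreal (k powr (q - 1)) * (\<integral>\<^sup>+s. w s * \<psi> ((1 + s) * t) \<partial>lborel)"
    proof (rule AE_haarI)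
      fix t :: real assume t: "0 < t"
      have "ennreal (t powr a) * (\<integral>\<^sup>+s. indicator {0<..} s * ennreal (s powr (\<beta> - 1)) * \<phi> (t + s) \<partial>lborel)
        = ennreal (t powr a) * (ennreal \<bar>t\<bar> * (\<integral>\<^sup>+s. indicator {0<..} (0 + t * s) * ennreal ((0 + t * s) powr (\<beta> - 1)) * \<phi> (t + (0 + t * s)) \<partial>lborel))"
        using t by (subst nn_integral_real_affine[where c = t and t = 0]) auto
      also have "\<dots> = (\<integral>\<^sup>+s. ennreal (t powr a) * (ennreal \<bar>t\<bar> * (indicator {0<..} (0 + t * s) * ennreal ((0 + t * s) powr (\<beta> - 1)) * \<phi> (t + (0 + t * s)))) \<partial>lborel)"
        by (simp add: nn_integral_cmult)
      also have "\<dots> = (\<integral>\<^sup>+s. w s * (ennreal (((1 + s) * t) powr (a + \<beta>)) * \<phi> ((1 + s) * t)) \<partial>lborel)"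
      proof (rule nn_integral_cong)
        fix s :: real
        show "ennreal (t powr a) * (ennreal \<bar>t\<bar> * (indicator {0<..} (0 + t * s) * ennreal ((0 + t * s) powr (\<beta> - 1)) * \<phi> (t + (0 + t * s))))
          = w s * (ennreal (((1 + s) * t) powr (a + \<beta>)) * \<phi> ((1 + s) * t))"
        proof (cases "0 < s")
          case True
          have "t powr a * (t * (t * s) powr (\<beta> - 1)) = s powr (\<beta> - 1) * t powr (a + \<beta>)"
            using t True by (simp add: powr_mult powr_add powr_diff)
          also have "\<dots> = s powr (\<beta> - 1) * ((1 + s) powr - (a + \<beta>) * (1 + s) powr (a + \<beta>)) * t powr (a + \<beta>)"
            using True unfolding powr_add[symmetric] by simp
          also have "\<dots> = (s powr (\<beta> - 1) * (1 + s) powr - (a + \<beta>)) * ((1 + s) * t) powr (a + \<beta>)"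
            by (simp add: powr_mult)
          finally have e: "ennreal (t powr a) * (ennreal t * ennreal ((t * s) powr (\<beta> - 1))) = ennreal (s powr (\<beta> - 1) * (1 + s) powr - (a + \<beta>)) * ennreal (((1 + s) * t) powr (a + \<beta>))"
            using t by (simp add: ennreal_mult[symmetric])
          have "t + t * s = (1 + s) * t" by (simp add: algebra_simps)
          then show ?thesis using t True e by (simp add: w_def mult.assoc[symmetric])
        qed (use t in \<open>auto simp: w_def zero_less_mult_iff\<close>)
      qed
      finally have "epowr (ennreal (t powr a) * (\<integral>\<^sup>+s. indicator {0<..} s * ennreal (s powr (\<beta> - 1)) * \<phi> (t + s) \<partial>lborel)) q
        = epowr (\<integral>\<^sup>+s. w s * (ennreal (((1 + s) * t) powr (a + \<beta>)) * \<phi> ((1 + s) * t)) \<partial>lborel) q" by simp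
      also have "\<dots> \<le> ennreal (k powr (q - 1)) * (\<integral>\<^sup>+s. w s * epowr (ennreal (((1 + s) * t) powr (a + \<beta>)) * \<phi> ((1 + s) * t)) q \<partial>lborel)"
        by (intro Jensen_weighted q k) auto
      finally show "epowr (ennreal (t powr a) * (\<integral>\<^sup>+s. indicator {0<..} s * ennreal (s powr (\<beta> - 1)) * \<phi> (t + s) \<partial>lborel)) q
        \<le> ennreal (k powr (q - 1)) * (\<integral>\<^sup>+s. w s * \<psi> ((1 + s) * t) \<partial>lborel)" unfolding \<psi>_def .
    qed
    then have "(\<integral>\<^sup>+t. epowr (ennreal (t powr a) * (\<integral>\<^sup>+s. indicator {0<..} s * ennreal (s powr (\<beta> - 1)) * \<phi> (t + s) \<partial>lborel)) q \<partial>haar)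
      \<le> (\<integral>\<^sup>+t. ennreal (k powr (q - 1)) * (\<integral>\<^sup>+s. w s * \<psi> ((1 + s) * t) \<partial>lborel) \<partial>haar)"
      by (rule nn_integral_mono_AE)
    also have "\<dots> = ennreal (k powr (q - 1)) * (\<integral>\<^sup>+t. \<integral>\<^sup>+s. w s * \<psi> ((1 + s) * t) \<partial>lborel \<partial>haar)"
      by (rule nn_integral_cmult) measurable
    also have "(\<integral>\<^sup>+t. \<integral>\<^sup>+s. w s * \<psi> ((1 + s) * t) \<partial>lborel \<partial>haar) = (\<integral>\<^sup>+s. \<integral>\<^sup>+t. w s * \<psi> ((1 + s) * t) \<partial>haar \<partial>lborel)"
    proof -
      interpret P: pair_sigma_finite lborel haar ..
      show ?thesis by (rule P.Fubini') measurable
    qed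
    also have "\<dots> = (\<integral>\<^sup>+s. w s * (\<integral>\<^sup>+r. \<psi> r \<partial>haar) \<partial>lborel)"
    proof (rule nn_integral_cong)
      fix s :: real
      show "(\<integral>\<^sup>+t. w s * \<psi> ((1 + s) * t) \<partial>haar) = w s * (\<integral>\<^sup>+r. \<psi> r \<partial>haar)"
        by (cases "0 < s") (auto simp: nn_integral_cmult nn_integral_haar_scale w_def)
    qed
    also have "\<dots> = (\<integral>\<^sup>+s. w s \<partial>lborel) * (\<integral>\<^sup>+r. \<psi> r \<partial>haar)" by (rule nn_integral_multc) measurable
    also have "ennreal (k powr (q - 1)) * \<dots> \<le> ennreal (k powr (q - 1)) * (ennreal k * (\<integral>\<^sup>+r. \<psi> r \<partial>haar))"
      by (intro mult_left_mono mult_right_mono k) auto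
    also have "\<dots> = ennreal (k powr (q - 1) * k) * (\<integral>\<^sup>+r. \<psi> r \<partial>haar)"
      using k by (simp add: ennreal_mult mult.assoc)
    finally show ?thesis unfolding \<psi>_def .
  qed
  show ?thesis by (rule that[of "k powr (q - 1) * k"]) (use k main in auto)
qed

definition tl_profile :: "nat \<Rightarrow> real \<Rightarrow> (real ^ 'd \<Rightarrow> real) \<Rightarrow> real \<Rightarrow> real ^ 'd \<Rightarrow> ennreal" where
  "tl_profile k \<alpha> f t x = ennreal (t powr (real k - \<alpha>)) * absf (poisson_deriv k t f) x"

lemma measurable_tl_profile [measurable]:
  assumes [measurable]: "f \<in> borel_measurable borel"
  shows "(\<lambda>(t, x). tl_profile k \<alpha> f t x) \<in> borel_measurable (borel \<Otimes>\<^sub>M borel)"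
  unfolding tl_profile_def by measurable

text \<open>Off the null set where \<open>avg_op 1\<close> is infinite the iterated
  \<open>deriv\<close> is \<open>poisson_deriv\<close>, with which all later estimates work.\<close>

lemma tl_seminorm_eq:
  assumes p: "1 \<le> p" and q: "0 < q" and f: "f \<in> gLp p"
  shows "tl_seminorm k \<alpha> p q f = epowr (vec_norm haar p q (tl_profile k \<alpha> f)) (1 / p)"
proof -
  have [measurable]: "f \<in> borel_measurable borel" using f by (rule gLp_measurable)
  have "(\<integral>\<^sup>+x. epowr (epowr (\<integral>\<^sup>+ t\<in>{0<..}. ennreal ((t powr (real k - \<alpha>) * \<bar>(deriv ^^ k) (\<lambda>s. poisson_hermite s f x) t\<bar>) powr q / t) \<partial>lborel) (1 / q)) p \<partial>gauss_measure)
    = vec_norm haar p q (tl_profile k \<alpha> f)"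
    unfolding vec_norm_def
  proof (rule nn_integral_cong_AE)
    show "AE x in gauss_measure. epowr (epowr (\<integral>\<^sup>+ t\<in>{0<..}. ennreal ((t powr (real k - \<alpha>) * \<bar>(deriv ^^ k) (\<lambda>s. poisson_hermite s f x) t\<bar>) powr q / t) \<partial>lborel) (1 / q)) p
       = epowr (\<integral>\<^sup>+t. epowr (tl_profile k \<alpha> f t x) q \<partial>haar) (p / q)"
      using AE_avg_op_finite[OF p f]
    proof eventually_elim
      case (elim x)
      have "(\<integral>\<^sup>+t. epowr (tl_profile k \<alpha> f t x) q \<partial>haar) = (\<integral>\<^sup>+t. indicator {0<..} t * ennreal (1 / t) * epowr (tl_profile k \<alpha> f t x) q \<partial>lborel)"
        by (rule nn_integral_haar) measurable
      also have "\<dots> = (\<integral>\<^sup>+ t\<in>{0<..}. ennreal ((t powr (real k - \<alpha>) * \<bar>(deriv ^^ k) (\<lambda>s. poisson_hermite s f x) t\<bar>) powr q / t) \<partial>lborel)"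
      proof (rule nn_integral_cong)
        fix t :: real
        show "indicator {0<..} t * ennreal (1 / t) * epowr (tl_profile k \<alpha> f t x) q =
          ennreal ((t powr (real k - \<alpha>) * \<bar>(deriv ^^ k) (\<lambda>s. poisson_hermite s f x) t\<bar>) powr q / t) * indicator {0<..} t"
        proof (cases "0 < t")
          case True
          have "tl_profile k \<alpha> f t x = ennreal (t powr (real k - \<alpha>) * \<bar>poisson_deriv k t f x\<bar>)"
            by (simp add: tl_profile_def ennreal_mult)
          then show ?thesis using True higher_deriv_poisson[OF _ elim True, of k]
            by (simp add: ennreal_mult[symmetric] del: ennreal_mult')
        qed simp
      qed
      finally show ?case by (simp add: epowr_epowr)
    qed
  qed
  then show ?thesis unfolding tl_seminorm_def gLp_norm_def by simp
qed

lemma avg_op_cmult: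
  assumes [measurable]: "g \<in> borel_measurable borel"
  shows "avg_op t (\<lambda>y. c * g y) x = c * avg_op t g x"
  unfolding avg_op_def by (subst nn_integral_cmult[symmetric]) (auto simp: nnT_cmult mult_ac)

text \<open>Half of the time carries the first \<open>k\<close> derivatives, the other half the
  remaining \<open>m - k\<close>, which cost the factor \<open>(t / 2)^(-(m-k))\<close>. Writing
  \<open>t\<close> as \<open>2 (t / 2)\<close> in the weight produces
  \<open>2^(m-\<alpha>)\<close>.\<close>

lemma tl_profile_raise:
  fixes \<alpha> p :: real
  assumes p: "1 \<le> p" and km: "k \<le> m"
  obtains C where "0 \<le> C" "\<And>(f :: real ^ 'd \<Rightarrow> real) t. f \<in> gLp p \<Longrightarrow> 0 < t \<Longrightarrow>
    AE x in gauss_measure. tl_profile m \<alpha> f t x \<le> ennreal C * avg_op (t / 2) (tl_profile k \<alpha> f (t / 2)) x"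
proof -
  define j where "j = m - k"
  have m: "m = j + k" using km by (simp add: j_def)
  obtain C where C: "0 \<le> C" "\<And>t (f :: real ^ 'd \<Rightarrow> real) x. 0 < t \<Longrightarrow> f \<in> borel_measurable borel \<Longrightarrow>
       absf (poisson_deriv j t f) x \<le> ennreal (C / t ^ j) * avg_op t (absf f) x" using poisson_deriv_bound by blast
  let ?C = "2 powr (real m - \<alpha>) * C"
  have "AE x in gauss_measure. tl_profile m \<alpha> f t x \<le> ennreal ?C * avg_op (t / 2) (tl_profile k \<alpha> f (t / 2)) x"
    if f: "f \<in> gLp p" and t: "0 < t" for f :: "real ^ 'd \<Rightarrow> real" and t
  proof -
    have [measurable]: "f \<in> borel_measurable borel" using f by (rule gLp_measurable)
    have t2: "0 < t / 2" using t by simp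
    have "AE x in gauss_measure. poisson_deriv (j + k) (t / 2 + t / 2) f x = poisson_deriv j (t / 2) (poisson_deriv k (t / 2) f) x"
      by (rule poisson_deriv_semigroup[OF p f t2 t2])
    then show ?thesis
    proof eventually_elim
      case (elim x)
      let ?h = "poisson_deriv k (t / 2) f"
      have "tl_profile m \<alpha> f t x = ennreal (t powr (real m - \<alpha>)) * absf (poisson_deriv j (t / 2) ?h) x"
        using elim by (simp add: tl_profile_def m)
      also have "\<dots> \<le> ennreal (t powr (real m - \<alpha>)) * (ennreal (C / (t / 2) ^ j) * avg_op (t / 2) (absf ?h) x)"
        by (intro mult_left_mono C t2) auto
      also have "\<dots> = ennreal ?C * (ennreal ((t / 2) powr (real k - \<alpha>)) * avg_op (t / 2) (absf ?h) x)"
      proof -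
        have "t powr (real m - \<alpha>) = 2 powr (real m - \<alpha>) * (t / 2) powr (real m - \<alpha>)"
          using t by (simp add: powr_divide)
        also have "(t / 2) powr (real m - \<alpha>) = (t / 2) powr (real k - \<alpha>) * (t / 2) ^ j"
          using t2 by (simp add: powr_realpow[symmetric] powr_add[symmetric] m algebra_simps)
        finally have "t powr (real m - \<alpha>) * (C / (t / 2) ^ j) = ?C * (t / 2) powr (real k - \<alpha>)"
          using t by simp
        then have "ennreal (t powr (real m - \<alpha>)) * ennreal (C / (t / 2) ^ j) = ennreal ?C * ennreal ((t / 2) powr (real k - \<alpha>))"
          using C t by (simp add: ennreal_mult[symmetric])
        then show ?thesis by (simp only: mult.assoc[symmetric])
      qed
      also have "\<dots> = ennreal ?C * avg_op (t / 2) (tl_profile k \<alpha> f (t / 2)) x"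
        unfolding tl_profile_def[abs_def] by (subst avg_op_cmult) auto
      finally show ?case .
    qed
  qed
  then show ?thesis using that[of ?C] C by auto
qed

text \<open>On \<open>hermite \<nu>\<close> the right-hand side is a Gamma integral of
  \<open>exp (- s sqrt |\<nu>|)\<close>, which produces the factor
  \<open>|\<nu>|^(-\<beta>/2)\<close>. The condition \<open>\<beta> < m\<close> makes the weight
  \<open>s^(\<beta>-1) (t + s)^(-m)\<close> integrable, so that this side is a bounded operator and
  uniqueness applies.\<close>

lemma poisson_deriv_riesz:
  fixes f :: "real ^ 'd \<Rightarrow> real"
  assumes p: "1 < p" and \<beta>: "0 < \<beta>" "\<beta> < real m" and t: "0 < t"
    and J: "is_riesz_extension p \<beta> J" and f: "f \<in> gLp p"
  shows "AE x in gauss_measure. poisson_deriv m t (J f) x =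
     (\<integral>s. indicator {0<..} s * (s powr (\<beta> - 1) / Gamma \<beta> * poisson_deriv m (t + s) f x) \<partial>lborel)"
proof -
  have p1: "0 < p" "1 \<le> p" using p by auto
  have G: "0 < Gamma \<beta>" using \<beta> by (intro Gamma_real_pos)
  have m0: "m \<noteq> 0" using \<beta> by auto
  have bJ: "lp_bounded p J" and hJ: "\<And>\<nu>. AE x in gauss_measure. J (hermite \<nu>) x =
          (if mi_abs \<nu> = 0 then 0 else real (mi_abs \<nu>) powr (- \<beta> / 2) * hermite \<nu> x)"
    using J p1 by (auto simp: is_riesz_extension_iff)
  define Q where "Q s f x = indicator {0<..} s * (s powr (\<beta> - 1) / Gamma \<beta> * poisson_deriv m (t + s) f x)" for s x and f :: "real ^ 'd \<Rightarrow> real"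
  obtain C where C: "0 \<le> C" "\<And>t (f :: real ^ 'd \<Rightarrow> real) x. 0 < t \<Longrightarrow> f \<in> borel_measurable borel \<Longrightarrow>
       absf (poisson_deriv m t f) x \<le> ennreal (C / t ^ m) * avg_op t (absf f) x" using poisson_deriv_bound by blast
  define w where "w s = ennreal (C / Gamma \<beta>) * (indicator {0<..} s * ennreal (s powr (\<beta> - 1) * (t + s) powr - real m))" for s
  have [measurable]: "w \<in> borel_measurable borel" unfolding w_def by measurable
  have "(\<integral>\<^sup>+s. w s \<partial>lborel) < top"
    unfolding w_def using nn_integral_beta_weight_finite[OF \<beta> t]
    by (subst nn_integral_cmult) (auto simp: ennreal_mult_less_top)
  then obtain k where k: "0 < k" "(\<integral>\<^sup>+s. w s \<partial>lborel) \<le> ennreal k" using ennreal_le_real by blast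
  have bQ: "lp_bounded p (\<lambda>f x. \<integral>s. Q s f x \<partial>lborel)"
  proof (rule lp_bounded_integral[where C = "k powr p * 6 powr p"])
    show "sigma_finite_measure (lborel :: real measure)" by (rule lborel.sigma_finite_measure_axioms)
    show "0 < p" "0 \<le> k powr p * 6 powr p" using p1 by auto
    fix f :: "real ^ 'd \<Rightarrow> real" assume f: "f \<in> gLp p"
    have [measurable]: "f \<in> borel_measurable borel" using f by (rule gLp_measurable)
    show "(\<lambda>(s, x). Q s f x) \<in> borel_measurable (lborel \<Otimes>\<^sub>M borel)" unfolding Q_def by measurable
    have "lp_int p (\<lambda>x. \<integral>\<^sup>+s. ennreal \<bar>Q s f x\<bar> \<partial>lborel) \<le> lp_int p (\<lambda>x. \<integral>\<^sup>+s. w s * avg_op (t + s) (absf f) x \<partial>lborel)"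
    proof (intro lp_int_mono p1 nn_integral_mono)
      fix x s
      show "ennreal \<bar>Q s f x\<bar> \<le> w s * avg_op (t + s) (absf f) x"
      proof (cases "0 < s")
        case True
        have "ennreal \<bar>Q s f x\<bar> = ennreal (s powr (\<beta> - 1) / Gamma \<beta>) * absf (poisson_deriv m (t + s) f) x"
          using True G by (simp add: Q_def abs_mult ennreal_mult[symmetric])
        also have "\<dots> \<le> ennreal (s powr (\<beta> - 1) / Gamma \<beta>) * (ennreal (C / (t + s) ^ m) * avg_op (t + s) (absf f) x)"
          using True t by (intro mult_left_mono C) auto
        also have "\<dots> = w s * avg_op (t + s) (absf f) x"
          using True t G C unfolding w_def mult.assoc[symmetric]
          by (simp add: ennreal_mult[symmetric] powr_minus powr_realpow divide_inverse) (simp add: mult_ac)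
        finally show ?thesis .
      qed (simp add: Q_def)
    qed
    also have "\<dots> \<le> ennreal (k powr p) * (ennreal (6 powr p) * lp_int p (absf f))"
    proof (rule Minkowski_weighted[OF lborel.sigma_finite_measure_axioms p1(2) k(1)])
      show "lp_int p (avg_op (t + s) (absf f)) \<le> ennreal (6 powr p) * lp_int p (absf f)" for s
        unfolding lp_int_def by (rule avg_op_bounded[OF _ p1(2)]) measurable
    qed (use k in auto)
    finally show "lp_int p (\<lambda>x. \<integral>\<^sup>+s. ennreal \<bar>Q s f x\<bar> \<partial>lborel) \<le> ennreal (k powr p * 6 powr p) * lp_int p (absf f)"
      by (simp add: ennreal_mult mult.assoc)
  next
    fix f g :: "real ^ 'd \<Rightarrow> real" and a c s assume f: "f \<in> gLp p" and g: "g \<in> gLp p"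
    show "AE x in gauss_measure. Q s (\<lambda>y. a * f y + c * g y) x = a * Q s f x + c * Q s g x"
    proof (cases "0 < s")
      case True
      then have "0 < t + s" using t by simp
      from poisson_deriv_lincomb_AE[OF p1(2) f g this, of m a c] show ?thesis
        by eventually_elim (simp add: Q_def algebra_simps)
    qed (simp add: Q_def)
  qed
  have "AE x in gauss_measure. poisson_deriv m t (J f) x = (\<integral>s. Q s f x \<partial>lborel)"
  proof (rule lp_bounded_unique[OF _ bQ p1(1) _ f])
    show "lp_bounded p (\<lambda>f. poisson_deriv m t (J f))"
      by (rule lp_bounded_compose[OF lp_bounded_poisson_deriv[OF p1(2) t] bJ p1(1)])
    fix \<nu> :: "'d \<Rightarrow> nat"
    let ?n = "real (mi_abs \<nu>)"
    define c where "c = (if mi_abs \<nu> = 0 then 0 else ?n powr (- \<beta> / 2))"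
    have h: "hermite \<nu> \<in> gLp p" by (rule hermite_gLp[OF p1(1)])
    then have Jh: "J (hermite \<nu>) \<in> gLp p" using bJ by (auto simp: lp_bounded_def)
    have "AE x in gauss_measure. J (hermite \<nu>) x = c * hermite \<nu> x + 0 * hermite \<nu> x"
      using hJ[of \<nu>] by eventually_elim (simp add: c_def)
    then have "AE x in gauss_measure. poisson_deriv m t (J (hermite \<nu>)) x = poisson_deriv m t (\<lambda>y. c * hermite \<nu> y + 0 * hermite \<nu> y) x"
      by (rule lp_bounded_cong[OF lp_bounded_poisson_deriv[OF p1(2) t] p1(1) Jh gLp_lincomb[OF p1(1) h h]])
    then show "AE x in gauss_measure. poisson_deriv m t (J (hermite \<nu>)) x = (\<integral>s. Q s (hermite \<nu>) x \<partial>lborel)"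
    proof eventually_elim
      case (elim x)
      have l: "poisson_deriv m t (J (hermite \<nu>)) x = (- sqrt ?n) ^ m * exp (- (sqrt ?n * t)) * (c * hermite \<nu> x)"
        using elim poisson_deriv_hermite[OF t, of m c \<nu> x] by simp
      have "(\<integral>s. Q s (hermite \<nu>) x \<partial>lborel) = (\<integral>s. ((- sqrt ?n) ^ m * exp (- (sqrt ?n * t)) * hermite \<nu> x / Gamma \<beta>) * (indicator {0<..} s * (s powr (\<beta> - 1) * exp (- (sqrt ?n * s)))) \<partial>lborel)"
      proof (rule Bochner_Integration.integral_cong[OF refl])
        fix s :: real
        have ex: "exp (- (sqrt ?n * (t + s))) = exp (- (sqrt ?n * t)) * exp (- (sqrt ?n * s))"
          unfolding exp_add[symmetric] by (simp add: algebra_simps)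
        show "Q s (hermite \<nu>) x = ((- sqrt ?n) ^ m * exp (- (sqrt ?n * t)) * hermite \<nu> x / Gamma \<beta>) * (indicator {0<..} s * (s powr (\<beta> - 1) * exp (- (sqrt ?n * s))))"
          using t poisson_deriv_hermite[of "t + s" m 1 \<nu> x] unfolding ex by (cases "0 < s") (auto simp: Q_def)
      qed
      also have "\<dots> = ((- sqrt ?n) ^ m * exp (- (sqrt ?n * t)) * hermite \<nu> x) * c"
      proof (cases "mi_abs \<nu> = 0")
        \<comment> \<open>In degree 0 the eigenvalue 0 to the positive power \<open>m\<close>
          vanishes, in accordance with \<open>c = 0\<close>.\<close>
        case True then show ?thesis using m0 by (simp add: c_def)
      next
        case False
        then have "0 < sqrt ?n" by simp
        from has_bochner_integral_Gamma[OF \<beta>(1) this]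
        have "(\<integral>s. indicator {0<..} s * (s powr (\<beta> - 1) * exp (- (sqrt ?n * s))) \<partial>lborel) = Gamma \<beta> * sqrt ?n powr - \<beta>"
          by (simp add: has_bochner_integral_iff)
        moreover have "sqrt ?n powr - \<beta> = c" using False by (simp add: c_def powr_half_sqrt[symmetric] powr_powr)
        ultimately show ?thesis using G by (subst integral_mult_right_zero) simp
      qed
      finally show ?case using l by simp
    qed
  qed
  then show ?thesis unfolding Q_def .
qed

section \<open>Boundedness of the Riesz potential\<close>

lemma riesz_seminorm_bound:
  fixes p q \<alpha> \<beta> :: real
  assumes p: "1 < p" and q: "1 \<le> q" and \<beta>: "0 < \<beta>" and m: "\<alpha> + \<beta> < real m" and \<alpha>: "0 \<le> \<alpha>" and km: "k \<le> m"
    and J: "is_riesz_extension p \<beta> J"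
  obtains C where "0 \<le> C" "\<And>f :: real ^ 'd \<Rightarrow> real. f \<in> gLp p \<Longrightarrow>
    tl_seminorm m (\<alpha> + \<beta>) p q (J f) \<le> ennreal C * tl_seminorm k \<alpha> p q f"
proof -
  have p1: "0 < p" "1 \<le> p" and q0: "0 < q" using p q by auto
  have \<beta>m: "\<beta> < real m" using m \<alpha> by simp
  have G: "0 < Gamma \<beta>" using \<beta> by (intro Gamma_real_pos)
  \<comment> \<open>With this \<open>a\<close>, Hardy's inequality exchanges the weight
    \<open>t^(m-\<alpha>-\<beta>)\<close> for \<open>t^(m-\<alpha>)\<close>, which is the gain of
    \<open>\<beta>\<close> in smoothness.\<close>
  define a where "a = real m - (\<alpha> + \<beta>)"
  have a: "0 < a" "a + \<beta> = real m - \<alpha>" using m by (auto simp: a_def)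
  obtain H where H: "0 \<le> H" "\<And>\<phi> :: real \<Rightarrow> ennreal. \<phi> \<in> borel_measurable borel \<Longrightarrow>
    (\<integral>\<^sup>+t. epowr (ennreal (t powr a) * (\<integral>\<^sup>+s. indicator {0<..} s * ennreal (s powr (\<beta> - 1)) * \<phi> (t + s) \<partial>lborel)) q \<partial>haar)
    \<le> ennreal H * (\<integral>\<^sup>+r. epowr (ennreal (r powr (a + \<beta>)) * \<phi> r) q \<partial>haar)"
    using Hardy_inequality[OF a(1) \<beta> q] by blast
  obtain R where R: "0 \<le> R" "\<And>(f :: real ^ 'd \<Rightarrow> real) t. f \<in> gLp p \<Longrightarrow> 0 < t \<Longrightarrow>
    AE x in gauss_measure. tl_profile m \<alpha> f t x \<le> ennreal R * avg_op (t / 2) (tl_profile k \<alpha> f (t / 2)) x"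
    using tl_profile_raise[OF p1(2) km] by blast
  obtain V where V: "0 \<le> V" "\<And>\<mu> (G :: real \<Rightarrow> real ^ 'd \<Rightarrow> ennreal). time_measure \<mu> \<Longrightarrow>
    (\<lambda>(t, x). G t x) \<in> borel_measurable (borel \<Otimes>\<^sub>M borel) \<Longrightarrow>
    vec_norm \<mu> p q (\<lambda>t. avg_op t (G t)) \<le> ennreal V * vec_norm \<mu> p q G"
    using vector_avg[OF p q] by blast
  define K where "K = (1 / Gamma \<beta>) powr q * H * R powr q"
  have K: "0 \<le> K" using H by (simp add: K_def)
  define C where "C = (K powr (p / q) * V) powr (1 / p)"
  have "tl_seminorm m (\<alpha> + \<beta>) p q (J f) \<le> ennreal C * tl_seminorm k \<alpha> p q f" if f: "f \<in> gLp p" for f :: "real ^ 'd \<Rightarrow> real"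
  proof -
    have Jf: "J f \<in> gLp p" using J f p1 by (auto simp: is_riesz_extension_iff lp_bounded_def)
    have [measurable]: "f \<in> borel_measurable borel" "J f \<in> borel_measurable borel" using f Jf by (auto simp: gLp_iff)
    let ?I = "\<lambda>t x. \<integral>s. indicator {0<..} s * (s powr (\<beta> - 1) / Gamma \<beta> * poisson_deriv m (t + s) f x) \<partial>lborel"
    have "AE t in haar. AE x in gauss_measure. poisson_deriv m t (J f) x = ?I t x"
      by (rule AE_haarI) (rule poisson_deriv_riesz[OF p \<beta> \<beta>m _ J f])
    \<comment> \<open>The exceptional sets depend on \<open>t\<close>; Fubini exchanges the
      quantifiers, so that for almost every \<open>x\<close> the identity holds for almost every
      \<open>t\<close>.\<close>
    then have AE1: "AE x in gauss_measure. AE t in haar. poisson_deriv m t (J f) x = ?I t x"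
      by (subst (asm) haar.tg.AE_commute) measurable
    have "AE t in haar. AE x in gauss_measure. tl_profile m \<alpha> f t x \<le> ennreal R * avg_op (t / 2) (tl_profile k \<alpha> f (t / 2)) x"
      by (intro AE_haarI R f)
    then have AE2: "AE x in gauss_measure. AE t in haar. tl_profile m \<alpha> f t x \<le> ennreal R * avg_op (t / 2) (tl_profile k \<alpha> f (t / 2)) x"
      by (subst (asm) haar.tg.AE_commute) measurable
    have pointwise: "AE x in gauss_measure. (\<integral>\<^sup>+t. epowr (tl_profile m (\<alpha> + \<beta>) (J f) t x) q \<partial>haar) \<le>
       ennreal K * (\<integral>\<^sup>+t. epowr (avg_op t (tl_profile k \<alpha> f t) x) q \<partial>haar)"
      using AE1 AE2
    proof eventually_elim
      case (elim x)
      define \<phi> where "\<phi> r = absf (poisson_deriv m r f) x" for r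
      have [measurable]: "\<phi> \<in> borel_measurable borel" unfolding \<phi>_def by measurable
      have "(\<integral>\<^sup>+t. epowr (tl_profile m (\<alpha> + \<beta>) (J f) t x) q \<partial>haar) \<le>
         (\<integral>\<^sup>+t. ennreal ((1 / Gamma \<beta>) powr q) * epowr (ennreal (t powr a) * (\<integral>\<^sup>+s. indicator {0<..} s * ennreal (s powr (\<beta> - 1)) * \<phi> (t + s) \<partial>lborel)) q \<partial>haar)"
      proof (rule nn_integral_mono_AE)
        show "AE t in haar. epowr (tl_profile m (\<alpha> + \<beta>) (J f) t x) q \<le>
           ennreal ((1 / Gamma \<beta>) powr q) * epowr (ennreal (t powr a) * (\<integral>\<^sup>+s. indicator {0<..} s * ennreal (s powr (\<beta> - 1)) * \<phi> (t + s) \<partial>lborel)) q"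
          using elim(1)
        proof eventually_elim
          case (elim t)
          let ?g = "\<lambda>s. indicator {0<..} s * (s powr (\<beta> - 1) / Gamma \<beta> * poisson_deriv m (t + s) f x)"
          have "absf (poisson_deriv m t (J f)) x \<le> (\<integral>\<^sup>+s. ennreal \<bar>?g s\<bar> \<partial>lborel)"
            unfolding elim
          proof (cases "integrable lborel ?g")
            case True from integral_norm_bound_ennreal[OF this] show "ennreal \<bar>\<integral>s. ?g s \<partial>lborel\<bar> \<le> (\<integral>\<^sup>+s. ennreal \<bar>?g s\<bar> \<partial>lborel)" by simp
          next
            case False
            then have "(\<integral>s. ?g s \<partial>lborel) = 0" by (rule not_integrable_integral_eq)
            then show "ennreal \<bar>\<integral>s. ?g s \<partial>lborel\<bar> \<le> (\<integral>\<^sup>+s. ennreal \<bar>?g s\<bar> \<partial>lborel)" by (simp only: abs_zero ennreal_0 zero_le)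
          qed
          also have "\<dots> = (\<integral>\<^sup>+s. ennreal (1 / Gamma \<beta>) * (indicator {0<..} s * ennreal (s powr (\<beta> - 1)) * \<phi> (t + s)) \<partial>lborel)"
            using G by (intro nn_integral_cong) (auto simp: \<phi>_def indicator_def abs_mult ennreal_mult[symmetric])
          also have "\<dots> = ennreal (1 / Gamma \<beta>) * (\<integral>\<^sup>+s. indicator {0<..} s * ennreal (s powr (\<beta> - 1)) * \<phi> (t + s) \<partial>lborel)"
            by (rule nn_integral_cmult) measurable
          finally have "tl_profile m (\<alpha> + \<beta>) (J f) t x \<le> ennreal (t powr a) * (ennreal (1 / Gamma \<beta>) * (\<integral>\<^sup>+s. indicator {0<..} s * ennreal (s powr (\<beta> - 1)) * \<phi> (t + s) \<partial>lborel))"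
            unfolding tl_profile_def a_def by (intro mult_left_mono) auto
          then have "tl_profile m (\<alpha> + \<beta>) (J f) t x \<le> ennreal (1 / Gamma \<beta>) * (ennreal (t powr a) * (\<integral>\<^sup>+s. indicator {0<..} s * ennreal (s powr (\<beta> - 1)) * \<phi> (t + s) \<partial>lborel))"
            by (simp only: mult_ac)
          then have "epowr (tl_profile m (\<alpha> + \<beta>) (J f) t x) q \<le> epowr (ennreal (1 / Gamma \<beta>) * (ennreal (t powr a) * (\<integral>\<^sup>+s. indicator {0<..} s * ennreal (s powr (\<beta> - 1)) * \<phi> (t + s) \<partial>lborel))) q"
            by (rule epowr_mono[OF q0])
          then show ?case using G epowr_mult[OF q0, of "ennreal (1 / Gamma \<beta>)"] by simp
        qed
      qed
      also have "\<dots> = ennreal ((1 / Gamma \<beta>) powr q) * (\<integral>\<^sup>+t. epowr (ennreal (t powr a) * (\<integral>\<^sup>+s. indicator {0<..} s * ennreal (s powr (\<beta> - 1)) * \<phi> (t + s) \<partial>lborel)) q \<partial>haar)"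
        by (rule nn_integral_cmult) measurable
      also have "\<dots> \<le> ennreal ((1 / Gamma \<beta>) powr q) * (ennreal H * (\<integral>\<^sup>+r. epowr (ennreal (r powr (a + \<beta>)) * \<phi> r) q \<partial>haar))"
        by (intro mult_left_mono H) auto
      also have "(\<integral>\<^sup>+r. epowr (ennreal (r powr (a + \<beta>)) * \<phi> r) q \<partial>haar) = (\<integral>\<^sup>+r. epowr (tl_profile m \<alpha> f r x) q \<partial>haar)"
        unfolding tl_profile_def \<phi>_def a(2) ..
      also have "ennreal ((1 / Gamma \<beta>) powr q) * (ennreal H * (\<integral>\<^sup>+r. epowr (tl_profile m \<alpha> f r x) q \<partial>haar)) \<le>
         ennreal ((1 / Gamma \<beta>) powr q) * (ennreal H * (\<integral>\<^sup>+r. ennreal (R powr q) * epowr (avg_op (1/2 * r) (tl_profile k \<alpha> f (1/2 * r)) x) q \<partial>haar))"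
      proof (intro mult_left_mono nn_integral_mono_AE)
        show "AE r in haar. epowr (tl_profile m \<alpha> f r x) q \<le> ennreal (R powr q) * epowr (avg_op (1/2 * r) (tl_profile k \<alpha> f (1/2 * r)) x) q"
          using elim(2)
        proof eventually_elim
          case (elim r)
          from epowr_mono[OF q0 elim] show ?case using q0 R(1) by (simp add: epowr_mult)
        qed
      qed auto
      also have "(\<integral>\<^sup>+r. ennreal (R powr q) * epowr (avg_op (1/2 * r) (tl_profile k \<alpha> f (1/2 * r)) x) q \<partial>haar) = 
          ennreal (R powr q) * (\<integral>\<^sup>+r. epowr (avg_op (1/2 * r) (tl_profile k \<alpha> f (1/2 * r)) x) q \<partial>haar)"
        by (rule nn_integral_cmult) measurable
      \<comment> \<open>Dilation invariance undoes the halving of the time.\<close>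
      also have "(\<integral>\<^sup>+r. epowr (avg_op (1/2 * r) (tl_profile k \<alpha> f (1/2 * r)) x) q \<partial>haar) = (\<integral>\<^sup>+r. epowr (avg_op r (tl_profile k \<alpha> f r) x) q \<partial>haar)"
        by (rule nn_integral_haar_scale) auto
      also have "ennreal ((1 / Gamma \<beta>) powr q) * (ennreal H * (ennreal (R powr q) * (\<integral>\<^sup>+r. epowr (avg_op r (tl_profile k \<alpha> f r) x) q \<partial>haar))) = ennreal K * (\<integral>\<^sup>+r. epowr (avg_op r (tl_profile k \<alpha> f r) x) q \<partial>haar)"
        unfolding K_def using H by (simp add: ennreal_mult mult.assoc)
      finally show ?case .
    qed
    have "vec_norm haar p q (tl_profile m (\<alpha> + \<beta>) (J f)) \<le> (\<integral>\<^sup>+x. ennreal (K powr (p / q)) * epowr (\<integral>\<^sup>+t. epowr (avg_op t (tl_profile k \<alpha> f t) x) q \<partial>haar) (p / q) \<partial>gauss_measure)"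
      unfolding vec_norm_def
    proof (rule nn_integral_mono_AE)
      have pq: "0 < p / q" using p1 q0 by simp
      show "AE x in gauss_measure. epowr (\<integral>\<^sup>+t. epowr (tl_profile m (\<alpha> + \<beta>) (J f) t x) q \<partial>haar) (p / q) \<le>
          ennreal (K powr (p / q)) * epowr (\<integral>\<^sup>+t. epowr (avg_op t (tl_profile k \<alpha> f t) x) q \<partial>haar) (p / q)"
        using pointwise
      proof eventually_elim
        case (elim x)
        from epowr_mono[OF pq elim] show ?case unfolding epowr_mult[OF pq] epowr_ennreal[OF K] .
      qed
    qed
    also have "\<dots> = ennreal (K powr (p / q)) * vec_norm haar p q (\<lambda>t. avg_op t (tl_profile k \<alpha> f t))"
      unfolding vec_norm_def by (rule nn_integral_cmult) measurable
    also have "\<dots> \<le> ennreal (K powr (p / q)) * (ennreal V * vec_norm haar p q (tl_profile k \<alpha> f))"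
      by (intro mult_left_mono V haar.time_measure_axioms) auto
    also have "\<dots> = ennreal (K powr (p / q) * V) * vec_norm haar p q (tl_profile k \<alpha> f)"
      using V by (simp add: ennreal_mult mult.assoc)
    finally have "epowr (vec_norm haar p q (tl_profile m (\<alpha> + \<beta>) (J f))) (1 / p) \<le> epowr (ennreal (K powr (p / q) * V) * vec_norm haar p q (tl_profile k \<alpha> f)) (1 / p)"
      using p1 by (intro epowr_mono) auto
    also have "\<dots> = ennreal C * epowr (vec_norm haar p q (tl_profile k \<alpha> f)) (1 / p)"
      using p1 V by (simp add: epowr_mult C_def)
    finally show ?thesis by (simp only: tl_seminorm_eq[OF p1(2) q0 f] tl_seminorm_eq[OF p1(2) q0 Jf])
  qed
  then show ?thesis using that[of C] by (auto simp: C_def)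
qed

theorem theorem2p1:
  fixes \<alpha> \<beta> p q :: real
  assumes "\<alpha> \<ge> 0" and "\<beta> > 0" and "1 < p" and "1 \<le> q"
  shows "(\<forall>f :: real ^ 'd \<Rightarrow> real. f \<in> tl_space \<alpha> p q \<longrightarrow>
            riesz_potential p \<beta> f \<in> tl_space (\<alpha> + \<beta>) p q) \<and>
         (\<exists>C::real. C \<ge> 0 \<and> (\<forall>f :: real ^ 'd \<Rightarrow> real. f \<in> tl_space \<alpha> p q \<longrightarrow>
            tl_norm (\<alpha> + \<beta>) p q (riesz_potential p \<beta> f) \<le> ennreal C * tl_norm \<alpha> p q f))"
proof -
  let ?J = "riesz_potential p \<beta> :: (real ^ 'd \<Rightarrow> real) \<Rightarrow> real ^ 'd \<Rightarrow> real"
  define k where "k = (LEAST k. \<alpha> < real k)"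
  define m where "m = (LEAST m. \<alpha> + \<beta> < real m)"
  have "\<exists>m :: nat. \<alpha> + \<beta> < real m" by (rule reals_Archimedean2)
  then have m: "\<alpha> + \<beta> < real m" unfolding m_def by (rule LeastI_ex)
  \<comment> \<open>Since \<open>\<beta> > 0\<close>, the order of differentiation is not lowered,
    as \<open>tl_profile_raise\<close> demands.\<close>
  have km: "k \<le> m" unfolding k_def by (rule Least_le) (use m assms in simp)
  \<comment> \<open>The operator is a choice, so its properties rest on the existence of an
    extension; the estimates above hold for an arbitrary one.\<close>
  have J: "is_riesz_extension p \<beta> ?J"
    unfolding riesz_potential_def by (rule someI_ex[OF riesz_extension_exists[OF assms(3,2)]])
  obtain C1 where C1: "0 \<le> C1" "\<And>f. f \<in> gLp p \<Longrightarrow> gLp_norm p (absf (?J f)) \<le> ennreal C1 * gLp_norm p (absf f)"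
    using J unfolding is_riesz_extension_def by blast
  obtain C2 where C2: "0 \<le> C2" "\<And>f. f \<in> gLp p \<Longrightarrow> tl_seminorm m (\<alpha> + \<beta>) p q (?J f) \<le> ennreal C2 * tl_seminorm k \<alpha> p q f"
    using riesz_seminorm_bound[OF assms(3,4,2) m assms(1) km J] by blast
  define C where "C = max C1 C2"
  have bound: "tl_norm (\<alpha> + \<beta>) p q (?J f) \<le> ennreal C * tl_norm \<alpha> p q f" if f: "f \<in> gLp p" for f
  proof -
    have "tl_norm (\<alpha> + \<beta>) p q (?J f) \<le> ennreal C1 * gLp_norm p (absf f) + ennreal C2 * tl_seminorm k \<alpha> p q f"
      unfolding tl_norm_def m_def[symmetric] by (intro add_mono C1 C2 f)
    also have "\<dots> \<le> ennreal C * gLp_norm p (absf f) + ennreal C * tl_seminorm k \<alpha> p q f"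
      by (intro add_mono mult_right_mono ennreal_leI) (auto simp: C_def)
    also have "\<dots> = ennreal C * tl_norm \<alpha> p q f" by (simp add: tl_norm_def k_def distrib_left)
    finally show ?thesis .
  qed
  have "?J f \<in> tl_space (\<alpha> + \<beta>) p q" if "f \<in> tl_space \<alpha> p q" for f
  proof -
    have f: "f \<in> gLp p" "tl_norm \<alpha> p q f < top" using that by (auto simp: tl_space_def)
    have "?J f \<in> gLp p" using J f(1) by (auto simp: is_riesz_extension_def)
    moreover have "ennreal C * tl_norm \<alpha> p q f < top" using f(2) by (simp add: ennreal_mult_less_top)
    ultimately show ?thesis using bound[OF f(1)] by (auto simp: tl_space_def intro: le_less_trans)
  qed
  moreover have "0 \<le> C" using C1 by (simp add: C_def)
  ultimately show ?thesis using bound by (auto simp: tl_space_def)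
qed

end
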